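(* Let $n\in\mathbb N$. For each $\Lambda>0$, $M_0\ge1$ and $K_0\ge1$, there exist constants as indicated below such that the following statement holds true. Let $\bar{\mathbf A}:(0,3)\to\mathbb R^{n\times n}$ and $a_0:(0,3)\to\mathbb R$ be measurable with $\Lambda^{-1}\le a_0\le\Lambda$, $\Lambda^{-1}|\xi|^2\le\langle\bar{\mathbf A}(x_n)\xi,\xi\rangle$ for all $\xi\in\mathbb R^n$ and a.e. $x_n$, and $\|\bar{\mathbf A}\|_{L^\infty}\le\Lambda$. Suppose that $\mu\in A_2(\mathbb R)$ satisfies $[\mu]_{A_2(\mathbb R)}\le M_0$ and $$\frac1{2\rho}\int_{y-\rho}^{y+\rho}\mu(s)\,ds\le K_0\,\mu(y)\quad\text{for a.e. }y\in(0,2)\text{ and any }\rho\in(0,y/2).$$ Then, for $\lambda\ge0$, any weak solution $u$ of $$\mu(x_n)a_0(x_n)u_t-\operatorname{div}[\mu(x_n)\bar{\mathbf A}(x_n)\nabla u]+\lambda\mu(x_n)u=0\ \text{ in }Q_3^+,\qquad\lim_{x_n\to0^+}\langle\mu(x_n)\bar{\mathbf A}(x_n)\nabla u,\mathbf e_n\rangle=0,$$ satisfies $$\|u\|_{L^\infty(Q_1^+)}\le C(n,\Lambda,M_0)\Big(\fint_{Q_3^+}u^2\mu(dz)\Big)^{1/2},$$ $$\|u_t\|_{L^\infty(Q_1^+)}+\|Du\|_{L^\infty(Q_1^+)}\le C(n,\Lambda,M_0,K_0)\Big(\fint_{Q_3^+}\big[|Du|^2+\lambda|u|^2\big]\mu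(dz)\Big)^{1/2}.$$
   Context: Notation. Write $x=(x',x_n)\in\mathbb R^{n-1}\times\mathbb R$, $z=(t,x)$, $\mathbf e_n=(0,\dots,0,1)$. For $\rho>0$: $D_\rho=B'_\rho\times(-\rho,\rho)$ with $B'_\rho$ the ball in $\mathbb R^{n-1}$ centered at $0$, $Q_\rho=(-\rho^2,0]\times D_\rho$, $D_\rho^+=D_\rho\cap\{x_n>0\}$, $Q_\rho^+=(-\rho^2,0]\times D_\rho^+$. $D$ and $\nabla$ denote the gradient in $x$. $\mu(dx)=\mu(x_n)dx$, $\mu(dz)=\mu(x_n)dx\,dt$, and $\fint_E g\,\mu(dz)=\mu(E)^{-1}\int_E g\,\mu(dz)$. $[\mu]_{A_2(\mathbb R)}=\sup_{y\in\mathbb R,r>0}\big(\frac1{2r}\int_{y-r}^{y+r}\mu\,ds\big)\big(\frac1{2r}\int_{y-r}^{y+r}\mu^{-1}ds\big)$. $W^{1,2}(\Omega,\mu)$ is the space of functions that, with their first weak derivatives, lie in $L^2(\Omega,\mu)$; $V^{1,2}(\Gamma\times\Omega,\mu)=L^2(\Gamma,W^{1,2}(\Omega,\mu))\cap L^\infty(\Gamma,L^2(\Omega,\mu))$. A weak solution (with the conormal condition) is $u\in V^{1,2}(Q_3^+,\mu)$ with $-\int_{Q_3^+}\mu a_0u\varphi_t\,dz+\int_{Q_3^+}\mu\langle\bar{\mathbf A}\nabla u,\nabla\varphi\rangle dz+\lambda\int_{Q_3^+}\mu u\varphi\,dz=0$ for all $\varphi\in C_0^\infty(Q_3)$. *)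

theory Defs
  imports "HOL-Analysis.Analysis" "HOL-Probability.Essential_Supremum"
begin

section \<open>Smooth functions and weak derivatives\<close>

definition dir_deriv :: "('a::euclidean_space \<Rightarrow> real) \<Rightarrow> 'a \<Rightarrow> 'a \<Rightarrow> real" where
  "dir_deriv f b x = frechet_derivative f (at x) b"

fun Ck :: "nat \<Rightarrow> ('a::euclidean_space \<Rightarrow> real) \<Rightarrow> bool" where
  "Ck 0 f \<longleftrightarrow> continuous_on UNIV f"
| "Ck (Suc m) f \<longleftrightarrow> (\<forall>x. f differentiable (at x)) \<and> (\<forall>b\<in>Basis. Ck m (dir_deriv f b))"

text \<open>The set \<open>C\<^sub>0\<^sup>\<infinity>(U)\<close>, its elements being extended by zero to the whole space.\<close>

definition test_functions :: "'a::euclidean_space set \<Rightarrow> ('a \<Rightarrow> real) set" where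
  "test_functions U =
     {\<phi>. (\<forall>m. Ck m \<phi>) \<and> compact (closure {x. \<phi> x \<noteq> 0}) \<and> closure {x. \<phi> x \<noteq> 0} \<subseteq> U}"

definition locally_integrable :: "'a::euclidean_space set \<Rightarrow> ('a \<Rightarrow> real) \<Rightarrow> bool" where
  "locally_integrable U f \<longleftrightarrow> (\<forall>K. compact K \<and> K \<subseteq> U \<longrightarrow> set_integrable lebesgue K f)"

definition weak_deriv ::
  "'a::euclidean_space set \<Rightarrow> 'a \<Rightarrow> ('a \<Rightarrow> real) \<Rightarrow> ('a \<Rightarrow> real) \<Rightarrow> bool" where
  "weak_deriv U b f g \<longleftrightarrow> locally_integrable U f \<and> locally_integrable U g \<and>
     (\<forall>\<phi>\<in>test_functions U.
        (LINT x:U|lebesgue. f x * dir_deriv \<phi> b x) = - (LINT x:U|lebesgue. g x * \<phi> x))"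


section \<open>Weighted spaces\<close>

definition wmeasure :: "('a::euclidean_space \<Rightarrow> real) \<Rightarrow> 'a set \<Rightarrow> 'a measure" where
  "wmeasure w E = density (lebesgue_on E) (\<lambda>x. ennreal (w x))"

definition average :: "('a::euclidean_space \<Rightarrow> real) \<Rightarrow> 'a set \<Rightarrow> ('a \<Rightarrow> real) \<Rightarrow> real" where
  "average w E g = (\<integral>x. g x \<partial>(wmeasure w E)) / measure (wmeasure w E) E"

definition L2sq :: "'a measure \<Rightarrow> ('a \<Rightarrow> 'b::euclidean_space) \<Rightarrow> ennreal" where
  "L2sq M f = (\<integral>\<^sup>+x. ennreal ((norm (f x))\<^sup>2) \<partial>M)"

definition L2 :: "'a measure \<Rightarrow> ('a \<Rightarrow> 'b::euclidean_space) set" where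
  "L2 M = {f \<in> borel_measurable M. L2sq M f < \<infinity>}"

definition Linf_norm :: "'a::euclidean_space set \<Rightarrow> ('a \<Rightarrow> 'b::euclidean_space) \<Rightarrow> ennreal" where
  "Linf_norm E f = esssup (lebesgue_on E) (\<lambda>x. ennreal (norm (f x)))"

text \<open>\<open>W12 \<Omega> w f g\<close>: \<open>f \<in> W\<^sup>1\<^sup>,\<^sup>2(\<Omega>, w)\<close> and \<open>g\<close> is (a representative of) its weak gradient.\<close>

definition W12 ::
  "(real ^ 'n::finite) set \<Rightarrow> (real ^ 'n \<Rightarrow> real) \<Rightarrow> (real ^ 'n \<Rightarrow> real) \<Rightarrow> (real ^ 'n \<Rightarrow> real ^ 'n) \<Rightarrow> bool" where
  "W12 \<Omega> w f g \<longleftrightarrow> f \<in> L2 (wmeasure w \<Omega>) \<and> g \<in> L2 (wmeasure w \<Omega>) \<and>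
     (\<forall>i. weak_deriv \<Omega> (axis i 1) f (\<lambda>x. g x $ i))"

text \<open>\<open>V12 \<Gamma> \<Omega> w u g\<close>: \<open>u\<close> belongs to \<open>L\<^sup>2(\<Gamma>, W\<^sup>1\<^sup>,\<^sup>2(\<Omega>, w)) \<inter> L\<^sup>\<infinity>(\<Gamma>, L\<^sup>2(\<Omega>, w))\<close> and \<open>g\<close> is its spatial
  weak gradient. The vector-valued function \<open>t \<mapsto> u(t, \<cdot>)\<close> is represented by a jointly
  measurable function of \<open>(t, x)\<close>; as the target spaces are separable, this is the same as
  strong measurability in \<open>t\<close>.\<close>

definition V12 ::
  "real set \<Rightarrow> (real ^ 'n::finite) set \<Rightarrow> (real ^ 'n \<Rightarrow> real) \<Rightarrow>
   (real \<times> (real ^ 'n) \<Rightarrow> real) \<Rightarrow> (real \<times> (real ^ 'n) \<Rightarrow> real ^ 'n) \<Rightarrow> bool" where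
  "V12 \<Gamma> \<Omega> w u g \<longleftrightarrow>
     u \<in> borel_measurable (lebesgue_on (\<Gamma> \<times> \<Omega>)) \<and>
     g \<in> borel_measurable (lebesgue_on (\<Gamma> \<times> \<Omega>)) \<and>
     (AE t in lebesgue_on \<Gamma>. W12 \<Omega> w (\<lambda>x. u (t, x)) (\<lambda>x. g (t, x))) \<and>
     (\<integral>\<^sup>+t. L2sq (wmeasure w \<Omega>) (\<lambda>x. u (t, x)) + L2sq (wmeasure w \<Omega>) (\<lambda>x. g (t, x))
        \<partial>(lebesgue_on \<Gamma>)) < \<infinity> \<and>
     (\<exists>B::real. AE t in lebesgue_on \<Gamma>. L2sq (wmeasure w \<Omega>) (\<lambda>x. u (t, x)) \<le> ennreal B)"


section \<open>Muckenhoupt weights\<close>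

definition A2_const :: "(real \<Rightarrow> real) \<Rightarrow> ennreal" where
  "A2_const \<mu> = (SUP (y, r) \<in> UNIV \<times> {0<..}.
     (ennreal (1 / (2 * r)) * (\<integral>\<^sup>+s\<in>{y-r..y+r}. ennreal (\<mu> s) \<partial>lebesgue)) *
     (ennreal (1 / (2 * r)) * (\<integral>\<^sup>+s\<in>{y-r..y+r}. inverse (ennreal (\<mu> s)) \<partial>lebesgue)))"

definition A2_weight :: "(real \<Rightarrow> real) \<Rightarrow> bool" where
  "A2_weight \<mu> \<longleftrightarrow> \<mu> \<in> borel_measurable lebesgue \<and> (AE s in lebesgue. 0 < \<mu> s) \<and>
     locally_integrable UNIV \<mu> \<and> A2_const \<mu> < \<infinity>"


section \<open>Cylinders and weak solutions\<close>

text \<open>The dimension is \<open>n = CARD('n) \<ge> 1\<close>. The index \<open>k\<close> names the distinguished coordinate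
  \<open>x\<^sub>n\<close>, and \<open>x - axis k (x $ k)\<close> is the remaining part \<open>x'\<close>.\<close>

definition D :: "'n::finite \<Rightarrow> real \<Rightarrow> (real ^ 'n) set" where
  "D k \<rho> = {x. norm (x - axis k (x $ k)) < \<rho> \<and> - \<rho> < x $ k \<and> x $ k < \<rho>}"

definition Dplus :: "'n::finite \<Rightarrow> real \<Rightarrow> (real ^ 'n) set" where
  "Dplus k \<rho> = D k \<rho> \<inter> {x. 0 < x $ k}"

definition Q :: "'n::finite \<Rightarrow> real \<Rightarrow> (real \<times> (real ^ 'n)) set" where
  "Q k \<rho> = {- (\<rho>\<^sup>2)<..0} \<times> D k \<rho>"

definition Qplus :: "'n::finite \<Rightarrow> real \<Rightarrow> (real \<times> (real ^ 'n)) set" where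
  "Qplus k \<rho> = {- (\<rho>\<^sup>2)<..0} \<times> Dplus k \<rho>"

definition time_deriv :: "(real \<times> (real ^ 'n::finite) \<Rightarrow> real) \<Rightarrow> real \<times> (real ^ 'n) \<Rightarrow> real" where
  "time_deriv \<phi> z = dir_deriv \<phi> (1, 0) z"

definition space_grad :: "(real \<times> (real ^ 'n::finite) \<Rightarrow> real) \<Rightarrow> real \<times> (real ^ 'n) \<Rightarrow> real ^ 'n" where
  "space_grad \<phi> z = (\<chi> i. dir_deriv \<phi> (0, axis i 1) z)"

text \<open>Weak solutions in \<open>Q\<^sub>3\<^sup>+\<close>, with \<open>Du\<close> the spatial weak gradient of \<open>u\<close>. Test functions are
  compactly supported in the interior of \<open>Q\<^sub>3\<close>: they vanish near the final time \<open>t = 0\<close> (so that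
  no terminal condition is imposed on \<open>u\<close>), but need not vanish at \<open>x\<^sub>n = 0\<close>, which encodes the
  conormal condition.\<close>

definition weak_solution ::
  "'n::finite \<Rightarrow> (real \<Rightarrow> real) \<Rightarrow> (real \<Rightarrow> real) \<Rightarrow> (real \<Rightarrow> real ^ 'n ^ 'n) \<Rightarrow> real \<Rightarrow>
   (real \<times> (real ^ 'n) \<Rightarrow> real) \<Rightarrow> (real \<times> (real ^ 'n) \<Rightarrow> real ^ 'n) \<Rightarrow> bool" where
  "weak_solution k \<mu> a0 A lam u Du \<longleftrightarrow>
     V12 {- 9<..0} (Dplus k 3) (\<lambda>x. \<mu> (x $ k)) u Du \<and>
     (\<forall>\<phi>\<in>test_functions (interior (Q k 3)).
        - (LINT z:Qplus k 3|lebesgue. \<mu> (snd z $ k) * a0 (snd z $ k) * u z * time_deriv \<phi> z)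
        + (LINT z:Qplus k 3|lebesgue. \<mu> (snd z $ k) * ((A (snd z $ k) *v Du z) \<bullet> space_grad \<phi> z))
        + lam * (LINT z:Qplus k 3|lebesgue. \<mu> (snd z $ k) * u z * \<phi> z) = 0)"

end

theory Submission
  imports Defs
begin

text \<open>The coefficients depend on the height \<open>s = x\<^sub>n\<close> only, so \<open>u\<close> and \<open>Du\<close> may be mollified in the
  tangential variables \<open>(t, x')\<close> with kernels that are one-sided in time. Every tangential derivative
  of a mollified solution is again one, and on almost every vertical line the weak formulation becomes
  an ordinary differential equation for \<open>v\<close> and the flux \<open>\<mu> \<langle>A \<nabla>v, e\<^sub>n\<rangle>\<close>, which vanishes at \<open>s = 0\<close>.
  Caccioppoli estimates then bound all tangential derivatives in the weighted space \<open>L\<^sup>2\<close>; a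
  one-dimensional Sobolev inequality in each tangential coordinate, followed by integration of
  the vertical derivative against \<open>1 / \<mu>\<close>, gives pointwise bounds for \<open>v\<close>, \<open>v\<^sub>t\<close> and the tangential gradient.
  The vertical derivative is recovered from the flux, and this is where the pointwise lower bound
  for \<open>\<mu>\<close> enters. To remove the mollification, kernels are chosen that nearly minimise a quadratic energy
  among the kernels of support \<open>h \<rightarrow> 0\<close>: by the parallelogram identity they form a Cauchy sequence for that
  energy, and the pointwise bounds turn this into uniform convergence.\<close>

text \<open>The coefficients are merely measurable in the height, so no equation may be
  differentiated vertically; this confines mollification to the tangential variables. Mollification
  is linear in the kernel and the pointwise bounds hold for kernels of any sign, so a bound for the
  difference of two mollified solutions is the bound for the difference kernel. That mollified
  functions tend to \<open>u\<close> is known beforehand only in pairings with bounded, almost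
  everywhere continuous functions; near-minimality supplies the Cauchy property. A kernel that looks
  backwards in time keeps test functions away from t = 0. Hence the slice equations hold at every t
  < 0, and the energy estimates can be cut off at any t0 < 0 with constants free of t0. The weight
  enters through J, the integral of 1 / \<mu> over (0,3). The averages bring the integral W of \<mu>
  over (0,3), and the A2 condition gives W * J <= 9 * M0. K0 enters only through a bound of the
  integral of \<mu> over (0,s) by K^2 * J * \<mu>(s)^2, with K = 8 * M0 * K0.\<close>

abbreviation bm :: "('a::topological_space \<Rightarrow> 'b::topological_space) set" where
 "bm \<equiv> borel_measurable borel"
abbreviation Lint :: "('a::euclidean_space \<Rightarrow> 'b::{banach, second_countable_topology}) \<Rightarrow> bool" where
 "Lint \<equiv> integrable lborel"
abbreviation lebesgue_int :: "('a::euclidean_space \<Rightarrow> 'b::{banach, second_countable_topology}) \<Rightarrow> 'b" (binder "LI " [0] 10) where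
 "lebesgue_int f \<equiv> integral\<^sup>L lborel f"
abbreviation lebesgue_nn :: "('a::euclidean_space \<Rightarrow> ennreal) \<Rightarrow> ennreal" (binder "NI " [0] 10) where
 "lebesgue_nn f \<equiv> nn_integral lborel f"
abbreviation ind :: "'a set \<Rightarrow> 'a \<Rightarrow> 'b::zero_neq_one" where "ind \<equiv> indicator"
abbreviation dd :: "('a::euclidean_space \<Rightarrow> real) \<Rightarrow> 'a \<Rightarrow> 'a \<Rightarrow> real" where "dd \<equiv> dir_deriv"
type_synonym 'n tx = "real \<times> (real ^ 'n)"

section \<open>Lines parallel to a coordinate axis\<close>

definition upd :: "'a::euclidean_space => 'a => real => 'a" where
 "upd b z r = z + (r - z \<bullet> b) *\<^sub>R b"

definition slab :: "'a::euclidean_space => 'a set" where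
 "slab b = {z. 0 < z \<bullet> b & z \<bullet> b < 1}"

lemma upd_inner: "b : Basis ==> c : Basis ==> upd b z r \<bullet> c = (if c = b then r else z \<bullet> c)"
 by (auto simp: upd_def inner_simps inner_Basis)

lemma upd_upd [simp]: "b : Basis ==> upd b (upd b z r) s = upd b z s"
 by (rule euclidean_eqI) (simp add: upd_inner)

lemma upd_commute: "b : Basis ==> c : Basis ==> b ~= c ==> upd b (upd c z r) s = upd c (upd b z s) r"
 by (rule euclidean_eqI) (simp add: upd_inner)

lemma upd_self [simp]: "upd b z (z \<bullet> b) = z"
 by (simp add: upd_def)

lemma upd_add: "b : Basis ==> upd b z r + s *\<^sub>R b = upd b z (r + s)"
 by (simp add: upd_def algebra_simps)

lemma add_scale_upd: "z + s *\<^sub>R b = upd b z (z \<bullet> b + s)"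
 by (simp add: upd_def algebra_simps)

lemma continuous_upd [continuous_intros]:
 "continuous_on S f ==> continuous_on S g ==> continuous_on S (%x. upd b (f x) (g x))"
 unfolding upd_def by (intro continuous_intros)

lemma measurable_upd [measurable]:
 "f : borel_measurable M ==> g : borel_measurable M ==> (%x. upd b (f x) (g x)) : borel_measurable M"
 unfolding upd_def by (intro borel_measurable_add borel_measurable_scaleR borel_measurable_diff borel_measurable_inner borel_measurable_const)

lemma slab_sets [measurable]: "slab b : sets borel"
proof -
 have "open (slab b)" unfolding slab_def
  by (intro open_Collect_conj open_Collect_less continuous_intros)
 then show ?thesis by auto
qed

lemma slab_upd: "b : Basis ==> c : Basis ==> b ~= c ==> upd b z r : slab c \<longleftrightarrow> z : slab c"
 by (simp add: slab_def upd_inner)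

text \<open>Lebesgue measure disintegrates along the lines parallel to \<open>b\<close>; the coordinate of \<open>z\<close> along
 \<open>b\<close> is a dummy variable ranging over the unit interval.\<close>

lemma lborel_line:
 fixes b :: "'a::euclidean_space"
 assumes b: "b : Basis"
 shows "distr (density (lborel \<Otimes>\<^sub>M lborel) (%(z, r). ind (slab b) z)) borel (%(z, r). upd b z r) = lborel"
proof (rule lborel_eqI[symmetric])
 fix l u :: 'a assume le: "!!c. c : Basis ==> l \<bullet> c <= u \<bullet> c"
 \<comment> \<open>Cut to the slab, the preimage of a box is a product: a box whose side along
   \<open>b\<close> is (0,1), so that it adds only a factor 1 to the volume, times the original side
   along \<open>b\<close> in the second variable.\<close>
 have key: "z : slab b & upd b z r : box l u \<longleftrightarrow> z : box (upd b l 0) (upd b u 1) & r : {l \<bullet> b <..< u \<bullet> b}" for z r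
 proof -
  have "upd b z r : box l u \<longleftrightarrow> (r : {l \<bullet> b <..< u \<bullet> b} & (\<forall>c\<in>Basis - {b}. l \<bullet> c < z \<bullet> c & z \<bullet> c < u \<bullet> c))"
   using b by (auto simp: box_def upd_inner)
  moreover have "z : box (upd b l 0) (upd b u 1) \<longleftrightarrow> (z : slab b & (\<forall>c\<in>Basis - {b}. l \<bullet> c < z \<bullet> c & z \<bullet> c < u \<bullet> c))"
   using b by (auto simp: box_def upd_inner slab_def)
  ultimately show ?thesis by blast
 qed
 have m: "(%(z, r). upd b z r) -` box l u : sets (borel \<Otimes>\<^sub>M borel)"
  using measurable_sets[of "%(z, r). upd b z r" "borel \<Otimes>\<^sub>M borel" borel "box l u"]
  by (simp add: split_beta' space_pair_measure)
 have "emeasure (distr (density (lborel \<Otimes>\<^sub>M lborel) (%(z, r). ind (slab b) z)) borel (%(z, r). upd b z r)) (box l u)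
  = (\<integral>\<^sup>+x. ind (slab b) (fst x) * ind (box l u) (upd b (fst x) (snd x)) \<partial>(lborel \<Otimes>\<^sub>M lborel))"
  by (subst emeasure_distr, simp, simp, subst emeasure_density, simp, use m in simp)
  (auto intro!: nn_integral_cong simp: space_pair_measure split: split_indicator)
 also have "... = (\<integral>\<^sup>+x. ind (box (upd b l 0) (upd b u 1) \<times> {l \<bullet> b <..< u \<bullet> b}) x \<partial>(lborel \<Otimes>\<^sub>M lborel))"
 proof (intro nn_integral_cong)
  fix x :: "'a \<times> real"
  show "ind (slab b) (fst x) * ind (box l u) (upd b (fst x) (snd x)) =
    (ind (box (upd b l 0) (upd b u 1) \<times> {l \<bullet> b <..< u \<bullet> b}) x :: ennreal)"
   using key[of "fst x" "snd x"] by (cases x) (auto simp: indicator_def)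
 qed
 also have "... = emeasure lborel (box (upd b l 0) (upd b u 1)) * emeasure lborel {l \<bullet> b <..< u \<bullet> b}"
  by (subst nn_integral_indicator) (auto simp: lborel.emeasure_pair_measure_Times)
 also have "emeasure lborel (box (upd b l 0) (upd b u 1)) = ennreal (\<Prod>c\<in>Basis. (upd b u 1 - upd b l 0) \<bullet> c)"
  using le b by (subst emeasure_lborel_box) (auto simp: upd_inner)
 also have "(\<Prod>c\<in>Basis. (upd b u 1 - upd b l 0) \<bullet> c) = (\<Prod>c\<in>Basis - {b}. (u - l) \<bullet> c)"
  using b by (simp add: prod.remove[OF _ b] upd_inner inner_diff_left)
 also have "emeasure lborel {l \<bullet> b <..< u \<bullet> b} = ennreal ((u - l) \<bullet> b)"
  using le b by (simp add: inner_diff_left)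
 also have "ennreal (\<Prod>c\<in>Basis - {b}. (u - l) \<bullet> c) * ennreal ((u - l) \<bullet> b) = ennreal (\<Prod>c\<in>Basis. (u - l) \<bullet> c)"
 proof -
  have "0 <= (u - l) \<bullet> b" "0 <= (\<Prod>c\<in>Basis - {b}. (u - l) \<bullet> c)"
   using le b by (auto intro!: prod_nonneg simp: inner_diff_left)
  then show ?thesis by (simp add: prod.remove[OF _ b] ennreal_mult mult.commute)
 qed
 finally show "emeasure (distr (density (lborel \<Otimes>\<^sub>M lborel) (%(z, r). ind (slab b) z)) borel (%(z, r). upd b z r)) (box l u) = (\<Prod>c\<in>Basis. (u - l) \<bullet> c)" .
qed simp

text \<open>Tonelli in both orders. The first form integrates line by line; in the second the outer
  variable is the coordinate along \<open>b\<close>, which turns an integral over space into an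
  integral over heights of slice integrals.\<close>

lemma nn_integral_line:
 fixes b :: "'a::euclidean_space"
 assumes b: "b : Basis" and [measurable]: "f : bm"
 shows "(NI z. f z) = (NI z. ind (slab b) z * (NI r. f (upd b z r)))"
  and "(NI z. f z) = (NI r. (NI z. ind (slab b) z * f (upd b z r)))"
proof -
 have "(NI z. f z) = (\<integral>\<^sup>+x. ind (slab b) (fst x) * f (upd b (fst x) (snd x)) \<partial>(lborel \<Otimes>\<^sub>M lborel))"
  by (subst lborel_line[OF b, symmetric], subst nn_integral_distr, simp, simp, subst nn_integral_density)
   (auto simp: split_beta')
 note * = this
 show "(NI z. f z) = (NI z. ind (slab b) z * (NI r. f (upd b z r)))"
  unfolding * by (subst lborel.nn_integral_fst[symmetric]) (auto simp: nn_integral_cmult)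
 show "(NI z. f z) = (NI r. (NI z. ind (slab b) z * f (upd b z r)))"
  unfolding * by (subst lborel_pair.nn_integral_snd[symmetric]) auto
qed

lemma integral_line:
 fixes b :: "'a::euclidean_space" and f :: "'a => 'c::{banach, second_countable_topology}"
 assumes b: "b : Basis" and f: "Lint f"
 shows "integrable (lborel \<Otimes>\<^sub>M lborel) (%(z, r). ind (slab b) z *\<^sub>R f (upd b z r))"
  and "(LI z. f z) = (LI z. ind (slab b) z *\<^sub>R (LI r. f (upd b z r)))"
  and "(LI z. f z) = (LI r. (LI z. ind (slab b) z *\<^sub>R f (upd b z r)))"
proof -
 have [measurable]: "f : bm" using f by auto
 let ?D = "density (lborel \<Otimes>\<^sub>M lborel) (%(z, r). ennreal (ind (slab b) z))"
 have line: "distr ?D borel (%(z, r). upd b z r) = lborel"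
  using lborel_line[OF b] by (simp add: ennreal_indicator)
 have "integrable ?D (%x. f (case x of (z, r) => upd b z r))"
  using f by (subst integrable_distr_eq[symmetric, where N=borel and g="%(z, r). upd b z r"]) (auto simp: line)
 then have I: "integrable (lborel \<Otimes>\<^sub>M lborel) (%x. ind (slab b) (fst x) *\<^sub>R f (upd b (fst x) (snd x)))"
  by (simp add: split_beta' integrable_density)
 then show "integrable (lborel \<Otimes>\<^sub>M lborel) (%(z, r). ind (slab b) z *\<^sub>R f (upd b z r))"
  by (simp add: split_beta')
 have "(LI z. f z) = (\<integral>x. f (case x of (z, r) => upd b z r) \<partial>?D)"
  by (subst integral_distr[symmetric, where N=borel]) (auto simp: line)
 also have "... = (\<integral>x. ind (slab b) (fst x) *\<^sub>R f (upd b (fst x) (snd x)) \<partial>(lborel \<Otimes>\<^sub>M lborel))"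
  by (simp add: split_beta' integral_density)
 finally have *: "(LI z. f z) = ..." .
 show "(LI z. f z) = (LI z. ind (slab b) z *\<^sub>R (LI r. f (upd b z r)))"
  unfolding * by (subst lborel_pair.integral_fst'[OF I, symmetric]) simp
 show "(LI z. f z) = (LI r. (LI z. ind (slab b) z *\<^sub>R f (upd b z r)))"
  unfolding * by (subst lborel_pair.integral_snd) (use I in \<open>auto simp: split_beta'\<close>)
qed

text \<open>Fubini for null sets: what holds for almost every height on each vertical line holds
  almost everywhere in space. The bad set has measure zero on every line, and the disintegration
  adds up these zeros.\<close>

lemma AE_line:
 fixes b :: "'a::euclidean_space"
 assumes b: "b : Basis" and [measurable]: "Measurable.pred borel P"
  and P: "!!z. AE r in lborel. P (upd b z r)"
 shows "AE z in lborel. P z"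
proof -
 have "(NI z. ind {z. ~ P z} z) = (NI z. ind (slab b) z * (NI r. ind {z. ~ P z} (upd b z r)))"
  by (rule nn_integral_line(1)[OF b]) measurable
 also have "... = 0"
 proof -
  have "(NI r. ind {z. ~ P z} (upd b z r)) = (\<integral>\<^sup>+(r::real). 0 \<partial>lborel)" for z
   using P[of z] by (intro nn_integral_cong_AE) (auto elim!: eventually_mono)
  then show ?thesis by simp
 qed
 finally have "emeasure lborel {z. ~ P z} = 0"
  by (subst (asm) nn_integral_indicator) simp_all
 then show ?thesis by (subst AE_iff_measurable[OF _ refl]) auto
qed

section \<open>Smooth functions\<close>

definition smooth :: "('a::euclidean_space => real) => bool" where
 "smooth f \<longleftrightarrow> (\<forall>m. Ck m f)"

lemma dir_deriv_eq: "(f has_derivative f') (at x) ==> dd f b x = f' b"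
 unfolding dir_deriv_def using frechet_derivative_at by metis

lemma has_derivative_dir_deriv:
 "f differentiable (at x) ==> (f has_derivative (%h. dd f h x)) (at x)"
 unfolding dir_deriv_def by (metis eta_contract_eq frechet_derivative_works)

lemma dir_deriv_sum:
 fixes f :: "'a::euclidean_space => real"
 assumes "f differentiable (at x)"
 shows "dd f h x = (\<Sum>b\<in>Basis. (h \<bullet> b) * dd f b x)"
proof -
 interpret linear "%h. dd f h x"
  using has_derivative_linear[OF has_derivative_dir_deriv[OF assms]] .
 have "dd f (\<Sum>b\<in>Basis. (h \<bullet> b) *\<^sub>R b) x = (\<Sum>b\<in>Basis. (h \<bullet> b) * dd f b x)"
  by (simp add: sum scale)
 then show ?thesis by (simp add: euclidean_representation)
qed

lemma dir_deriv_line: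
 fixes f :: "'a::euclidean_space => real"
 assumes "f differentiable (at (x + r *\<^sub>R b))"
 shows "((%r. f (x + r *\<^sub>R b)) has_real_derivative dd f b (x + r *\<^sub>R b)) (at r)"
proof -
 interpret linear "%h. dd f h (x + r *\<^sub>R b)"
  using has_derivative_linear[OF has_derivative_dir_deriv[OF assms]] .
 have "((%r. f (x + r *\<^sub>R b)) has_derivative (%h. dd f (h *\<^sub>R b) (x + r *\<^sub>R b))) (at r)"
  by (rule has_derivative_compose[where g = f and f = "%r. x + r *\<^sub>R b" and x = r])
   (auto intro!: derivative_eq_intros has_derivative_dir_deriv assms)
 then show ?thesis
  by (simp add: scale has_field_derivative_def mult_commute_abs)
qed

lemma Ck_continuous: "Ck m f ==> continuous_on UNIV f"
 by (cases m) (auto simp: continuous_on_eq_continuous_within intro!: differentiable_imp_continuous_within)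

lemma Ck_SucD: "Ck (Suc m) f ==> Ck m f"
proof (induction m arbitrary: f)
 case 0
 then show ?case using Ck_continuous[OF 0] by simp
qed auto

lemma Ck_const: "Ck m (%_. c)"
proof (induction m arbitrary: c)
 case (Suc m)
 have "dd (%_. c) b = (%_. 0)" for b :: 'a
  by (rule ext, rule dir_deriv_eq) (rule has_derivative_const)
 then show ?case using Suc[of 0] by simp
qed simp

lemma Ck_add: "Ck m f ==> Ck m g ==> Ck m (%x. f x + g x)"
proof (induction m arbitrary: f g)
 case (Suc m)
 then have "f differentiable (at x)" "g differentiable (at x)" for x by auto
 then have "dd (%x. f x + g x) b = (%x. dd f b x + dd g b x)" for b
  by (intro ext dir_deriv_eq has_derivative_add has_derivative_dir_deriv)
 then show ?case using Suc by (auto intro!: differentiable_add)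
qed (auto intro: continuous_intros)

lemma dir_deriv_mult:
 assumes "f differentiable (at x)" "g differentiable (at x)"
 shows "dd (%x. f x * g x) b x = f x * dd g b x + dd f b x * g x"
 by (intro dir_deriv_eq has_derivative_mult has_derivative_dir_deriv assms)

lemma Ck_mult: "Ck m f ==> Ck m g ==> Ck m (%x. f x * g x)"
proof (induction m arbitrary: f g)
 case (Suc m)
 then have "f differentiable (at x)" "g differentiable (at x)" for x by auto
 then have "dd (%x. f x * g x) b = (%x. f x * dd g b x + dd f b x * g x)" for b
  by (intro ext dir_deriv_mult)
 then show ?case using Suc.prems Suc.IH Ck_SucD[OF Suc.prems(1)] Ck_SucD[OF Suc.prems(2)]
  by (auto intro!: differentiable_mult Ck_add)
qed (auto intro: continuous_intros)

lemma Ck_diff: "Ck m f ==> Ck m g ==> Ck m (%x. f x - g x)"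
 using Ck_add[of m f "%x. -1 * g x"] Ck_mult[OF Ck_const[of m "-1"], of g] by simp

lemma Ck_sum: "finite I ==> (!!i. i : I ==> Ck m (f i)) ==> Ck m (%x. \<Sum>i\<in>I. f i x)"
 by (induction I rule: finite_induct) (auto intro: Ck_const Ck_add)

lemma dir_deriv_affine:
 fixes f :: "'b::euclidean_space => real" and L :: "'a::euclidean_space => 'b"
 assumes L: "bounded_linear L" and f: "f differentiable (at (c + L x))"
 shows "dd (%x. f (c + L x)) b x = dd f (L b) (c + L x)"
  and "(%x. f (c + L x)) differentiable (at x)"
proof -
 have A: "((%x. c + L x) has_derivative L) (at x)"
  by (rule has_derivative_eq_rhs[OF has_derivative_add[OF has_derivative_const[of c] bounded_linear_imp_has_derivative[OF L]]])
   (simp add: fun_eq_iff)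
 have D: "((%x. f (c + L x)) has_derivative (%h. dd f (L h) (c + L x))) (at x)"
  by (rule has_derivative_compose[where g = f and f = "%x. c + L x" and x = x])
   (rule A, rule has_derivative_dir_deriv[OF f])
 then show "(%x. f (c + L x)) differentiable (at x)" by (rule differentiableI)
 show "dd (%x. f (c + L x)) b x = dd f (L b) (c + L x)"
  using dir_deriv_eq[OF D] .
qed

text \<open>A partial derivative of the composite is a fixed linear combination of partial
  derivatives of \<open>f\<close>, composed with the same affine map; this keeps the induction
  going. \<open>Ck\<close> tests basis directions only, hence the expansion of \<open>L b\<close> in
  the basis.\<close>

lemma Ck_affine:
 fixes f :: "'b::euclidean_space => real" and L :: "'a::euclidean_space => 'b"
 assumes L: "bounded_linear L"
 shows "Ck m f ==> Ck m (%x. f (c + L x))"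
proof (induction m arbitrary: f)
 case 0
 then have "continuous_on UNIV f" by simp
 then have "continuous_on UNIV (%x. f (c + L x))"
  by (rule continuous_on_compose2) (intro continuous_on_add continuous_on_const linear_continuous_on[OF L], simp)
 then show ?case by simp
next
 case (Suc m)
 then have f: "f differentiable (at x)" for x by auto
 have "dd (%x. f (c + L x)) b = (%x. \<Sum>j\<in>Basis. (L b \<bullet> j) * dd f j (c + L x))" for b
  by (intro ext trans[OF dir_deriv_affine(1)[OF L f] dir_deriv_sum[OF f]])
 moreover have "Ck m (%x. \<Sum>j\<in>Basis. (L b \<bullet> j) * dd f j (c + L x))" for b
  using Suc by (intro Ck_sum Ck_mult Ck_const) auto
 ultimately show ?case
  using dir_deriv_affine(2)[OF L f] by simp
qed

lemma smooth_continuous: "smooth f ==> continuous_on UNIV f"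
 using Ck_continuous unfolding smooth_def by blast

lemma smooth_differentiable: "smooth f ==> f differentiable (at x)"
 unfolding smooth_def by (metis Ck.simps(2))

lemma smooth_dir_deriv: "smooth f ==> b : Basis ==> smooth (dd f b)"
 unfolding smooth_def by (metis Ck.simps(2))

lemma smooth_const: "smooth (%_. c)" unfolding smooth_def by (simp add: Ck_const)
lemma smooth_add: "smooth f ==> smooth g ==> smooth (%x. f x + g x)" unfolding smooth_def by (simp add: Ck_add)
lemma smooth_mult: "smooth f ==> smooth g ==> smooth (%x. f x * g x)" unfolding smooth_def by (simp add: Ck_mult)
lemma smooth_affine: "bounded_linear L ==> smooth f ==> smooth (%x. f (c + L x))"
 unfolding smooth_def by (simp add: Ck_affine)
lemma smooth_cmult: "smooth f ==> smooth (%x. c * f x)"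
 by (rule smooth_mult[OF smooth_const])
lemma smooth_diff: "smooth f ==> smooth g ==> smooth (%x. f x - g x)"
 using smooth_add[of f "%x. -1 * g x"] smooth_cmult[of g "-1"] by simp
lemma smooth_prod: "finite I ==> (!!i. i : I ==> smooth (f i)) ==> smooth (%x. \<Prod>i\<in>I. f i x)"
 by (induction I rule: finite_induct) (auto intro: smooth_const smooth_mult)

lemma dir_deriv_real:
 "(f has_real_derivative y) (at x) ==> dd f (1::real) x = y"
 using dir_deriv_eq[of f "(*) y" x 1] by (simp add: has_field_derivative_def)

lemma smooth_realI:
 fixes f :: "real => real"
 assumes "!!x. (f has_real_derivative f' x) (at x)" "smooth f'"
 shows "smooth f"
 unfolding smooth_def
proof
 fix m
 have "dd f 1 = f'" using dir_deriv_real[OF assms(1)] by auto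
 moreover have "f differentiable (at x)" for x
  using assms(1)[of x] by (meson differentiableI has_field_derivative_imp_has_derivative)
 ultimately have "Ck (Suc m) f"
  using assms(2) by (simp add: smooth_def)
 then show "Ck m f" by (rule Ck_SucD)
qed

text \<open>The denominators make the family closed under differentiation up to linear combinations,
  so smoothness becomes one induction over all \<open>k\<close> at once. The classical flat function
  is the case \<open>k = 0\<close>.\<close>

definition flat_exp :: "nat => real => real" where
 "flat_exp k x = (if x > 0 then exp (- (1 / x)) / x ^ k else 0)"

text \<open>From (1 + y / n)^n <= exp y with y = 1 / x and n = k + 2. The exponent exceeds
  \<open>k\<close> by two so that a factor x^2 survives, which makes the derivative at the origin
  vanish.\<close>

lemma flat_exp_bound: "\<bar>flat_exp k x\<bar> <= real (k + 2) ^ (k + 2) * x^2"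
proof (cases "x > 0")
 case True
 define n where "n = k + 2"
 have "(1 / x / real n) ^ n <= (1 + 1 / x / real n) ^ n"
  using True by (intro power_mono) auto
 also have "... <= exp (1 / x)"
  using True by (intro exp_ge_one_plus_x_over_n_power_n) (auto simp: n_def intro: order_trans[of _ 0])
 finally have "(1 / x / real n) ^ n <= exp (1 / x)" .
 moreover have "(1 / x / real n) ^ n = 1 / (real n ^ n * x ^ n)"
  by (simp add: power_divide power_mult_distrib mult.commute)
 moreover have "0 < real n ^ n * x ^ n" using True by (auto simp: n_def)
 ultimately have "exp (- (1 / x)) <= real n ^ n * x ^ n"
  by (simp add: exp_minus field_simps del: zero_less_mult_iff)
 also have "x ^ n = x ^ k * x^2" unfolding n_def by (rule power_add)
 finally have "exp (- (1 / x)) / x ^ k <= (real n ^ n * (x ^ k * x^2)) / x ^ k"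
  using True by (intro divide_right_mono) auto
 also have "... = real n ^ n * x^2" using True by simp
 finally have "exp (- (1 / x)) / x ^ k <= real n ^ n * x^2" .
 then show ?thesis using True by (simp add: flat_exp_def n_def)
qed (simp add: flat_exp_def)

lemma flat_exp_deriv:
 "(flat_exp k has_real_derivative flat_exp (k + 2) x - real k * flat_exp (k + 1) x) (at x)"
proof (cases "x = 0")
 case True
 have "((%h. flat_exp k h / h) \<longlongrightarrow> 0) (at 0)"
 proof (rule Lim_null_comparison)
  show "\<forall>\<^sub>F h in at 0. norm (flat_exp k h / h) <= real (k + 2) ^ (k + 2) * \<bar>h\<bar>"
  proof (rule eventually_at_filter[THEN iffD2], rule always_eventually, intro allI impI)
   fix h :: real assume "h ~= 0"
   then show "norm (flat_exp k h / h) <= real (k + 2) ^ (k + 2) * \<bar>h\<bar>"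
    using flat_exp_bound[of k h] by (simp add: divide_le_eq power2_eq_square mult.assoc abs_mult[symmetric])
  qed
  show "((%h. real (k + 2) ^ (k + 2) * \<bar>h\<bar>) \<longlongrightarrow> 0) (at 0)"
   by (auto intro!: tendsto_eq_intros)
 qed
 then show ?thesis using True by (simp add: DERIV_def flat_exp_def)
next
 case False
 show ?thesis
 proof (cases "x > 0")
  case True
  have P: "x * x ^ (j - Suc 0) = (if j = 0 then x else x ^ j)" for j by (cases j) auto
  have "((%x. exp (- (1 / x)) / x ^ k) has_real_derivative
    exp (- (1 / x)) / x ^ (k + 2) - real k * (exp (- (1 / x)) / x ^ (k + 1))) (at x)"
  proof (cases k)
   case 0 then show ?thesis using True
    by (auto intro!: derivative_eq_intros simp: power2_eq_square field_simps)
  next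
   case (Suc j) then show ?thesis using True
    by (auto intro!: derivative_eq_intros simp: P power2_eq_square field_simps power_add)
  qed
  moreover have "\<forall>\<^sub>F y in nhds x. flat_exp k y = exp (- (1 / y)) / y ^ k"
   using eventually_nhds_in_open[of "{0<..}" x] True by (auto elim!: eventually_mono simp: flat_exp_def)
  ultimately show ?thesis using True by (subst DERIV_cong_ev[OF refl _ refl]) (auto simp: flat_exp_def)
 next
  case False
  then have "\<forall>\<^sub>F y in nhds x. flat_exp k y = 0"
   using eventually_nhds_in_open[of "{..<0}" x] \<open>x ~= 0\<close> by (auto elim!: eventually_mono simp: flat_exp_def)
  then show ?thesis using False by (subst DERIV_cong_ev[OF refl _ refl]) (auto simp: flat_exp_def)
 qed
qed

lemma smooth_flat_exp: "smooth (flat_exp k)"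
proof -
 have "Ck m (flat_exp k)" for m
 proof (induction m arbitrary: k)
  case 0
  show ?case using DERIV_isCont[OF flat_exp_deriv] by (simp add: continuous_at_imp_continuous_on)
 next
  case (Suc m)
  have "dd (flat_exp k) 1 = (%x. flat_exp (k + 2) x - real k * flat_exp (k + 1) x)"
   using dir_deriv_real[OF flat_exp_deriv] by auto
  moreover have "flat_exp k differentiable (at x)" for x
   using flat_exp_deriv by (meson differentiableI has_field_derivative_imp_has_derivative)
  ultimately show ?case using Suc[of "k + 2"] Suc[of "k + 1"] by (auto intro!: Ck_diff Ck_mult Ck_const)
 qed
 then show ?thesis by (simp add: smooth_def)
qed

text \<open>As \<open>n\<close> grows the bump tends to the indicator of the open interval, and for
  \<open>n = 1\<close> it is a smooth positive profile: one family serves both to approximate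
  indicators and to build kernels.\<close>

definition bump :: "nat => real => real => real => real" where
 "bump n c d x = flat_exp 0 (real n * (x - c)) * flat_exp 0 (real n * (d - x))"

lemma smooth_bump: "smooth (bump n c d)"
proof -
 have "smooth (%x. flat_exp 0 (real n * (- c) + real n * x) * flat_exp 0 (real n * d + (- real n) * x))"
  by (intro smooth_mult smooth_affine smooth_flat_exp bounded_linear_mult_right)
 then show ?thesis unfolding bump_def[abs_def] by (simp add: algebra_simps)
qed

lemma bump_nonneg: "0 <= bump n c d x" and bump_le_1: "bump n c d x <= 1"
 by (auto simp: bump_def flat_exp_def intro!: mult_le_one)

lemma bump_outside: "x <= c \<or> d <= x ==> bump n c d x = 0"
 by (auto simp: bump_def flat_exp_def mult_le_0_iff zero_less_mult_iff)

lemma bump_pos: "c < x ==> x < d ==> 0 < n ==> 0 < bump n c d x"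
 by (auto simp: bump_def flat_exp_def)

lemma flat_exp_tendsto: "y > 0 ==> (%n. flat_exp 0 (real n * y)) \<longlonglongrightarrow> 1"
proof -
 assume y: "y > 0"
 have "(%n. exp (- (1 / y * (1 / real n)))) \<longlonglongrightarrow> exp (- (1 / y * 0))"
  by (intro tendsto_intros lim_1_over_n)
 then have *: "(%n. exp (- (1 / y * (1 / real n)))) \<longlonglongrightarrow> 1" by simp
 show ?thesis
  by (rule Lim_transform_eventually[OF *], rule eventually_sequentiallyI[of 1])
   (use y in \<open>auto simp: flat_exp_def field_simps\<close>)
qed

lemma bump_tendsto: "(%n. bump n c d x) \<longlonglongrightarrow> ind {c<..<d} x"
proof (cases "c < x & x < d")
 case True
 then have "(%n. bump n c d x) \<longlonglongrightarrow> 1 * 1"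
  unfolding bump_def by (intro tendsto_mult flat_exp_tendsto) auto
 then show ?thesis using True by simp
next
 case False
 then have "bump n c d x = 0" for n by (intro bump_outside) auto
 then show ?thesis using False by auto
qed

section \<open>Test functions on an interval\<close>

lemma integrable_indicator_times:
 fixes f :: "'a => real"
 shows "A : sets M ==> integrable M f ==> integrable M (%x. ind A x * f x)"
 using integrable_mult_indicator[of A M f] by simp

lemma ennreal_eq_uminus: "ennreal a = ennreal (- a) ==> a = 0"
 using ennreal_neg[of a] ennreal_neg[of "- a"] ennreal_eq_0_iff[of a] ennreal_eq_0_iff[of "- a"]
 by (metis linorder_le_cases neg_0_le_iff_le neg_le_0_iff_le order_antisym)

lemma enn2real_inj: "enn2real x = enn2real y ==> x ~= \<infinity> ==> y ~= \<infinity> ==> x = y"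
 by (cases x; cases y) auto

text \<open>The positive and the negative part of \<open>f\<close> are densities of two finite
  measures. These agree on boxes, an intersection-stable generator, so they are equal and so are the
  densities; equal positive and negative parts can only be zero.\<close>

lemma AE_zero_of_box_integrals:
 fixes f :: "'a::euclidean_space => real"
 assumes f: "Lint f"
  and z: "!!l u. (LI x. ind (box l u) x * f x) = 0"
 shows "AE x in lborel. f x = 0"
proof -
 have [measurable]: "f : bm" using f by auto
 let ?p = "%x. ennreal (f x)" and ?m = "%x. ennreal (- f x)"
 have fin: "(NI x. ?p x) < \<infinity>" "(NI x. ?m x) < \<infinity>"
  using f unfolding real_integrable_def by (auto simp: less_top)
 have "density lborel ?p = density lborel ?m"
 proof (rule measure_eqI_generator_eq)
  let ?E = "range (%(a, b). box a b::'a set)"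
  show "Int_stable ?E" by (auto simp: Int_stable_def box_Int_box)
  show "?E \<subseteq> Pow UNIV" "sets (density lborel ?p) = sigma_sets UNIV ?E" "sets (density lborel ?m) = sigma_sets UNIV ?E"
   by (simp_all add: borel_eq_box)
  let ?A = "%n::nat. box (- (real n *\<^sub>R One)) (real n *\<^sub>R One) :: 'a set"
  show "range ?A \<subseteq> ?E" "(\<Union>i. ?A i) = UNIV" unfolding UN_box_eq_UNIV by auto
  show "emeasure (density lborel ?p) (?A i) ~= \<infinity>" for i
  proof -
   have "emeasure (density lborel ?p) (?A i) <= (NI x. ?p x)"
    by (subst emeasure_density) (auto intro!: nn_integral_mono split: split_indicator)
   then show ?thesis using fin by (auto simp: top_unique)
  qed
  fix X assume "X : ?E"
  then obtain l u where X: "X = box l u" by auto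
  have I: "Lint (%x. ind X x * f x)"
   using f X by (intro integrable_indicator_times) auto
  have e: "(NI x. ?p x * ind X x) = (NI x. ennreal (ind X x * f x))"
   "(NI x. ?m x * ind X x) = (NI x. ennreal (- (ind X x * f x)))"
   by (auto intro!: nn_integral_cong split: split_indicator)
  have "(LI x. ind X x * f x) = 0" using z X by simp
  then have "enn2real (NI x. ennreal (ind X x * f x)) = enn2real (NI x. ennreal (- (ind X x * f x)))"
   by (subst (asm) real_lebesgue_integral_def[OF I]) simp
  moreover have "(NI x. ennreal (ind X x * f x)) ~= \<infinity>" "(NI x. ennreal (- (ind X x * f x))) ~= \<infinity>"
   using I unfolding real_integrable_def by auto
  ultimately have PM: "(NI x. ?p x * ind X x) = (NI x. ?m x * ind X x)"
   unfolding e by (rule enn2real_inj)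
  have XB: "X : sets lborel" using X by simp
  have m: "?p : borel_measurable lborel" "?m : borel_measurable lborel" by measurable
  show "emeasure (density lborel ?p) X = emeasure (density lborel ?m) X"
   using PM by (simp only: emeasure_density[OF m(1) XB] emeasure_density[OF m(2) XB])
 qed
 then have "AE x in lborel. ?p x = ?m x"
  by (intro sigma_finite_measure.density_unique[OF sigma_finite_lborel]) auto
 then show ?thesis
  by eventually_elim (rule ennreal_eq_uminus)
qed

text \<open>An open set is a countable union of boxes. On each of them \<open>f\<close> is extended
  by zero, and since the intersection of two boxes is a box, the hypothesis covers every box that
  tests the extension.\<close>

lemma AE_zero_of_box_integrals_on:
 fixes f :: "'a::euclidean_space => real"
 assumes U: "open U" and f: "Lint (%x. ind U x * f x)"
  and z: "!!l u. box l u \<subseteq> U ==> (LI x. ind (box l u) x * f x) = 0"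
 shows "AE x in lborel. x : U --> f x = 0"
proof -
 have [measurable]: "U : sets borel" using U by auto
 obtain B where B: "countable B" "!!X. X : B ==> X \<subseteq> U & (\<exists>a b. X = box a b)" "\<Union>B = U"
  using open_countable_Union_open_box[OF U] by (metis PowD subsetD)
 have "AE x in lborel. x : X --> f x = 0" if X: "X : B" for X
 proof -
  obtain a b where ab: "X = box a b" "X \<subseteq> U" using B(2)[OF X] by auto
  have "Lint (%x. ind X x * (ind U x * f x))"
   using f ab by (intro integrable_indicator_times[OF _ f]) auto
  also have "(%x. ind X x * (ind U x * f x)) = (%x. ind X x * f x)"
   using ab by (auto simp: fun_eq_iff split: split_indicator)
  finally have "AE x in lborel. ind X x * f x = 0"
  proof (rule AE_zero_of_box_integrals)
   fix l u :: 'a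
   obtain l' u' where lu: "box l u \<inter> X = box l' u'" using ab by (auto simp: box_Int_box)
   have "(LI x. ind (box l u) x * (ind X x * f x)) = (LI x. ind (box l' u') x * f x)"
    unfolding lu[symmetric] by (intro Bochner_Integration.integral_cong) (auto split: split_indicator)
   also have "... = 0" using lu ab by (intro z) auto
   finally show "(LI x. ind (box l u) x * (ind X x * f x)) = 0" .
  qed
  then show ?thesis by eventually_elim (auto split: split_indicator_asm)
 qed
 then have "AE x in lborel. \<forall>X\<in>B. x : X --> f x = 0"
  using B(1) by (subst AE_ball_countable) auto
 then show ?thesis
  by eventually_elim (use B(3) in auto)
qed

definition test1 :: "real => real => (real => real) set" where
 "test1 a b = {\<eta>. smooth \<eta> & (\<exists>c d. a < c & d < b & (\<forall>x. x ~: {c..d} --> \<eta> x = 0))}"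

lemma test1_bump: "a < c ==> d < b ==> bump n c d : test1 a b"
 unfolding test1_def by (rule CollectI, intro conjI smooth_bump exI[of _ c] exI[of _ d]) (auto intro: bump_outside)

text \<open>Bumps are bounded by one and converge to indicators of intervals, so dominated
  convergence reduces the claim to integrals over intervals.\<close>

lemma fundamental_lemma:
 fixes f :: "real => real"
 assumes f: "Lint f"
  and z: "!!\<eta>. \<eta> : test1 a b ==> (LI x. f x * \<eta> x) = 0"
 shows "AE x in lborel. x : {a<..<b} --> f x = 0"
proof (rule AE_zero_of_box_integrals_on)
 have [measurable]: "f : bm" using f by auto
 show "Lint (%x. ind {a<..<b} x * f x)"
  using f by (intro integrable_indicator_times) auto
 have *: "(LI x. ind {c<..<d} x * f x) = 0" if "a < c" "d < b" for c d
 proof (rule LIMSEQ_unique)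
  have "(%n. (LI x. f x * bump n c d x)) \<longlonglongrightarrow> (LI x. ind {c<..<d} x * f x)"
  proof (rule integral_dominated_convergence[where w="%x. norm (f x)"])
   show "(%x. f x * bump n c d x) : borel_measurable lborel" for n
    using borel_measurable_continuous_onI[OF smooth_continuous[OF smooth_bump[of n c d]]] by auto
   show "AE x in lborel. norm (f x * bump n c d x) <= norm (f x)" for n
    using bump_nonneg[of n c d] bump_le_1[of n c d] by (auto simp: abs_mult mult_left_le)
   show "AE x in lborel. (%n. f x * bump n c d x) \<longlonglongrightarrow> ind {c<..<d} x * f x"
   proof (rule AE_I2)
    fix x show "(%n. f x * bump n c d x) \<longlonglongrightarrow> ind {c<..<d} x * f x"
     using tendsto_mult[OF tendsto_const[of "f x"] bump_tendsto[of c d x]] by (simp add: mult.commute)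
   qed
  qed (use f in auto)
  then show "(%n. 0) \<longlonglongrightarrow> (LI x. ind {c<..<d} x * f x)"
   using z[OF test1_bump[OF that]] by simp
 qed simp
 fix l u :: real assume lu: "box l u \<subseteq> {a<..<b}"
 show "(LI x. ind (box l u) x * f x) = 0"
 proof (rule LIMSEQ_unique)
  \<comment> \<open>A bump is a test function only if its interval stays strictly inside (a,b),
    while the given box may touch the ends; it is therefore exhausted by shrunken intervals.\<close>
  let ?J = "%n. {l + 1 / real (Suc n) <..< u - 1 / real (Suc n)}"
  have "(LI x. ind (?J n) x * f x) = 0" for n
  proof (cases "l < u")
   case True
   then have "a <= l" "u <= b" using lu by (auto simp: box_real greaterThanLessThan_subseteq_greaterThanLessThan)
   moreover have "0 < 1 / real (Suc n)" by simp
   ultimately have "a < l + 1 / real (Suc n)" "u - 1 / real (Suc n) < b" by linarith+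
   then show ?thesis by (rule *)
  next
   case False
   moreover have "0 < 1 / real (Suc n)" by simp
   ultimately have "~ l + 1 / real (Suc n) < u - 1 / real (Suc n)" by linarith
   then have "?J n = {}" by simp
   then show ?thesis by simp
  qed
  then show "(%n. (LI x. ind (?J n) x * f x)) \<longlonglongrightarrow> 0" by simp
  show "(%n. (LI x. ind (?J n) x * f x)) \<longlonglongrightarrow> (LI x. ind (box l u) x * f x)"
  proof (rule integral_dominated_convergence[where w="%x. norm (f x)"])
   show "AE x in lborel. (%n. ind (?J n) x * f x) \<longlonglongrightarrow> ind (box l u) x * f x"
   proof (rule AE_I2)
    fix x :: real
    have inv: "(%n. 1 / real (Suc n)) \<longlonglongrightarrow> 0" using LIMSEQ_inverse_real_of_nat by (simp add: inverse_eq_divide)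
    have "(%n. ind (?J n) x :: real) \<longlonglongrightarrow> ind (box l u) x"
    proof (cases "l < x & x < u")
     case True
     then have "\<forall>\<^sub>F n in sequentially. 1 / real (Suc n) < x - l" "\<forall>\<^sub>F n in sequentially. 1 / real (Suc n) < u - x"
      using order_tendstoD(2)[OF inv] by auto
     then have "\<forall>\<^sub>F n in sequentially. ind (?J n) x = (1::real)"
      by eventually_elim (auto simp: algebra_simps)
     then show ?thesis using True by (auto simp: box_real intro: tendsto_eventually)
    next
     case False
     have "x ~: ?J n" for n
     proof
      assume "x : ?J n"
      moreover have "0 < 1 / real (Suc n)" by simp
      ultimately show False using False unfolding greaterThanLessThan_iff by linarith
     qed
     then have "ind (?J n) x = (0::real)" for n by simp
     then show ?thesis using False by (auto simp: box_real)
    qed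
    then show "(%n. ind (?J n) x * f x) \<longlonglongrightarrow> ind (box l u) x * f x"
     by (intro tendsto_mult tendsto_const)
   qed
   show "AE x in lborel. norm (ind (?J n) x * f x) <= norm (f x)" for n
    by (auto split: split_indicator)
  qed (use f in auto)
 qed
qed simp

lemma test1_continuous: "\<eta> : test1 a b ==> continuous_on UNIV \<eta>"
 by (auto simp: test1_def intro: smooth_continuous)

lemma test1_borel: "\<eta> : test1 a b ==> \<eta> : bm"
 by (rule borel_measurable_continuous_onI[OF test1_continuous])

lemma test1_bounded: "\<eta> : test1 a b ==> \<exists>B. \<forall>x. \<bar>\<eta> x\<bar> <= B"
proof -
 assume e: "\<eta> : test1 a b"
 then obtain c d where cd: "!!x. x ~: {c..d} ==> \<eta> x = 0" by (auto simp: test1_def)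
 have "compact (\<eta> ` {c..d})"
  by (intro compact_continuous_image continuous_on_subset[OF test1_continuous[OF e]]) auto
 then obtain B where "!!x. x : {c..d} ==> \<bar>\<eta> x\<bar> <= B"
  using compact_imp_bounded bounded_iff by (metis image_eqI real_norm_def)
 then have "\<bar>\<eta> x\<bar> <= max B 0" for x
  by (cases "x : {c..d}") (auto simp: cd max.coboundedI1)
 then show ?thesis by blast
qed

lemma test1_integrable: "\<eta> : test1 a b ==> Lint \<eta>"
proof -
 assume e: "\<eta> : test1 a b"
 then obtain c d where cd: "!!x. x ~: {c..d} ==> \<eta> x = 0" by (auto simp: test1_def)
 have "Lint (%x. ind {c..d} x *\<^sub>R \<eta> x)"
  using borel_integrable_atLeastAtMost'[OF continuous_on_subset[OF test1_continuous[OF e]], of c d]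
  by (simp add: set_integrable_def)
 moreover have "(%x. ind {c..d} x *\<^sub>R \<eta> x) = \<eta>"
  using cd by (auto simp: fun_eq_iff split: split_indicator)
 ultimately show ?thesis by simp
qed

lemma integrable_times_test1:
 assumes "Lint f" "\<eta> : test1 a b"
 shows "Lint (%x. f x * \<eta> x :: real)"
proof -
 obtain B where B: "!!x. \<bar>\<eta> x\<bar> <= B" using test1_bounded[OF assms(2)] by auto
 show ?thesis
 proof (rule Bochner_Integration.integrable_bound)
  show "Lint (%x. B * f x)" using assms by simp
  show "(%x. f x * \<eta> x) : borel_measurable lborel" using assms test1_borel by auto
  show "AE x in lborel. norm (f x * \<eta> x) <= norm (B * f x)"
  proof (rule AE_I2)
   fix x show "norm (f x * \<eta> x) <= norm (B * f x)"
    using B[of x] mult_right_mono[of "\<bar>\<eta> x\<bar>" "\<bar>B\<bar>" "\<bar>f x\<bar>"] by (auto simp: abs_mult mult.commute)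
  qed
 qed
qed

lemma test1_cmult: "\<eta> : test1 a b ==> (%x. c * \<eta> x) : test1 a b"
 by (auto simp: test1_def intro!: smooth_cmult)

lemma test1_diff:
 assumes "\<eta> : test1 a b" "th : test1 a b" shows "(%x. \<eta> x - th x) : test1 a b"
proof -
 obtain c d c' d' where cd: "a < c" "d < b" "!!x. x ~: {c..d} ==> \<eta> x = 0"
  "a < c'" "d' < b" "!!x. x ~: {c'..d'} ==> th x = 0"
  using assms by (auto simp: test1_def)
 then have "a < min c c'" "max d d' < b" by auto
 moreover have "\<forall>x. x ~: {min c c'..max d d'} --> \<eta> x - th x = 0"
 proof (intro allI impI)
  fix x assume "x ~: {min c c'..max d d'}"
  then have "x ~: {c..d}" "x ~: {c'..d'}" by auto
  then show "\<eta> x - th x = 0" using cd by simp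
 qed
 moreover have "smooth (%x. \<eta> x - th x)" using assms by (auto simp: test1_def intro: smooth_diff)
 ultimately show ?thesis unfolding test1_def by blast
qed

text \<open>Zero mean is what brings the antiderivative back to its starting value beyond the
  support.\<close>

lemma smooth_primitive:
 fixes \<eta> :: "real => real"
 assumes e: "\<eta> : test1 a b" and z: "(LI x. \<eta> x) = 0"
 shows "\<exists>th\<in>test1 a b. \<forall>x. (th has_real_derivative \<eta> x) (at x)"
proof -
 obtain c d where cd: "a < c" "d < b" "!!x. x ~: {c..d} ==> \<eta> x = 0" and sm: "smooth \<eta>"
  using e by (auto simp: test1_def)
 note cont = test1_continuous[OF e]
 have "\<exists>F. \<forall>x :: real. -\<infinity> < ereal x --> ereal x < \<infinity> --> (F has_vector_derivative \<eta> x) (at x)"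
  using cont by (intro einterval_antiderivative) (auto simp: continuous_on_eq_continuous_at)
 then obtain F where F: "!!x. (F has_vector_derivative \<eta> x) (at x)" by auto
 have ftc: "(LI x. ind {p..q} x *\<^sub>R \<eta> x) = F q - F p" if "p <= q" for p q
  using that by (intro integral_FTC_atLeastAtMost has_vector_derivative_at_within[OF F] continuous_on_subset[OF cont]) auto
 \<comment> \<open>Nothing forces \<open>c <= d\<close>. If the interval is empty then \<eta>
   vanishes everywhere, and \<open>min c d\<close> is still a valid base point.\<close>
 have F0: "F x = F (min c d)" if "x ~: {c..d}" for x
 proof (cases "x < c")
  case True
  have "(LI y. ind {p..q} y *\<^sub>R \<eta> y) = (\<integral>(y::real). 0 \<partial>lborel)" if "q <= c \<or> d < c" for p q
  proof (rule integral_cong_AE)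
   show "AE y in lborel. ind {p..q} y *\<^sub>R \<eta> y = 0"
    using AE_lborel_singleton[of c]
   proof eventually_elim
    case (elim y)
    show ?case
    proof (cases "y : {p..q}")
     case True
     then have "y ~: {c..d}" using that elim by auto
     then show ?thesis using cd(3) by simp
    qed simp
   qed
  qed (use test1_borel[OF e] in auto)
  then have *: "F q = F p" if "q <= c \<or> d < c" "p <= q" for p q using ftc[of p q] that by simp
  show ?thesis using *[of "min c d" x] *[of x "min c d"] True by linarith
 next
  case False
  then have x: "d < x" "c <= x" using that by auto
  have "(LI y. ind {min c d..x} y *\<^sub>R \<eta> y) = (LI y. \<eta> y)"
  proof (rule Bochner_Integration.integral_cong)
   fix y show "ind {min c d..x} y *\<^sub>R \<eta> y = \<eta> y"
    by (cases "y : {c..d}") (use x cd(3)[of y] in auto)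
  qed simp
  then show ?thesis using ftc[of "min c d" x] x z by simp
 qed
 have D: "((%x. F x - F (min c d)) has_real_derivative \<eta> x) (at x)" for x
  using F[of x] by (auto intro!: derivative_eq_intros simp: has_real_derivative_iff_has_vector_derivative[symmetric])
 have "(%x. F x - F (min c d)) : test1 a b"
 proof -
  have "\<forall>x. x ~: {c..d} --> F x - F (min c d) = 0" using F0 by simp
  then show ?thesis using cd(1,2) smooth_realI[OF D sm] unfolding test1_def by blast
 qed
 then show ?thesis using D by blast
qed

text \<open>A test function minus its mean times a fixed bump of mass one has zero mean, hence is
  the derivative of a test function. The constant is the integral of \<open>f\<close> against that
  bump, and the fundamental lemma finishes.\<close>

lemma du_Bois_Reymond:
 fixes f :: "real => real"
 assumes ab: "a < b" and f: "Lint f"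
  and z: "!!\<eta> \<eta>'. \<eta> : test1 a b ==> (!!x. (\<eta> has_real_derivative \<eta>' x) (at x)) ==> \<eta>' : test1 a b ==> (LI x. f x * \<eta>' x) = 0"
 shows "\<exists>c. AE x in lborel. x : {a<..<b} --> f x = c"
proof -
 define p q where "p = (2 * a + b) / 3" and "q = (a + 2 * b) / 3"
 have pq: "a < p" "p < q" "q < b" using ab by (auto simp: p_def q_def)
 define \<rho>0 where "\<rho>0 = bump 1 p q"
 have r0: "\<rho>0 : test1 a b" unfolding \<rho>0_def by (rule test1_bump) (use pq in auto)
 have "(LI x. \<rho>0 x) > 0"
 proof -
  have "(LI x. \<rho>0 x) ~= 0"
  proof
   assume "(LI x. \<rho>0 x) = 0"
   then have "AE x in lborel. \<rho>0 x = 0"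
    by (subst (asm) integral_nonneg_eq_0_iff_AE[OF test1_integrable[OF r0]]) (auto simp: \<rho>0_def bump_nonneg)
   then have "AE x in lborel. x ~: {p<..<q}"
    by eventually_elim (use bump_pos[of p _ q 1] in \<open>force simp: \<rho>0_def\<close>)
   then have "emeasure lborel {p<..<q} = 0"
    by (subst (asm) AE_iff_measurable[of "{p<..<q}"]) auto
   then show False using pq by simp
  qed
  moreover have "(LI x. \<rho>0 x) \<ge> 0" by (intro integral_nonneg_AE) (auto simp: \<rho>0_def bump_nonneg)
  ultimately show ?thesis by simp
 qed
 define \<rho> where "\<rho> = (%x. (1 / (LI x. \<rho>0 x)) * \<rho>0 x)"
 have r: "\<rho> : test1 a b" unfolding \<rho>_def by (rule test1_cmult[OF r0])
 have r1: "(LI x. \<rho> x) = 1"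
  using \<open>(LI x. \<rho>0 x) > 0\<close> unfolding \<rho>_def by simp
 define c where "c = (LI x. f x * \<rho> x)"
 have [measurable]: "f : bm" using f by auto
 let ?g = "%x. ind {a<..<b} x * (f x - c)"
 have ig: "Lint ?g"
 proof -
  have "Lint (%x. ind {a<..<b} x * f x - c * ind {a<..<b} x)"
   using f ab by (intro Bochner_Integration.integrable_diff integrable_indicator_times) auto
  then show ?thesis by (simp add: algebra_simps)
 qed
 have "AE x in lborel. x : {a<..<b} --> ?g x = 0"
 proof (rule fundamental_lemma[OF ig])
  fix \<psi> assume p: "\<psi> : test1 a b"
  define J where "J = (LI x. \<psi> x)"
  define \<eta> where "\<eta> = (%x. \<psi> x - J * \<rho> x)"
  have e: "\<eta> : test1 a b" unfolding \<eta>_def by (intro test1_diff test1_cmult p r)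
  have "(LI x. \<eta> x) = J - J * 1"
   unfolding \<eta>_def using test1_integrable[OF p] test1_integrable[OF r] r1 by (simp add: J_def)
  then obtain th where th: "th : test1 a b" "!!x. (th has_real_derivative \<eta> x) (at x)"
   using smooth_primitive[OF e] by auto
  have "(LI x. f x * \<eta> x) = 0" by (rule z[OF th e])
  moreover have "(LI x. f x * \<eta> x) = (LI x. f x * \<psi> x) - J * c"
   using integrable_times_test1[OF f p] integrable_times_test1[OF f r]
   by (simp add: \<eta>_def c_def algebra_simps)
  moreover have "(LI x. ?g x * \<psi> x) = (LI x. f x * \<psi> x - c * \<psi> x)"
  proof (rule Bochner_Integration.integral_cong)
   fix x
   have "\<psi> x = 0" if "x ~: {a<..<b}" using p that by (force simp: test1_def)
   then show "?g x * \<psi> x = f x * \<psi> x - c * \<psi> x" by (cases "x : {a<..<b}") (auto simp: algebra_simps)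
  qed simp
  moreover have "... = (LI x. f x * \<psi> x) - c * J"
   using integrable_times_test1[OF f p] test1_integrable[OF p] by (simp add: J_def)
  ultimately show "(LI x. ?g x * \<psi> x) = 0" by simp
 qed
 then have "AE x in lborel. x : {a<..<b} --> f x = c"
  by eventually_elim auto
 then show ?thesis by blast
qed

section \<open>Primitives of integrable functions and integration by parts\<close>

definition prim :: "(real => real) => real => real" where
 "prim f s = (LI r. ind {0<..<s} r * f r)"

lemma prim_eq:
 assumes "Lint f" and that: "0 <= p" "p <= q"
 shows "prim f q - prim f p = (LI r. ind {p<..<q} r * f r)"
proof -
 have [measurable]: "f : bm" using assms by auto
 have "prim f q - prim f p = (LI r. ind {0<..<q} r * f r - ind {0<..<p} r * f r)"
  unfolding prim_def using assms by (subst Bochner_Integration.integral_diff) (auto intro: integrable_indicator_times)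
 also have "... = (LI r. ind {p<..<q} r * f r)"
 proof (rule integral_cong_AE)
  show "AE r in lborel. ind {0<..<q} r * f r - ind {0<..<p} r * f r = ind {p<..<q} r * f r"
   using AE_lborel_singleton[of p] by eventually_elim (use that in \<open>auto split: split_indicator\<close>)
 qed measurable
 finally show ?thesis .
qed

lemma prim_bound:
 assumes "Lint f"
 shows "\<bar>prim f s\<bar> <= (LI r. \<bar>f r\<bar>)"
proof -
 have [measurable]: "f : bm" using assms by auto
 have "\<bar>prim f s\<bar> <= (LI r. \<bar>ind {0<..<s} r * f r\<bar>)"
  unfolding prim_def using integral_norm_bound[of lborel "%r. ind {0<..<s} r * f r"] by simp
 also have "... <= (LI r. \<bar>f r\<bar>)"
  using assms by (intro integral_mono integrable_abs integrable_indicator_times) (auto split: split_indicator)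
 finally show ?thesis .
qed

lemma borel_measurable_prim [measurable]:
 assumes [measurable]: "f : bm"
 shows "prim f : bm"
proof -
 have "(%s. (LI r. (if 0 < r & r < s then f r else 0))) : bm"
  by (intro lborel.borel_measurable_lebesgue_integral) measurable
 moreover have "prim f = (%s. (LI r. (if 0 < r & r < s then f r else 0)))"
  unfolding prim_def by (auto intro!: ext Bochner_Integration.integral_cong split: split_indicator)
 ultimately show ?thesis by simp
qed

lemma integrable_times_prim:
 assumes a: "Lint a" and b: "Lint b"
 shows "Lint (%r. a r * prim b r)"
proof (rule Bochner_Integration.integrable_bound)
 have [measurable]: "a : bm" "b : bm" using assms by auto
 show "Lint (%r. (LI r. \<bar>b r\<bar>) * a r)" using a by simp
 show "(%r. a r * prim b r) : borel_measurable lborel" by measurable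
 show "AE r in lborel. norm (a r * prim b r) <= norm ((LI r. \<bar>b r\<bar>) * a r)"
 proof (rule AE_I2)
  fix r
  have "\<bar>prim b r\<bar> * \<bar>a r\<bar> <= \<bar>\<integral>r. \<bar>b r\<bar> \<partial>lborel\<bar> * \<bar>a r\<bar>"
   using prim_bound[OF b, of r] by (intro mult_right_mono) auto
  then show "norm (a r * prim b r) <= norm ((LI r. \<bar>b r\<bar>) * a r)" by (simp add: abs_mult mult.commute)
 qed
qed

text \<open>Integration by parts for absolutely continuous functions, by Fubini: the square (0,s) x
  (0,s) is cut along its diagonal, and each triangle gives one of the two terms.\<close>

lemma prim_mult:
 assumes a: "Lint a" and b: "Lint b"
 shows "prim a s * prim b s = prim (%r. a r * prim b r + prim a r * b r) s"
proof -
 have [measurable]: "a : bm" "b : bm" using assms by auto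
 let ?i = "%r. ind {0<..<s} r :: real"
 have ia: "Lint (%r. ?i r * a r)" and ib: "Lint (%r. ?i r * b r)"
  using a b by (auto intro: integrable_indicator_times)
 have I2: "integrable (lborel \<Otimes>\<^sub>M lborel) (%(r, q). ?i r * a r * (ind {r<..} q * (?i q * b q)))"
 proof (rule Bochner_Integration.integrable_bound)
  show "integrable (lborel \<Otimes>\<^sub>M lborel) (%x. (?i (fst x) * a (fst x)) * (?i (snd x) * b (snd x)))"
  proof (rule lborel_pair.Fubini_integrable)
   show "Lint (%r. (LI q. norm (?i (fst (r, q)) * a (fst (r, q)) * (?i (snd (r, q)) * b (snd (r, q))))))"
   proof -
    have "(%r. (LI q. norm (?i (fst (r, q)) * a (fst (r, q)) * (?i (snd (r, q)) * b (snd (r, q))))))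
      = (%r. norm (?i r * a r) * (LI q. norm (?i q * b q)))"
     by (simp only: fst_conv snd_conv norm_mult[of "?i _ * a _" "?i _ * b _"] integral_mult_right_zero)
    then show ?thesis using integrable_mult_left[OF integrable_norm[OF ia]] by simp
   qed
   show "AE r in lborel. Lint (%q. ?i (fst (r, q)) * a (fst (r, q)) * (?i (snd (r, q)) * b (snd (r, q))))"
    using ib by simp
  qed measurable
  have "(%x. ?i (fst x) * a (fst x) * ((if fst x < snd x then 1 else 0) * (?i (snd x) * b (snd x)))) : borel_measurable (lborel \<Otimes>\<^sub>M lborel)"
   by measurable
  then show "(%(r, q). ?i r * a r * (ind {r<..} q * (?i q * b q))) : borel_measurable (lborel \<Otimes>\<^sub>M lborel)"
   by (simp add: split_beta' indicator_def)
 qed (auto split: split_indicator)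
 have "prim a s * prim b s = (LI r. ?i r * a r * prim b s)"
  by (simp add: prim_def)
 also have "... = (LI r. ?i r * (a r * prim b r) + ?i r * a r * (LI q. ind {r<..} q * (?i q * b q)))"
 proof (rule Bochner_Integration.integral_cong)
  fix r
  have "prim b s - prim b r = (LI q. ind {r<..} q * (?i q * b q))" if "0 < r" "r < s"
   using that by (subst prim_eq[OF b]) (auto intro!: Bochner_Integration.integral_cong split: split_indicator)
  then show "?i r * a r * prim b s = ?i r * (a r * prim b r) + ?i r * a r * (LI q. ind {r<..} q * (?i q * b q))"
   by (auto split: split_indicator simp: algebra_simps)
 qed simp
 also have "... = (LI r. ?i r * (a r * prim b r)) + (LI r. ?i r * a r * (LI q. ind {r<..} q * (?i q * b q)))"
  using lborel_pair.integrable_fst'[OF I2] integrable_times_prim[OF a b]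
  by (intro Bochner_Integration.integral_add integrable_indicator_times) auto
 also have "(LI r. ?i r * a r * (LI q. ind {r<..} q * (?i q * b q)))
   = (LI r. (LI q. ?i r * a r * (ind {r<..} q * (?i q * b q))))" by simp
 also have "... = (LI q. (LI r. ?i r * a r * (ind {r<..} q * (?i q * b q))))"
  using lborel_pair.Fubini_integral[of "%r q. ?i r * a r * (ind {r<..} q * (?i q * b q))"] I2 by simp
 also have "... = (LI q. ?i q * (prim a q * b q))"
 proof (rule Bochner_Integration.integral_cong)
  fix q
  have "(LI r. ?i r * a r * (ind {r<..} q * (?i q * b q))) = (LI r. ?i q * b q * (ind {0<..<q} r * a r))"
   by (intro Bochner_Integration.integral_cong) (auto split: split_indicator)
  also have "... = ?i q * (prim a q * b q)" by (simp add: prim_def)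
  finally show "(LI r. ?i r * a r * (ind {r<..} q * (?i q * b q))) = ?i q * (prim a q * b q)" .
 qed simp
 also have "(LI r. ?i r * (a r * prim b r)) + (LI q. ?i q * (prim a q * b q))
   = prim (%r. a r * prim b r + prim a r * b r) s"
  unfolding prim_def[of "%r. a r * prim b r + prim a r * b r"] distrib_left
  using integrable_times_prim[OF a b] integrable_times_prim[OF b a]
  by (intro Bochner_Integration.integral_add[symmetric] integrable_indicator_times) (auto simp: mult.commute)
 finally show ?thesis .
qed

section \<open>Integrals of derivatives along coordinate lines\<close>

lemma integral_FTC_line:
 fixes g g' :: "real => real"
 assumes "!!r. (g has_real_derivative g' r) (at r)" and "Lint (%r. ind {..c} r * g' r)"
  and z: "!!r. r <= - R ==> g r = 0"
 shows "(LI r. ind {..c} r * g' r) = g c"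
proof -
 let ?f = "%r. ind {..c} r * g' r"
 define p where "p = - \<bar>R\<bar> - \<bar>c\<bar> - 1"
 have pc: "p <= c" "p < - R" by (auto simp: p_def)
 have "(g' has_integral (g c - g p)) {p..c}"
  using assms(1) by (intro fundamental_theorem_of_calculus pc)
   (auto simp: has_real_derivative_iff_has_vector_derivative[symmetric] intro: has_field_derivative_at_within)
 then have "(?f has_integral (g c - g p)) {p..c}"
  by (rule has_integral_eq[rotated]) auto
 then have "(?f has_integral (g c - g p)) UNIV"
 proof (rule has_integral_on_superset)
  fix r assume "r ~: {p..c}"
  show "?f r = 0"
  proof (cases "r < p")
   case True
   then have "r < - R" using pc by simp
   then have "\<forall>\<^sub>F x in nhds r. g x = 0"
    using eventually_nhds_in_open[of "{..<-R}" r] by (auto elim!: eventually_mono simp: z)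
   then have "(g has_real_derivative 0) (at r)" by (subst DERIV_cong_ev[OF refl _ refl]) auto
   then have "g' r = 0" using assms(1) DERIV_unique by blast
   then show ?thesis by simp
  next
   case False then show ?thesis using \<open>r ~: {p..c}\<close> by auto
  qed
 qed simp
 moreover have "(?f has_integral (LI r. ?f r)) UNIV"
  using assms(2) by (rule has_integral_integral_lborel)
 ultimately have "(LI r. ?f r) = g c - g p" by (rule has_integral_unique[symmetric])
 moreover have "g p = 0" using z pc by simp
 ultimately show ?thesis by simp
qed

lemma line_deriv:
 assumes b: "b : Basis" and d: "!!z. ((%r. h (z + r *\<^sub>R b)) has_real_derivative h' z) (at 0)"
 shows "((%r. h (upd b z r)) has_real_derivative h' (upd b z r)) (at r)"
proof -
 have "((%q. h (upd b z r + (q - r) *\<^sub>R b)) has_real_derivative h' (upd b z r) * 1) (at r)"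
  by (rule DERIV_chain'[where g="%q. h (upd b z r + q *\<^sub>R b)" and f="%q. q - r"])
   (auto intro!: derivative_eq_intros d)
 then show ?thesis using b by (simp add: upd_add)
qed

text \<open>On each line the derivative integrates to the value of \<open>h\<close> on the end face,
  because \<open>h\<close> vanishes far back, and only the sign of that value matters. This form
  suits the final time, where the boundary term has a sign but no bound.\<close>

lemma integral_deriv_nonneg:
 fixes h h' :: "'a::euclidean_space => real"
 assumes b: "b : Basis" and d: "!!z. ((%r. h (z + r *\<^sub>R b)) has_real_derivative h' z) (at 0)"
  and i: "Lint (%z. ind {z. z \<bullet> b <= c} z * h' z)"
  and z: "!!z. z \<bullet> b <= - R ==> h z = 0" and nn: "!!z. z \<bullet> b = c ==> 0 <= h z"
 shows "0 <= (LI z. ind {z. z \<bullet> b <= c} z * h' z)"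
proof -
 have "0 <= (LI z. ind (slab b) z *\<^sub>R (LI r. ind {..c} r * h' (upd b z r)))"
 proof (intro integral_nonneg_AE AE_I2)
  fix z :: 'a
  have "0 <= (LI r. ind {..c} r * h' (upd b z r))"
  proof (cases "Lint (%r. ind {..c} r * h' (upd b z r))")
   case True
   have "(LI r. ind {..c} r * h' (upd b z r)) = h (upd b z c)"
    by (rule integral_FTC_line[where R=R, OF line_deriv[OF b d] True]) (use b in \<open>auto simp: upd_inner intro!: z\<close>)
   also have "... \<ge> 0" using b by (intro nn) (auto simp: upd_inner)
   finally show ?thesis .
  next
   \<comment> \<open>Integrability is guaranteed on almost every line only; on the others the
     Bochner integral is 0 by convention, which is compatible with the claim.\<close>
   case False then show ?thesis by (simp add: not_integrable_integral_eq)
  qed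
  then show "0 <= ind (slab b) z *\<^sub>R (LI r. ind {..c} r * h' (upd b z r))" by simp
 qed
 also have "... = (LI z. ind {z. z \<bullet> b <= c} z * h' z)"
  by (subst integral_line(2)[OF b i]) (use b in \<open>auto simp: upd_inner indicator_def intro!: Bochner_Integration.integral_cong\<close>)
 finally show ?thesis .
qed

text \<open>In a half space that contains the support, the preceding inequality holds for both
  \<open>h\<close> and its negative.\<close>

lemma integral_deriv_zero:
 fixes h h' :: "'a::euclidean_space => real"
 assumes b: "b : Basis" and d: "!!z. ((%r. h (z + r *\<^sub>R b)) has_real_derivative h' z) (at 0)"
  and i: "Lint h'" and z: "!!z. \<bar>z \<bullet> b\<bar> \<ge> R ==> h z = 0"
 shows "(LI z. h' z) = 0"
proof -
 have e: "ind {z. z \<bullet> b <= \<bar>R\<bar> + 1} z * h' z = h' z" for z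
 proof (cases "z \<bullet> b <= \<bar>R\<bar> + 1")
  case False
  have "\<forall>\<^sub>F r in nhds (0::real). r : {-1<..<1}" by (rule eventually_nhds_in_open) auto
  then have "\<forall>\<^sub>F r in nhds (0::real). h (z + r *\<^sub>R b) = 0"
  proof eventually_elim
   case (elim r)
   then show ?case using False b by (intro z) (auto simp: inner_simps)
  qed
  then have "((%r. h (z + r *\<^sub>R b)) has_real_derivative 0) (at 0)"
   by (subst DERIV_cong_ev[OF refl _ refl]) auto
  then have "h' z = 0" using d[of z] DERIV_unique by blast
  then show ?thesis by simp
 qed simp
 have *: "0 <= (LI z. s * h' z)" for s :: real
 proof -
  have "0 <= (LI z. ind {z. z \<bullet> b <= \<bar>R\<bar> + 1} z * (s * h' z))"
  proof (rule integral_deriv_nonneg[OF b, where R="\<bar>R\<bar>" and h="%z. s * h z"])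
   show "((%r. s * h (z + r *\<^sub>R b)) has_real_derivative s * h' z) (at 0)" for z
    by (rule DERIV_cmult[OF d])
   show "Lint (%z. ind {z. z \<bullet> b <= \<bar>R\<bar> + 1} z * (s * h' z))"
    using i by (simp only: mult.left_commute[of _ s] e integrable_mult_right)
   show "s * h w = 0" if "w \<bullet> b <= - \<bar>R\<bar>" for w using that z[of w] by simp
   show "0 <= s * h w" if "w \<bullet> b = \<bar>R\<bar> + 1" for w using that z[of w] by simp
  qed
  then show ?thesis by (simp only: mult.left_commute[of _ s] e)
 qed
 show ?thesis using *[of 1] *[of "-1"] by simp
qed

section \<open>Coordinates on space-time: height, cross-section, tangential directions\<close>

abbreviation ek :: "'n::finite => 'n tx" where "ek l \<equiv> (0, axis l 1)"
abbreviation tau :: "real \<times> (real ^ 'n::finite)" where "tau \<equiv> (1, 0)"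
abbreviation ht :: "'n::finite => 'n tx => real" where "ht k z \<equiv> snd z $ k"

text \<open>The directions along which the coefficients are constant: time and the n - 1 horizontal
  axes, n in all.\<close>

definition tang :: "'n::finite => ('n tx) set" where
 "tang k = Basis - {ek k}"

definition cross :: "'n::finite => 'n tx => real ^ 'n" where
 "cross k z = snd z - axis k (snd z $ k)"

lemma Basis_W: "(Basis :: (real \<times> (real ^ 'n::finite)) set) = insert tau (range ek)"
 by (auto simp: Basis_prod_def Basis_vec_def)

lemma ek_Basis [simp]: "ek l : Basis" and tau_Basis [simp]: "tau : Basis"
 by (auto simp: Basis_W)

lemma ek_eq_iff [simp]: "ek l = ek m \<longleftrightarrow> l = m" "tau ~= ek l" "ek l ~= tau"
 by (auto, metis axis_eq_axis zero_neq_one)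

lemma ek_tang [simp]: "ek l : tang k \<longleftrightarrow> l ~= k" and tau_tang [simp]: "tau : tang k"
 unfolding tang_def by (simp_all del: prod.inject)

lemma tang_Basis: "b : tang k ==> b : Basis" by (simp add: tang_def)
lemma tang_neq: "b : tang k ==> b ~= ek k" by (simp add: tang_def)

lemma tang_cases:
 assumes "b : tang k"
 obtains "b = tau" | l where "l ~= k" "b = ek l"
proof -
 from tang_Basis[OF assms, unfolded Basis_W] show thesis
 proof (rule insertE)
  assume "b : range ek"
  then obtain l where l: "b = ek l" by (rule rangeE)
  then have "l ~= k" using tang_neq[OF assms] by metis
  then show thesis using l by (rule that(2))
 qed (rule that(1))
qed

lemma inner_ek [simp]: "z \<bullet> ek l = snd z $ l" and inner_tau [simp]: "z \<bullet> tau = fst z"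
 by (auto simp: inner_prod_def inner_axis)

lemma ht_upd [simp]: "ht k (upd (ek k) z r) = r"
 using upd_inner[of "ek k" "ek k" z r] by simp

lemma ht_upd_tang: "b : tang k ==> ht k (upd b z r) = ht k z"
 using upd_inner[of b "ek k" z r] tang_Basis[of b k] tang_neq[of b k] by (auto split: if_splits simp del: prod.inject)

lemma ht_add_tang: "b : tang k ==> ht k (z + r *\<^sub>R b) = ht k z"
 by (simp add: add_scale_upd ht_upd_tang)

lemma fst_upd_ek [simp]: "fst (upd (ek k) z r) = fst z"
 using upd_inner[of "ek k" tau z r] by simp

lemma cross_nth: "cross k z $ l = (if l = k then 0 else snd z $ l)"
 by (simp add: cross_def axis_def)

lemma cross_upd_ek [simp]: "cross k (upd (ek k) z r) = cross k z"
 by (simp add: vec_eq_iff cross_nth) (metis ek_eq_iff(1) inner_ek upd_inner ek_Basis)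

lemma cross_add: "cross k (z + r *\<^sub>R b) = cross k z + r *\<^sub>R cross k b"
 by (simp add: vec_eq_iff cross_nth)

lemma norm_cross_le: "norm (cross k z) <= norm (snd z)"
 by (rule norm_le_componentwise_cart) (simp add: cross_nth)

lemma continuous_ht [continuous_intros]: "continuous_on S f ==> continuous_on S (%x. ht k (f x))"
 by (intro continuous_intros)

lemma continuous_cross [continuous_intros]: "continuous_on S f ==> continuous_on S (%x. cross k (f x))"
proof -
 have "(%x. cross k (f x)) = (%x. \<chi> l. if l = k then 0 else snd (f x) $ l)"
  by (simp add: fun_eq_iff vec_eq_iff cross_nth)
 moreover assume "continuous_on S f"
 then have "continuous_on S (%x. if l = k then 0 else snd (f x) $ l)" for l
  by (cases "l = k") (auto intro!: continuous_intros)
 then have "continuous_on S (%x. \<chi> l. if l = k then 0 else snd (f x) $ l)"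
  by (rule continuous_on_vec_lambda)
 ultimately show ?thesis by (simp only:)
qed

lemma measurable_ht [measurable]: "ht k : bm"
 by (intro borel_measurable_continuous_onI continuous_intros)

lemma measurable_fst_W [measurable]: "fst : borel_measurable (borel :: (real \<times> (real ^ 'n::finite)) measure)"
 by (intro borel_measurable_continuous_onI continuous_intros)


section \<open>An explicit cutoff function\<close>

definition psi :: "real => real" where "psi r = (max 0 r)^2"
definition dpsi :: "real => real" where "dpsi r = 2 * max 0 r"

lemma psi_deriv: "(psi has_real_derivative dpsi r) (at r)"
proof (cases "r = 0")
 case True
 have "((%h. psi h / h) \<longlongrightarrow> 0) (at 0)"
  by (rule Lim_null_comparison[of _ "%h. \<bar>h\<bar>"])
   (auto intro!: always_eventually tendsto_eq_intros simp: psi_def max_def power2_eq_square)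
 then show ?thesis using True by (simp add: DERIV_def psi_def dpsi_def)
next
 case False
 show ?thesis
 proof (cases "r > 0")
  case True
  then have "\<forall>\<^sub>F x in nhds r. psi x = x^2"
   using eventually_nhds_in_open[of "{0<..}" r] by (auto elim!: eventually_mono simp: psi_def)
  then show ?thesis using True
   by (subst DERIV_cong_ev[OF refl _ refl]) (auto simp: dpsi_def intro!: derivative_eq_intros)
 next
  case f: False
  then have "\<forall>\<^sub>F x in nhds r. psi x = 0"
   using eventually_nhds_in_open[of "{..<0}" r] False by (auto elim!: eventually_mono simp: psi_def)
  then show ?thesis using f False
   by (subst DERIV_cong_ev[OF refl _ refl]) (auto simp: dpsi_def)
 qed
qed

lemma psi_bounds: "0 <= psi r" "r <= 4 ==> psi r <= 16" "0 <= dpsi r" "r <= 4 ==> dpsi r <= 8"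
 "r <= 0 ==> psi r = 0" "r <= 0 ==> dpsi r = 0"
 using power_mono[of "max 0 r" 4 2] by (auto simp: psi_def dpsi_def max_def)

lemma continuous_psi [continuous_intros]:
 "continuous_on S f ==> continuous_on S (%x. psi (f x))" "continuous_on S f ==> continuous_on S (%x. dpsi (f x))"
 unfolding psi_def dpsi_def by (intro continuous_intros, assumption)+

text \<open>The cutoff is differentiated only once, so a C^1 profile is enough, and an explicit one
  keeps its constants numerical. For t <= 0 each factor is at most 16, whence the division by 16^3.
  It need not vanish at t = 0 or at height 0: the first boundary is handled by a sign, the second by
  the conormal condition.\<close>

definition zeta :: "'n::finite => 'n tx => real" where
 "zeta k z = psi (4 + fst z) * psi (4 - cross k z \<bullet> cross k z) * psi (4 - (ht k z)^2) / 4096"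

definition dzeta :: "'n::finite => 'n tx => 'n tx => real" where
 "dzeta k b z = (dpsi (4 + fst z) * fst b * psi (4 - cross k z \<bullet> cross k z) * psi (4 - (ht k z)^2)
  + psi (4 + fst z) * (dpsi (4 - cross k z \<bullet> cross k z) * (- 2 * (cross k z \<bullet> cross k b))) * psi (4 - (ht k z)^2)
  + psi (4 + fst z) * psi (4 - cross k z \<bullet> cross k z) * (dpsi (4 - (ht k z)^2) * (- 2 * ht k z * ht k b))) / 4096"

lemma zeta_deriv: "((%r. zeta k (z + r *\<^sub>R b)) has_real_derivative dzeta k b z) (at 0)"
proof -
 have 1: "((%r. psi (4 + fst (z + r *\<^sub>R b))) has_real_derivative dpsi (4 + fst z) * fst b) (at 0)"
  by (rule DERIV_chain'[where g=psi, OF _ psi_deriv, THEN DERIV_cong]) (auto intro!: derivative_eq_intros)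
 have "((%r. 4 - cross k (z + r *\<^sub>R b) \<bullet> cross k (z + r *\<^sub>R b)) has_real_derivative - 2 * (cross k z \<bullet> cross k b)) (at 0)"
  unfolding cross_add inner_simps
  by (auto intro!: derivative_eq_intros simp: inner_commute)
 then have 2: "((%r. psi (4 - cross k (z + r *\<^sub>R b) \<bullet> cross k (z + r *\<^sub>R b))) has_real_derivative dpsi (4 - cross k z \<bullet> cross k z) * (- 2 * (cross k z \<bullet> cross k b))) (at 0)"
  by (rule DERIV_chain'[where g=psi, OF _ psi_deriv, THEN DERIV_cong]) simp
 have "((%r. 4 - (ht k (z + r *\<^sub>R b))^2) has_real_derivative - 2 * ht k z * ht k b) (at 0)"
  by (auto intro!: derivative_eq_intros)
 then have 3: "((%r. psi (4 - (ht k (z + r *\<^sub>R b))^2)) has_real_derivative dpsi (4 - (ht k z)^2) * (- 2 * ht k z * ht k b)) (at 0)"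
  by (rule DERIV_chain'[where g=psi, OF _ psi_deriv, THEN DERIV_cong]) simp
 show ?thesis unfolding zeta_def
  by (rule DERIV_cong[OF DERIV_cdivide[OF DERIV_mult[OF DERIV_mult[OF 1 2] 3]]]) (simp add: dzeta_def algebra_simps)
qed

lemma continuous_zeta: "continuous_on UNIV (zeta k)" and continuous_dzeta: "continuous_on UNIV (dzeta k b)"
 unfolding zeta_def dzeta_def by (intro continuous_intros; simp)+

lemma measurable_zeta [measurable]: "zeta k : bm" and measurable_dzeta [measurable]: "dzeta k b : bm"
 by (intro borel_measurable_continuous_onI continuous_zeta continuous_dzeta)+

lemma zeta_nonneg: "0 <= zeta k z"
 by (auto simp: zeta_def intro!: mult_nonneg_nonneg psi_bounds)

lemma zeta_le_1: "fst z <= 0 ==> zeta k z <= 1"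
proof -
 assume "fst z <= 0"
 then have "psi (4 + fst z) * psi (4 - cross k z \<bullet> cross k z) * psi (4 - (ht k z)^2) <= 16 * 16 * 16"
  by (intro mult_mono psi_bounds mult_nonneg_nonneg) auto
 then show ?thesis by (simp add: zeta_def)
qed

lemma zeta_support:
 assumes "zeta k z ~= 0 \<or> dzeta k b z ~= 0"
 shows "- 4 < fst z" "norm (cross k z) < 2" "\<bar>ht k z\<bar> < 2"
proof -
 have *: "4 + fst z > 0 & 4 - cross k z \<bullet> cross k z > 0 & 4 - (ht k z)^2 > 0"
 proof (intro conjI; rule ccontr)
  assume "~ 0 < 4 + fst z"
  then show False using assms psi_bounds(5,6)[of "4 + fst z"] by (simp add: zeta_def dzeta_def)
 next
  assume "~ 0 < 4 - cross k z \<bullet> cross k z"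
  then show False using assms psi_bounds(5,6)[of "4 - cross k z \<bullet> cross k z"] by (simp add: zeta_def dzeta_def)
 next
  assume "~ 0 < 4 - (ht k z)^2"
  then show False using assms psi_bounds(5,6)[of "4 - (ht k z)^2"] by (simp add: zeta_def dzeta_def)
 qed
 then show "- 4 < fst z" by simp
 have "(norm (cross k z))^2 < 2^2" using * by (simp add: power2_norm_eq_inner)
 then show "norm (cross k z) < 2" by (rule power2_less_imp_less) simp
 have "\<bar>ht k z\<bar>^2 < 2^2" using * by simp
 then show "\<bar>ht k z\<bar> < 2" by (rule power2_less_imp_less) simp
qed

text \<open>Before the division by 4096 the three terms of the product rule are at most 2048, 8192
  and 8192, so the quotient is at most 4.5.\<close>

lemma dzeta_bound:
 assumes t: "fst z <= 0" and b: "norm b <= 1"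
 shows "\<bar>dzeta k b z\<bar> <= 5"
proof (cases "dzeta k b z = 0")
 case False
 note s = zeta_support[OF disjI2[OF False]]
 have fb: "\<bar>fst b\<bar> <= 1" "norm (cross k b) <= 1" "\<bar>ht k b\<bar> <= 1"
  using b norm_fst_le[of "fst b" "snd b"] norm_snd_le[of "snd b" "fst b"] norm_cross_le[of k b] component_le_norm_cart[of "snd b" k] by auto
 have ps: "psi (4 + fst z) <= 16" "psi (4 - cross k z \<bullet> cross k z) <= 16" "psi (4 - (ht k z)^2) <= 16"
  "dpsi (4 + fst z) <= 8" "dpsi (4 - cross k z \<bullet> cross k z) <= 8" "dpsi (4 - (ht k z)^2) <= 8"
  using t by (auto intro!: psi_bounds)
 have m: "\<bar>a * b * c * d\<bar> <= A * B * C * D" if "\<bar>a\<bar> <= A" "\<bar>b\<bar> <= B" "\<bar>c\<bar> <= C" "\<bar>d\<bar> <= D" for a b c d A B C D :: real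
  unfolding abs_mult using that by (intro mult_mono) (auto intro: order_trans[OF abs_ge_zero])
 have c2: "\<bar>cross k z \<bullet> cross k b\<bar> <= 2 * 1"
  using Cauchy_Schwarz_ineq2[of "cross k z" "cross k b"] mult_mono[of "norm (cross k z)" 2 "norm (cross k b)" 1] s fb by auto
 have h2: "\<bar>ht k z * ht k b\<bar> <= 2 * 1"
  unfolding abs_mult using s fb by (intro mult_mono) auto
 have "\<bar>dpsi (4 + fst z) * fst b * psi (4 - cross k z \<bullet> cross k z) * psi (4 - (ht k z)^2)\<bar> <= 8 * 1 * 16 * 16"
  using ps fb psi_bounds by (intro m) (auto simp: abs_of_nonneg)
 moreover have "\<bar>psi (4 + fst z) * dpsi (4 - cross k z \<bullet> cross k z) * (- 2 * (cross k z \<bullet> cross k b)) * psi (4 - (ht k z)^2)\<bar> <= 16 * 8 * 4 * 16"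
  using ps psi_bounds c2 by (intro m) (auto simp: abs_of_nonneg abs_mult)
 moreover have "\<bar>psi (4 + fst z) * psi (4 - cross k z \<bullet> cross k z) * dpsi (4 - (ht k z)^2) * (- 2 * (ht k z * ht k b))\<bar> <= 16 * 16 * 8 * 4"
  using ps psi_bounds h2 by (intro m) (auto simp: abs_of_nonneg abs_mult mult.commute)
 ultimately show ?thesis unfolding dzeta_def by (simp add: mult.assoc)
qed simp

text \<open>Each of the three factors is at least 9 there, and 729 / 4096 exceeds 1 / 6.\<close>

lemma zeta_lower:
 assumes "- 1 <= fst z" "norm (cross k z) <= 1" "\<bar>ht k z\<bar> <= 1"
 shows "1 / 6 <= zeta k z"
proof -
 have *: "9 <= psi r" if "3 <= r" for r using power_mono[of 3 "max 0 r" 2] that by (simp add: psi_def max_def split: if_splits)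
 have "cross k z \<bullet> cross k z <= 1" using power_mono[OF assms(2), of 2] by (simp add: power2_norm_eq_inner)
 moreover have "(ht k z)^2 <= 1" using power_mono[OF assms(3), of 2] by simp
 ultimately have "9 * 9 * 9 <= psi (4 + fst z) * psi (4 - cross k z \<bullet> cross k z) * psi (4 - (ht k z)^2)"
  using assms by (intro mult_mono *) (auto intro!: mult_nonneg_nonneg psi_bounds)
 then show ?thesis by (simp add: zeta_def)
qed

lemma prim_add: "Lint f ==> Lint g ==> prim (%r. f r + g r) s = prim f s + prim g s"
 unfolding prim_def distrib_left by (intro Bochner_Integration.integral_add integrable_indicator_times) auto

lemma prim_cmult: "prim (%r. c * f r) s = c * prim f s"
 unfolding prim_def by (simp add: mult.left_commute)

text \<open>The integrand is the derivative of \<open>prim g\<close> times V, where V = (c + prim P)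
  * \<eta>. No boundary terms arise: \<open>prim g\<close> vanishes at 0, which is the conormal
  condition when \<open>prim g\<close> is the flux, and \<eta> vanishes at 3. With
  \<open>c = 1\<close> and \<open>P = 0\<close> the same identity says that \<open>g\<close> is the
  weak derivative of \<open>prim g\<close>.\<close>

lemma vertical_parts:
 assumes P: "Lint P" and g: "Lint g"
  and e: "!!r. (\<eta> has_real_derivative \<eta>' r) (at r)" and c': "continuous_on UNIV \<eta>'" and e3: "\<eta> 3 = 0"
 shows "(LI r. ind {0<..<3} r * (g r * ((c + prim P r) * \<eta> r) + prim g r * (P r * \<eta> r + (c + prim P r) * \<eta>' r))) = 0"
proof -
 \<comment> \<open>Truncated to [0,3] the derivative of \<eta> is integrable, so \<eta> is itself a
   constant plus a primitive there and \<open>prim_mult\<close> applies to products with it.\<close>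
 define e' where "e' = (%r. ind {0..3} r * \<eta>' r)"
 have ie: "Lint e'"
  using borel_integrable_atLeastAtMost'[OF continuous_on_subset[OF c'], of 0 3] by (simp add: set_integrable_def e'_def)
 have eta: "\<eta> r = \<eta> 0 + prim e' r" if "0 <= r" "r <= 3" for r
 proof -
  have "prim e' r = (LI x. ind {0..r} x *\<^sub>R \<eta>' x)"
   unfolding prim_def
  proof (rule integral_cong_AE)
   show "AE x in lborel. ind {0<..<r} x * e' x = ind {0..r} x *\<^sub>R \<eta>' x"
    using AE_lborel_singleton[of 0] AE_lborel_singleton[of r]
    by eventually_elim (use that in \<open>auto simp: e'_def split: split_indicator\<close>)
   have [measurable]: "\<eta>' : bm" by (rule borel_measurable_continuous_onI[OF c'])
   show "(%x. ind {0<..<r} x * e' x) : borel_measurable lborel" "(%x. ind {0..r} x *\<^sub>R \<eta>' x) : borel_measurable lborel"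
    unfolding e'_def by measurable
  qed
  also have "... = \<eta> r - \<eta> 0"
   using that e by (intro integral_FTC_atLeastAtMost continuous_on_subset[OF c'])
    (auto simp: has_real_derivative_iff_has_vector_derivative[symmetric] intro: has_field_derivative_at_within)
  finally show ?thesis by simp
 qed
 define q where "q = (%r. c * e' r + (\<eta> 0 * P r + (P r * prim e' r + prim P r * e' r)))"
 have iPe: "Lint (%r. P r * prim e' r + prim P r * e' r)"
  using integrable_times_prim[OF P ie] integrable_times_prim[OF ie P] by (simp add: mult.commute)
 have iq: "Lint q"
  unfolding q_def using ie P iPe by simp
 have V: "(c + prim P r) * \<eta> r = c * \<eta> 0 + prim q r" if "0 <= r" "r <= 3" for r
 proof -
  have "prim q r = c * prim e' r + (\<eta> 0 * prim P r + prim P r * prim e' r)"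
   unfolding q_def using ie P iPe by (simp add: prim_add prim_cmult prim_mult[OF P ie])
  then show ?thesis using eta[OF that] by (simp add: algebra_simps)
 qed
 have igq: "Lint (%r. g r * prim q r + prim g r * q r)"
  using integrable_times_prim[OF g iq] integrable_times_prim[OF iq g] by (simp add: mult.commute)
 have "0 = prim g 3 * ((c + prim P 3) * \<eta> 3)" using e3 by simp
 also have "... = c * \<eta> 0 * prim g 3 + prim (%r. g r * prim q r + prim g r * q r) 3"
  by (subst V) (simp_all add: algebra_simps prim_mult[OF g iq])
 also have "... = prim (%r. c * \<eta> 0 * g r + (g r * prim q r + prim g r * q r)) 3"
  using g igq by (simp add: prim_add prim_cmult)
 also have "... = (LI r. ind {0<..<3} r * (g r * ((c + prim P r) * \<eta> r) + prim g r * (P r * \<eta> r + (c + prim P r) * \<eta>' r)))"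
  unfolding prim_def[of _ 3]
 proof (rule Bochner_Integration.integral_cong)
  fix r :: real
  show "ind {0<..<3} r * (c * \<eta> 0 * g r + (g r * prim q r + prim g r * q r)) =
    ind {0<..<3} r * (g r * ((c + prim P r) * \<eta> r) + prim g r * (P r * \<eta> r + (c + prim P r) * \<eta>' r))"
  proof (cases "r : {0<..<3}")
   case True
   then have r: "0 <= r" "r <= 3" by auto
   have "e' r = \<eta>' r" using True by (simp add: e'_def)
   then have "q r = P r * \<eta> r + (c + prim P r) * \<eta>' r"
    using eta[OF r] by (simp add: q_def algebra_simps)
   then show ?thesis using True V[OF r] by (simp add: algebra_simps)
  qed simp
 qed simp
 finally show ?thesis by simp
qed

section \<open>Energy estimates for tangential families\<close>

text \<open>All that the energy method has to know about a family of solutions stable under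
  tangential differentiation; \<open>d b i\<close> is the index of the derivative of the i-th member
  along \<open>b\<close>. The bounds in \<open>dom\<close> are qualitative, with a constant for each
  index, and serve integrability alone. The last three assumptions are the equation on vertical
  lines: horizontal gradient, vertical gradient, and the flux as a primitive that starts at 0. Their
  range reaches beyond the support of the cutoff in the past and in the cross-section.\<close>

locale tangential_family =
 fixes k :: "'n::finite" and \<Lambda> lam t0 :: real and \<mu> a0 :: "real => real" and A :: "real => real ^ 'n ^ 'n"
  and S :: "'i set" and v :: "'i => 'n tx => real" and p :: "'i => 'n tx => real ^ 'n"
  and d :: "'n tx => 'i => 'i" and m1 :: "real => real"
 assumes Lambda: "1 <= \<Lambda>" and lam: "0 <= lam" and t0: "t0 < 0"
  and mu_pos: "!!s. 0 < \<mu> s" and mu_borel [measurable]: "\<mu> : bm"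
  and a0_borel [measurable]: "a0 : bm" and a0_bounds: "!!s. 1 / \<Lambda> <= a0 s" "!!s. a0 s <= \<Lambda>"
  and A_borel [measurable]: "!!i j. (%s. A s $ i $ j) : bm"
  and A_ell: "!!s \<xi>. (norm \<xi>)^2 / \<Lambda> <= (A s *v \<xi>) \<bullet> \<xi>"
  and A_bound: "!!s \<xi>. norm (A s *v \<xi>) <= \<Lambda> * norm \<xi>"
  and m1_borel [measurable]: "m1 : bm" and m1_nonneg: "!!s. 0 <= m1 s"
  and m1_out: "!!s. s ~: {0<..<3} ==> m1 s = 0"
  and m1_int: "Lint m1" "Lint (%s. \<mu> s * m1 s)" "Lint (%s. \<mu> s * (m1 s)^2)"
  and d_S: "!!i b. i : S ==> b : tang k ==> d b i : S"
  and v_borel: "!!i. i : S ==> v i : bm"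
  and p_borel: "!!i l. i : S ==> (%z. p i z $ l) : bm"
  and v_deriv: "!!i b z. i : S ==> b : tang k ==> ((%r. v i (z + r *\<^sub>R b)) has_real_derivative v (d b i) z) (at 0)"
  and p_deriv: "!!i b z l. i : S ==> b : tang k ==> ((%r. p i (z + r *\<^sub>R b) $ l) has_real_derivative p (d b i) z $ l) (at 0)"
  and dom: "!!i. i : S ==> \<exists>C\<ge>0. \<forall>z. \<bar>v i z\<bar> <= C * m1 (ht k z) & norm (p i z) <= C * m1 (ht k z)"
  and tang_grad: "!!i l z. i : S ==> l ~= k ==> - 5 < fst z ==> fst z < 0 ==> norm (cross k z) < 5 / 2 ==>
    AE s in lborel. s : {0<..<3} --> p i (upd (ek k) z s) $ l = v (d (ek l) i) (upd (ek k) z s)"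
  and vert_grad: "!!i z. i : S ==> - 5 < fst z ==> fst z < 0 ==> norm (cross k z) < 5 / 2 ==>
    \<exists>c. AE s in lborel. s : {0<..<3} --> v i (upd (ek k) z s) = c + prim (%r. p i (upd (ek k) z r) $ k) s"
  and flux: "!!i z. i : S ==> - 5 < fst z ==> fst z < 0 ==> norm (cross k z) < 5 / 2 ==>
    AE s in lborel. s : {0<..<3} --> \<mu> s * (A s *v p i (upd (ek k) z s)) $ k
     = prim (%r. \<mu> r * (a0 r * v (d tau i) (upd (ek k) z r) + lam * v i (upd (ek k) z r)
       - (\<Sum>l\<in>UNIV - {k}. (A r *v p (d (ek l) i) (upd (ek k) z r)) $ l))) s"
begin

definition fl :: "'i => 'n => 'n tx => real" where
 "fl i l z = (A (ht k z) *v p i z) $ l"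

text \<open>The past up to t0. Since t0 < 0, wherever \<open>T\<close> is nonzero the time is
  strictly negative, as the slice equations require.\<close>

definition T :: "'n tx => real" where "T = ind {z. z \<bullet> tau <= t0}"

definition bx :: "('n tx) set" where
 "bx = {z. - 4 <= fst z & fst z <= 0 & (\<forall>l. l ~= k --> \<bar>snd z $ l\<bar> <= 2)}"

text \<open>Bookkeeping of integrability: \<open>dom1\<close> is for single factors,
  \<open>dom2\<close> for products of two of them. Times \<mu> and a cutoff, \<open>dom2\<close>
  functions are integrable before t0 because \<mu> * m1^2 is integrable in the height and the cutoff
  bounds the other variables.\<close>

definition dom1 :: "('n tx => real) => bool" where
 "dom1 f \<longleftrightarrow> f : bm & (\<exists>C\<ge>0. \<forall>z. \<bar>f z\<bar> <= C * m1 (ht k z))"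

definition dom2 :: "('n tx => real) => bool" where
 "dom2 f \<longleftrightarrow> f : bm & (\<exists>C\<ge>0. \<forall>z. \<bar>f z\<bar> <= C * (m1 (ht k z))^2)"

lemma T_borel [measurable]: "T : bm" unfolding T_def by measurable

lemma T_cases: "T z = 0 \<or> T z = 1 & fst z <= t0" by (auto simp: T_def split: split_indicator)
lemma T_nonneg: "0 <= T z" using T_cases[of z] by auto

lemma dom1_borel: "dom1 f ==> f : bm" by (simp add: dom1_def)
lemma dom1_mult: "dom1 f ==> dom1 g ==> dom2 (%z. f z * g z)"
proof -
 assume f: "dom1 f" and g: "dom1 g"
 obtain C where C: "0 <= C" "!!z. \<bar>f z\<bar> <= C * m1 (ht k z)" using f by (auto simp: dom1_def)
 obtain E where E: "0 <= E" "!!z. \<bar>g z\<bar> <= E * m1 (ht k z)" using g by (auto simp: dom1_def)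
 have "\<bar>f z * g z\<bar> <= C * E * (m1 (ht k z))^2" for z
  using mult_mono[OF C(2)[of z] E(2)[of z]] C(1) m1_nonneg[of "ht k z"] by (simp add: abs_mult power2_eq_square algebra_simps)
 moreover have "(%z. f z * g z) : bm" using f g by (auto simp: dom1_def)
 ultimately show ?thesis using C(1) E(1) unfolding dom2_def by (metis mult_nonneg_nonneg)
qed

lemma dom2_add: "dom2 f ==> dom2 g ==> dom2 (%z. f z + g z)"
proof -
 assume f: "dom2 f" and g: "dom2 g"
 obtain C where C: "0 <= C" "!!z. \<bar>f z\<bar> <= C * (m1 (ht k z))^2" using f by (auto simp: dom2_def)
 obtain E where E: "0 <= E" "!!z. \<bar>g z\<bar> <= E * (m1 (ht k z))^2" using g by (auto simp: dom2_def)
 have "\<bar>f z + g z\<bar> <= (C + E) * (m1 (ht k z))^2" for z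
  using C(2)[of z] E(2)[of z] by (simp add: algebra_simps)
 moreover have "(%z. f z + g z) : bm" using f g by (auto simp: dom2_def)
 ultimately show ?thesis using C(1) E(1) unfolding dom2_def by (metis add_nonneg_nonneg)
qed

lemma dom2_sum: "finite I ==> (!!i. i : I ==> dom2 (f i)) ==> dom2 (%z. \<Sum>i\<in>I. f i z)"
proof (induction I rule: finite_induct)
 case empty
 show ?case unfolding dom2_def by (auto intro!: exI[of _ 0])
qed (auto intro: dom2_add)

lemma dom1_v: "i : S ==> dom1 (v i)"
 using dom[of i] v_borel[of i] unfolding dom1_def by blast

lemma dom1_p: "i : S ==> dom1 (%z. p i z $ l)"
proof -
 assume i: "i : S"
 then obtain C where "0 <= C" "!!z. norm (p i z) <= C * m1 (ht k z)" using dom[of i] by auto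
 then have "\<bar>p i z $ l\<bar> <= C * m1 (ht k z)" for z
  using component_le_norm_cart[of "p i z" l] order_trans by blast
 then show ?thesis using p_borel[OF i] \<open>0 <= C\<close> unfolding dom1_def by blast
qed

lemma fl_borel: "i : S ==> fl i l : bm"
proof -
 assume "i : S"
 note [measurable] = p_borel[OF this]
 have "fl i l = (%z. \<Sum>j\<in>UNIV. A (ht k z) $ l $ j * p i z $ j)"
  by (simp add: fl_def[abs_def] matrix_vector_mult_def fun_eq_iff)
 then show ?thesis by simp
qed

lemma dom1_fl: "i : S ==> dom1 (fl i l)"
proof -
 assume i: "i : S"
 then obtain C where C: "0 <= C" "!!z. norm (p i z) <= C * m1 (ht k z)" using dom[of i] by auto
 have "\<bar>fl i l z\<bar> <= \<Lambda> * C * m1 (ht k z)" for z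
 proof -
  have "\<bar>fl i l z\<bar> <= norm (A (ht k z) *v p i z)" unfolding fl_def by (rule component_le_norm_cart)
  also have "... <= \<Lambda> * norm (p i z)" by (rule A_bound)
  also have "... <= \<Lambda> * (C * m1 (ht k z))" using Lambda C(2) by (intro mult_left_mono) auto
  finally show ?thesis by (simp add: mult.assoc)
 qed
 moreover have "0 <= \<Lambda> * C" using Lambda C by simp
 ultimately show ?thesis using fl_borel[OF i] unfolding dom1_def by blast
qed

lemma dom_integrable:
 assumes f: "dom2 f" and w [measurable]: "w : bm"
  and B: "!!z. T z ~= 0 ==> \<bar>w z\<bar> <= B" and bx: "!!z. T z ~= 0 ==> w z ~= 0 ==> z : bx"
 shows "Lint (%z. T z * (\<mu> (ht k z) * (w z * f z)))"
proof -
 obtain C where C: "0 <= C" "!!z. \<bar>f z\<bar> <= C * (m1 (ht k z))^2" using f by (auto simp: dom2_def)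
 have [measurable]: "f : bm" using f by (auto simp: dom2_def)
 have cl: "closed bx"
  unfolding bx_def by (intro closed_Collect_conj closed_Collect_le closed_Collect_all closed_Collect_imp continuous_intros) auto
 then have [measurable]: "bx : sets borel" by auto
 have "\<bar>T z * (\<mu> (ht k z) * (w z * f z))\<bar> <= \<bar>B\<bar> * C * (ind bx z * (\<mu> (ht k z) * (m1 (ht k z))^2))" for z
 proof (cases "T z ~= 0 & w z ~= 0")
  case True
  then have "T z = 1" "z : bx" "\<bar>w z\<bar> <= \<bar>B\<bar>" using T_cases[of z] bx[of z] B[of z] by auto
  then have "\<bar>w z\<bar> * \<bar>f z\<bar> <= \<bar>B\<bar> * (C * (m1 (ht k z))^2)" by (intro mult_mono C) auto
  then have "\<mu> (ht k z) * (\<bar>w z\<bar> * \<bar>f z\<bar>) <= \<mu> (ht k z) * (\<bar>B\<bar> * (C * (m1 (ht k z))^2))"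
   using mu_pos[of "ht k z"] by (intro mult_left_mono) auto
  then show ?thesis using \<open>T z = 1\<close> \<open>z : bx\<close> mu_pos[of "ht k z"] by (simp add: abs_mult algebra_simps)
 next
  case False
  have "0 <= \<bar>B\<bar> * C * (ind bx z * (\<mu> (ht k z) * (m1 (ht k z))^2))"
   using C mu_pos[of "ht k z"] by (auto intro!: mult_nonneg_nonneg)
  then show ?thesis using False by auto
 qed
 moreover have "Lint (%z. ind bx z * (\<mu> (ht k z) * (m1 (ht k z))^2))"
 proof (rule integrableI_nonneg)
  show "AE z in lborel. 0 <= ind bx z * (\<mu> (ht k z) * (m1 (ht k z))^2)"
   using mu_pos by (auto intro!: AE_I2 mult_nonneg_nonneg simp: less_imp_le)
  have bxu: "upd (ek k) z r : bx \<longleftrightarrow> z : bx" for z r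
  proof -
   have "snd (upd (ek k) z r) $ l = snd z $ l" if "l ~= k" for l
    using upd_inner[of "ek k" "ek l" z r] that by (simp del: prod.inject)
   then show ?thesis by (simp add: bx_def)
  qed
  have "(NI z. ennreal (ind bx z * (\<mu> (ht k z) * (m1 (ht k z))^2)))
    = (NI z. ind (slab (ek k)) z * (NI r. ennreal (ind bx z * (\<mu> r * (m1 r)^2))))"
   by (subst nn_integral_line(1)[OF ek_Basis[of k]]) (simp_all add: bxu indicator_def)
  also have "... = (NI z. ind (slab (ek k) \<inter> bx) z * (NI r. ennreal (\<mu> r * (m1 r)^2)))"
   by (intro nn_integral_cong) (auto split: split_indicator)
  also have "... = emeasure lborel (slab (ek k) \<inter> bx) * (NI r. ennreal (\<mu> r * (m1 r)^2))"
   by (subst nn_integral_multc) auto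
  also have "... < \<infinity>"
  proof -
   have "slab (ek k) \<inter> bx \<subseteq> cbox (-4, \<chi> l. -2) (0, \<chi> l. 2)"
   proof
    fix z assume z: "z : slab (ek k) \<inter> bx"
    have "-2 <= snd z $ l & snd z $ l <= 2" for l
    proof (cases "l = k")
     case True then show ?thesis using z by (auto simp: slab_def)
    next
     case False then show ?thesis using z by (force simp: bx_def abs_le_iff)
    qed
    then show "z : cbox (-4, \<chi> l. -2) (0, \<chi> l. 2)"
     using z by (cases z) (auto simp: bx_def mem_box_cart cbox_Pair_eq)
   qed
   then have "emeasure lborel (slab (ek k) \<inter> bx) <= emeasure lborel (cbox (-4, \<chi> l. -2) (0 :: real, (\<chi> l. 2) :: real ^ 'n))"
    by (intro emeasure_mono) auto
   also have "... < \<infinity>" by (rule emeasure_lborel_cbox_finite)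
   finally show ?thesis
    using m1_int(3) unfolding real_integrable_def by (auto simp: ennreal_mult_less_top less_top)
  qed
  finally show "(NI z. ennreal (ind bx z * (\<mu> (ht k z) * (m1 (ht k z))^2))) < \<infinity>" .
 qed measurable
 ultimately have bound: "!!z. \<bar>T z * (\<mu> (ht k z) * (w z * f z))\<bar> <= \<bar>B\<bar> * C * (ind bx z * (\<mu> (ht k z) * (m1 (ht k z))^2))"
  and int: "Lint (%z. \<bar>B\<bar> * C * (ind bx z * (\<mu> (ht k z) * (m1 (ht k z))^2)))"
  by simp_all
 show ?thesis
 proof (rule Bochner_Integration.integrable_bound[OF int])
  show "(%z. T z * (\<mu> (ht k z) * (w z * f z))) : borel_measurable lborel" by measurable
  show "AE z in lborel. norm (T z * (\<mu> (ht k z) * (w z * f z))) <= norm (\<bar>B\<bar> * C * (ind bx z * (\<mu> (ht k z) * (m1 (ht k z))^2)))"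
  proof (rule AE_I2)
   fix z show "norm (T z * (\<mu> (ht k z) * (w z * f z))) <= norm (\<bar>B\<bar> * C * (ind bx z * (\<mu> (ht k z) * (m1 (ht k z))^2)))"
    unfolding real_norm_def by (rule order_trans[OF bound abs_ge_self])
  qed
 qed
qed

lemma zeta_bx: "T z ~= 0 ==> zeta k z ~= 0 \<or> dzeta k b z ~= 0 ==> z : bx"
proof -
 assume "T z ~= 0" and z: "zeta k z ~= 0 \<or> dzeta k b z ~= 0"
 then have "fst z <= 0" using T_cases[of z] t0 by auto
 moreover note s = zeta_support[OF z]
 moreover have "\<bar>snd z $ l\<bar> <= 2" if "l ~= k" for l
  using component_le_norm_cart[of "cross k z" l] s(2) that by (simp add: cross_nth)
 ultimately show ?thesis by (simp add: bx_def)
qed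

lemma zeta_T: "T z ~= 0 ==> 0 <= zeta k z & zeta k z <= 1 & \<bar>zeta k z ^ N\<bar> <= 1"
 using T_cases[of z] t0 zeta_nonneg[of k z] zeta_le_1[of z k] by (auto simp: power_le_one abs_of_nonneg)

lemma dzeta_T: "T z ~= 0 ==> b : Basis ==> \<bar>dzeta k b z\<bar> <= 5"
 using T_cases[of z] t0 by (intro dzeta_bound) auto

lemma W1_int:
 assumes "dom2 f"
 shows "Lint (%z. T z * (\<mu> (ht k z) * (zeta k z ^ Suc N * f z)))"
proof (rule dom_integrable[where B=1, OF assms])
 fix z assume z: "T z ~= 0"
 show "\<bar>zeta k z ^ Suc N\<bar> <= 1" using zeta_T[OF z] by blast
 assume "zeta k z ^ Suc N ~= 0"
 then show "z : bx" by (intro zeta_bx[OF z]) auto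
qed measurable

lemma W2_int:
 assumes "dom2 f" and b: "b : Basis"
 shows "Lint (%z. T z * (\<mu> (ht k z) * (zeta k z ^ N * dzeta k b z * f z)))"
proof (rule dom_integrable[where B=5, OF assms(1)])
 fix z assume z: "T z ~= 0"
 have "\<bar>zeta k z ^ N\<bar> * \<bar>dzeta k b z\<bar> <= 1 * 5" using zeta_T[OF z, of N] dzeta_T[OF z b] by (intro mult_mono) auto
 then show "\<bar>zeta k z ^ N * dzeta k b z\<bar> <= 5" by (simp add: abs_mult)
 assume "zeta k z ^ N * dzeta k b z ~= 0"
 then show "z : bx" by (intro zeta_bx[OF z, of b]) auto
qed measurable

end

section \<open>Integration by parts and the tested equation\<close>

context tangential_family
begin

lemma T_tang: "l ~= k ==> T (z + r *\<^sub>R ek l) = T z"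
 by (simp add: T_def inner_prod_def indicator_def)

lemma T_upd: "T (upd (ek k) z r) = T z"
 by (simp add: T_def indicator_def del: inner_Pair)

lemma zeta_pow_deriv:
 "((%r. zeta k (z + r *\<^sub>R b) ^ Suc N) has_real_derivative real (Suc N) * zeta k z ^ N * dzeta k b z) (at 0)"
 using DERIV_power[OF zeta_deriv[of k z b], of "Suc N"] by (simp add: mult_ac)

lemma fl_deriv:
 assumes "i : S" "b : tang k"
 shows "((%r. fl i l (z + r *\<^sub>R b)) has_real_derivative fl (d b i) l z) (at 0)"
proof -
 have "((%r. \<Sum>j\<in>UNIV. A (ht k z) $ l $ j * p i (z + r *\<^sub>R b) $ j) has_real_derivative
   (\<Sum>j\<in>UNIV. A (ht k z) $ l $ j * p (d b i) z $ j)) (at 0)"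
  by (intro DERIV_sum DERIV_cmult p_deriv assms)
 then show ?thesis
  by (simp only: fl_def matrix_vector_mult_def ht_add_tang[OF assms(2), of z] vec_lambda_beta)
qed

lemma weight_deriv:
 assumes b: "b : tang k"
  and f': "((%r. f (z + r *\<^sub>R b)) has_real_derivative f' z) (at 0)"
  and g': "((%r. g (z + r *\<^sub>R b)) has_real_derivative g' z) (at 0)"
 shows "((%r. \<mu> (ht k (z + r *\<^sub>R b)) * (zeta k (z + r *\<^sub>R b) ^ Suc N * (f (z + r *\<^sub>R b) * g (z + r *\<^sub>R b)))) has_real_derivative
   \<mu> (ht k z) * (zeta k z ^ Suc N * (f' z * g z + f z * g' z)) + real (Suc N) * (\<mu> (ht k z) * (zeta k z ^ N * dzeta k b z * (f z * g z)))) (at 0)"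
proof -
 have *: "((%r. zeta k (z + r *\<^sub>R b) ^ Suc N * (f (z + r *\<^sub>R b) * g (z + r *\<^sub>R b))) has_real_derivative
   zeta k z ^ Suc N * (f' z * g z + f z * g' z) + (real (Suc N) * zeta k z ^ N * dzeta k b z) * (f z * g z)) (at 0)"
  by (rule DERIV_cong[OF DERIV_mult[OF zeta_pow_deriv DERIV_mult[OF f' g']]]) (simp add: algebra_simps)
 show ?thesis
  by (simp only: ht_add_tang[OF b]) (rule DERIV_cong[OF DERIV_cmult[OF *]], simp add: algebra_simps)
qed

text \<open>Neither \<mu> nor the set {t <= t0} changes in a horizontal direction, so only
  \<open>f\<close>, \<open>g\<close> and the cutoff are differentiated, and the cutoff removes the
  boundary.\<close>

lemma tang_parts:
 assumes l: "l ~= k" and dm: "dom1 f" "dom1 g" "dom1 f'" "dom1 g'"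
  and f': "!!z. ((%r. f (z + r *\<^sub>R ek l)) has_real_derivative f' z) (at 0)"
  and g': "!!z. ((%r. g (z + r *\<^sub>R ek l)) has_real_derivative g' z) (at 0)"
 shows "(LI z. T z * (\<mu> (ht k z) * (zeta k z ^ Suc N * (f' z * g z + f z * g' z))))
  + real (Suc N) * (LI z. T z * (\<mu> (ht k z) * (zeta k z ^ N * dzeta k (ek l) z * (f z * g z)))) = 0"
proof -
 let ?A = "%z. T z * (\<mu> (ht k z) * (zeta k z ^ Suc N * (f' z * g z + f z * g' z)))"
 let ?B = "%z. T z * (\<mu> (ht k z) * (zeta k z ^ N * dzeta k (ek l) z * (f z * g z)))"
 have lt: "ek l : tang k" using l by simp
 have A: "Lint ?A" by (intro W1_int dom2_add dom1_mult dm)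
 have B: "Lint ?B" by (intro W2_int dom1_mult dm ek_Basis)
 have "(LI z. ?A z + real (Suc N) * ?B z) = 0"
 proof (rule integral_deriv_zero[where h="%z. T z * (\<mu> (ht k z) * (zeta k z ^ Suc N * (f z * g z)))" and R=2, OF ek_Basis[of l]])
  fix z
  show "((%r. T (z + r *\<^sub>R ek l) * (\<mu> (ht k (z + r *\<^sub>R ek l)) * (zeta k (z + r *\<^sub>R ek l) ^ Suc N * (f (z + r *\<^sub>R ek l) * g (z + r *\<^sub>R ek l))))) has_real_derivative
    ?A z + real (Suc N) * ?B z) (at 0)"
   by (simp only: T_tang[OF l]) (rule DERIV_cong[OF DERIV_cmult[OF weight_deriv[OF lt f' g']]], simp add: algebra_simps)
  assume z: "\<bar>z \<bullet> ek l\<bar> \<ge> 2"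
  have "zeta k z = 0"
  proof (rule ccontr)
   assume "zeta k z ~= 0"
   then have "norm (cross k z) < 2" by (intro zeta_support(2)[of k z tau]) auto
   then have "\<bar>snd z $ l\<bar> < 2" using component_le_norm_cart[of "cross k z" l] l by (simp add: cross_nth)
   then show False using z by (simp del: inner_Pair)
  qed
  then show "T z * (\<mu> (ht k z) * (zeta k z ^ Suc N * (f z * g z))) = 0" by simp
 qed (use A B in simp)
 then show ?thesis using A B by simp
qed

text \<open>The face t = t0 leaves the integral of \<mu> * zeta^(N+1) * f * g, which is nonnegative
  and is dropped. This is why an inequality stands where the horizontal counterpart has an
  equation.\<close>

lemma time_parts:
 assumes dm: "dom1 f" "dom1 g" "dom1 f'" "dom1 g'"
  and f': "!!z. ((%r. f (z + r *\<^sub>R tau)) has_real_derivative f' z) (at 0)"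
  and g': "!!z. ((%r. g (z + r *\<^sub>R tau)) has_real_derivative g' z) (at 0)"
  and nn: "!!z. 0 <= f z * g z"
 shows "0 <= (LI z. T z * (\<mu> (ht k z) * (zeta k z ^ Suc N * (f' z * g z + f z * g' z))))
  + real (Suc N) * (LI z. T z * (\<mu> (ht k z) * (zeta k z ^ N * dzeta k tau z * (f z * g z))))"
proof -
 let ?A = "%z. \<mu> (ht k z) * (zeta k z ^ Suc N * (f' z * g z + f z * g' z))"
 let ?B = "%z. \<mu> (ht k z) * (zeta k z ^ N * dzeta k tau z * (f z * g z))"
 have A: "Lint (%z. T z * ?A z)" by (intro W1_int dom2_add dom1_mult dm)
 have B: "Lint (%z. T z * ?B z)" by (intro W2_int dom1_mult dm tau_Basis)
 have e: "T z * (?A z + real (Suc N) * ?B z) = T z * ?A z + real (Suc N) * (T z * ?B z)" for z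
  by (simp add: algebra_simps)
 have "0 <= (LI z. T z * (?A z + real (Suc N) * ?B z))"
  unfolding T_def
 proof (rule integral_deriv_nonneg[where h="%z. \<mu> (ht k z) * (zeta k z ^ Suc N * (f z * g z))" and R=4, OF tau_Basis])
  show "Lint (%z. ind {z. z \<bullet> tau <= t0} z * (?A z + real (Suc N) * ?B z))"
   using A B unfolding T_def[symmetric] e by simp
  fix z
  show "((%r. \<mu> (ht k (z + r *\<^sub>R tau)) * (zeta k (z + r *\<^sub>R tau) ^ Suc N * (f (z + r *\<^sub>R tau) * g (z + r *\<^sub>R tau)))) has_real_derivative
    ?A z + real (Suc N) * ?B z) (at 0)"
   by (rule weight_deriv[OF tau_tang f' g'])
  show "0 <= \<mu> (ht k z) * (zeta k z ^ Suc N * (f z * g z))"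
   using mu_pos[of "ht k z"] zeta_nonneg[of k z] by (intro mult_nonneg_nonneg[OF _ mult_nonneg_nonneg[OF zero_le_power nn]]) auto
  assume z: "z \<bullet> tau <= - 4"
  have "zeta k z = 0"
  proof (rule ccontr)
   assume "zeta k z ~= 0"
   then have "- 4 < fst z" by (intro zeta_support(1)[of k z tau]) auto
   then show False using z by (simp del: inner_Pair)
  qed
  then show "\<mu> (ht k z) * (zeta k z ^ Suc N * (f z * g z)) = 0" by simp
 qed
 then show ?thesis using A B unfolding e by simp
qed

text \<open>The vertical derivative of the flux, divided by \<mu>, as the equation prescribes it:
  the time and zero order terms minus the horizontal part of the divergence.\<close>

definition G :: "'i => 'n tx => real" where
 "G i z = a0 (ht k z) * v (d tau i) z + lam * v i z - (\<Sum>l\<in>UNIV - {k}. fl (d (ek l) i) l z)"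

lemma dom1_borel_bound:
 assumes "dom1 f"
 shows "Lint (%r. f (upd (ek k) z r))" "Lint (%r. \<mu> r * f (upd (ek k) z r))"
proof -
 obtain C where C: "0 <= C" "!!z. \<bar>f z\<bar> <= C * m1 (ht k z)" using assms by (auto simp: dom1_def)
 have m: "(%r. f (upd (ek k) z r)) : bm"
  by (rule measurable_compose[OF _ dom1_borel[OF assms]]) measurable
 then have m': "(%r. \<mu> r * f (upd (ek k) z r)) : bm" by measurable
 have C': "\<bar>f (upd (ek k) z r)\<bar> <= C * m1 r" for r using C(2)[of "upd (ek k) z r"] by simp
 show "Lint (%r. f (upd (ek k) z r))"
  by (rule Bochner_Integration.integrable_bound[OF integrable_mult_right[OF m1_int(1), of C]])
   (use m C' in \<open>auto intro!: AE_I2 order_trans[OF _ abs_ge_self]\<close>)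
 have "\<bar>\<mu> r * f (upd (ek k) z r)\<bar> <= C * (\<mu> r * m1 r)" for r
  using mult_left_mono[OF C'[of r], of "\<mu> r"] mu_pos[of r] by (simp add: abs_mult algebra_simps)
 then show "Lint (%r. \<mu> r * f (upd (ek k) z r))"
  by (intro Bochner_Integration.integrable_bound[OF integrable_mult_right[OF m1_int(2), of C]])
   (use m' in \<open>auto intro!: AE_I2 order_trans[OF _ abs_ge_self]\<close>)
qed

lemma dom1_add: "dom1 f ==> dom1 g ==> dom1 (%z. f z + g z)"
proof -
 assume f: "dom1 f" and g: "dom1 g"
 obtain C where C: "0 <= C" "!!z. \<bar>f z\<bar> <= C * m1 (ht k z)" using f by (auto simp: dom1_def)
 obtain E where E: "0 <= E" "!!z. \<bar>g z\<bar> <= E * m1 (ht k z)" using g by (auto simp: dom1_def)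
 have "\<bar>f z + g z\<bar> <= (C + E) * m1 (ht k z)" for z
  using C(2)[of z] E(2)[of z] by (simp add: algebra_simps)
 moreover have "(%z. f z + g z) : bm" using f g by (auto simp: dom1_def)
 ultimately show ?thesis using C(1) E(1) unfolding dom1_def by (metis add_nonneg_nonneg)
qed

lemma dom1_bounded: "dom1 f ==> w : bm ==> (!!z. \<bar>w z\<bar> <= B) ==> dom1 (%z. w z * f z)"
proof -
 assume f: "dom1 f" and w: "w : bm" and B: "!!z. \<bar>w z\<bar> <= B"
 obtain C where C: "0 <= C" "!!z. \<bar>f z\<bar> <= C * m1 (ht k z)" using f by (auto simp: dom1_def)
 have B0: "0 <= B" using B[of undefined] by simp
 have "\<bar>w z * f z\<bar> <= B * C * m1 (ht k z)" for z
  using mult_mono[OF B[of z] C(2)[of z] B0] by (simp add: abs_mult mult.assoc)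
 moreover have "(%z. w z * f z) : bm" using f w by (auto simp: dom1_def)
 ultimately show ?thesis using C(1) B0 unfolding dom1_def by (metis mult_nonneg_nonneg)
qed

lemma dom1_cmult: "dom1 f ==> dom1 (%z. c * f z)"
 by (rule dom1_bounded[where B="\<bar>c\<bar>"]) auto

lemma a0_abs: "\<bar>a0 s\<bar> <= \<Lambda>"
proof -
 have "0 < 1 / \<Lambda>" using Lambda by simp
 then show ?thesis using a0_bounds(1)[of s] a0_bounds(2)[of s] by linarith
qed

lemma dom1_a0: "dom1 f ==> dom1 (%z. a0 (ht k z) * f z)"
 by (rule dom1_bounded[where B=\<Lambda>]) (auto simp: a0_abs)

lemma dom1_sum: "finite I ==> (!!i. i : I ==> dom1 (f i)) ==> dom1 (%z. \<Sum>i\<in>I. f i z)"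
proof (induction I rule: finite_induct)
 case empty
 show ?case unfolding dom1_def by (auto intro!: exI[of _ 0])
qed (auto intro: dom1_add)

lemma dom1_G: "i : S ==> dom1 (G i)"
proof -
 assume i: "i : S"
 have "dom1 (%z. (a0 (ht k z) * v (d tau i) z + lam * v i z) + (-1) * (\<Sum>l\<in>UNIV - {k}. fl (d (ek l) i) l z))"
  using i by (intro dom1_add dom1_cmult dom1_a0 dom1_v dom1_sum dom1_fl d_S) auto
 then show ?thesis by (simp add: G_def[abs_def])
qed

lemma dom1_out:
 assumes f: "dom1 f" and z: "ht k z ~: {0<..<3}"
 shows "f z = 0"
proof -
 obtain C where C: "!!z. \<bar>f z\<bar> <= C * m1 (ht k z)" using f unfolding dom1_def by blast
 show ?thesis using C[of z] m1_out[OF z] by simp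
qed

lemma zeta_line_deriv:
 "((%r. zeta k (upd (ek k) z r) ^ Suc N) has_real_derivative real (Suc N) * zeta k (upd (ek k) z r) ^ N * dzeta k (ek k) (upd (ek k) z r)) (at r)"
 by (rule line_deriv[OF ek_Basis, where h="%z. zeta k z ^ Suc N" and h'="%z. real (Suc N) * zeta k z ^ N * dzeta k (ek k) z"])
  (rule zeta_pow_deriv)

text \<open>On every vertical line the flux equation is tested with zeta^(N+1) * v_j and integrated
  by parts; then the lines are integrated. The index \<open>i\<close> of the solution and the index
  \<open>j\<close> of the test function are independent.\<close>

lemma vertical:
 assumes i: "i : S" and j: "j : S"
 shows "(LI z. T z * (\<mu> (ht k z) * (zeta k z ^ Suc N * (G i z * v j z + fl i k z * p j z $ k))))
  + real (Suc N) * (LI z. T z * (\<mu> (ht k z) * (zeta k z ^ N * dzeta k (ek k) z * (fl i k z * v j z)))) = 0"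
proof -
 let ?A = "%z. T z * (\<mu> (ht k z) * (zeta k z ^ Suc N * (G i z * v j z + fl i k z * p j z $ k)))"
 let ?B = "%z. T z * (\<mu> (ht k z) * (zeta k z ^ N * dzeta k (ek k) z * (fl i k z * v j z)))"
 note dms = dom1_G[OF i] dom1_v[OF j] dom1_fl[OF i] dom1_p[OF j]
 have A: "Lint ?A" by (intro W1_int dom2_add dom1_mult dms)
 have B: "Lint ?B" by (intro W2_int dom1_mult dms ek_Basis)
 \<comment> \<open>Lines that are too late or outside the range of the slice equations have zero
   integrand, through \<open>T\<close> or through the cutoff. On the others
   \<open>vertical_parts\<close> applies, with the vertical gradient of v_j as \<open>P\<close> and
   \<mu> * G as \<open>g\<close>.\<close>
 have zero: "(LI r. ?A (upd (ek k) z r) + real (Suc N) * ?B (upd (ek k) z r)) = 0" for z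
 proof (cases "T z ~= 0 & - 5 < fst z & norm (cross k z) < 5 / 2")
  case False
  have "?A (upd (ek k) z r) + real (Suc N) * ?B (upd (ek k) z r) = 0" for r
  proof (cases "T z = 0")
   case True then show ?thesis by (simp add: T_upd)
  next
   case F: False
   have "zeta k (upd (ek k) z r) = 0 & dzeta k (ek k) (upd (ek k) z r) = 0"
   proof (rule ccontr)
    assume "~ ?thesis"
    then have "zeta k (upd (ek k) z r) ~= 0 \<or> dzeta k (ek k) (upd (ek k) z r) ~= 0" by blast
    from zeta_support[OF this] show False using F False by simp
   qed
   then show ?thesis by simp
  qed
  then show ?thesis by simp
 next
  case True
  then have z: "- 5 < fst z" "fst z < 0" "norm (cross k z) < 5 / 2" and T1: "T z = 1"
   using T_cases[of z] t0 by auto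
  let ?u = "%r. upd (ek k) z r"
  define P where "P = (%r. p j (?u r) $ k)"
  define g where "g = (%r. \<mu> r * G i (?u r))"
  define \<eta> where "\<eta> = (%r. zeta k (?u r) ^ Suc N)"
  define \<eta>' where "\<eta>' = (%r. real (Suc N) * zeta k (?u r) ^ N * dzeta k (ek k) (?u r))"
  obtain c where c: "AE s in lborel. s : {0<..<3} --> v j (?u s) = c + prim P s"
   using vert_grad[OF j z] by (auto simp: P_def)
  have F: "AE s in lborel. s : {0<..<3} --> \<mu> s * fl i k (?u s) = prim g s"
   using flux[OF i z] by (simp add: g_def G_def fl_def)
  have iP: "Lint P" unfolding P_def by (rule dom1_borel_bound(1)[OF dom1_p[OF j]])
  have ig: "Lint g" unfolding g_def by (rule dom1_borel_bound(2)[OF dom1_G[OF i]])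
  have "zeta k (?u 3) = 0"
  proof (rule ccontr)
   assume "zeta k (?u 3) ~= 0"
   then have "\<bar>ht k (?u 3)\<bar> < 2" by (intro zeta_support(3)[of k _ tau]) auto
   then show False by simp
  qed
  then have e3: "\<eta> 3 = 0" by (simp add: \<eta>_def)
  have cu: "continuous_on UNIV ?u" by (intro continuous_intros)
  have c': "continuous_on UNIV \<eta>'"
   unfolding \<eta>'_def by (intro continuous_intros continuous_on_compose2[OF continuous_zeta cu] continuous_on_compose2[OF continuous_dzeta cu]) auto
  have e: "(\<eta> has_real_derivative \<eta>' r) (at r)" for r
   unfolding \<eta>_def \<eta>'_def by (rule zeta_line_deriv)
  have "(LI r. ?A (?u r) + real (Suc N) * ?B (?u r))
   = (LI r. ind {0<..<3} r * (g r * ((c + prim P r) * \<eta> r) + prim g r * (P r * \<eta> r + (c + prim P r) * \<eta>' r)))"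
  proof (rule integral_cong_AE)
   have m [measurable]: "?u : bm" by measurable
   have [measurable]: "?A : bm" "?B : bm" using A B by auto
   show "(%r. ?A (?u r) + real (Suc N) * ?B (?u r)) : borel_measurable lborel"
   proof -
    have FA: "(%z. ?A z + real (Suc N) * ?B z) : bm" by measurable
    show ?thesis using measurable_compose[OF m FA] by (simp only: measurable_lborel2)
   qed
   have [measurable]: "g : bm" "P : bm" using ig iP by auto
   have [measurable]: "\<eta> : bm" "\<eta>' : bm"
    using borel_measurable_continuous_onI[OF c'] DERIV_isCont[OF e]
    by (auto intro!: borel_measurable_continuous_onI continuous_at_imp_continuous_on)
   show "(%r. ind {0<..<3} r * (g r * ((c + prim P r) * \<eta> r) + prim g r * (P r * \<eta> r + (c + prim P r) * \<eta>' r))) : borel_measurable lborel"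
    by measurable
   show "AE r in lborel. ?A (?u r) + real (Suc N) * ?B (?u r) = ind {0<..<3} r * (g r * ((c + prim P r) * \<eta> r) + prim g r * (P r * \<eta> r + (c + prim P r) * \<eta>' r))"
    using c F
   proof eventually_elim
    case (elim r)
    show ?case
    proof (cases "r : {0<..<3}")
     case True
     then have 1: "c + prim P r = v j (?u r)" "prim g r = \<mu> r * fl i k (?u r)" using elim by auto
     have "?A (?u r) = g r * (v j (?u r) * \<eta> r) + (\<mu> r * fl i k (?u r)) * (P r * \<eta> r)"
      by (simp add: T_upd T1 g_def P_def \<eta>_def algebra_simps)
     moreover have "real (Suc N) * ?B (?u r) = (\<mu> r * fl i k (?u r)) * (v j (?u r) * \<eta>' r)"
      by (simp add: T_upd T1 \<eta>'_def algebra_simps)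
     ultimately show ?thesis using True by (simp add: 1 distrib_left)
    next
     case False
     then have "v j (?u r) = 0" "fl i k (?u r) = 0" using dom1_out[OF dom1_v[OF j], of "?u r"] dom1_out[OF dom1_fl[OF i], of "?u r"] by auto
     then show ?thesis using False by simp
    qed
   qed
  qed
  also have "... = 0" by (rule vertical_parts[OF iP ig e c' e3])
  finally show ?thesis .
 qed
 have "(LI z. ?A z + real (Suc N) * ?B z) = 0"
  by (subst integral_line(2)[OF ek_Basis[of k]]) (use A B zero in \<open>simp_all del: ht_upd\<close>)
 then show ?thesis using A B by simp
qed

lemma AE_tang_grad:
 assumes j: "j : S" and l: "l ~= k"
 shows "AE z in lborel. T z ~= 0 --> zeta k z ~= 0 --> p j z $ l = v (d (ek l) j) z"
proof (rule AE_line[OF ek_Basis[of k]])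
 have lt: "d (ek l) j : S" using j l by (intro d_S) auto
 have [measurable]: "v (d (ek l) j) : bm" by (rule v_borel[OF lt])
 note [measurable] = p_borel[OF j, of l]
 show "Measurable.pred borel (%z. T z ~= 0 --> zeta k z ~= 0 --> p j z $ l = v (d (ek l) j) z)" by measurable
 fix z
 show "AE r in lborel. T (upd (ek k) z r) ~= 0 --> zeta k (upd (ek k) z r) ~= 0 --> p j (upd (ek k) z r) $ l = v (d (ek l) j) (upd (ek k) z r)"
 proof (cases "T z ~= 0 & - 5 < fst z & norm (cross k z) < 5 / 2")
  case True
  then have z: "- 5 < fst z" "fst z < 0" "norm (cross k z) < 5 / 2" using T_cases[of z] t0 by auto
  from tang_grad[OF j l z] show ?thesis
  proof eventually_elim
   case (elim r)
   then show ?case using dom1_out[OF dom1_p[OF j, of l], of "upd (ek k) z r"] dom1_out[OF dom1_v[OF lt], of "upd (ek k) z r"]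
    by (cases "r : {0<..<3}") auto
  qed
 next
  case False
  show ?thesis
  proof (intro AE_I2 impI)
   fix r assume a: "T (upd (ek k) z r) ~= 0" "zeta k (upd (ek k) z r) ~= 0"
   then have "zeta k (upd (ek k) z r) ~= 0 \<or> dzeta k tau (upd (ek k) z r) ~= 0" by simp
   from zeta_support[OF this] a(1) False show "p j (upd (ek k) z r) $ l = v (d (ek l) j) (upd (ek k) z r)"
    by (simp add: T_upd)
  qed
 qed
qed

definition H :: "'i => 'n tx => real" where
 "H i z = (\<Sum>l\<in>UNIV. fl i l z * dzeta k (ek l) z)"

text \<open>The integrand of the weak equation of v_i for the test function zeta^(N+1) * v_j, with
  the time derivative kept on v_i; \<open>H\<close> collects what the gradient of the cutoff
  contributes.\<close>

definition X :: "'i => 'i => nat => 'n tx => real" where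
 "X i j N z = zeta k z ^ Suc N * ((a0 (ht k z) * v (d tau i) z + lam * v i z) * v j z + (\<Sum>l\<in>UNIV. fl i l z * p j z $ l))
  + real (Suc N) * zeta k z ^ N * H i z * v j z"

text \<open>\<open>G\<close> contains the horizontal part of the divergence. Horizontal integration
  by parts moves these derivatives onto the test function, where \<open>AE_tang_grad\<close>
  identifies them with components of the gradient. The case j = i leads to the Caccioppoli
  inequality, the case j = d tau i to the bound of the time derivative.\<close>

lemma master:
 assumes i: "i : S" and j: "j : S"
 shows "Lint (%z. T z * (\<mu> (ht k z) * X i j N z))" and "(LI z. T z * (\<mu> (ht k z) * X i j N z)) = 0"
proof -
 define V where "V = (%z. T z * (\<mu> (ht k z) * (zeta k z ^ Suc N * (G i z * v j z + fl i k z * p j z $ k))))"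
 define B where "B = (%l z. T z * (\<mu> (ht k z) * (zeta k z ^ N * dzeta k (ek l) z * (fl i l z * v j z))))"
 define E where "E = (%l z. T z * (\<mu> (ht k z) * (zeta k z ^ Suc N * (fl (d (ek l) i) l z * v j z + fl i l z * v (d (ek l) j) z))))"
 define E' where "E' = (%l z. T z * (\<mu> (ht k z) * (zeta k z ^ Suc N * (fl (d (ek l) i) l z * v j z + fl i l z * p j z $ l))))"
 have V: "Lint V"
  unfolding V_def by (intro W1_int dom2_add dom1_mult dom1_G dom1_v dom1_fl dom1_p i j)
 have B: "Lint (B l)" for l
  unfolding B_def by (intro W2_int dom1_mult dom1_v dom1_fl i j ek_Basis)
 have dl: "d (ek l) i : S" "d (ek l) j : S" if "l ~= k" for l using that i j by (auto intro!: d_S)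
 have E: "Lint (E l)" if "l ~= k" for l
  unfolding E_def by (intro W1_int dom2_add dom1_mult dom1_v dom1_fl i j dl that)
 have E': "Lint (E' l)" if "l ~= k" for l
  unfolding E'_def by (intro W1_int dom2_add dom1_mult dom1_v dom1_fl dom1_p i j dl that)
 have EE: "(LI z. E l z) = (LI z. E' l z)" if l: "l ~= k" for l
 proof (rule integral_cong_AE)
  show "E l : borel_measurable lborel" "E' l : borel_measurable lborel" using E[OF l] E'[OF l] by auto
  show "AE z in lborel. E l z = E' l z"
   using AE_tang_grad[OF j l] by eventually_elim (auto simp: E_def E'_def)
 qed
 have Et: "(LI z. E l z) + real (Suc N) * (LI z. B l z) = 0" if l: "l ~= k" for l
  unfolding E_def B_def
  using l by (intro tang_parts dom1_fl dom1_v i j dl fl_deriv v_deriv) auto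
 have Vt: "(LI z. V z) + real (Suc N) * (LI z. B k z) = 0"
  unfolding V_def B_def by (rule vertical[OF i j])
 have XE: "T z * (\<mu> (ht k z) * X i j N z) = (V z + real (Suc N) * B k z) + (\<Sum>l\<in>UNIV - {k}. E' l z + real (Suc N) * B l z)" for z
 proof -
  have s: "(\<Sum>l\<in>UNIV. f l) = f k + (\<Sum>l\<in>UNIV - {k}. f l)" for f :: "'n => real" by (simp add: sum.remove)
  show ?thesis
   unfolding X_def V_def B_def E'_def H_def G_def s[of "%l. fl i l z * p j z $ l"] s[of "%l. fl i l z * dzeta k (ek l) z"]
   by (simp add: algebra_simps sum.distrib sum_distrib_left sum_distrib_right)
 qed
 show "Lint (%z. T z * (\<mu> (ht k z) * X i j N z))"
  unfolding XE
  by (intro Bochner_Integration.integrable_add Bochner_Integration.integrable_sum integrable_mult_right V B E') auto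
 have "(LI z. T z * (\<mu> (ht k z) * X i j N z))
   = ((LI z. V z) + real (Suc N) * (LI z. B k z)) + (\<Sum>l\<in>UNIV - {k}. (LI z. E' l z) + real (Suc N) * (LI z. B l z))"
 proof -
  have EB: "Lint (%z. E' l z + real (Suc N) * B l z)" if "l : UNIV - {k}" for l
   using E' B that by auto
  have "(LI z. (V z + real (Suc N) * B k z) + (\<Sum>l\<in>UNIV - {k}. E' l z + real (Suc N) * B l z))
    = (LI z. V z + real (Suc N) * B k z) + (LI z. (\<Sum>l\<in>UNIV - {k}. E' l z + real (Suc N) * B l z))"
   by (intro Bochner_Integration.integral_add Bochner_Integration.integrable_add Bochner_Integration.integrable_sum integrable_mult_right V B EB)
  also have "(LI z. V z + real (Suc N) * B k z) = (LI z. V z) + real (Suc N) * (LI z. B k z)"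
   using V B by simp
  also have "(LI z. (\<Sum>l\<in>UNIV - {k}. E' l z + real (Suc N) * B l z)) = (\<Sum>l\<in>UNIV - {k}. (LI z. E' l z + real (Suc N) * B l z))"
   by (rule Bochner_Integration.integral_sum[OF EB])
  also have "... = (\<Sum>l\<in>UNIV - {k}. (LI z. E' l z) + real (Suc N) * (LI z. B l z))"
   using E' B by (intro sum.cong) auto
  finally show ?thesis unfolding XE .
 qed
 also have "... = 0" using Vt Et EE by simp
 finally show "(LI z. T z * (\<mu> (ht k z) * X i j N z)) = 0" .
qed

end

section \<open>Caccioppoli inequalities and energies of tangential derivatives\<close>

lemma cacc_alg:
 fixes \<Lambda> :: real
 assumes L: "1 <= \<Lambda>" and z: "0 <= \<zeta>" "\<zeta> <= 1" and h: "\<bar>h\<bar> <= B * P" and t: "\<bar>t\<bar> <= 5" and a: "0 <= a" "a <= \<Lambda>"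
  and E: "P^2 / \<Lambda> <= E" and n: "0 <= n" "n <= N" and BP: "0 <= B" "0 <= P"
 shows "\<zeta>^2 * P^2 / (2 * \<Lambda>) - (\<Lambda> / 2 * (N * B)^2 + 5 / 2 * N * \<Lambda>) * w^2 <= \<zeta>^2 * E + n * \<zeta> * (h * w - t * a * w^2 / 2)"
proof -
 have 1: "- (N * \<zeta> * (B * P * \<bar>w\<bar>)) <= n * \<zeta> * (h * w)"
 proof -
  have "\<bar>h * w\<bar> <= B * P * \<bar>w\<bar>" using h by (simp add: abs_mult mult_right_mono)
  then have "\<bar>n * \<zeta> * (h * w)\<bar> <= N * \<zeta> * (B * P * \<bar>w\<bar>)"
   using n z BP by (subst abs_mult) (auto intro!: mult_mono simp: abs_mult)
  then show ?thesis by linarith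
 qed
 have 2: "n * \<zeta> * (t * a * w^2 / 2) <= 5 / 2 * N * \<Lambda> * w^2"
 proof -
  have "n * \<zeta> * (t * a) <= N * 1 * (5 * \<Lambda>)"
  proof -
   have "t * a <= 5 * \<Lambda>" using t a by (intro order_trans[OF mult_right_mono[of t 5 a]]) auto
   then have "n * \<zeta> * (t * a) <= n * \<zeta> * (5 * \<Lambda>)" using n z by (intro mult_left_mono) auto
   also have "... <= N * 1 * (5 * \<Lambda>)" using n z L by (intro mult_right_mono mult_mono) auto
   finally show ?thesis .
  qed
  then have "n * \<zeta> * (t * a) * (w^2 / 2) <= N * 1 * (5 * \<Lambda>) * (w^2 / 2)" by (intro mult_right_mono) auto
  then show ?thesis by simp
 qed
 \<comment> \<open>Young's inequality weighted so that exactly half of the elliptic term P^2 /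
   \<Lambda> pays for the gradient of the cutoff; the other half is the gain in the
   conclusion.\<close>
 have 3: "N * \<zeta> * (B * P * \<bar>w\<bar>) <= \<zeta>^2 * P^2 / (2 * \<Lambda>) + \<Lambda> / 2 * (N * B)^2 * w^2"
 proof -
  have "0 <= (\<zeta> * P - \<Lambda> * (N * B) * \<bar>w\<bar>)^2 / (2 * \<Lambda>)" using L by simp
  also have "... = \<zeta>^2 * P^2 / (2 * \<Lambda>) + \<Lambda> / 2 * (N * B)^2 * w^2 - N * \<zeta> * (B * P * \<bar>w\<bar>)"
   using L by (simp add: power2_diff field_simps power2_eq_square)
  finally show ?thesis by simp
 qed
 have 4: "\<zeta>^2 * P^2 / \<Lambda> <= \<zeta>^2 * E" using mult_left_mono[OF E, of "\<zeta>^2"] by simp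
 have 5: "\<zeta>^2 * P^2 / \<Lambda> = \<zeta>^2 * P^2 / (2 * \<Lambda>) + \<zeta>^2 * P^2 / (2 * \<Lambda>)" using L by (simp add: field_simps)
 show ?thesis using 1 2 3 4 5 by (simp add: algebra_simps)
qed

text \<open>Pointwise form of testing with the time derivative w. Of the coercive term w^2 /
  \<Lambda>, one eighth goes to the gradient of the cutoff and one eighth to l * u * w, which leaves
  3 / (4 * \<Lambda>). \<open>E\<close> pairs the flux with the gradient of w, of length R;
  \<open>e\<close> stays free so that a Caccioppoli inequality for w can absorb R^2 later.\<close>

lemma e3_alg:
 fixes \<Lambda> :: real
 assumes L: "1 <= \<Lambda>" and z: "0 <= \<zeta>" "\<zeta> <= 1" and h: "\<bar>h\<bar> <= B * P" and a: "1 / \<Lambda> <= a"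
  and E: "\<bar>E\<bar> <= \<Lambda> * P * R" and n: "0 <= n" "n <= N" and BP: "0 <= B" "0 <= P" "0 <= R" and e: "0 < e"
 shows "3 / (4 * \<Lambda>) * (\<zeta>^2 * w^2) - 2 * \<Lambda> * l^2 * (\<zeta>^2 * u^2) - e * (\<zeta> ^ 4 * R^2) - (\<Lambda>^2 / (4 * e) + 2 * \<Lambda> * (N * B)^2) * P^2
  <= \<zeta>^2 * ((a * w + l * u) * w + E) + n * \<zeta> * (h * w)"
proof -
 have 1: "- (N * \<zeta> * (B * P * \<bar>w\<bar>)) <= n * \<zeta> * (h * w)"
 proof -
  have "\<bar>h * w\<bar> <= B * P * \<bar>w\<bar>" using h by (simp add: abs_mult mult_right_mono)
  then have "\<bar>n * \<zeta> * (h * w)\<bar> <= N * \<zeta> * (B * P * \<bar>w\<bar>)"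
   using n z BP by (subst abs_mult) (auto intro!: mult_mono simp: abs_mult)
  then show ?thesis by linarith
 qed
 have 3: "N * \<zeta> * (B * P * \<bar>w\<bar>) <= \<zeta>^2 * w^2 / (8 * \<Lambda>) + 2 * \<Lambda> * (N * B)^2 * P^2"
 proof -
  have "0 <= (\<zeta> * \<bar>w\<bar> - 4 * \<Lambda> * (N * B) * P)^2 / (8 * \<Lambda>)" using L by simp
  also have "... = \<zeta>^2 * w^2 / (8 * \<Lambda>) + 2 * \<Lambda> * (N * B)^2 * P^2 - N * \<zeta> * (B * P * \<bar>w\<bar>)"
   using L by (simp add: power2_diff field_simps power2_eq_square)
  finally show ?thesis by simp
 qed
 have 4: "\<zeta>^2 * w^2 / \<Lambda> <= \<zeta>^2 * (a * w * w)"
 proof -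
  have "1 / \<Lambda> * (\<zeta>^2 * w^2) <= a * (\<zeta>^2 * w^2)" by (rule mult_right_mono[OF a]) simp
  then show ?thesis by (simp add: power2_eq_square mult_ac)
 qed
 have 5: "- (\<zeta>^2 * w^2 / (8 * \<Lambda>) + 2 * \<Lambda> * l^2 * (\<zeta>^2 * u^2)) <= \<zeta>^2 * (l * u * w)"
 proof -
  have "0 <= \<zeta>^2 * (w + 4 * \<Lambda> * l * u)^2 / (8 * \<Lambda>)" using L by simp
  also have "... = \<zeta>^2 * w^2 / (8 * \<Lambda>) + 2 * \<Lambda> * l^2 * (\<zeta>^2 * u^2) + \<zeta>^2 * (l * u * w)"
   using L by (simp add: power2_sum field_simps power2_eq_square)
  finally show ?thesis by simp
 qed
 have 6: "- (e * (\<zeta> ^ 4 * R^2) + \<Lambda>^2 / (4 * e) * P^2) <= \<zeta>^2 * E"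
 proof -
  have "0 <= (2 * e * (\<zeta>^2 * R) - \<Lambda> * P)^2 / (4 * e)" using e by simp
  also have "... = e * (\<zeta> ^ 4 * R^2) + \<Lambda>^2 / (4 * e) * P^2 - \<zeta>^2 * (\<Lambda> * P * R)"
   using e by (simp add: power2_diff field_simps power2_eq_square power4_eq_xxxx)
  finally have "\<zeta>^2 * (\<Lambda> * P * R) <= e * (\<zeta> ^ 4 * R^2) + \<Lambda>^2 / (4 * e) * P^2" by simp
  moreover have "- (\<zeta>^2 * (\<Lambda> * P * R)) <= \<zeta>^2 * E"
   using mult_left_mono[of "- (\<Lambda> * P * R)" E "\<zeta>^2"] E by (simp add: abs_le_iff)
  ultimately show ?thesis by linarith
 qed
 have 7: "\<zeta>^2 * w^2 / \<Lambda> = 3 / (4 * \<Lambda>) * (\<zeta>^2 * w^2) + \<zeta>^2 * w^2 / (8 * \<Lambda>) + \<zeta>^2 * w^2 / (8 * \<Lambda>)" using L by (simp add: field_simps)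
 have 8: "\<zeta>^2 * ((a * w + l * u) * w + E) = \<zeta>^2 * (a * w * w) + \<zeta>^2 * (l * u * w) + \<zeta>^2 * E" by (simp add: algebra_simps)
 have 9: "(\<Lambda>^2 / (4 * e) + 2 * \<Lambda> * (N * B)^2) * P^2 = \<Lambda>^2 / (4 * e) * P^2 + 2 * \<Lambda> * (N * B)^2 * P^2" by (simp add: algebra_simps)
 show ?thesis unfolding 8 9 using 1 3 4 5 6 7 by linarith
qed

context tangential_family
begin

text \<open>Energies before t0 with the cutoff to the power m + 1. Growing powers of a single cutoff
  take the place of shrinking cylinders: differentiating it costs one power, absorbing the result
  into a square costs two.\<close>

definition Wn :: "('n tx => real) => nat => real" where
 "Wn f m = (LI z. T z * (\<mu> (ht k z) * (zeta k z ^ Suc m * f z)))"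

definition pn :: "'i => 'n tx => real" where "pn i z = (norm (p i z))^2"

lemma pn_sum: "pn i z = (\<Sum>l\<in>UNIV. p i z $ l * p i z $ l)"
 by (simp add: pn_def power2_norm_eq_inner inner_vec_def)

lemma dom2_pn: "i : S ==> dom2 (pn i)"
 unfolding pn_sum[abs_def] by (intro dom2_sum dom1_mult dom1_p) auto

lemma dom2_v2: "i : S ==> dom2 (%z. (v i z)^2)"
 unfolding power2_eq_square by (intro dom1_mult dom1_v)

lemma dom2_p2: "i : S ==> dom2 (%z. (p i z $ l)^2)"
 unfolding power2_eq_square by (intro dom1_mult dom1_p)

lemma Wn_mono:
 assumes "dom2 f" "dom2 g" "!!z. f z <= g z"
 shows "Wn f m <= Wn g m"
 unfolding Wn_def
proof (intro integral_mono W1_int assms)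
 fix z show "T z * (\<mu> (ht k z) * (zeta k z ^ Suc m * f z)) <= T z * (\<mu> (ht k z) * (zeta k z ^ Suc m * g z))"
  using mu_pos[of "ht k z"] T_nonneg[of z] zeta_nonneg[of k z] assms(3)[of z]
  by (intro mult_left_mono) auto
qed

lemma Wn_nonneg: "(!!z. 0 <= f z) ==> 0 <= Wn f m"
 unfolding Wn_def
proof (intro integral_nonneg_AE AE_I2)
 fix z assume "!!z. 0 <= f z"
 then show "0 <= T z * (\<mu> (ht k z) * (zeta k z ^ Suc m * f z))"
  using mu_pos[of "ht k z"] by (intro mult_nonneg_nonneg T_nonneg zero_le_power zeta_nonneg) (auto simp: less_imp_le)
qed

lemma Wn_antimono:
 assumes "dom2 f" "!!z. 0 <= f z" "m <= m'"
 shows "Wn f m' <= Wn f m"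
 unfolding Wn_def
proof (intro integral_mono W1_int assms)
 fix z show "T z * (\<mu> (ht k z) * (zeta k z ^ Suc m' * f z)) <= T z * (\<mu> (ht k z) * (zeta k z ^ Suc m * f z))"
 proof (cases "T z = 0")
  case False
  then have "zeta k z ^ Suc m' <= zeta k z ^ Suc m" using zeta_T[of z 0] assms(3) by (intro power_decreasing) auto
  then show ?thesis using mu_pos[of "ht k z"] T_nonneg[of z] assms(2)[of z]
   by (intro mult_left_mono mult_right_mono) auto
 qed simp
qed

text \<open>The constant in the bound of \<open>H\<close> by the length of the gradient: n summands,
  each with the factor 5 of the differentiated cutoff and the factor \<Lambda> of the
  matrix.\<close>

definition B0 :: real where "B0 = 5 * real CARD('n) * \<Lambda>"
definition kc :: "real => real" where "kc N = \<Lambda> / 2 * (N * B0)^2 + 5 / 2 * N * \<Lambda>"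

lemma B0_nonneg: "0 <= B0" using Lambda by (simp add: B0_def)

lemma fl_bound: "\<bar>fl i l z\<bar> <= \<Lambda> * norm (p i z)"
 unfolding fl_def using component_le_norm_cart A_bound order_trans by metis

lemma H_bound: "T z ~= 0 ==> \<bar>H i z\<bar> <= B0 * norm (p i z)"
proof -
 assume z: "T z ~= 0"
 have "\<bar>fl i l z * dzeta k (ek l) z\<bar> <= \<Lambda> * norm (p i z) * 5" for l
  unfolding abs_mult using Lambda by (intro mult_mono fl_bound dzeta_T[OF z ek_Basis]) auto
 then have "(\<Sum>l\<in>UNIV. \<bar>fl i l z * dzeta k (ek l) z\<bar>) <= real CARD('n) * (\<Lambda> * norm (p i z) * 5)"
  by (intro order_trans[OF sum_bounded_above[where K="\<Lambda> * norm (p i z) * 5"]]) auto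
 then show ?thesis unfolding H_def B0_def by (intro order_trans[OF sum_abs]) (simp add: mult_ac)
qed

lemma fl_inner: "(\<Sum>l\<in>UNIV. fl i l z * p j z $ l) = (A (ht k z) *v p i z) \<bullet> p j z"
 by (simp add: fl_def inner_vec_def)

lemma kc_ge_1: "3 <= N ==> 1 <= kc N"
proof -
 assume "3 <= N"
 then have "1 * 1 <= 5 / 2 * N * \<Lambda>" using Lambda by (intro mult_mono) auto
 moreover have "0 <= \<Lambda> / 2 * (N * B0)^2" using Lambda by simp
 ultimately show ?thesis unfolding kc_def by linarith
qed

text \<open>The equation is tested with its own solution. The time term is half the time derivative
  of a0 * v^2, so \<open>time_parts\<close> disposes of it up to the differentiated cutoff; what
  remains is \<open>cacc_alg\<close> at every point.\<close>

lemma caccioppoli: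
 assumes i: "i : S" and N: "real m + 3 <= N"
 shows "lam * Wn (%z. (v i z)^2) (m + 2) + Wn (pn i) (m + 2) / (2 * \<Lambda>) <= kc N * Wn (%z. (v i z)^2) m"
proof -
 let ?w = "v (d tau i)"
 define Tm where "Tm = (%z. T z * (\<mu> (ht k z) * (zeta k z ^ Suc (m + 2) * (a0 (ht k z) * ?w z * v i z + a0 (ht k z) * v i z * ?w z))))"
 define Tb where "Tb = (%z. T z * (\<mu> (ht k z) * (zeta k z ^ (m + 2) * dzeta k tau z * (a0 (ht k z) * v i z * v i z))))"
 define Xi where "Xi = (%z. T z * (\<mu> (ht k z) * X i i (m + 2) z))"
 have wS: "d tau i : S" using i by (intro d_S) auto
 note dms = dom1_a0[OF dom1_v[OF i]] dom1_a0[OF dom1_v[OF wS]] dom1_v[OF i] dom1_v[OF wS]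
 have iTm: "Lint Tm" unfolding Tm_def by (intro W1_int dom2_add dom1_mult dms)
 have iTb: "Lint Tb" unfolding Tb_def by (intro W2_int dom1_mult dms tau_Basis)
 have iX: "Lint Xi" "(LI z. Xi z) = 0" unfolding Xi_def using master[OF i i] by auto
 have time: "0 <= (LI z. Tm z) + real (Suc (m + 2)) * (LI z. Tb z)"
  unfolding Tm_def Tb_def
 proof (rule time_parts[OF dms(1,3,2,4)])
  fix z
  show "((%r. a0 (ht k (z + r *\<^sub>R tau)) * v i (z + r *\<^sub>R tau)) has_real_derivative a0 (ht k z) * ?w z) (at 0)"
   by (simp only: ht_add_tang[OF tau_tang]) (rule DERIV_cmult[OF v_deriv[OF i tau_tang]])
  show "((%r. v i (z + r *\<^sub>R tau)) has_real_derivative ?w z) (at 0)" by (rule v_deriv[OF i tau_tang])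
  have "0 < 1 / \<Lambda>" using Lambda by simp
  then have "0 <= a0 (ht k z)" using a0_bounds(1)[of "ht k z"] by linarith
  then show "0 <= a0 (ht k z) * v i z * v i z" by (simp add: mult.assoc)
 qed
 define L where "L = (%z. lam * (T z * (\<mu> (ht k z) * (zeta k z ^ Suc (m + 2) * (v i z)^2)))
   + T z * (\<mu> (ht k z) * (zeta k z ^ Suc (m + 2) * pn i z)) / (2 * \<Lambda>) - kc N * (T z * (\<mu> (ht k z) * (zeta k z ^ Suc m * (v i z)^2))))"
 have iL: "Lint L"
  unfolding L_def using W1_int[OF dom2_v2[OF i], of "m + 2"] W1_int[OF dom2_v2[OF i], of m] W1_int[OF dom2_pn[OF i], of "m + 2"]
  by (intro Bochner_Integration.integrable_add Bochner_Integration.integrable_diff integrable_mult_right integrable_divide)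
 \<comment> \<open>Subtracting half of the nonnegative quantity in \<open>time\<close> cancels the
   product of v and its time derivative in \<open>Xi\<close> and leaves only the time derivative of
   the cutoff.\<close>
 have "(LI z. L z) <= (LI z. Xi z - (Tm z + real (Suc (m + 2)) * Tb z) / 2)"
 proof (rule integral_mono[OF iL])
  show "Lint (%z. Xi z - (Tm z + real (Suc (m + 2)) * Tb z) / 2)" using iX iTm iTb by simp
  fix z
  show "L z <= Xi z - (Tm z + real (Suc (m + 2)) * Tb z) / 2"
  proof (cases "T z = 0")
   case True then show ?thesis by (simp add: L_def Xi_def Tm_def Tb_def)
  next
   case False
   define y where "y = zeta k z"
   define n where "n = real m + 3"
   define E where "E = (A (ht k z) *v p i z) \<bullet> p i z"
   have T1: "T z = 1" using False T_cases[of z] by auto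
   have y: "0 <= y" "y <= 1" using zeta_T[OF False, of 0] by (auto simp: y_def)
   have a: "0 <= a0 (ht k z)" "a0 (ht k z) <= \<Lambda>"
   proof -
    have "0 < 1 / \<Lambda>" using Lambda by simp
    then show "0 <= a0 (ht k z)" using a0_bounds(1)[of "ht k z"] by linarith
   qed (rule a0_bounds)
   have alg: "y^2 * (norm (p i z))^2 / (2 * \<Lambda>) - (\<Lambda> / 2 * (N * B0)^2 + 5 / 2 * N * \<Lambda>) * (v i z)^2
     <= y^2 * E + n * y * (H i z * v i z - dzeta k tau z * a0 (ht k z) * (v i z)^2 / 2)"
    using N A_ell unfolding E_def n_def
    by (intro cacc_alg[OF Lambda y H_bound[OF False] dzeta_T[OF False tau_Basis] a] B0_nonneg) auto
   have "\<mu> (ht k z) * y ^ Suc m * (y^2 * pn i z / (2 * \<Lambda>) - kc N * (v i z)^2)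
     <= \<mu> (ht k z) * y ^ Suc m * (y^2 * E + n * y * (H i z * v i z - dzeta k tau z * a0 (ht k z) * (v i z)^2 / 2))"
    using alg y mu_pos[of "ht k z"] by (intro mult_left_mono) (auto simp: kc_def pn_def)
   moreover have "L z = lam * \<mu> (ht k z) * y ^ Suc (m + 2) * (v i z)^2 + \<mu> (ht k z) * y ^ Suc m * (y^2 * pn i z / (2 * \<Lambda>) - kc N * (v i z)^2)"
    unfolding L_def T1 y_def by (simp add: algebra_simps power_add power2_eq_square)
   moreover have "Xi z - (Tm z + real (Suc (m + 2)) * Tb z) / 2 = lam * \<mu> (ht k z) * y ^ Suc (m + 2) * (v i z)^2
     + \<mu> (ht k z) * y ^ Suc m * (y^2 * E + n * y * (H i z * v i z - dzeta k tau z * a0 (ht k z) * (v i z)^2 / 2))"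
    unfolding Xi_def Tm_def Tb_def X_def fl_inner T1 E_def[symmetric] y_def[symmetric] n_def
    by (simp add: algebra_simps power_add power2_eq_square add_divide_distrib diff_divide_distrib)
   ultimately show ?thesis by linarith
  qed
 qed
 also have "... <= 0" using iX iTm iTb time by simp
 finally have "(LI z. L z) <= 0" .
 moreover have "(LI z. L z) = lam * Wn (%z. (v i z)^2) (m + 2) + Wn (pn i) (m + 2) / (2 * \<Lambda>) - kc N * Wn (%z. (v i z)^2) m"
  unfolding L_def Wn_def using W1_int[OF dom2_v2[OF i], of "m + 2"] W1_int[OF dom2_v2[OF i], of m] W1_int[OF dom2_pn[OF i], of "m + 2"]
  by (simp del: power_Suc)
 ultimately show ?thesis by simp
qed

end

section \<open>Iterated integrals along coordinate lines\<close>

fun line_int :: "'a::euclidean_space list => ('a => ennreal) => 'a => ennreal" where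
 "line_int [] F z = F z"
| "line_int (b # bs) F z = (NI r. line_int bs F (upd b z r))"

lemma line_int_borel [measurable]: "F : bm ==> line_int bs F : bm"
proof (induction bs)
 case Nil
 have "line_int [] F = F" by auto
 then show ?case using Nil by simp
next
 case (Cons b bs)
 then have [measurable]: "line_int bs F : bm" by simp
 have "(%z. (NI r. line_int bs F (upd b z r))) : bm" by measurable
 then show ?case by simp
qed

lemma line_int_add:
 assumes [measurable]: "F : bm" "G : bm"
 shows "line_int bs (%z. F z + G z) z = line_int bs F z + line_int bs G z"
proof (induction bs arbitrary: z)
 case (Cons b bs)
 have "line_int (b # bs) (%z. F z + G z) z = (NI r. line_int bs F (upd b z r) + line_int bs G (upd b z r))"
  by (simp add: Cons)
 also have "... = line_int (b # bs) F z + line_int (b # bs) G z"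
  by (subst nn_integral_add) auto
 finally show ?case .
qed simp

lemma line_int_inv:
 "set bs \<subseteq> Basis ==> b : set bs ==> line_int bs F (upd b z r) = line_int bs F z"
proof (induction bs arbitrary: z r)
 case (Cons c bs)
 show ?case
 proof (cases "c = b")
  case True then show ?thesis using Cons.prems by simp
 next
  case False
  then have "b : set bs" "b : Basis" "c : Basis" using Cons.prems by auto
  then show ?thesis using Cons False by (simp add: upd_commute[of c b])
 qed
qed simp

lemma line_int_const:
 fixes z z' :: "'a::euclidean_space"
 assumes "set bs = Basis"
 shows "line_int bs F z = line_int bs F z'"
proof -
 have "(!!c. c : Basis - J ==> z \<bullet> c = z' \<bullet> c) ==> line_int bs F z = line_int bs F z'" if "finite J" "J \<subseteq> Basis" for J and z z' :: 'a
  using that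
 proof (induction J arbitrary: z rule: finite_induct)
  case empty
  then have "z = z'" by (simp add: euclidean_eq_iff[of z])
  then show ?case by simp
 next
  case (insert b J)
  have "line_int bs F (upd b z (z' \<bullet> b)) = line_int bs F z'"
   using insert by (intro insert.IH) (auto simp: upd_inner)
  then show ?case using insert.prems assms by (simp add: line_int_inv)
 qed
 from this[of Basis z z'] show ?thesis by auto
qed

lemma nn_integral_line_int:
 fixes F :: "'a::euclidean_space => ennreal"
 assumes F: "F : bm" and bs: "distinct bs" "set bs \<subseteq> Basis"
 shows "(NI z. F z) = (NI z. (\<Prod>b\<in>set bs. ind (slab b) z) * line_int bs F z)"
 using bs
proof (induction bs)
 case (Cons b bs)
 note [measurable] = F
 have bB: "b : Basis" using Cons by auto
 have "(NI z. F z) = (NI z. (\<Prod>b\<in>set bs. ind (slab b) z) * line_int bs F z)"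
  using Cons by simp
 also have "... = (NI z. ind (slab b) z * (NI r. (\<Prod>c\<in>set bs. ind (slab c) (upd b z r)) * line_int bs F (upd b z r)))"
  by (rule nn_integral_line(1)[OF bB]) measurable
 also have "... = (NI z. ind (slab b) z * (NI r. (\<Prod>c\<in>set bs. ind (slab c) z) * line_int bs F (upd b z r)))"
 proof -
  have "(ind (slab c) (upd b z r) :: ennreal) = ind (slab c) z" if "c : set bs" for c z r
  proof -
   have "c : Basis" "c ~= b" using that Cons by auto
   then have "upd b z r : slab c \<longleftrightarrow> z : slab c" using bB by (intro slab_upd) auto
   then show ?thesis by (simp add: indicator_def)
  qed
  then have "(\<Prod>c\<in>set bs. ind (slab c) (upd b z r)) = (\<Prod>c\<in>set bs. ind (slab c) z :: ennreal)" for z r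
   by (rule prod.cong[OF refl])
  then show ?thesis by simp
 qed
 also have "... = (NI z. (\<Prod>c\<in>set (b # bs). ind (slab c) z) * line_int (b # bs) F z)"
  using Cons by (intro nn_integral_cong) (simp add: nn_integral_cmult mult.assoc)
 finally show ?case .
qed simp

text \<open>After integration along every axis the value no longer depends on the point. Averaging
  this constant over the unit cube, of volume one, reproduces the full integral.\<close>

lemma line_int_Basis:
 fixes F :: "'a::euclidean_space => ennreal"
 assumes F: "F : bm" and bs: "distinct bs" "set bs = Basis"
 shows "line_int bs F z = (NI z. F z)"
proof -
 have "(NI z. F z) = (\<integral>\<^sup>+(w::'a). (\<Prod>b\<in>Basis. ind (slab b) w) * line_int bs F z \<partial>lborel)"
 proof -
  have "(NI z. F z) = (NI w. (\<Prod>b\<in>Basis. ind (slab b) w) * line_int bs F w)"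
   using nn_integral_line_int[OF F bs(1)] bs(2) by simp
  also have "... = (\<integral>\<^sup>+(w::'a). (\<Prod>b\<in>Basis. ind (slab b) w) * line_int bs F z \<partial>lborel)"
  proof (rule nn_integral_cong)
   fix w show "(\<Prod>b\<in>Basis. ind (slab b) w) * line_int bs F w = (\<Prod>b\<in>Basis. ind (slab b) w) * line_int bs F z"
    by (simp only: line_int_const[OF bs(2), of F w z])
  qed
  finally show ?thesis .
 qed
 also have "... = (\<integral>\<^sup>+(w::'a). ind (box 0 One) w * line_int bs F z \<partial>lborel)"
 proof (intro nn_integral_cong)
  fix w :: 'a
  have "(\<Prod>b\<in>Basis. ind (slab b) w) = (ind (box 0 One) w :: ennreal)"
  proof (cases "w : box 0 One")
   case True
   then have "\<forall>b\<in>Basis. w : slab b" by (auto simp: box_def slab_def)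
   then show ?thesis using True by simp
  next
   case False
   then obtain b where "b : Basis" "w ~: slab b" by (auto simp: box_def slab_def)
   then have "(\<Prod>b\<in>Basis. ind (slab b) w) = (0 :: ennreal)" by (intro prod_zero bexI[of _ b]) auto
   then show ?thesis using False by simp
  qed
  then show "(\<Prod>b\<in>Basis. ind (slab b) w) * line_int bs F z = ind (box 0 One) w * line_int bs F z" by simp
 qed
 also have "... = emeasure lborel (box 0 One :: 'a set) * line_int bs F z"
  by (subst nn_integral_multc) auto
 also have "emeasure lborel (box 0 One :: 'a set) = 1"
  by (subst emeasure_lborel_box) auto
 finally show ?thesis by simp
qed

context tangential_family
begin

text \<open>Read off from \<open>time_energy\<close>: the outer 2 * \<Lambda> undoes the coercivity
  1 / (2 * \<Lambda>) that remains, the first summand comes from the zero order term, and the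
  bracket is the last constant of \<open>e3_alg\<close> for the chosen \<open>e\<close>.\<close>

definition ke :: "real => real" where
 "ke N = 2 * \<Lambda> * (2 * \<Lambda> * kc N + (2 * \<Lambda> ^ 4 * kc N + 2 * \<Lambda> * (N * B0)^2))"

text \<open>The matrix need not be symmetric, so the flux against the gradient of v_t is no time
  derivative. It is split with a small factor in front of the squared gradient of v_t, which the
  Caccioppoli inequality for v_t, two cutoff powers higher, turns back into v_t^2.\<close>

lemma time_energy:
 assumes i: "i : S" and N: "real m + 5 <= N"
 shows "Wn (%z. (v (d tau i) z)^2) (m + 2) <= ke N * (Wn (pn i) m + lam * Wn (%z. (v i z)^2) m)"
proof -
 let ?w = "v (d tau i)" and ?j = "d tau i"
 have j: "?j : S" using i by (intro d_S) auto
 define Xi where "Xi = (%z. T z * (\<mu> (ht k z) * X i ?j (m + 2) z))"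
 have iX: "Lint Xi" "(LI z. Xi z) = 0" unfolding Xi_def using master[OF i j] by auto
 have K1: "1 <= kc N" using N by (intro kc_ge_1) auto
 \<comment> \<open>Chosen so that \<open>e\<close> times the Caccioppoli factor 2 * \<Lambda> * kc N
   equals 1 / (4 * \<Lambda>), a third of the coercivity 3 / (4 * \<Lambda>) at hand.\<close>
 define e where "e = 1 / (8 * \<Lambda>^2 * kc N)"
 have e0: "0 < e" using K1 Lambda by (simp add: e_def)
 define C where "C = \<Lambda>^2 / (4 * e) + 2 * \<Lambda> * (N * B0)^2"
 have C: "C = 2 * \<Lambda> ^ 4 * kc N + 2 * \<Lambda> * (N * B0)^2"
  using Lambda K1 by (simp add: C_def e_def field_simps power2_eq_square power4_eq_xxxx)
 define t where "t = (%f m z. T z * (\<mu> (ht k z) * (zeta k z ^ Suc m * f z)))"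
 have it: "Lint (t f m)" if "dom2 f" for f m unfolding t_def by (rule W1_int[OF that])
 have Wt: "Wn f m = (LI z. t f m z)" for f m unfolding t_def Wn_def ..
 define L where "L = (%z. 3 / (4 * \<Lambda>) * t (%z. (?w z)^2) (m + 2) z - 2 * \<Lambda> * lam^2 * t (%z. (v i z)^2) (m + 2) z
   - e * t (pn ?j) (m + 4) z - C * t (pn i) m z)"
 note its = it[OF dom2_v2[OF j]] it[OF dom2_v2[OF i]] it[OF dom2_pn[OF i]] it[OF dom2_pn[OF j]]
 have iL: "Lint L"
  unfolding L_def by (intro Bochner_Integration.integrable_diff integrable_mult_right its)
 have "(LI z. L z) <= (LI z. Xi z)"
 proof (rule integral_mono[OF iL iX(1)])
  fix z
  show "L z <= Xi z"
  proof (cases "T z = 0")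
   case True then show ?thesis by (simp add: L_def Xi_def t_def)
  next
   case False
   define y where "y = zeta k z"
   define n where "n = real m + 3"
   define E where "E = (A (ht k z) *v p i z) \<bullet> p ?j z"
   have T1: "T z = 1" using False T_cases[of z] by auto
   have y: "0 <= y" "y <= 1" using zeta_T[OF False, of 0] by (auto simp: y_def)
   have E: "\<bar>E\<bar> <= \<Lambda> * norm (p i z) * norm (p ?j z)"
    unfolding E_def by (rule order_trans[OF Cauchy_Schwarz_ineq2 mult_right_mono[OF A_bound]]) simp
   have "\<mu> (ht k z) * y ^ Suc m * (3 / (4 * \<Lambda>) * (y^2 * (?w z)^2) - 2 * \<Lambda> * lam^2 * (y^2 * (v i z)^2) - e * (y ^ 4 * pn ?j z) - C * pn i z)
     <= \<mu> (ht k z) * y ^ Suc m * (y^2 * ((a0 (ht k z) * ?w z + lam * v i z) * ?w z + E) + n * y * (H i z * ?w z))"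
   proof (rule mult_left_mono)
    show "3 / (4 * \<Lambda>) * (y^2 * (?w z)^2) - 2 * \<Lambda> * lam^2 * (y^2 * (v i z)^2) - e * (y ^ 4 * pn ?j z) - C * pn i z
     <= y^2 * ((a0 (ht k z) * ?w z + lam * v i z) * ?w z + E) + n * y * (H i z * ?w z)"
     unfolding C_def pn_def
     using N by (intro e3_alg[OF Lambda y H_bound[OF False] a0_bounds(1) E]) (auto simp: n_def e0 B0_nonneg)
    show "0 <= \<mu> (ht k z) * y ^ Suc m" using mu_pos[of "ht k z"] y by (intro mult_nonneg_nonneg) auto
   qed
   moreover have "L z = \<mu> (ht k z) * y ^ Suc m * (3 / (4 * \<Lambda>) * (y^2 * (?w z)^2) - 2 * \<Lambda> * lam^2 * (y^2 * (v i z)^2) - e * (y ^ 4 * pn ?j z) - C * pn i z)"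
   proof -
    have P: "y ^ Suc (m + 4) = y ^ Suc m * y ^ 4" "y ^ Suc (m + 2) = y ^ Suc m * y^2" by (metis add_Suc power_add)+
    show ?thesis unfolding L_def t_def T1 y_def[symmetric] P by (simp add: algebra_simps del: power_Suc)
   qed
   moreover have "Xi z = \<mu> (ht k z) * y ^ Suc m * (y^2 * ((a0 (ht k z) * ?w z + lam * v i z) * ?w z + E) + n * y * (H i z * ?w z))"
    unfolding Xi_def X_def fl_inner T1 E_def[symmetric] y_def[symmetric] n_def
    by (simp add: algebra_simps power_add power2_eq_square)
   ultimately show ?thesis by simp
  qed
 qed
 then have "(LI z. L z) <= 0" using iX by simp
 moreover have "(LI z. L z) = 3 / (4 * \<Lambda>) * Wn (%z. (?w z)^2) (m + 2) - 2 * \<Lambda> * lam^2 * Wn (%z. (v i z)^2) (m + 2)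
   - e * Wn (pn ?j) (m + 4) - C * Wn (pn i) m"
  unfolding L_def Wt using its by simp
 ultimately have 1: "3 / (4 * \<Lambda>) * Wn (%z. (?w z)^2) (m + 2) <= 2 * \<Lambda> * lam * (lam * Wn (%z. (v i z)^2) (m + 2))
   + e * Wn (pn ?j) (m + 4) + C * Wn (pn i) m" by (simp add: power2_eq_square algebra_simps)
 define a where "a = Wn (%z. (?w z)^2) (m + 2)"
 define V where "V = Wn (%z. (v i z)^2) m"
 define P where "P = Wn (pn i) m"
 have nn: "0 <= a" "0 <= V" "0 <= P" "0 <= Wn (pn ?j) (m + 4)" "0 <= Wn (pn i) (m + 2)" "0 <= Wn (%z. (v i z)^2) (m + 2)" "0 <= Wn (%z. (v ?j z)^2) (m + 4)"
  unfolding a_def V_def P_def by (auto intro!: Wn_nonneg simp: pn_def)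
 have "Wn (pn ?j) (m + 4) / (2 * \<Lambda>) <= kc N * a"
 proof -
  have "lam * Wn (%z. (v ?j z)^2) (m + 4) + Wn (pn ?j) (m + 4) / (2 * \<Lambda>) <= kc N * a"
   using caccioppoli[OF j, of "m + 2" N] N unfolding a_def by (simp add: numeral_eq_Suc)
  then show ?thesis using nn(7) lam by (smt (verit) mult_nonneg_nonneg)
 qed
 then have "Wn (pn ?j) (m + 4) <= 2 * \<Lambda> * kc N * a" using Lambda by (simp add: field_simps)
 then have "e * Wn (pn ?j) (m + 4) <= e * (2 * \<Lambda> * kc N * a)" using e0 by (intro mult_left_mono) auto
 also have "... = a / (4 * \<Lambda>)" using Lambda K1 by (simp add: e_def field_simps power2_eq_square)
 finally have 2: "e * Wn (pn ?j) (m + 4) <= a / (4 * \<Lambda>)" .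
 have "lam * Wn (%z. (v i z)^2) (m + 2) <= kc N * V"
 proof -
  have "lam * Wn (%z. (v i z)^2) (m + 2) + Wn (pn i) (m + 2) / (2 * \<Lambda>) <= kc N * V"
   using caccioppoli[OF i, of m N] N unfolding V_def by simp
  moreover have "0 <= Wn (pn i) (m + 2) / (2 * \<Lambda>)" using nn Lambda by simp
  ultimately show ?thesis by simp
 qed
 then have 3: "2 * \<Lambda> * lam * (lam * Wn (%z. (v i z)^2) (m + 2)) <= 2 * \<Lambda> * lam * (kc N * V)"
  using Lambda lam by (intro mult_left_mono) auto
 have "a / (2 * \<Lambda>) = 3 / (4 * \<Lambda>) * a - a / (4 * \<Lambda>)" using Lambda by (simp add: field_simps)
 also have "... <= 2 * \<Lambda> * lam * (kc N * V) + C * P" using 1 2 3 unfolding a_def P_def by linarith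
 finally have "a <= 2 * \<Lambda> * (2 * \<Lambda> * lam * (kc N * V) + C * P)" using Lambda by (simp add: field_simps)
 also have "... <= 2 * \<Lambda> * ((2 * \<Lambda> * kc N + C) * (P + lam * V))"
 proof (rule mult_left_mono)
  have "0 <= C" unfolding C using K1 Lambda by auto
  then have "0 <= 2 * \<Lambda> * kc N * P + C * (lam * V)" using nn lam K1 Lambda by (intro add_nonneg_nonneg mult_nonneg_nonneg) auto
  then show "2 * \<Lambda> * lam * (kc N * V) + C * P <= (2 * \<Lambda> * kc N + C) * (P + lam * V)" by (simp add: algebra_simps)
 qed (use Lambda in simp)
 also have "... = ke N * (P + lam * V)" unfolding ke_def C by simp
 finally show ?thesis unfolding a_def P_def V_def .
qed

lemma ke_ge_1: "3 <= N ==> 1 <= ke N"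
proof -
 assume "3 <= N"
 then have k: "1 <= kc N" by (rule kc_ge_1)
 have "1 * 1 <= 2 * \<Lambda> * kc N" using k Lambda by (intro mult_mono) auto
 moreover have "0 <= 2 * \<Lambda> ^ 4 * kc N + 2 * \<Lambda> * (N * B0)^2" using k Lambda by (intro add_nonneg_nonneg mult_nonneg_nonneg) auto
 ultimately have "1 * 1 <= 2 * \<Lambda> * (2 * \<Lambda> * kc N + (2 * \<Lambda> ^ 4 * kc N + 2 * \<Lambda> * (N * B0)^2))"
  using Lambda by (intro mult_mono) auto
 then show ?thesis by (simp add: ke_def)
qed

text \<open>Only the time direction calls for \<open>time_energy\<close>: a horizontal derivative is
  a component of the gradient and already part of the right-hand side.\<close>

lemma tang_energy1:
 assumes i: "i : S" and b: "b : tang k" and N: "real m + 5 <= N"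
 shows "Wn (%z. (v (d b i) z)^2) (m + 2) <= ke N * (Wn (pn i) m + lam * Wn (%z. (v i z)^2) m)"
 using b
proof (cases rule: tang_cases)
 case 1
 then show ?thesis using time_energy[OF i N] by simp
next
 case (2 l)
 have bi: "d b i : S" using i b by (rule d_S)
 have "Wn (%z. (v (d b i) z)^2) (m + 2) = Wn (%z. (p i z $ l)^2) (m + 2)"
  unfolding Wn_def
 proof (rule integral_cong_AE)
  show "(%z. T z * (\<mu> (ht k z) * (zeta k z ^ Suc (m + 2) * (v (d b i) z)^2))) : borel_measurable lborel"
   "(%z. T z * (\<mu> (ht k z) * (zeta k z ^ Suc (m + 2) * (p i z $ l)^2))) : borel_measurable lborel"
   using W1_int[OF dom2_v2[OF bi]] W1_int[OF dom2_p2[OF i]] by blast+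
  show "AE z in lborel. T z * (\<mu> (ht k z) * (zeta k z ^ Suc (m + 2) * (v (d b i) z)^2)) = T z * (\<mu> (ht k z) * (zeta k z ^ Suc (m + 2) * (p i z $ l)^2))"
   using AE_tang_grad[OF i 2(1)] by eventually_elim (auto simp: 2)
 qed
 also have "... <= Wn (pn i) (m + 2)"
 proof (rule Wn_mono[OF dom2_p2[OF i] dom2_pn[OF i]])
  fix z
  show "(p i z $ l)^2 <= pn i z" unfolding pn_def
   using component_le_norm_cart[of "p i z" l] by (metis abs_ge_zero power2_abs power_mono)
 qed
 also have "... <= Wn (pn i) m" by (rule Wn_antimono[OF dom2_pn[OF i]]) (auto simp: pn_def)
 also have "... <= 1 * (Wn (pn i) m + lam * Wn (%z. (v i z)^2) m)" using lam Wn_nonneg[of "%z. (v i z)^2" m] by simp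
 also have "... <= ke N * (Wn (pn i) m + lam * Wn (%z. (v i z)^2) m)"
  using N lam by (intro mult_right_mono ke_ge_1 add_nonneg_nonneg mult_nonneg_nonneg Wn_nonneg) (auto simp: pn_def)
 finally show ?thesis .
qed

definition kr :: "real => real" where "kr N = ke N * ((2 * \<Lambda> + 1) * kc N)"

lemma kr_ge_1: "3 <= N ==> 1 <= kr N"
proof -
 assume "3 <= N"
 then have "1 * (1 * 1) <= ke N * ((2 * \<Lambda> + 1) * kc N)"
  using Lambda kc_ge_1[of N] ke_ge_1[of N] by (intro mult_mono) auto
 then show ?thesis by (simp add: kr_def)
qed

lemma caccioppoli_full:
 assumes i: "i : S" and N: "real m + 3 <= N"
 shows "Wn (pn i) (m + 2) + lam * Wn (%z. (v i z)^2) (m + 2) <= (2 * \<Lambda> + 1) * kc N * Wn (%z. (v i z)^2) m"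
proof -
 let ?V = "Wn (%z. (v i z)^2)"
 note c = caccioppoli[OF i N]
 have nn: "0 <= Wn (pn i) (m + 2)" "0 <= ?V (m + 2)" by (auto intro!: Wn_nonneg simp: pn_def)
 have "Wn (pn i) (m + 2) / (2 * \<Lambda>) <= kc N * ?V m" using c mult_nonneg_nonneg[OF lam nn(2)] by linarith
 then have "Wn (pn i) (m + 2) <= 2 * \<Lambda> * (kc N * ?V m)" using Lambda by (simp add: field_simps)
 moreover have "0 <= Wn (pn i) (m + 2) / (2 * \<Lambda>)" using nn Lambda by simp
 then have "lam * ?V (m + 2) <= kc N * ?V m" using c by linarith
 ultimately show ?thesis by (simp add: algebra_simps)
qed

text \<open>Two powers of the cutoff pay for \<open>caccioppoli_full\<close> and two for
  \<open>tang_energy1\<close>. As the right-hand side is again an energy of a member of the family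
  without its gradient, the estimate can be iterated.\<close>

lemma tang_energy:
 assumes i: "i : S" and b: "b : tang k" and N: "real m + 7 <= N"
 shows "Wn (%z. (v (d b i) z)^2) (m + 4) <= kr N * Wn (%z. (v i z)^2) m"
proof -
 have "Wn (%z. (v (d b i) z)^2) (m + 4) <= ke N * (Wn (pn i) (m + 2) + lam * Wn (%z. (v i z)^2) (m + 2))"
  using tang_energy1[OF i b, of "m + 2" N] N by (simp add: numeral_eq_Suc)
 also have "... <= ke N * ((2 * \<Lambda> + 1) * kc N * Wn (%z. (v i z)^2) m)"
  using N ke_ge_1[of N] by (intro mult_left_mono caccioppoli_full i) auto
 finally show ?thesis by (simp add: kr_def mult.assoc)
qed

end

section \<open>Sobolev inequality in the tangential directions\<close>

lemma card_tang: "card (tang (k :: 'n::finite)) = CARD('n)"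
 by (simp add: tang_def)

context tangential_family
begin

text \<open>All mixed derivatives with at most one derivative in each listed direction: these are
  what successive one-dimensional Sobolev inequalities produce.\<close>

fun desc :: "('n tx) list => 'i => 'i list" where
 "desc [] i = [i]"
| "desc (b # bs) i = desc bs i @ desc bs (d b i)"

lemma desc_S: "i : S ==> set bs \<subseteq> tang k ==> set (desc bs i) \<subseteq> S"
proof (induction bs arbitrary: i)
 case (Cons b bs)
 then have "d b i : S" by (intro d_S) auto
 then show ?case using Cons.IH[of i] Cons.IH[of "d b i"] Cons.prems by simp
qed simp

lemma length_desc: "length (desc bs i) = 2 ^ length bs"
 by (induction bs arbitrary: i) auto

definition eN :: "('i => 'n tx => real) => nat => 'i => 'n tx => ennreal" where
 "eN F N i z = ennreal (T z * (\<mu> (ht k z) * (zeta k z ^ Suc N * (F i z)^2)))"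

lemma zeta_zero_far:
 assumes "b : tang k" "z \<bullet> b <= - 4"
 shows "zeta k z = 0"
proof (rule ccontr)
 assume "zeta k z ~= 0"
 then have *: "zeta k z ~= 0 \<or> dzeta k tau z ~= 0" by simp
 from assms(1) show False
 proof (cases rule: tang_cases)
  case 1 then show False using zeta_support(1)[OF *] assms(2) by (simp del: inner_Pair)
 next
  case (2 l)
  then have "\<bar>snd z $ l\<bar> < 2"
   using component_le_norm_cart[of "cross k z" l] zeta_support(2)[OF *] by (simp add: cross_nth)
  then show False using 2 assms(2) by (simp del: inner_Pair)
 qed
qed

text \<open>The fundamental theorem of calculus for \<mu> * zeta^(N+3) * F^2, started at the
  coordinate -4 where the cutoff vanishes; \<mu> is constant along the line. The constant collects 1
  from 2fg <= f^2 + g^2 and 5 * (N + 3) from the differentiated power of the cutoff.\<close>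

lemma sobolev_line:
 assumes b: "b : tang k" and i: "i : S"
  and F: "!!i z. i : S ==> ((%r. F i (z + r *\<^sub>R b)) has_real_derivative F (d b i) z) (at 0)"
  and C: "5 * (real N + 3) + 1 <= C"
 shows "eN F (N + 2) i z <= (NI r. ennreal C * (eN F N i (upd b z r) + eN F N (d b i) (upd b z r)))"
proof (cases "T z = 0 \<or> z \<bullet> b <= - 4")
 case True
 then have "eN F (N + 2) i z = 0" using zeta_zero_far[OF b, of z] by (auto simp: eN_def)
 then show ?thesis by simp
next
 case False
 have bB: "b : Basis" using b by (rule tang_Basis)
 have T1: "T z = 1" "fst z <= t0" using False T_cases[of z] by auto
 have zb: "- 4 <= z \<bullet> b" using False by simp
 define h where "h = (%z. \<mu> (ht k z) * (zeta k z ^ Suc (N + 2) * (F i z * F i z)))"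
 define h' where "h' = (%z. \<mu> (ht k z) * (zeta k z ^ Suc (N + 2) * (F (d b i) z * F i z + F i z * F (d b i) z))
   + real (Suc (N + 2)) * (\<mu> (ht k z) * (zeta k z ^ (N + 2) * dzeta k b z * (F i z * F i z))))"
 have hd: "((%r. h (upd b z r)) has_real_derivative h' (upd b z r)) (at r)" for r
  by (rule line_deriv[OF bB]) (unfold h_def h'_def,
   rule weight_deriv[where f="F i" and g="F i" and f'="F (d b i)" and g'="F (d b i)", OF b], (rule F[OF i])+)
 have hz: "ht k (upd b z r) = ht k z" for r using b by (rule ht_upd_tang)
 \<comment> \<open>Integration runs backwards from \<open>z\<close>, also in the time direction, so
   the whole segment stays in {t <= t0}.\<close>
 have TT: "T (upd b z r) = 1" if "r <= z \<bullet> b" for r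
  using b
 proof (cases rule: tang_cases)
  case 1
  then show ?thesis using that T1 upd_inner[of tau tau z r] by (simp add: T_def indicator_def del: inner_Pair)
 next
  case (2 l)
  then show ?thesis using T1 upd_inner[of "ek l" tau z r] by (simp add: T_def indicator_def split: if_splits del: inner_Pair)
 qed
 have cu: "continuous_on UNIV (upd b z)" by (intro continuous_intros)
 have cF: "continuous_on UNIV (%r. F j (upd b z r))" if "j : S" for j
  using line_deriv[OF bB F[OF that], of z] by (intro continuous_at_imp_continuous_on ballI DERIV_isCont) blast
 have bi: "d b i : S" using i b by (rule d_S)
 have ch': "continuous_on UNIV (%r. h' (upd b z r))"
  unfolding h'_def hz
  by (intro continuous_intros cF i bi continuous_on_compose2[OF continuous_zeta cu] continuous_on_compose2[OF continuous_dzeta cu]) auto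
 have "h (upd b z (-4)) = 0"
  using zeta_zero_far[OF b, of "upd b z (-4)"] bB by (simp add: h_def upd_inner)
 then have ftc: "(LI r. ind {-4..z \<bullet> b} r *\<^sub>R h' (upd b z r)) = h z"
  using zb hd by (subst integral_FTC_atLeastAtMost[where F="%r. h (upd b z r)"])
   (auto simp: has_real_derivative_iff_has_vector_derivative[symmetric] intro: has_field_derivative_at_within continuous_on_subset[OF ch'])
 have int: "Lint (%r. ind {-4..z \<bullet> b} r *\<^sub>R h' (upd b z r))"
  using borel_integrable_atLeastAtMost'[OF continuous_on_subset[OF ch'], of "-4" "z \<bullet> b"] by (simp add: set_integrable_def)
 have "eN F (N + 2) i z = ennreal (norm (LI r. ind {-4..z \<bullet> b} r *\<^sub>R h' (upd b z r)))"
 proof -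
  have "0 <= h z" unfolding h_def
   by (intro mult_nonneg_nonneg[OF less_imp_le[OF mu_pos]] mult_nonneg_nonneg[OF zero_le_power[OF zeta_nonneg]] zero_le_square)
  then show ?thesis unfolding ftc by (simp add: eN_def T1 h_def power2_eq_square)
 qed
 also have "... <= (NI r. ennreal (norm (ind {-4..z \<bullet> b} r *\<^sub>R h' (upd b z r))))"
  by (rule integral_norm_bound_ennreal[OF int])
 also have "... <= (NI r. ennreal C * (eN F N i (upd b z r) + eN F N (d b i) (upd b z r)))"
 proof (intro nn_integral_mono)
  fix r :: real
  show "ennreal (norm (ind {-4..z \<bullet> b} r *\<^sub>R h' (upd b z r))) <= ennreal C * (eN F N i (upd b z r) + eN F N (d b i) (upd b z r))"
  proof (cases "r : {-4..z \<bullet> b}")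
   case True
   define w where "w = upd b z r"
   have Tw: "T w = 1" using True TT unfolding w_def by simp
   define y where "y = zeta k w"
   define f g where "f = F i w" and "g = F (d b i) w"
   have y: "0 <= y" "y <= 1" using zeta_T[of w 0] Tw by (auto simp: y_def)
   have dz: "\<bar>dzeta k b w\<bar> <= 5" using dzeta_T[of w b] Tw bB by simp
   have fg: "\<bar>2 * f * g\<bar> <= f^2 + g^2"
    using sum_squares_bound[of "\<bar>f\<bar>" "\<bar>g\<bar>"] by (simp add: abs_mult)
   have "\<bar>h' w\<bar> = \<bar>\<mu> (ht k w) * y ^ Suc N * (y^2 * (2 * f * g) + (real N + 3) * (y * dzeta k b w * f^2))\<bar>"
    unfolding h'_def y_def[symmetric] f_def[symmetric] g_def[symmetric]
    by (simp add: power2_eq_square algebra_simps)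
   also have "... = \<mu> (ht k w) * y ^ Suc N * \<bar>y^2 * (2 * f * g) + (real N + 3) * (y * dzeta k b w * f^2)\<bar>"
    using mu_pos[of "ht k w"] y by (simp add: abs_mult)
   also have "... <= \<mu> (ht k w) * y ^ Suc N * (C * (f^2 + g^2))"
   proof (rule mult_left_mono)
    have "\<bar>y^2 * (2 * f * g)\<bar> <= 1 * (f^2 + g^2)"
     unfolding abs_mult[of "y^2"] using y fg by (intro mult_mono) (auto simp: power_le_one)
    moreover have "\<bar>(real N + 3) * (y * dzeta k b w * f^2)\<bar> <= (real N + 3) * (1 * 5 * f^2)"
     unfolding abs_mult using y dz by (intro mult_mono) auto
    moreover have "f^2 + g^2 + (real N + 3) * (5 * f^2) <= C * (f^2 + g^2)"
    proof -
     have "(5 * (real N + 3) + 1) * (f^2 + g^2) <= C * (f^2 + g^2)" using C by (intro mult_right_mono) auto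
     moreover have "0 <= 5 * (real N + 3) * g^2" by simp
     moreover have "f^2 + g^2 + (real N + 3) * (5 * f^2) = (5 * (real N + 3) + 1) * (f^2 + g^2) - 5 * (real N + 3) * g^2"
      by (simp add: algebra_simps)
     ultimately show ?thesis by linarith
    qed
    ultimately show "\<bar>y^2 * (2 * f * g) + (real N + 3) * (y * dzeta k b w * f^2)\<bar> <= C * (f^2 + g^2)"
     using abs_triangle_ineq[of "y^2 * (2 * f * g)" "(real N + 3) * (y * dzeta k b w * f^2)"] unfolding mult_1 by linarith
    show "0 <= \<mu> (ht k w) * y ^ Suc N" using mu_pos[of "ht k w"] y by (intro mult_nonneg_nonneg) auto
   qed
   also have "... = C * (T w * (\<mu> (ht k w) * (y ^ Suc N * f^2)) + T w * (\<mu> (ht k w) * (y ^ Suc N * g^2)))"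
    by (simp add: Tw algebra_simps)
   finally have le: "\<bar>h' w\<bar> <= ..." .
   have C0: "0 <= C" using C by simp
   have nn: "0 <= T w * (\<mu> (ht k w) * (y ^ Suc N * f^2))" "0 <= T w * (\<mu> (ht k w) * (y ^ Suc N * g^2))"
    using y mu_pos[of "ht k w"] Tw by (auto intro!: mult_nonneg_nonneg simp: less_imp_le)
   have "ennreal (norm (ind {-4..z \<bullet> b} r *\<^sub>R h' (upd b z r))) = ennreal \<bar>h' w\<bar>"
    using True by (simp add: w_def)
   also have "... <= ennreal (C * (T w * (\<mu> (ht k w) * (y ^ Suc N * f^2)) + T w * (\<mu> (ht k w) * (y ^ Suc N * g^2))))"
    by (rule ennreal_leI[OF le])
   also have "... = ennreal C * (eN F N i w + eN F N (d b i) w)"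
    unfolding eN_def y_def[symmetric] f_def[symmetric] g_def[symmetric]
    using C0 nn by (simp only: ennreal_mult ennreal_plus add_nonneg_nonneg)
   finally show ?thesis by (simp add: w_def)
  qed simp
 qed
 finally show ?thesis .
qed

lemma eN_borel: "F i : bm ==> eN F N i : bm"
 unfolding eN_def[abs_def] by measurable

lemma sobolev_iter:
 assumes bs: "set bs \<subseteq> tang k" and i: "i : S"
  and F: "!!i b z. i : S ==> b : tang k ==> ((%r. F i (z + r *\<^sub>R b)) has_real_derivative F (d b i) z) (at 0)"
  and Fb: "!!i. i : S ==> F i : bm"
  and C: "5 * (real (N + 2 * length bs) + 3) + 1 <= C"
 shows "eN F (N + 2 * length bs) i z <= ennreal C ^ length bs * line_int bs (%z. \<Sum>j\<leftarrow>desc bs i. eN F N j z) z"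
 using bs i C
proof (induction bs arbitrary: i z)
 case (Cons b bs)
 let ?s = "%i z. \<Sum>j\<leftarrow>desc bs i. eN F N j z"
 have b: "b : tang k" and bs: "set bs \<subseteq> tang k" using Cons.prems by auto
 have bi: "d b i : S" using Cons.prems(2) b by (rule d_S)
 have sb: "?s i : bm" if "i : S" for i
 proof -
  have "set xs \<subseteq> S ==> (%z. \<Sum>j\<leftarrow>xs. eN F N j z) : bm" for xs
   by (induction xs) (auto intro!: eN_borel Fb borel_measurable_add)
  then show ?thesis using desc_S[OF that bs] by blast
 qed
 note [measurable] = sb[OF Cons.prems(2)] sb[OF bi]
 have "eN F (N + 2 * length (b # bs)) i z = eN F ((N + 2 * length bs) + 2) i z" by (simp add: add.commute add.left_commute)
 also have "... <= (NI r. ennreal C * (eN F (N + 2 * length bs) i (upd b z r) + eN F (N + 2 * length bs) (d b i) (upd b z r)))"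
 proof (rule sobolev_line[where F=F, OF b Cons.prems(2)])
  show "((%r. F i (z + r *\<^sub>R b)) has_real_derivative F (d b i) z) (at 0)" if "i : S" for i z
   by (rule F[OF that b])
  show "5 * (real (N + 2 * length bs) + 3) + 1 <= C" using Cons.prems by simp
 qed
 also have "... <= (NI r. ennreal C * (ennreal C ^ length bs * line_int bs (?s i) (upd b z r) + ennreal C ^ length bs * line_int bs (?s (d b i)) (upd b z r)))"
  using Cons.prems bs bi by (intro nn_integral_mono mult_left_mono add_mono Cons.IH) auto
 also have "... = (NI r. ennreal C ^ length (b # bs) * line_int bs (%z. ?s i z + ?s (d b i) z) (upd b z r))"
  by (intro nn_integral_cong) (simp add: line_int_add distrib_left mult_ac)
 also have "... = ennreal C ^ length (b # bs) * (NI r. line_int bs (%z. ?s i z + ?s (d b i) z) (upd b z r))"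
  by (rule nn_integral_cmult) measurable
 finally show ?case by simp
qed simp

lemma nn_eN:
 assumes "dom1 (F i)"
 shows "(NI z. eN F N i z) = ennreal (Wn (%z. (F i z)^2) N)"
proof -
 have d2: "dom2 (%z. (F i z)^2)" using dom1_mult[OF assms assms] by (simp add: power2_eq_square)
 show ?thesis unfolding eN_def Wn_def
 proof (rule nn_integral_eq_integral[OF W1_int[OF d2]])
  show "AE z in lborel. 0 <= T z * (\<mu> (ht k z) * (zeta k z ^ Suc N * (F i z)^2))"
   by (intro AE_I2 mult_nonneg_nonneg[OF T_nonneg] mult_nonneg_nonneg[OF less_imp_le[OF mu_pos]]
     mult_nonneg_nonneg[OF zero_le_power[OF zeta_nonneg]] zero_le_power2)
 qed
qed

definition tbs :: "('n tx) list" where "tbs = (SOME bs. distinct bs & set bs = tang k)"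

lemma tbs: "distinct tbs" "set tbs = tang k" "length tbs = CARD('n)"
proof -
 have "finite (tang k)" by (simp add: tang_def)
 then have "\<exists>bs. distinct bs & set bs = tang k" using finite_distinct_list by blast
 then have *: "distinct tbs & set tbs = tang k" unfolding tbs_def by (rule someI_ex)
 then show "distinct tbs" "set tbs = tang k" by auto
 then show "length tbs = CARD('n)" using distinct_card[of tbs] card_tang[of k] by simp
qed

text \<open>Sobolev embedding in n tangential variables with values in the weighted L^2 space of a
  vertical line. The one-dimensional inequality is used once per tangential direction, and the
  integral over heights completes the iterated integral to one over space. The factor 2 in 2 * C
  accounts for the number of derivatives in \<open>desc\<close>.\<close>

lemma sobolev:
 assumes i: "i : S"
  and F: "!!i b z. i : S ==> b : tang k ==> ((%r. F i (z + r *\<^sub>R b)) has_real_derivative F (d b i) z) (at 0)"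
  and Fd: "!!i. i : S ==> dom1 (F i)"
  and C: "5 * (real (N + 2 * CARD('n)) + 3) + 1 <= C"
  and B: "!!j. j : set (desc tbs i) ==> Wn (%z. (F j z)^2) N <= B"
 shows "(NI s. eN F (N + 2 * CARD('n)) i (upd (ek k) z s)) <= ennreal ((2 * C) ^ CARD('n) * B)"
proof -
 let ?s = "%z. \<Sum>j\<leftarrow>desc tbs i. eN F N j z"
 have dS: "set (desc tbs i) \<subseteq> S" using i tbs by (intro desc_S) auto
 have "set xs \<subseteq> S ==> (%z. \<Sum>j\<leftarrow>xs. eN F N j z) : bm" for xs
  using Fd dom1_borel by (induction xs) (auto intro!: eN_borel borel_measurable_add)
 then have sm [measurable]: "?s : bm" using dS by blast
 have C0: "0 <= C" using C by simp
 have B0: "0 <= B"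
 proof -
  have "desc tbs i ~= []" using length_desc[of tbs i] by (metis length_0_conv power_not_zero zero_neq_numeral)
  then obtain j where "j : set (desc tbs i)" by (meson list.set_sel(1))
  then show ?thesis using B[of j] Wn_nonneg[of "%z. (F j z)^2" N] by simp
 qed
 have "(NI s. eN F (N + 2 * CARD('n)) i (upd (ek k) z s))
   <= (NI s. ennreal C ^ CARD('n) * line_int tbs ?s (upd (ek k) z s))"
  using sobolev_iter[of tbs i F N C] i F Fd dom1_borel tbs C by (intro nn_integral_mono) auto
 also have "... = ennreal C ^ CARD('n) * line_int (ek k # tbs) ?s z"
  by (subst nn_integral_cmult) auto
 also have "line_int (ek k # tbs) ?s z = (NI z. ?s z)"
 proof (rule line_int_Basis[OF sm])
  show "set (ek k # tbs) = Basis"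
   by (simp only: list.set tbs(2) tang_def insert_Diff[OF ek_Basis])
  show "distinct (ek k # tbs)" by (simp only: distinct.simps tbs(1,2) ek_tang) simp
 qed
 also have "... <= ennreal (2 ^ CARD('n) * B)"
 proof -
  have "set xs \<subseteq> set (desc tbs i) ==> (NI z. (\<Sum>j\<leftarrow>xs. eN F N j z)) <= ennreal (real (length xs) * B)" for xs
  proof (induction xs)
   case (Cons j xs)
   then have jS: "j : S" "set xs \<subseteq> S" using dS by auto
   have [measurable]: "eN F N j : bm" "(%z. \<Sum>j\<leftarrow>xs. eN F N j z) : bm"
    using \<open>!!xs. set xs \<subseteq> S ==> _\<close> jS Fd dom1_borel by (auto intro!: eN_borel)
   have "(NI z. (\<Sum>j\<leftarrow>(j # xs). eN F N j z)) = (NI z. eN F N j z) + (NI z. (\<Sum>j\<leftarrow>xs. eN F N j z))"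
    by (simp add: nn_integral_add)
   also have "... <= ennreal B + ennreal (real (length xs) * B)"
    using Cons jS by (intro add_mono) (auto simp: nn_eN[of F, OF Fd] intro!: ennreal_leI B)
   also have "... = ennreal (real (length (j # xs)) * B)"
    using B0 by (simp add: ennreal_plus[symmetric] algebra_simps del: ennreal_plus)
   finally show ?case .
  qed simp
  from this[of "desc tbs i"] show ?thesis using length_desc[of tbs i] tbs by simp
 qed
 also have "ennreal C ^ CARD('n) * ennreal (2 ^ CARD('n) * B) = ennreal ((2 * C) ^ CARD('n) * B)"
  using C0 B0 by (simp add: ennreal_power ennreal_mult[symmetric] power_mult_distrib mult_ac)
 finally show ?thesis by (simp add: mult_left_mono)
qed

text \<open>Every direction is charged four cutoff powers and a factor \<open>kr N\<close>, whether
  it is differentiated or not; if it is not, monotonicity in the exponent and 1 <= kr N are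
  enough.\<close>

lemma desc_energy:
 assumes "set bs \<subseteq> tang k" "i : S" "real (m + 4 * length bs) + 3 <= N" "3 <= N" "j : set (desc bs i)"
 shows "Wn (%z. (v j z)^2) (m + 4 * length bs) <= kr N ^ length bs * Wn (%z. (v i z)^2) m"
 using assms
proof (induction bs arbitrary: i m)
 case (Cons b bs)
 have b: "b : tang k" and bs: "set bs \<subseteq> tang k" using Cons.prems by auto
 have k1: "1 <= kr N" using Cons.prems by (intro kr_ge_1) auto
 have bi: "d b i : S" using Cons.prems(2) b by (rule d_S)
 obtain i' where i': "i' : S" "j : set (desc bs i')" "Wn (%z. (v i' z)^2) (m + 4) <= kr N * Wn (%z. (v i z)^2) m"
 proof (cases "j : set (desc bs i)")
  case True
  have "Wn (%z. (v i z)^2) (m + 4) <= Wn (%z. (v i z)^2) m"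
   by (rule Wn_antimono[OF dom2_v2[OF Cons.prems(2)]]) auto
  also have "... <= kr N * Wn (%z. (v i z)^2) m"
   using mult_right_mono[OF k1, of "Wn (%z. (v i z)^2) m"] Wn_nonneg[of "%z. (v i z)^2" m] by simp
  finally show thesis using that True Cons.prems(2) by blast
 next
  case False
  then have "j : set (desc bs (d b i))" using Cons.prems by simp
  moreover have "Wn (%z. (v (d b i) z)^2) (m + 4) <= kr N * Wn (%z. (v i z)^2) m"
   using Cons.prems by (intro tang_energy b) auto
  ultimately show thesis using that bi by blast
 qed
 have "Wn (%z. (v j z)^2) ((m + 4) + 4 * length bs) <= kr N ^ length bs * Wn (%z. (v i' z)^2) (m + 4)"
  using Cons.prems by (intro Cons.IH bs i') auto
 also have "... <= kr N ^ length bs * (kr N * Wn (%z. (v i z)^2) m)"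
  using i'(3) k1 by (intro mult_left_mono) auto
 finally show ?case by (simp add: algebra_simps)
qed simp

text \<open>\<open>NN\<close> leaves room for all exponents that occur for m <= 10. The companion
  \<open>E0\<close> adds up the lost cutoff powers: 4 * n for n tangential derivatives, 2 * n for n
  Sobolev steps and 2 for passing to the gradient.\<close>

definition NN :: real where "NN = 6 * real CARD('n) + 20"
definition E0 :: nat where "E0 = 6 * CARD('n) + 2"
definition Ks :: real where
 "Ks = (2 * (5 * (NN + 3) + 1)) ^ CARD('n) * ((2 * \<Lambda> + 1) * kc NN * kr NN ^ CARD('n))"

lemma Ks_nonneg: "0 <= Ks"
 unfolding Ks_def NN_def using kc_ge_1[of NN] kr_ge_1[of NN] Lambda
 by (auto simp: NN_def intro!: mult_nonneg_nonneg)

lemma slice_energy: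
 assumes i: "i : S" and m: "m <= 10"
 shows "(NI s. eN v (m + E0) i (upd (ek k) z s)) <= ennreal (Ks * Wn (%z. (v i z)^2) m)"
  and "(NI s. eN (%i z. p i z $ l) (m + E0) i (upd (ek k) z s)) <= ennreal (Ks * Wn (%z. (v i z)^2) m)"
proof -
 let ?n = "CARD('n)"
 let ?B = "(2 * \<Lambda> + 1) * kc NN * (kr NN ^ ?n * Wn (%z. (v i z)^2) m)"
 have N3: "3 <= NN" by (simp add: NN_def)
 note k1 = kc_ge_1[OF N3] kr_ge_1[OF N3]
 have L1: "1 <= (2 * \<Lambda> + 1) * kc NN" using mult_mono[of 1 "2 * \<Lambda> + 1" 1 "kc NN"] k1 Lambda by simp
 have e: "m + E0 = (m + 4 * ?n + 2) + 2 * ?n" by (simp add: E0_def)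
 have jS: "j : S" if "j : set (desc tbs i)" for j using that desc_S[OF i, of tbs] tbs by auto
 have j: "Wn (%z. (v j z)^2) (m + 4 * ?n) <= kr NN ^ ?n * Wn (%z. (v i z)^2) m" if "j : set (desc tbs i)" for j
  using desc_energy[of tbs i m NN j] tbs that i m by (simp add: NN_def)
 have B: "Ks * Wn (%z. (v i z)^2) m = (2 * (5 * (NN + 3) + 1)) ^ ?n * ?B" by (simp add: Ks_def mult_ac)
 have C: "5 * (real ((m + 4 * ?n + 2) + 2 * ?n) + 3) + 1 <= 5 * (NN + 3) + 1" using m by (simp add: NN_def)
 show "(NI s. eN v (m + E0) i (upd (ek k) z s)) <= ennreal (Ks * Wn (%z. (v i z)^2) m)"
  unfolding e B
 proof (rule sobolev[where F=v, OF i _ _ C])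
  show "((%r. v i (z + r *\<^sub>R b)) has_real_derivative v (d b i) z) (at 0)" if "i : S" "b : tang k" for i b z
   by (rule v_deriv[OF that])
  show "dom1 (v i)" if "i : S" for i by (rule dom1_v[OF that])
  fix j assume j': "j : set (desc tbs i)"
  have "Wn (%z. (v j z)^2) (m + 4 * ?n + 2) <= Wn (%z. (v j z)^2) (m + 4 * ?n)"
   by (rule Wn_antimono[OF dom2_v2[OF jS[OF j']]]) auto
  also have "... <= 1 * (kr NN ^ ?n * Wn (%z. (v i z)^2) m)" using j[OF j'] by simp
  also have "... <= ?B"
   using L1 k1 by (intro mult_right_mono mult_nonneg_nonneg Wn_nonneg) auto
  finally show "Wn (%z. (v j z)^2) (m + 4 * ?n + 2) <= ?B" .
 qed
 show "(NI s. eN (%i z. p i z $ l) (m + E0) i (upd (ek k) z s)) <= ennreal (Ks * Wn (%z. (v i z)^2) m)"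
  unfolding e B
 proof (rule sobolev[where F="%i z. p i z $ l", OF i _ _ C])
  show "((%r. p i (z + r *\<^sub>R b) $ l) has_real_derivative p (d b i) z $ l) (at 0)" if "i : S" "b : tang k" for i b z
   by (rule p_deriv[OF that])
  show "dom1 (%z. p i z $ l)" if "i : S" for i by (rule dom1_p[OF that])
  fix j assume j': "j : set (desc tbs i)"
  have "Wn (%z. (p j z $ l)^2) (m + 4 * ?n + 2) <= Wn (pn j) (m + 4 * ?n + 2)"
  proof (rule Wn_mono[OF dom2_p2[OF jS[OF j']] dom2_pn[OF jS[OF j']]])
   fix z show "(p j z $ l)^2 <= pn j z" unfolding pn_def
    using component_le_norm_cart[of "p j z" l] by (metis abs_ge_zero power2_abs power_mono)
  qed
  also have "... <= Wn (pn j) (m + 4 * ?n + 2) + lam * Wn (%z. (v j z)^2) (m + 4 * ?n + 2)"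
   using lam Wn_nonneg[of "%z. (v j z)^2" "m + 4 * ?n + 2"] by simp
  also have "... <= (2 * \<Lambda> + 1) * kc NN * Wn (%z. (v j z)^2) (m + 4 * ?n)"
   using m by (intro caccioppoli_full jS j') (simp add: NN_def)
  also have "... <= ?B" using L1 j[OF j'] by (intro mult_left_mono) auto
  finally show "Wn (%z. (p j z $ l)^2) (m + 4 * ?n + 2) <= ?B" .
 qed
qed

end

section \<open>From energies to pointwise bounds on vertical lines\<close>

lemma ennreal_le_sqrtI:
 assumes "x^2 <= ennreal a" "0 <= a" shows "x <= ennreal (sqrt a)"
proof (cases x)
 case (real r)
 then have "r^2 <= a" using assms by (simp add: ennreal_power)
 then have "r <= sqrt a" using real_le_rsqrt by blast
 then show ?thesis using real by (simp add: ennreal_leI)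
next
 case top
 then show ?thesis using assms by (simp add: power2_eq_square top_unique)
qed

lemma weighted_Cauchy_Schwarz:
 fixes w f :: "real => real"
 assumes w: "!!s. 0 <= w s" and [measurable]: "w : bm" "f : bm"
  and a: "Lint w" "(LI s. w s) <= a" and b: "Lint (%s. w s * (f s)^2)" "(LI s. w s * (f s)^2) <= b"
 shows "(NI s. ennreal (w s * \<bar>f s\<bar>)) <= ennreal (sqrt (a * b))"
proof (rule ennreal_le_sqrtI)
 have a0: "0 <= a" by (rule order_trans[OF _ a(2)]) (intro integral_nonneg_AE AE_I2 w)
 have b0: "0 <= b" by (rule order_trans[OF _ b(2)]) (intro integral_nonneg_AE AE_I2 mult_nonneg_nonneg w zero_le_power2)
 show "0 <= a * b" using a0 b0 by simp
 have "(NI s. ennreal (w s * \<bar>f s\<bar>))^2 = (NI s. ennreal (sqrt (w s)) * ennreal (sqrt (w s) * \<bar>f s\<bar>))^2"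
  using w by (intro arg_cong[where f="%x. x^2"] nn_integral_cong) (simp add: ennreal_mult[symmetric] mult.assoc[symmetric])
 also have "... <= (NI s. (ennreal (sqrt (w s)))^2) * (NI s. (ennreal (sqrt (w s) * \<bar>f s\<bar>))^2)"
  by (rule Cauchy_Schwarz_nn_integral) measurable
 also have "... = (NI s. ennreal (w s)) * (NI s. ennreal (w s * (f s)^2))"
  using w by (simp add: ennreal_power power_mult_distrib)
 also have "... = ennreal (LI s. w s) * ennreal (LI s. w s * (f s)^2)"
  using w by (subst (1 2) nn_integral_eq_integral) (auto intro!: a b)
 also have "... <= ennreal a * ennreal b" by (intro mult_mono ennreal_leI a b) auto
 finally show "(NI s. ennreal (w s * \<bar>f s\<bar>))^2 <= ennreal (a * b)" using a0 b0 by (simp add: ennreal_mult)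
qed

lemma sum_squared_le:
 fixes f :: "'a => real"
 shows "finite I ==> (\<Sum>i\<in>I. f i)^2 <= real (card I) * (\<Sum>i\<in>I. (f i)^2)"
 using Cauchy_Schwarz_ineq_sum[of "%_. 1" f I] by simp

context tangential_family
begin

definition SI :: "('n tx => real) => 'n tx => real" where
 "SI f z = (LI s. ind {0<..<1} s * (\<mu> s * (f (upd (ek k) z s))^2))"

text \<open>Where \<open>SI\<close> is evaluated the cutoff is at least 1 / 6, and for m <= 10 its
  exponent m + E0 + 1 is at most 11 + E0.\<close>

definition c1 :: real where "c1 = 6 ^ (11 + E0) * Ks"

lemma c1_nonneg: "0 <= c1" using Ks_nonneg by (simp add: c1_def)

lemma slice_borel: "f : bm ==> (%s. f (upd (ek k) z s)) : bm"
 by (rule measurable_compose[where N=borel]) measurable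

lemma SI_int:
 assumes "dom1 f"
 shows "Lint (%s. ind {0<..<1} s * (\<mu> s * (f (upd (ek k) z s))^2))"
proof -
 obtain C where C: "0 <= C" "!!z. \<bar>f z\<bar> <= C * m1 (ht k z)" using assms unfolding dom1_def by blast
 note [measurable] = slice_borel[OF dom1_borel[OF assms], of z]
 show ?thesis
 proof (rule Bochner_Integration.integrable_bound[OF integrable_mult_right[OF m1_int(3), of "C^2"]])
  show "(%s. ind {0<..<1} s * (\<mu> s * (f (upd (ek k) z s))^2)) : borel_measurable lborel" by measurable
  show "AE s in lborel. norm (ind {0<..<1} s * (\<mu> s * (f (upd (ek k) z s))^2)) <= norm (C^2 * (\<mu> s * (m1 s)^2))"
  proof (rule AE_I2)
   fix s
   have "\<bar>f (upd (ek k) z s)\<bar>^2 <= (C * m1 s)^2" using C(2)[of "upd (ek k) z s"] by (intro power_mono) auto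
   then have "\<mu> s * (f (upd (ek k) z s))^2 <= \<mu> s * (C^2 * (m1 s)^2)"
    using mu_pos[of s] by (intro mult_left_mono) (auto simp: power_mult_distrib)
   then show "norm (ind {0<..<1} s * (\<mu> s * (f (upd (ek k) z s))^2)) <= norm (C^2 * (\<mu> s * (m1 s)^2))"
    using mu_pos[of s] by (auto simp: abs_mult mult.left_commute split: split_indicator)
  qed
 qed
qed

lemma SI_nonneg: "0 <= SI f z"
 unfolding SI_def by (intro integral_nonneg_AE AE_I2 mult_nonneg_nonneg less_imp_le[OF mu_pos] zero_le_power2) auto

lemma SI_le:
 assumes f: "dom1 (F i)" and z: "T z ~= 0" "- 1 <= fst z" "norm (cross k z) <= 1" and m: "m <= 10" and B: "0 <= B"
  and e: "(NI s. eN F (m + E0) i (upd (ek k) z s)) <= ennreal (Ks * B)"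
 shows "SI (F i) z <= c1 * B"
proof -
 have T1: "T z = 1" using z T_cases[of z] by auto
 let ?f = "%s. F i (upd (ek k) z s)"
 have eb: "(%s. eN F (m + E0) i (upd (ek k) z s)) : bm"
  by (rule slice_borel[OF eN_borel[where F=F and i=i, OF dom1_borel[OF f]]])
 have "ennreal (SI (F i) z) = (NI s. ennreal (ind {0<..<1} s * (\<mu> s * (?f s)^2)))"
  unfolding SI_def by (intro nn_integral_eq_integral[symmetric] SI_int f AE_I2 mult_nonneg_nonneg less_imp_le[OF mu_pos] zero_le_power2) auto
 also have "... <= (NI s. ennreal (6 ^ (11 + E0)) * eN F (m + E0) i (upd (ek k) z s))"
 proof (intro nn_integral_mono)
  fix s :: real
  show "ennreal (ind {0<..<1} s * (\<mu> s * (?f s)^2)) <= ennreal (6 ^ (11 + E0)) * eN F (m + E0) i (upd (ek k) z s)"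
  proof (cases "s : {0<..<1}")
   case True
   let ?y = "zeta k (upd (ek k) z s)"
   have y: "1 / 6 <= ?y" using z True by (intro zeta_lower) auto
   have "1 <= (6 * ?y) ^ Suc (m + E0)" using y by (intro one_le_power) auto
   also have "... = 6 ^ Suc (m + E0) * ?y ^ Suc (m + E0)" by (rule power_mult_distrib)
   also have "... <= 6 ^ (11 + E0) * ?y ^ Suc (m + E0)"
    using m y by (intro mult_right_mono power_increasing) auto
   finally have "1 * (\<mu> s * (?f s)^2) <= (6 ^ (11 + E0) * ?y ^ Suc (m + E0)) * (\<mu> s * (?f s)^2)"
    using mu_pos[of s] by (intro mult_right_mono) auto
   then have "ind {0<..<1} s * (\<mu> s * (?f s)^2) <= 6 ^ (11 + E0) * (T (upd (ek k) z s) * (\<mu> (ht k (upd (ek k) z s)) * (?y ^ Suc (m + E0) * (?f s)^2)))"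
    using True by (simp only: T_upd T1 ht_upd indicator_simps mult_1 mult_ac)
   then show ?thesis unfolding eN_def by (subst ennreal_mult'[symmetric]) (auto intro: ennreal_leI)
  qed simp
 qed
 also have "... <= ennreal (6 ^ (11 + E0)) * ennreal (Ks * B)"
  using eb by (subst nn_integral_cmult) (auto intro!: mult_left_mono e)
 also have "... = ennreal (c1 * B)" using Ks_nonneg B by (simp add: c1_def ennreal_mult[symmetric] mult.assoc)
 finally show ?thesis using c1_nonneg B by (simp add: ennreal_le_iff)
qed

lemma SI_v: "i : S ==> T z ~= 0 ==> - 1 <= fst z ==> norm (cross k z) <= 1 ==> m <= 10 ==> SI (v i) z <= c1 * Wn (%z. (v i z)^2) m"
 by (rule SI_le[where F=v]) (auto intro: dom1_v Wn_nonneg slice_energy(1))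

lemma SI_p: "i : S ==> T z ~= 0 ==> - 1 <= fst z ==> norm (cross k z) <= 1 ==> m <= 10 ==> SI (%z. p i z $ l) z <= c1 * Wn (%z. (v i z)^2) m"
 by (rule SI_le[where F="%i z. p i z $ l"]) (auto intro: dom1_p Wn_nonneg slice_energy(2))

definition Kv :: real where "Kv = 4 * c1"

text \<open>Cauchy-Schwarz with respect to the measure 1 / \<mu>, applied to \<mu> * f. This is
  where the integral of 1 / \<mu> enters the pointwise bounds.\<close>

lemma L1_slice:
 assumes J: "Lint (%s. ind {0<..<3} s / \<mu> s)" "(LI s. ind {0<..<3} s / \<mu> s) <= J"
  and f: "dom1 f" and B: "SI f z <= B"
 shows "(NI s. ennreal (ind {0<..<1} s * \<bar>f (upd (ek k) z s)\<bar>)) <= ennreal (sqrt (J * B))"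
proof -
 note [measurable] = slice_borel[OF dom1_borel[OF f], of z]
 have mu0: "\<mu> s ~= 0" for s using mu_pos[of s] by simp
 have i1: "Lint (%s. ind {0<..<1} s / \<mu> s)"
  by (rule Bochner_Integration.integrable_bound[OF J(1)]) (auto split: split_indicator)
 have "(NI s. ennreal ((ind {0<..<1} s / \<mu> s) * \<bar>\<mu> s * f (upd (ek k) z s)\<bar>)) <= ennreal (sqrt (J * B))"
 proof (rule weighted_Cauchy_Schwarz)
  show "0 <= ind {0<..<1} s / \<mu> s" for s using mu_pos[of s] by (simp add: less_imp_le)
  show "(LI s. ind {0<..<1} s / \<mu> s) <= J"
   by (rule order_trans[OF integral_mono[OF i1 J(1)] J(2)]) (use mu_pos in \<open>auto split: split_indicator simp: less_imp_le\<close>)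
  have e: "ind {0<..<1} s / \<mu> s * (\<mu> s * f (upd (ek k) z s))^2 = ind {0<..<1} s * (\<mu> s * (f (upd (ek k) z s))^2)" for s
   using mu0[of s] by (simp add: power2_eq_square)
  show "Lint (%s. ind {0<..<1} s / \<mu> s * (\<mu> s * f (upd (ek k) z s))^2)"
   unfolding e by (rule SI_int[OF f])
  show "(LI s. ind {0<..<1} s / \<mu> s * (\<mu> s * f (upd (ek k) z s))^2) <= B"
   using B unfolding e SI_def .
 qed (use i1 in measurable)
 also have "(NI s. ennreal ((ind {0<..<1} s / \<mu> s) * \<bar>\<mu> s * f (upd (ek k) z s)\<bar>))
   = (NI s. ennreal (ind {0<..<1} s * \<bar>f (upd (ek k) z s)\<bar>))"
  using mu_pos by (intro nn_integral_cong) (auto simp: abs_mult split: split_indicator simp: less_imp_le mu0)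
 finally show ?thesis .
qed

text \<open>A function on (0,1) is bounded by the mean of its modulus plus the integral of the
  modulus of its derivative. \<open>L1_slice\<close> bounds each by the same square root, hence the
  factor 4 after squaring.\<close>

lemma sup_v:
 assumes J: "Lint (%s. ind {0<..<3} s / \<mu> s)" "(LI s. ind {0<..<3} s / \<mu> s) <= J"
  and i: "i : S" and z: "T z ~= 0" "- 1 <= fst z" "norm (cross k z) <= 1" and m: "m <= 10"
 shows "AE s in lborel. s : {0<..<1} --> (v i (upd (ek k) z s))^2 <= Kv * J * Wn (%z. (v i z)^2) m"
proof -
 have zr: "- 5 < fst z" "fst z < 0" "norm (cross k z) < 5 / 2" using z T_cases[of z] t0 by auto
 let ?f = "%s. v i (upd (ek k) z s)"
 define P where "P = (%r. p i (upd (ek k) z r) $ k)"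
 obtain c where c: "AE s in lborel. s : {0<..<3} --> ?f s = c + prim P s"
  using vert_grad[OF i zr] by (auto simp: P_def)
 have iP: "Lint P" unfolding P_def by (rule dom1_borel_bound(1)[OF dom1_p[OF i]])
 then have [measurable]: "P : bm" by auto
 note [measurable] = slice_borel[OF v_borel[OF i], of z]
 define B where "B = c1 * Wn (%z. (v i z)^2) m"
 have B0: "0 <= B" unfolding B_def by (intro mult_nonneg_nonneg c1_nonneg Wn_nonneg) auto
 have J0: "0 <= J"
 proof -
  have "0 <= (LI s. ind {0<..<3} s / \<mu> s)"
   using mu_pos by (intro integral_nonneg_AE AE_I2) (auto simp: less_imp_le)
  then show ?thesis using J(2) by simp
 qed
 have PP: "(NI s. ennreal (ind {0<..<1} s * \<bar>P s\<bar>)) <= ennreal (sqrt (J * B))"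
  unfolding P_def by (rule L1_slice[OF J dom1_p[OF i]]) (unfold B_def, rule SI_p[OF i z m])
 have FF: "(NI s. ennreal (ind {0<..<1} s * \<bar>?f s\<bar>)) <= ennreal (sqrt (J * B))"
  by (rule L1_slice[OF J dom1_v[OF i]]) (unfold B_def, rule SI_v[OF i z m])
 have diff: "ennreal \<bar>c + prim P s\<bar> <= ennreal \<bar>c + prim P s'\<bar> + ennreal (sqrt (J * B))" if s: "s : {0<..<1}" "s' : {0<..<1}" for s s'
 proof -
  have *: "ennreal \<bar>prim P q - prim P r\<bar> <= ennreal (sqrt (J * B))" if "r : {0<..<1}" "q : {0<..<1}" "r <= q" for r q
  proof -
   have i': "Lint (%x. ind {r<..<q} x * P x)" by (rule integrable_indicator_times[OF _ iP]) simp
   have "ennreal \<bar>prim P q - prim P r\<bar> = ennreal (norm (LI x. ind {r<..<q} x * P x))"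
    using that by (subst prim_eq[OF iP]) auto
   also have "... <= (NI x. ennreal (norm (ind {r<..<q} x * P x)))" by (rule integral_norm_bound_ennreal[OF i'])
   also have "... <= (NI s. ennreal (ind {0<..<1} s * \<bar>P s\<bar>))"
    using that by (intro nn_integral_mono ennreal_leI) (auto split: split_indicator)
   finally show ?thesis using PP by (rule order_trans)
  qed
  have "\<bar>prim P s - prim P s'\<bar> <= sqrt (J * B)"
   using *[of s s'] *[of s' s] s J0 B0 by (cases "s <= s'") (auto simp: abs_minus_commute)
  then have "\<bar>c + prim P s\<bar> <= \<bar>c + prim P s'\<bar> + sqrt (J * B)" by linarith
  then show ?thesis using J0 B0 by (simp add: ennreal_plus[symmetric] ennreal_leI del: ennreal_plus)
 qed
 show ?thesis using c
 proof eventually_elim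
  case (elim s)
  show ?case
  proof
   assume s: "s : {0<..<1}"
   then have fs: "?f s = c + prim P s" using elim by auto
   \<comment> \<open>The interval has length one, so a constant equals its integral over s', and the
     value at s can be compared with the values at all s' under the integral.\<close>
   have "ennreal \<bar>?f s\<bar> = (NI s'. ennreal \<bar>?f s\<bar> * ind {0<..<1::real} s')" by (subst nn_integral_cmult_indicator) auto
   also have "... <= (NI s'. ennreal (ind {0<..<1} s' * \<bar>c + prim P s'\<bar>) + ennreal (sqrt (J * B)) * ind {0<..<1} s')"
    using diff[OF s] unfolding fs by (intro nn_integral_mono) (auto split: split_indicator)
   also have "... = (NI s'. ennreal (ind {0<..<1} s' * \<bar>c + prim P s'\<bar>)) + ennreal (sqrt (J * B))"
    by (subst nn_integral_add) (auto simp: nn_integral_cmult_indicator)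
   also have "(NI s'. ennreal (ind {0<..<1} s' * \<bar>c + prim P s'\<bar>)) = (NI s'. ennreal (ind {0<..<1} s' * \<bar>?f s'\<bar>))"
    using c by (intro nn_integral_cong_AE) (auto elim!: eventually_mono split: split_indicator)
   also have "... + ennreal (sqrt (J * B)) <= ennreal (sqrt (J * B)) + ennreal (sqrt (J * B))"
    using FF by (rule add_right_mono)
   also have "... = ennreal (2 * sqrt (J * B))" using J0 B0 by (simp add: ennreal_plus[symmetric] del: ennreal_plus)
   finally have "\<bar>?f s\<bar> <= 2 * sqrt (J * B)" using J0 B0 by simp
   then have "\<bar>?f s\<bar>^2 <= (2 * sqrt (J * B))^2" by (intro power_mono) auto
   then show "(?f s)^2 <= Kv * J * Wn (%z. (v i z)^2) m" using J0 B0 by (simp add: power_mult_distrib Kv_def B_def mult_ac)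
  qed
 qed
qed

text \<open>The localised form of the energy on the right-hand side of the second estimate of the
  theorem.\<close>

definition I0 :: "'i => real" where "I0 i = Wn (pn i) 0 + lam * Wn (%z. (v i z)^2) 0"

lemma I0_nonneg: "0 <= I0 i"
 unfolding I0_def by (intro add_nonneg_nonneg mult_nonneg_nonneg lam Wn_nonneg) (auto simp: pn_def)

text \<open>The derivative is itself a member of the family, so \<open>sup_v\<close> applies to it
  with m = 2, the exponent which \<open>tang_energy1\<close> reaches from 0.\<close>

lemma sup_tang:
 assumes J: "Lint (%s. ind {0<..<3} s / \<mu> s)" "(LI s. ind {0<..<3} s / \<mu> s) <= J"
  and i: "i : S" and z: "T z ~= 0" "- 1 <= fst z" "norm (cross k z) <= 1" and b: "b : tang k"
 shows "AE s in lborel. s : {0<..<1} --> (v (d b i) (upd (ek k) z s))^2 <= Kv * ke NN * J * I0 i"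
proof -
 have J0: "0 <= J"
 proof -
  have "0 <= (LI s. ind {0<..<3} s / \<mu> s)"
   using mu_pos by (intro integral_nonneg_AE AE_I2) (auto simp: less_imp_le)
  then show ?thesis using J(2) by simp
 qed
 have "Kv * J * Wn (%z. (v (d b i) z)^2) (0 + 2) <= Kv * J * (ke NN * I0 i)"
  unfolding I0_def using J0 c1_nonneg by (intro mult_left_mono tang_energy1 i b) (auto simp: NN_def Kv_def)
 moreover have "AE s in lborel. s : {0<..<1} --> (v (d b i) (upd (ek k) z s))^2 <= Kv * J * Wn (%z. (v (d b i) z)^2) (0 + 2)"
  by (rule sup_v[OF J d_S[OF i b] z]) simp
 ultimately show ?thesis by (auto elim!: eventually_mono simp: mult_ac)
qed

text \<open>The summands belong to the time derivative, the zero order term and the horizontal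
  divergence. In n^3, one factor comes from squaring the sum over l, one from the number of its
  terms and one from the components of each gradient.\<close>

definition Kg :: real where
 "Kg = 3 * c1 * (\<Lambda>^2 * ke NN + (2 * \<Lambda> + 1) * kc NN + real CARD('n) ^ 3 * \<Lambda>^2 * ke NN)"

text \<open>\<open>G\<close> consists of tangential derivatives and their gradients, whose slice
  energies are bounded by \<open>tang_energy1\<close>, and of lam * v, which the zero order term of
  the Caccioppoli inequality controls.\<close>

lemma SI_G:
 assumes i: "i : S" and z: "T z ~= 0" "- 1 <= fst z" "norm (cross k z) <= 1"
 shows "SI (G i) z <= Kg * I0 i"
proof -
 let ?n = "real CARD('n)"
 let ?u = "%s. upd (ek k) z s"
 have N: "3 <= NN" by (simp add: NN_def)
 have tS: "d tau i : S" and lS: "l ~= k ==> d (ek l) i : S" for l using i by (auto intro!: d_S)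
 let ?q = "%f s. ind {0<..<1} s * (\<mu> s * (f (?u s))^2)"
 have pw: "?q (G i) s <= 3 * (\<Lambda>^2 * ?q (v (d tau i)) s + lam^2 * ?q (v i) s + ?n * (\<Sum>l\<in>UNIV - {k}. \<Lambda>^2 * (\<Sum>j\<in>UNIV. ?q (%z. p (d (ek l) i) z $ j) s)))" for s
 proof (cases "s : {0<..<1}")
  case True
  let ?w = "?u s"
  have three: "(a + b - c)^2 <= 3 * (a^2 + b^2 + c^2)" for a b c :: real
   using zero_le_power2[of "a - b"] zero_le_power2[of "a + c"] zero_le_power2[of "b + c"] by (simp add: power2_eq_square algebra_simps)
  have "(a0 s * v (d tau i) ?w)^2 <= \<Lambda>^2 * (v (d tau i) ?w)^2"
   unfolding power_mult_distrib using power_mono[OF a0_abs[of s], of 2] by (intro mult_right_mono) auto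
  moreover have "(\<Sum>l\<in>UNIV - {k}. fl (d (ek l) i) l ?w)^2 <= ?n * (\<Sum>l\<in>UNIV - {k}. \<Lambda>^2 * (\<Sum>j\<in>UNIV. (p (d (ek l) i) ?w $ j)^2))"
  proof -
   have "(\<Sum>l\<in>UNIV - {k}. fl (d (ek l) i) l ?w)^2 <= real (card (UNIV - {k})) * (\<Sum>l\<in>UNIV - {k}. (fl (d (ek l) i) l ?w)^2)"
    by (rule sum_squared_le) simp
   also have "... <= ?n * (\<Sum>l\<in>UNIV - {k}. \<Lambda>^2 * (\<Sum>j\<in>UNIV. (p (d (ek l) i) ?w $ j)^2))"
   proof (intro mult_mono sum_mono)
    show "real (card (UNIV - {k})) <= ?n" by (simp add: card_mono)
    fix l
    have "(fl (d (ek l) i) l ?w)^2 <= (\<Lambda> * norm (p (d (ek l) i) ?w))^2"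
     using power_mono[OF fl_bound[of "d (ek l) i" l ?w], of 2] by simp
    also have "... = \<Lambda>^2 * (\<Sum>j\<in>UNIV. (p (d (ek l) i) ?w $ j)^2)"
     using pn_sum[of "d (ek l) i" ?w] by (simp add: pn_def power_mult_distrib power2_eq_square)
    finally show "(fl (d (ek l) i) l ?w)^2 <= \<Lambda>^2 * (\<Sum>j\<in>UNIV. (p (d (ek l) i) ?w $ j)^2)" .
   qed (auto intro!: sum_nonneg)
   finally show ?thesis .
  qed
  ultimately have "(G i ?w)^2 <= 3 * (\<Lambda>^2 * (v (d tau i) ?w)^2 + lam^2 * (v i ?w)^2 + ?n * (\<Sum>l\<in>UNIV - {k}. \<Lambda>^2 * (\<Sum>j\<in>UNIV. (p (d (ek l) i) ?w $ j)^2)))"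
   unfolding G_def ht_upd by (intro order_trans[OF three] mult_left_mono add_mono) (auto simp: power_mult_distrib)
  then have "\<mu> s * (G i ?w)^2 <= \<mu> s * (3 * (\<Lambda>^2 * (v (d tau i) ?w)^2 + lam^2 * (v i ?w)^2 + ?n * (\<Sum>l\<in>UNIV - {k}. \<Lambda>^2 * (\<Sum>j\<in>UNIV. (p (d (ek l) i) ?w $ j)^2))))"
   using mu_pos[of s] by (intro mult_left_mono) auto
  then show ?thesis using True by (simp add: algebra_simps sum_distrib_left)
 qed simp
 have "SI (G i) z <= (LI s. 3 * (\<Lambda>^2 * ?q (v (d tau i)) s + lam^2 * ?q (v i) s + ?n * (\<Sum>l\<in>UNIV - {k}. \<Lambda>^2 * (\<Sum>j\<in>UNIV. ?q (%z. p (d (ek l) i) z $ j) s))))"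
  unfolding SI_def
  by (intro integral_mono SI_int dom1_G i pw integrable_mult_right Bochner_Integration.integrable_add Bochner_Integration.integrable_sum dom1_v dom1_p tS lS) auto
 also have "... = 3 * (\<Lambda>^2 * SI (v (d tau i)) z + lam^2 * SI (v i) z + ?n * (\<Sum>l\<in>UNIV - {k}. \<Lambda>^2 * (\<Sum>j\<in>UNIV. SI (%z. p (d (ek l) i) z $ j) z)))"
 proof -
  have ip: "Lint (?q (%z. p (d (ek l) i) z $ j))" if "l : UNIV - {k}" for l j using that by (intro SI_int dom1_p lS) auto
  have isum: "Lint (%s. \<Lambda>^2 * (\<Sum>j\<in>UNIV. ?q (%z. p (d (ek l) i) z $ j) s))" if "l : UNIV - {k}" for l
   by (intro integrable_mult_right Bochner_Integration.integrable_sum ip that)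
  have iv: "Lint (?q (v (d tau i)))" "Lint (?q (v i))" by (intro SI_int dom1_v tS i)+
  have s1: "(LI s. (\<Sum>l\<in>UNIV - {k}. \<Lambda>^2 * (\<Sum>j\<in>UNIV. ?q (%z. p (d (ek l) i) z $ j) s))) = (\<Sum>l\<in>UNIV - {k}. \<Lambda>^2 * (\<Sum>j\<in>UNIV. SI (%z. p (d (ek l) i) z $ j) z))"
   unfolding SI_def by (subst Bochner_Integration.integral_sum[OF isum], assumption, intro sum.cong refl)
    (subst integral_mult_right_zero, subst Bochner_Integration.integral_sum, auto intro: ip)
  have lin: "(LI s. 3 * (\<alpha> * f s + \<beta> * g s + \<gamma> * h s)) = 3 * (\<alpha> * (LI s. f s) + \<beta> * (LI s. g s) + \<gamma> * (LI s. h s))"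
   if "Lint f" "Lint g" "Lint h" for f g h :: "real => real" and \<alpha> \<beta> \<gamma>
   using that by simp
  have i3: "Lint (%s. \<Sum>l\<in>UNIV - {k}. \<Lambda>^2 * (\<Sum>j\<in>UNIV. ?q (%z. p (d (ek l) i) z $ j) s))"
   by (intro Bochner_Integration.integrable_sum isum)
  show ?thesis unfolding s1[symmetric] unfolding SI_def
   by (rule lin[OF iv i3])
 qed
 also have "... <= 3 * (\<Lambda>^2 * (c1 * (ke NN * I0 i)) + c1 * ((2 * \<Lambda> + 1) * kc NN * I0 i) + ?n * (\<Sum>l\<in>UNIV - {k}. \<Lambda>^2 * (\<Sum>j\<in>(UNIV::'n set). c1 * (ke NN * I0 i))))"
 proof (intro mult_left_mono add_mono sum_mono)
  have te: "Wn (%z. (v (d b i) z)^2) 2 <= ke NN * I0 i" if "b : tang k" for b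
   using tang_energy1[OF i that, of 0 NN, unfolded add_0] by (simp add: NN_def I0_def)
  have "SI (v (d tau i)) z <= c1 * Wn (%z. (v (d tau i) z)^2) 2" by (rule SI_v[OF tS z]) simp
  also have "... <= c1 * (ke NN * I0 i)" using te c1_nonneg by (intro mult_left_mono) auto
  finally show "SI (v (d tau i)) z <= c1 * (ke NN * I0 i)" .
  \<comment> \<open>Of the two factors lam, one is spent in the Caccioppoli inequality, which trades
    lam * v^2 for v^2 at a lower cutoff power; the other completes v^2 to a term of
    \<open>I0\<close>.\<close>
  have "SI (v i) z <= c1 * Wn (%z. (v i z)^2) 2" by (rule SI_v[OF i z]) simp
  then have "lam^2 * SI (v i) z <= lam^2 * (c1 * Wn (%z. (v i z)^2) 2)" by (intro mult_left_mono) auto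
  also have "... = c1 * (lam * (lam * Wn (%z. (v i z)^2) 2))" by (simp add: power2_eq_square)
  also have "... <= c1 * ((2 * \<Lambda> + 1) * kc NN * I0 i)"
  proof (rule mult_left_mono[OF _ c1_nonneg])
   have "lam * Wn (%z. (v i z)^2) 2 <= Wn (pn i) 2 + lam * Wn (%z. (v i z)^2) 2" using Wn_nonneg[of "pn i" 2] by (simp add: pn_def)
   also have "... <= (2 * \<Lambda> + 1) * kc NN * Wn (%z. (v i z)^2) 0" using caccioppoli_full[OF i, of 0 NN, unfolded add_0] by (simp add: NN_def)
   finally have "lam * (lam * Wn (%z. (v i z)^2) 2) <= lam * ((2 * \<Lambda> + 1) * kc NN * Wn (%z. (v i z)^2) 0)" using lam by (rule mult_left_mono)
   also have "... = (2 * \<Lambda> + 1) * kc NN * (lam * Wn (%z. (v i z)^2) 0)" by simp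
   also have "... <= (2 * \<Lambda> + 1) * kc NN * I0 i"
    unfolding I0_def using kc_ge_1[OF N] Lambda Wn_nonneg[of "pn i" 0] by (intro mult_left_mono) (auto simp: pn_def)
   finally show "lam * (lam * Wn (%z. (v i z)^2) 2) <= (2 * \<Lambda> + 1) * kc NN * I0 i" .
  qed
  finally show "lam^2 * SI (v i) z <= c1 * ((2 * \<Lambda> + 1) * kc NN * I0 i)" .
  fix l j assume l: "l : UNIV - {k}"
  then have "SI (%z. p (d (ek l) i) z $ j) z <= c1 * Wn (%z. (v (d (ek l) i) z)^2) 2" by (intro SI_p lS z) auto
  also have "... <= c1 * (ke NN * I0 i)" using te[of "ek l"] l c1_nonneg by (intro mult_left_mono) auto
  finally show "SI (%z. p (d (ek l) i) z $ j) z <= c1 * (ke NN * I0 i)" .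
 qed auto
 also have "... <= Kg * I0 i"
 proof -
  have X: "0 <= \<Lambda>^2 * (?n * (c1 * (ke NN * I0 i)))"
   using c1_nonneg ke_ge_1[OF N] I0_nonneg[of i] by (intro mult_nonneg_nonneg) auto
  have "(\<Sum>l\<in>UNIV - {k}. \<Lambda>^2 * (\<Sum>j\<in>(UNIV::'n set). c1 * (ke NN * I0 i))) = real (card (UNIV - {k})) * (\<Lambda>^2 * (?n * (c1 * (ke NN * I0 i))))" by simp
  also have "... <= ?n * (\<Lambda>^2 * (?n * (c1 * (ke NN * I0 i))))" by (intro mult_right_mono X) (simp add: card_mono)
  finally have "?n * (\<Sum>l\<in>UNIV - {k}. \<Lambda>^2 * (\<Sum>j\<in>(UNIV::'n set). c1 * (ke NN * I0 i))) <= ?n * (?n * (\<Lambda>^2 * (?n * (c1 * (ke NN * I0 i)))))" by (intro mult_left_mono) auto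
  then show ?thesis unfolding Kg_def by (simp add: algebra_simps power3_eq_cube)
 qed
 finally show ?thesis .
qed

definition Kp :: real where
 "Kp = real CARD('n) * (Kv * ke NN) + real CARD('n) * \<Lambda>^2 * Kg + (real CARD('n))^2 * \<Lambda> ^ 4 * (Kv * ke NN)"

text \<open>The tangential components come from \<open>sup_tang\<close>. For the vertical one,
  Cauchy-Schwarz bounds the squared flux at s by the integral of \<mu> over (0,s) times
  \<open>SI (G i)\<close>; hypothesis \<open>K\<close> permits division by \<mu>(s)^2, and since the
  k-th diagonal entry of the matrix is at least 1 / \<Lambda>, the component is recovered from the
  flux and the tangential ones.\<close>

lemma sup_grad:
 assumes J: "Lint (%s. ind {0<..<3} s / \<mu> s)" "(LI s. ind {0<..<3} s / \<mu> s) <= J"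
  and U: "Lint (%s. ind {0<..<3} s * \<mu> s)"
  and K: "AE s in lborel. s : {0<..<1} --> (LI r. ind {0<..<s} r * \<mu> r) <= K^2 * J * (\<mu> s)^2"
  and i: "i : S" and z: "T z ~= 0" "- 1 <= fst z" "norm (cross k z) <= 1"
 shows "AE s in lborel. s : {0<..<1} --> pn i (upd (ek k) z s) <= Kp * (1 + K^2) * J * I0 i"
proof -
 let ?n = "real CARD('n)"
 let ?u = "%s. upd (ek k) z s"
 have zr: "- 5 < fst z" "fst z < 0" "norm (cross k z) < 5 / 2" using z T_cases[of z] t0 by auto
 have N: "3 <= NN" by (simp add: NN_def)
 have J0: "0 <= J"
 proof -
  have "0 <= (LI s. ind {0<..<3} s / \<mu> s)"
   using mu_pos by (intro integral_nonneg_AE AE_I2) (auto simp: less_imp_le)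
  then show ?thesis using J(2) by simp
 qed
 define E where "E = Kv * ke NN * J * I0 i"
 define g where "g = (%r. \<mu> r * G i (?u r))"
 have F: "AE s in lborel. s : {0<..<3} --> \<mu> s * fl i k (?u s) = prim g s"
  using flux[OF i zr] by (simp add: g_def G_def fl_def)
 have ig: "Lint g" unfolding g_def by (rule dom1_borel_bound(2)[OF dom1_G[OF i]])
 note [measurable] = slice_borel[OF dom1_borel[OF dom1_G[OF i]], of z]
 have G0: "0 <= Kg * I0 i" using SI_G[OF i z] SI_nonneg[of "G i" z] by simp
 have prim_sq: "(prim g s)^2 <= (LI r. ind {0<..<s} r * \<mu> r) * (Kg * I0 i)" if s: "s : {0<..<1}" for s
 proof -
  let ?w = "%r. ind {0<..<s} r * \<mu> r"
  have iw: "Lint ?w"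
   using mu_pos s by (intro Bochner_Integration.integrable_bound[OF U]) (auto split: split_indicator)
  have w0: "0 <= ?w r" for r using mu_pos[of r] by (simp add: less_imp_le)
  have iq: "Lint (%r. ?w r * (G i (?u r))^2)"
   using s mu_pos by (intro Bochner_Integration.integrable_bound[OF SI_int[OF dom1_G[OF i], of z]]) (auto split: split_indicator)
  have a0: "0 <= (LI r. ?w r)" by (intro integral_nonneg_AE AE_I2 w0)
  have ip: "Lint (%r. ind {0<..<s} r * g r)" by (rule integrable_indicator_times[OF _ ig]) simp
  have "ennreal \<bar>prim g s\<bar> = ennreal (norm (LI r. ind {0<..<s} r * g r))" by (simp add: prim_def)
  also have "... <= (NI r. ennreal (norm (ind {0<..<s} r * g r)))" by (rule integral_norm_bound_ennreal[OF ip])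
  also have "... = (NI r. ennreal (?w r * \<bar>G i (?u r)\<bar>))"
   using mu_pos by (intro nn_integral_cong) (auto simp: g_def abs_mult abs_of_pos split: split_indicator)
  also have "... <= ennreal (sqrt ((LI r. ?w r) * (Kg * I0 i)))"
  proof (rule weighted_Cauchy_Schwarz[OF w0 _ _ iw order_refl iq])
   have "(LI r. ?w r * (G i (?u r))^2) <= SI (G i) z"
    unfolding SI_def using s mu_pos
    by (intro integral_mono iq SI_int dom1_G i) (auto split: split_indicator simp: less_imp_le)
   also have "... <= Kg * I0 i" by (rule SI_G[OF i z])
   finally show "(LI r. ?w r * (G i (?u r))^2) <= Kg * I0 i" .
  qed measurable
  finally have "\<bar>prim g s\<bar> <= sqrt ((LI r. ?w r) * (Kg * I0 i))" using a0 G0 by simp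
  then have "\<bar>prim g s\<bar>^2 <= (sqrt ((LI r. ?w r) * (Kg * I0 i)))^2" by (intro power_mono) auto
  then show ?thesis using a0 G0 by simp
 qed
 have tg: "AE s in lborel. \<forall>l\<in>UNIV - {k}. s : {0<..<1} --> (p i (?u s) $ l)^2 <= E"
 proof (rule AE_finite_allI)
  fix l assume l: "l : UNIV - {k}"
  have "AE s in lborel. s : {0<..<1} --> (v (d (ek l) i) (?u s))^2 <= E"
   unfolding E_def using l by (intro sup_tang[OF J i z]) auto
  moreover have "AE s in lborel. s : {0<..<3} --> p i (?u s) $ l = v (d (ek l) i) (?u s)"
   using l by (intro tang_grad[OF i _ zr]) auto
  ultimately show "AE s in lborel. s : {0<..<1} --> (p i (?u s) $ l)^2 <= E"
   by eventually_elim auto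
 qed simp
 show ?thesis using F K tg
 proof eventually_elim
  case (elim s)
  show ?case
  proof
   assume s: "s : {0<..<1}"
   let ?w = "?u s"
   have m: "0 < \<mu> s" by (rule mu_pos)
   have "(\<mu> s)^2 * (fl i k ?w)^2 = (prim g s)^2" using elim(1) s by (simp add: power_mult_distrib[symmetric])
   also have "... <= (LI r. ind {0<..<s} r * \<mu> r) * (Kg * I0 i)" by (rule prim_sq[OF s])
   also have "... <= (K^2 * J * (\<mu> s)^2) * (Kg * I0 i)" using elim(2) s G0 by (intro mult_right_mono) auto
   finally have "(\<mu> s)^2 * (fl i k ?w)^2 <= (\<mu> s)^2 * (K^2 * J * (Kg * I0 i))" by (simp add: mult_ac)
   then have fl2: "(fl i k ?w)^2 <= K^2 * J * (Kg * I0 i)" using m by simp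
   have pl: "(p i ?w $ l)^2 <= E" if "l ~= k" for l using elim(3) s that by auto
   have Akl: "\<bar>A s $ k $ l\<bar> <= \<Lambda>" for l
   proof -
    have "A s $ k $ l = (A s *v axis l 1) $ k" by (simp add: matrix_vector_mult_basis column_def)
    also have "\<bar>...\<bar> <= norm (A s *v axis l 1)" by (rule component_le_norm_cart)
    also have "... <= \<Lambda> * norm (axis l 1 :: real ^ 'n)" by (rule A_bound)
    finally show ?thesis by simp
   qed
   have Akk: "1 / \<Lambda> <= A s $ k $ k"
    using A_ell[of "axis k 1" s] by (simp add: matrix_vector_mult_basis column_def inner_axis)
   have split: "fl i k ?w = A s $ k $ k * p i ?w $ k + (\<Sum>l\<in>UNIV - {k}. A s $ k $ l * p i ?w $ l)"
    by (simp add: fl_def matrix_vector_mult_def sum.remove[of UNIV k])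
   define h where "h = (%l. if l = k then \<bar>fl i k ?w\<bar> else \<Lambda> * \<bar>p i ?w $ l\<bar>)"
   have "\<bar>p i ?w $ k\<bar> / \<Lambda> <= A s $ k $ k * \<bar>p i ?w $ k\<bar>" using mult_right_mono[OF Akk, of "\<bar>p i ?w $ k\<bar>"] by simp
   also have "... <= \<bar>A s $ k $ k * p i ?w $ k\<bar>" unfolding abs_mult by (intro mult_right_mono) auto
   also have "... = \<bar>fl i k ?w - (\<Sum>l\<in>UNIV - {k}. A s $ k $ l * p i ?w $ l)\<bar>" using split by simp
   also have "... <= \<bar>fl i k ?w\<bar> + (\<Sum>l\<in>UNIV - {k}. \<bar>A s $ k $ l * p i ?w $ l\<bar>)"
    by (intro order_trans[OF abs_triangle_ineq4] add_left_mono sum_abs)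
   also have "... <= \<bar>fl i k ?w\<bar> + (\<Sum>l\<in>UNIV - {k}. \<Lambda> * \<bar>p i ?w $ l\<bar>)"
    unfolding abs_mult by (intro add_left_mono sum_mono mult_right_mono Akl) auto
   also have "... = (\<Sum>l\<in>UNIV. h l)" by (simp add: h_def sum.remove[of UNIV k])
   finally have "\<bar>p i ?w $ k\<bar> <= \<Lambda> * (\<Sum>l\<in>UNIV. h l)" using Lambda by (simp add: field_simps)
   then have "\<bar>p i ?w $ k\<bar>^2 <= (\<Lambda> * (\<Sum>l\<in>UNIV. h l))^2" by (intro power_mono) auto
   also have "... = \<Lambda>^2 * (\<Sum>l\<in>UNIV. h l)^2" by (rule power_mult_distrib)
   also have "... <= \<Lambda>^2 * (?n * (\<Sum>l\<in>UNIV. (h l)^2))"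
    using sum_squared_le[of UNIV h] by (intro mult_left_mono) auto
   also have "(\<Sum>l\<in>UNIV. (h l)^2) = (fl i k ?w)^2 + (\<Sum>l\<in>UNIV - {k}. \<Lambda>^2 * (p i ?w $ l)^2)"
    by (simp add: h_def sum.remove[of UNIV k] power_mult_distrib)
   finally have pk: "(p i ?w $ k)^2 <= \<Lambda>^2 * (?n * ((fl i k ?w)^2 + \<Lambda>^2 * (\<Sum>l\<in>UNIV - {k}. (p i ?w $ l)^2)))"
    by (simp add: sum_distrib_left)
   have E0: "0 <= E" unfolding E_def Kv_def using c1_nonneg ke_ge_1[OF N] J0 I0_nonneg[of i] by (intro mult_nonneg_nonneg) auto
   have "(\<Sum>l\<in>UNIV - {k}. (p i ?w $ l)^2) <= real (card (UNIV - {k})) * E" using pl by (intro sum_bounded_above) auto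
   also have "... <= ?n * E" using E0 by (intro mult_right_mono) (simp_all add: card_mono)
   finally have ps: "(\<Sum>l\<in>UNIV - {k}. (p i ?w $ l)^2) <= ?n * E" .
   have "pn i ?w = (p i ?w $ k)^2 + (\<Sum>l\<in>UNIV - {k}. (p i ?w $ l)^2)"
    by (simp add: pn_sum sum.remove[of UNIV k] power2_eq_square)
   also have "... <= \<Lambda>^2 * (?n * (K^2 * J * (Kg * I0 i) + \<Lambda>^2 * (?n * E))) + ?n * E"
    by (intro add_mono ps order_trans[OF pk] mult_left_mono fl2) auto
   also have "... = (?n * \<Lambda>^2 * Kg * K^2 + ?n^2 * \<Lambda> ^ 4 * (Kv * ke NN) + ?n * (Kv * ke NN)) * (J * I0 i)"
    unfolding E_def by (simp add: power2_eq_square power4_eq_xxxx algebra_simps)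
   also have "... <= (Kp * (1 + K^2)) * (J * I0 i)"
   proof (rule mult_right_mono)
    have c: "0 <= Kv * ke NN" unfolding Kv_def using c1_nonneg ke_ge_1[OF N] by (intro mult_nonneg_nonneg) auto
    have k: "0 <= Kg" unfolding Kg_def using c1_nonneg ke_ge_1[OF N] kc_ge_1[OF N] Lambda
     by (intro mult_nonneg_nonneg add_nonneg_nonneg) auto
    have "0 <= ?n * \<Lambda>^2 * Kg + ?n^2 * \<Lambda> ^ 4 * (Kv * ke NN) * K^2 + ?n * (Kv * ke NN) * K^2"
     by (intro add_nonneg_nonneg mult_nonneg_nonneg[OF mult_nonneg_nonneg[OF _ c]] mult_nonneg_nonneg[OF _ k]) auto
    then show "?n * \<Lambda>^2 * Kg * K^2 + ?n^2 * \<Lambda> ^ 4 * (Kv * ke NN) + ?n * (Kv * ke NN) <= Kp * (1 + K^2)"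
     unfolding Kp_def by (simp add: algebra_simps)
    show "0 <= J * I0 i" using J0 I0_nonneg by simp
   qed
   finally show "pn i ?w <= Kp * (1 + K^2) * J * I0 i" by (simp add: mult_ac)
  qed
 qed
qed

end

section \<open>Tangential mollification\<close>

text \<open>A function of (t, x') written on the whole space, hence constant in the height. Its
  support has nonnegative tangential coordinates, so z - w only looks backwards, in particular in
  time. No sign is imposed, which admits derivatives and differences of kernels.\<close>

definition kern :: "'n::finite => real => ('n tx => real) => bool" where
 "kern k h th \<longleftrightarrow> smooth th & (\<forall>w r. th (w + r *\<^sub>R ek k) = th w) & (\<forall>w. th w ~= 0 --> (\<forall>b\<in>tang k. 0 <= w \<bullet> b & w \<bullet> b <= h))"

lemma kern_smooth: "kern k h th ==> smooth th" by (simp add: kern_def)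
lemma kern_shift: "kern k h th ==> th (w + r *\<^sub>R ek k) = th w" unfolding kern_def by blast
lemma kern_supp: "kern k h th ==> th w ~= 0 ==> b : tang k ==> 0 <= w \<bullet> b & w \<bullet> b <= h" unfolding kern_def by blast
lemma kern_upd: "kern k h th ==> th (upd (ek k) w r) = th w" unfolding upd_def by (rule kern_shift)
lemma kern_borel: "kern k h th ==> th : bm"
 by (rule borel_measurable_continuous_onI[OF smooth_continuous[OF kern_smooth]])

lemma kern_mono: "kern k h th ==> h <= h' ==> kern k h' th"
 unfolding kern_def by (meson order_trans)

lemma kern_add:
 assumes a: "kern k h th" and b: "kern k h th'"
 shows "kern k h (%w. th w + th' w)"
 unfolding kern_def
proof (intro conjI allI impI ballI)
 show "smooth (%w. th w + th' w)" by (intro smooth_add kern_smooth[OF a] kern_smooth[OF b])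
 show "th (w + r *\<^sub>R ek k) + th' (w + r *\<^sub>R ek k) = th w + th' w" for w r
  by (simp only: kern_shift[OF a] kern_shift[OF b])
 fix w c assume "th w + th' w ~= 0" "c : tang k"
 then have "th w ~= 0 \<or> th' w ~= 0" "c : tang k" by auto
 then show "0 <= w \<bullet> c" "w \<bullet> c <= h" using kern_supp[OF a] kern_supp[OF b] by blast+
qed

lemma kern_cmult:
 assumes a: "kern k h th" shows "kern k h (%w. c * th w)"
 unfolding kern_def
proof (intro conjI allI impI ballI)
 show "smooth (%w. c * th w)" by (intro smooth_cmult kern_smooth[OF a])
 show "c * th (w + r *\<^sub>R ek k) = c * th w" for w r by (simp only: kern_shift[OF a])
 fix w b assume "c * th w ~= 0" "b : tang k"
 then have "th w ~= 0" "b : tang k" by auto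
 then show "0 <= w \<bullet> b" "w \<bullet> b <= h" using kern_supp[OF a] by blast+
qed

lemma kern_bounded:
 fixes k :: "'n::finite"
 assumes "kern k h th" shows "\<exists>C\<ge>0. \<forall>w. \<bar>th w\<bar> <= C"
proof -
 let ?K = "cbox (0, 0) (h, \<chi> l. if l = k then 0 else h) :: ('n tx) set"
 have "compact (th ` ?K)"
  by (intro compact_continuous_image continuous_on_subset[OF smooth_continuous[OF kern_smooth[OF assms]]]) auto
 then obtain C where C: "!!w. w : ?K ==> \<bar>th w\<bar> <= C"
  using compact_imp_bounded bounded_iff by (metis image_eqI real_norm_def)
 have "\<bar>th w\<bar> <= max C 0" for w
 proof (cases "th w = 0")
  case False
  let ?w = "upd (ek k) w 0"
  have w: "th ?w = th w" by (rule kern_upd[OF assms])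
  then have nz: "th ?w ~= 0" using False by simp
  have "0 <= fst ?w & fst ?w <= h" using kern_supp[OF assms nz tau_tang] by (simp only: inner_tau)
  moreover have "0 <= snd ?w $ l & snd ?w $ l <= (if l = k then 0 else h)" for l
  proof (cases "l = k")
   case True then show ?thesis using ht_upd[of k w 0] by simp
  next
   case l: False
   then have "ek l : tang k" by simp
   from kern_supp[OF assms nz this] show ?thesis using l by (simp only: inner_ek if_False)
  qed
  ultimately have "?w : ?K" by (cases ?w) (auto simp: cbox_Pair_eq mem_box_cart)
  then have "\<bar>th ?w\<bar> <= C" by (rule C)
  then show ?thesis by (simp add: w)
 qed simp
 then show ?thesis by (intro exI[of _ "max C 0"]) auto
qed

lemma kern_deriv_line: "kern k h th ==> ((%r. th (w + r *\<^sub>R b)) has_real_derivative dd th b (w + r *\<^sub>R b)) (at r)"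
 by (rule dir_deriv_line[OF smooth_differentiable[OF kern_smooth]])

lemma kern_dir_ek: "kern k h th ==> dd th (ek k) w = 0"
proof -
 assume k: "kern k h th"
 have "((%r. th (w + r *\<^sub>R ek k)) has_real_derivative dd th (ek k) (w + 0 *\<^sub>R ek k)) (at 0)"
  by (rule kern_deriv_line[OF k])
 then have "((%r. th w) has_real_derivative dd th (ek k) w) (at (0::real))"
  by (simp only: kern_shift[OF k] scaleR_zero_left add_0_right)
 then show ?thesis using DERIV_unique DERIV_const by blast
qed

lemma kern_dir:
 assumes k: "kern k h th" and b: "b : tang k"
 shows "kern k h (dd th b)"
 unfolding kern_def
proof (intro conjI allI impI ballI)
 show "smooth (dd th b)" by (rule smooth_dir_deriv[OF kern_smooth[OF k] tang_Basis[OF b]])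
 fix w r
 have "dd (%x. th (r *\<^sub>R ek k + x)) b w = dd th b (r *\<^sub>R ek k + w)"
  by (rule dir_deriv_affine(1)[where L="%x. x"]) (auto intro: smooth_differentiable[OF kern_smooth[OF k]])
 then show "dd th b (w + r *\<^sub>R ek k) = dd th b w"
  by (simp only: add.commute[of "r *\<^sub>R ek k"] kern_shift[OF k])
next
 fix w c assume nz: "dd th b w ~= 0" and c: "c : tang k"
 have *: "dd th b w = 0" if "open U" "w : U" "!!x. x : U ==> th x = 0" for U
 proof -
  have "(th has_derivative (%_. 0)) (at w)"
   by (rule has_derivative_transform_within_open[OF has_derivative_const[of 0] that(1,2)]) (simp add: that(3))
  then show ?thesis by (rule dir_deriv_eq)
 qed
 have "open {x. x \<bullet> c < 0}" "open {x. h < x \<bullet> c}" by (intro open_Collect_less continuous_intros)+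
 then show "0 <= w \<bullet> c" "w \<bullet> c <= h"
  using *[of "{x. x \<bullet> c < 0}"] *[of "{x. h < x \<bullet> c}"] nz kern_supp[OF k _ c] by (force simp: not_less[symmetric])+
qed


section \<open>Convolution in the tangential variables\<close>

definition ms :: "'n::finite => ('n tx => real) => real => real" where
 "ms k f s = (LI w. ind (slab (ek k)) w * \<bar>f (upd (ek k) w s)\<bar>)"

text \<open>Convolution in (t, x') at the height of \<open>z\<close>; the vertical coordinate of
  \<open>w\<close> is the dummy variable of the unit slab.\<close>

definition conv :: "'n::finite => ('n tx => real) => ('n tx => real) => 'n tx => real" where
 "conv k f th z = (LI w. th (z - w) * (ind (slab (ek k)) w * f (upd (ek k) w (ht k z))))"

text \<open>Integrability on every horizontal slice, not just on almost every one, so that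
  \<open>conv\<close> is differentiable at every point. A representative with this property comes
  from \<open>slice_representative\<close>.\<close>

definition sl :: "'n::finite => ('n tx => real) => bool" where
 "sl k f \<longleftrightarrow> f : bm & (\<forall>s. Lint (%w. ind (slab (ek k)) w * f (upd (ek k) w s)))"

lemma sl_borel: "sl k f ==> f : bm" by (simp add: sl_def)
lemma sl_int: "sl k f ==> Lint (%w. ind (slab (ek k)) w * f (upd (ek k) w s))" by (simp add: sl_def)

lemma integrable_bounded_mult:
 fixes f g :: "'a => real"
 assumes "integrable M f" "g : borel_measurable M" "!!x. \<bar>g x\<bar> <= C"
 shows "integrable M (%x. g x * f x)"
proof (rule Bochner_Integration.integrable_bound[OF integrable_mult_right[OF assms(1), of C]])
 show "(%x. g x * f x) : borel_measurable M" using assms by auto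
 show "AE x in M. norm (g x * f x) <= norm (C * f x)"
 proof (rule AE_I2)
  fix x
  have "\<bar>g x\<bar> * \<bar>f x\<bar> <= \<bar>C\<bar> * \<bar>f x\<bar>" using assms(3)[of x] by (intro mult_right_mono) auto
  then show "norm (g x * f x) <= norm (C * f x)" by (simp add: abs_mult)
 qed
qed

lemma kern_diff_borel: "kern k h th ==> (%w. th (z - w)) : bm"
 by (rule borel_measurable_continuous_onI[OF continuous_on_compose2[OF smooth_continuous[OF kern_smooth]]])
  (auto intro!: continuous_intros)

lemma conv_int:
 assumes k: "kern k h th" and f: "sl k f"
 shows "Lint (%w. th (z - w) * (ind (slab (ek k)) w * f (upd (ek k) w s)))"
proof -
 obtain C where C: "!!w. \<bar>th w\<bar> <= C" using kern_bounded[OF k] by blast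
 show ?thesis
  by (rule integrable_bounded_mult[OF sl_int[OF f], where C=C]) (use kern_diff_borel[OF k] C in simp_all)
qed

lemma conv_bound:
 assumes k: "kern k h th" and f: "sl k f"
 shows "\<exists>C\<ge>0. \<forall>z. \<bar>conv k f th z\<bar> <= C * ms k f (ht k z)"
proof -
 obtain C where C: "0 <= C" "!!w. \<bar>th w\<bar> <= C" using kern_bounded[OF k] by auto
 have "\<bar>conv k f th z\<bar> <= C * ms k f (ht k z)" for z
 proof -
  have "\<bar>conv k f th z\<bar> <= (LI w. \<bar>th (z - w) * (ind (slab (ek k)) w * f (upd (ek k) w (ht k z)))\<bar>)"
   unfolding conv_def using integral_norm_bound[of lborel "%w. th (z - w) * (ind (slab (ek k)) w * f (upd (ek k) w (ht k z)))"] by simp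
  also have "... <= (LI w. C * \<bar>ind (slab (ek k)) w * f (upd (ek k) w (ht k z))\<bar>)"
  proof (rule integral_mono)
   show "Lint (%w. \<bar>th (z - w) * (ind (slab (ek k)) w * f (upd (ek k) w (ht k z)))\<bar>)"
    by (intro integrable_abs conv_int[OF k f])
   show "Lint (%w. C * \<bar>ind (slab (ek k)) w * f (upd (ek k) w (ht k z))\<bar>)"
    by (intro integrable_mult_right integrable_abs sl_int f)
   fix w show "\<bar>th (z - w) * (ind (slab (ek k)) w * f (upd (ek k) w (ht k z)))\<bar> <= C * \<bar>ind (slab (ek k)) w * f (upd (ek k) w (ht k z))\<bar>"
    unfolding abs_mult[of "th (z - w)"] by (intro mult_right_mono C) auto
  qed
  also have "... = C * ms k f (ht k z)" by (simp add: ms_def abs_mult)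
  finally show ?thesis .
 qed
 then show ?thesis using C by blast
qed

lemma conv_borel:
 assumes k: "kern k h th" and f: "sl k f"
 shows "conv k f th : bm"
proof -
 note [measurable] = kern_borel[OF k] sl_borel[OF f]
 have "(%z. (LI w. th (z - w) * (ind (slab (ek k)) w * f (upd (ek k) w (ht k z))))) : bm"
  by measurable
 then show ?thesis unfolding conv_def[abs_def] .
qed

lemma ms_borel:
 assumes f: "sl k f"
 shows "ms k f : bm"
proof -
 note [measurable] = sl_borel[OF f]
 have "(%s. (LI w. ind (slab (ek k)) w * \<bar>f (upd (ek k) w s)\<bar>)) : bm"
  by measurable
 then show ?thesis unfolding ms_def[abs_def] .
qed

lemma ms_nonneg: "0 <= ms k f s"
 unfolding ms_def by (intro integral_nonneg_AE AE_I2) auto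

text \<open>Difference quotients of the kernel are bounded by the supremum of its derivative, so a
  multiple of the modulus of the slice of \<open>f\<close> is a majorant for dominated
  convergence.\<close>

lemma conv_deriv:
 assumes k: "kern k h th" and f: "sl k f" and b: "b : tang k"
 shows "((%r. conv k f th (z + r *\<^sub>R b)) has_real_derivative conv k f (dd th b) z) (at 0)"
proof -
 let ?g = "%w. ind (slab (ek k)) w * f (upd (ek k) w (ht k z))"
 have kd: "kern k h (dd th b)" by (rule kern_dir[OF k b])
 obtain C where C: "0 <= C" "!!w. \<bar>dd th b w\<bar> <= C" using kern_bounded[OF kd] by auto
 have ig: "Lint ?g" by (rule sl_int[OF f])
 note [measurable] = kern_diff_borel[OF k] kern_diff_borel[OF kd]
 have gm [measurable]: "?g : bm" using ig by auto
 have "((%r. (conv k f th (z + r *\<^sub>R b) - conv k f th z) / r) \<longlongrightarrow> conv k f (dd th b) z) (at 0)"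
  unfolding tendsto_at_iff_sequentially comp_def
 proof (intro allI impI)
  fix X :: "nat => real" assume X: "\<forall>i. X i : UNIV - {0}" "X \<longlonglongrightarrow> 0"
  have e: "(conv k f th (z + X n *\<^sub>R b) - conv k f th z) / X n = (LI w. (th (z + X n *\<^sub>R b - w) - th (z - w)) / X n * ?g w)" for n
  proof -
   have i1: "Lint (%w. th (z + X n *\<^sub>R b - w) * ?g w)" "Lint (%w. th (z - w) * ?g w)"
    by (rule conv_int[OF k f])+
   have "(LI w. (th (z + X n *\<^sub>R b - w) - th (z - w)) / X n * ?g w)
     = (LI w. (th (z + X n *\<^sub>R b - w) * ?g w - th (z - w) * ?g w) / X n)"
    by (intro Bochner_Integration.integral_cong) (auto simp: algebra_simps diff_divide_distrib)
   also have "... = (LI w. th (z + X n *\<^sub>R b - w) * ?g w - th (z - w) * ?g w) / X n" by (rule integral_divide_zero)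
   also have "(LI w. th (z + X n *\<^sub>R b - w) * ?g w - th (z - w) * ?g w) = (LI w. th (z + X n *\<^sub>R b - w) * ?g w) - (LI w. th (z - w) * ?g w)"
    by (rule Bochner_Integration.integral_diff[OF i1])
   finally show ?thesis unfolding conv_def ht_add_tang[OF b] by (rule sym)
  qed
  show "(%n. (conv k f th (z + X n *\<^sub>R b) - conv k f th z) / X n) \<longlonglongrightarrow> conv k f (dd th b) z"
   unfolding e unfolding conv_def
  proof (rule integral_dominated_convergence[where w="%w. C * \<bar>?g w\<bar>"])
   show "(%w. dd th b (z - w) * ?g w) : borel_measurable lborel"
    "!!n. (%w. (th (z + X n *\<^sub>R b - w) - th (z - w)) / X n * ?g w) : borel_measurable lborel"
    by measurable
   show "Lint (%w. C * \<bar>?g w\<bar>)" using ig by simp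
   show "AE w in lborel. (%n. (th (z + X n *\<^sub>R b - w) - th (z - w)) / X n * ?g w) \<longlonglongrightarrow> dd th b (z - w) * ?g w"
   proof (intro AE_I2 tendsto_mult tendsto_const)
    fix w
    have "((%r. (th (z - w + r *\<^sub>R b) - th (z - w)) / r) \<longlongrightarrow> dd th b (z - w)) (at 0)"
     using kern_deriv_line[OF k, of "z - w" b 0] by (simp add: DERIV_def)
    then have "(%n. (th (z - w + X n *\<^sub>R b) - th (z - w)) / X n) \<longlonglongrightarrow> dd th b (z - w)"
     using X unfolding tendsto_at_iff_sequentially comp_def by blast
    then show "(%n. (th (z + X n *\<^sub>R b - w) - th (z - w)) / X n) \<longlonglongrightarrow> dd th b (z - w)"
     by (simp add: algebra_simps)
   qed
   show "AE w in lborel. norm ((th (z + X n *\<^sub>R b - w) - th (z - w)) / X n * ?g w) <= C * \<bar>?g w\<bar>" for n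
   proof (rule AE_I2)
    fix w
    have "norm (th (z - w + X n *\<^sub>R b) - th (z - w + 0 *\<^sub>R b)) <= C * norm (X n - 0)"
    proof (rule field_differentiable_bound[where S=UNIV])
     show "((%r. th (z - w + r *\<^sub>R b)) has_field_derivative dd th b (z - w + r *\<^sub>R b)) (at r within UNIV)" for r
      using kern_deriv_line[OF k, of "z - w" b r] by simp
    qed (use C in auto)
    moreover have "z - w + X n *\<^sub>R b = z + X n *\<^sub>R b - w" by simp
    ultimately have "\<bar>th (z + X n *\<^sub>R b - w) - th (z - w)\<bar> <= C * \<bar>X n\<bar>" by simp
    then have "\<bar>(th (z + X n *\<^sub>R b - w) - th (z - w)) / X n\<bar> <= C" using X(1) by (simp add: divide_le_eq)
    then show "norm ((th (z + X n *\<^sub>R b - w) - th (z - w)) / X n * ?g w) <= C * \<bar>?g w\<bar>"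
     unfolding real_norm_def abs_mult[of _ "?g w"] by (rule mult_right_mono) simp
   qed
  qed
 qed
 then show ?thesis by (simp add: DERIV_def)
qed

text \<open>The passage from space to a single vertical line: by Fubini, testing the mollified
  function on the line through \<open>z\<close> with \<open>g\<close> amounts to testing
  \<open>f\<close> in space with \<open>g\<close> of the height times the reflected kernel. The
  kernel is constant in the height and can be moved out of the slice integral.\<close>

lemma pairing:
 assumes k: "kern k h th" and f: "sl k f" and g: "Lint (%w. g (ht k w) * f w)"
 shows "Lint (%s. g s * conv k f th (upd (ek k) z s))"
  and "(LI s. g s * conv k f th (upd (ek k) z s)) = (LI w. th (z - w) * (g (ht k w) * f w))"
proof -
 let ?F = "%w. th (z - w) * (g (ht k w) * f w)"
 obtain C where C: "!!w. \<bar>th w\<bar> <= C" using kern_bounded[OF k] by auto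
 have F: "Lint ?F"
  by (rule integrable_bounded_mult[OF g, where C=C]) (use kern_diff_borel[OF k] C in simp_all)
 have sh: "th (z - upd (ek k) w r) = th (z - w)" for w r
 proof -
  have "z - upd (ek k) w r = (z - w) + (w \<bullet> ek k - r) *\<^sub>R ek k" by (simp add: upd_def algebra_simps zero_prod_def)
  then show ?thesis by (simp only: kern_shift[OF k])
 qed
 have sh': "th (upd (ek k) z r - w) = th (z - w)" for w r
 proof -
  have "upd (ek k) z r - w = (z - w) + (r - z \<bullet> ek k) *\<^sub>R ek k" by (simp add: upd_def algebra_simps zero_prod_def)
  then show ?thesis by (simp only: kern_shift[OF k])
 qed
 have e: "(LI w. ind (slab (ek k)) w *\<^sub>R ?F (upd (ek k) w r)) = g r * conv k f th (upd (ek k) z r)" for r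
 proof -
  have "(LI w. ind (slab (ek k)) w *\<^sub>R ?F (upd (ek k) w r))
    = (LI w. g r * (th (z - w) * (ind (slab (ek k)) w * f (upd (ek k) w r))))"
   unfolding sh ht_upd by (intro Bochner_Integration.integral_cong) auto
  also have "... = g r * conv k f th (upd (ek k) z r)"
   unfolding conv_def sh' ht_upd by (rule integral_mult_right_zero)
  finally show ?thesis .
 qed
 show "(LI s. g s * conv k f th (upd (ek k) z s)) = (LI w. ?F w)"
  using integral_line(3)[OF ek_Basis[of k] F] by (simp only: e)
 have "Lint (%r. (LI w. ind (slab (ek k)) w *\<^sub>R ?F (upd (ek k) w r)))"
  using integral_line(1)[OF ek_Basis[of k] F] by (rule lborel_pair.integrable_snd)
 then show "Lint (%s. g s * conv k f th (upd (ek k) z s))" unfolding e .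
qed

definition supp_in :: "('a::euclidean_space => real) => 'a set => bool" where
 "supp_in \<phi> U \<longleftrightarrow> (\<exists>C. compact C & C \<subseteq> U & (\<forall>w. w ~: C --> \<phi> w = 0))"

text \<open>The product test function that \<open>pairing\<close> calls for: \<eta> acts in the
  height, the kernel reflected at \<open>z\<close> in the tangential variables.\<close>

definition tfun :: "'n::finite => (real => real) => ('n tx => real) => 'n tx => 'n tx => real" where
 "tfun k \<eta> th z w = \<eta> (ht k w) * th (z - w)"

lemma bl_ht: "bounded_linear (ht k)"
 using bounded_linear_inner_left[of "ek k"] by simp

lemma tfun_smooth: "smooth \<eta> ==> kern k h th ==> smooth (tfun k \<eta> th z)"
 and tfun_deriv: "smooth \<eta> ==> kern k h th ==> dd (tfun k \<eta> th z) b w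
   = - (\<eta> (ht k w) * dd th b (z - w)) + ht k b * dd \<eta> 1 (ht k w) * th (z - w)"
proof -
 assume e: "smooth \<eta>" and k: "kern k h th"
 have th: "(%w. th (z - w)) = (%w. th (z + (- w)))" by simp
 have blm: "bounded_linear (%w::'a tx. - w)" by (rule bounded_linear_minus[OF bounded_linear_ident])
 have s1: "smooth (%w. \<eta> (ht k w))" using smooth_affine[OF bl_ht[of k] e, of 0] by simp
 have s2: "smooth (%w. th (z - w))" unfolding th by (rule smooth_affine[OF blm kern_smooth[OF k]])
 show "smooth (tfun k \<eta> th z)" unfolding tfun_def[abs_def] by (rule smooth_mult[OF s1 s2])
 have d1: "dd (%w. \<eta> (ht k w)) b w = ht k b * dd \<eta> 1 (ht k w)"
  using dir_deriv_affine(1)[OF bl_ht[of k] smooth_differentiable[OF e], where c=0 and x=w and b=b]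
   dir_deriv_sum[OF smooth_differentiable[OF e], of "ht k b" "ht k w"] by simp
 have "dd (%w. th (z - w)) b w = dd th (- b) (z + (- w))"
  unfolding th by (rule dir_deriv_affine(1)[OF blm smooth_differentiable[OF kern_smooth[OF k]]])
 also have "... = - dd th b (z - w)"
 proof -
  interpret linear "%h. dd th h (z + (- w))"
   using has_derivative_linear[OF has_derivative_dir_deriv[OF smooth_differentiable[OF kern_smooth[OF k]]]] .
  show ?thesis using neg[of b] by simp
 qed
 finally have d2: "dd (%w. th (z - w)) b w = - dd th b (z - w)" .
 show "dd (tfun k \<eta> th z) b w = - (\<eta> (ht k w) * dd th b (z - w)) + ht k b * dd \<eta> 1 (ht k w) * th (z - w)"
  unfolding tfun_def[abs_def] dir_deriv_mult[OF smooth_differentiable[OF s1] smooth_differentiable[OF s2]] d1 d2 by simp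
qed

text \<open>The horizontal displacement has norm at most n * h <= 1 / 4, so a cross-section of norm
  below 5 / 2 stays below 3. In time the support reaches back by at most h and never beyond the time
  of \<open>z\<close>, which is negative.\<close>

lemma tfun_supp:
 fixes k :: "'n::finite"
 assumes k: "kern k h th" and h: "0 < h" "real CARD('n) * h <= 1 / 4" and e: "\<eta> : test1 a b" and b3: "- 3 <= a" "b <= 3"
  and z: "- 5 < fst z" "fst z < 0" "norm (cross k z) < 5 / 2"
 shows "supp_in (tfun k \<eta> th z) ({- 9<..<0} \<times> {x. norm (x - axis k (x $ k)) < 3 & a < x $ k & x $ k < b})"
proof -
 obtain c d where cd: "a < c" "d < b" "!!x. x ~: {c..d} ==> \<eta> x = 0" using e by (auto simp: test1_def)
 let ?C = "cbox (fst z - h, \<chi> l. if l = k then c else snd z $ l - h) (fst z, \<chi> l. if l = k then d else snd z $ l)"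
 have h4: "h <= 1 / 4"
 proof -
  have "1 * h <= real CARD('n) * h" using h by (intro mult_right_mono) (simp_all add: Suc_leI)
  then show ?thesis using h(2) unfolding mult_1 by (rule order_trans)
 qed
 show ?thesis unfolding supp_in_def
 proof (intro exI[of _ ?C] conjI allI impI)
  show "compact ?C" by simp
  show "?C \<subseteq> {- 9<..<0} \<times> {x. norm (x - axis k (x $ k)) < 3 & a < x $ k & x $ k < b}"
  proof
   fix w assume w: "w : ?C"
   obtain t x where tx: "w = (t, x)" by (cases w)
   have t: "fst z - h <= t" "t <= fst z" and x: "!!l. (if l = k then c else snd z $ l - h) <= x $ l & x $ l <= (if l = k then d else snd z $ l)"
    using w unfolding tx by (auto simp: cbox_Pair_eq mem_box_cart)
   have "norm (x - axis k (x $ k) - cross k z) <= (\<Sum>l\<in>UNIV. \<bar>(x - axis k (x $ k) - cross k z) $ l\<bar>)" by (rule norm_le_l1_cart)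
   also have "... <= (\<Sum>l\<in>(UNIV::'n set). h)"
   proof (rule sum_mono)
    fix l show "\<bar>(x - axis k (x $ k) - cross k z) $ l\<bar> <= h"
     using x[of l] h by (cases "l = k") (auto simp: cross_nth axis_def)
   qed
   also have "... <= 1 / 4" using h by simp
   finally have "norm (x - axis k (x $ k)) < 3" using z norm_triangle_ineq[of "x - axis k (x $ k) - cross k z" "cross k z"] by simp
   moreover have "a < x $ k & x $ k < b" using x[of k] cd by simp
   moreover have "- 9 < t" "t < 0" using t z h4 by linarith+
   ultimately show "w : {- 9<..<0} \<times> {x. norm (x - axis k (x $ k)) < 3 & a < x $ k & x $ k < b}" by (simp add: tx)
  qed
  fix w assume w: "w ~: ?C"
  show "tfun k \<eta> th z w = 0"
  proof (rule ccontr)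
   assume "tfun k \<eta> th z w ~= 0"
   then have ne: "\<eta> (ht k w) ~= 0" "th (z - w) ~= 0" by (auto simp: tfun_def)
   have k1: "ht k w : {c..d}" using cd(3) ne(1) by blast
   have "0 <= fst z - fst w & fst z - fst w <= h" using kern_supp[OF k ne(2) tau_tang] by (simp only: inner_tau fst_diff)
   moreover have "snd z $ l - h <= snd w $ l & snd w $ l <= snd z $ l" if "l ~= k" for l
   proof -
    have "ek l : tang k" using that by simp
    from kern_supp[OF k ne(2) this] have "0 <= snd z $ l - snd w $ l & snd z $ l - snd w $ l <= h"
     by (simp only: inner_ek snd_diff vector_minus_component)
    then show ?thesis by linarith
   qed
   ultimately have "w : ?C" using k1 by (cases w) (auto simp: cbox_Pair_eq mem_box_cart)
   then show False using w by simp
  qed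
 qed
qed

section \<open>Integrals over the half cylinder and its horizontal slices\<close>

definition Qp :: "'n::finite => ('n tx) set" where
 "Qp k = {z. - 9 < fst z & fst z <= 0 & norm (cross k z) < 3 & 0 < ht k z & ht k z < 3}"

definition Yp :: "'n::finite => ('n tx) set" where
 "Yp k = {z. - 9 < fst z & fst z <= 0 & norm (cross k z) < 3}"

lemma measurable_cross [measurable]: "(%z. norm (cross k z)) : bm"
 by (intro borel_measurable_continuous_onI continuous_intros continuous_cross)

lemma Yp_sets [measurable]: "Yp k : sets borel" unfolding Yp_def by measurable
lemma Qp_sets [measurable]: "Qp k : sets borel" unfolding Qp_def by measurable

lemma Qp_Yp: "z : Qp k \<longleftrightarrow> z : Yp k & ht k z : {0<..<3}" by (auto simp: Qp_def Yp_def)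
lemma Yp_upd: "upd (ek k) z r : Yp k \<longleftrightarrow> z : Yp k" by (simp add: Yp_def)

text \<open>The volume of a box around the half cylinder, of length 9 in time and 6 in each of the n
  space directions.\<close>

definition Cn :: "'n::finite itself => real" where "Cn _ = 9 * 6 ^ CARD('n)"

lemma slab_Yp: "emeasure lborel (slab (ek k) \<inter> Yp (k :: 'n::finite)) <= ennreal (Cn TYPE('n))"
proof -
 have "slab (ek k) \<inter> Yp k \<subseteq> cbox (-9, \<chi> l. -3) (0, \<chi> l. 3)"
 proof
  fix z assume z: "z : slab (ek k) \<inter> Yp k"
  have "-3 <= snd z $ l & snd z $ l <= 3" for l
  proof (cases "l = k")
   case True then show ?thesis using z by (auto simp: slab_def)
  next
   case False then show ?thesis using z component_le_norm_cart[of "cross k z" l] by (auto simp: Yp_def cross_nth)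
  qed
  then show "z : cbox (-9, \<chi> l. -3) (0, \<chi> l. 3)"
   using z by (cases z) (auto simp: Yp_def mem_box_cart cbox_Pair_eq)
 qed
 then have "emeasure lborel (slab (ek k) \<inter> Yp k) <= emeasure lborel (cbox (-9, \<chi> l. -3) (0 :: real, (\<chi> l. 3) :: real ^ 'n))"
  by (intro emeasure_mono) auto
 also have "... = ennreal (\<Prod>b\<in>Basis. ((0 :: real, (\<chi> l. 3) :: real ^ 'n) - (-9, \<chi> l. -3)) \<bullet> b)"
  by (subst emeasure_lborel_cbox) (auto simp: Basis_W inner_axis)
 also have "(\<Prod>b\<in>Basis. ((0 :: real, (\<chi> l. 3) :: real ^ 'n) - (-9, \<chi> l. -3)) \<bullet> b) = 9 * (\<Prod>l\<in>(UNIV :: 'n set). 6)"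
 proof -
  have inj: "inj (ek :: 'n => _)" by (rule injI) (rule iffD1[OF ek_eq_iff(1)])
  have nt: "tau ~: range (ek :: 'n => _)" using ek_eq_iff(2) by blast
  show ?thesis unfolding Basis_W
   by (subst prod.insert[OF _ nt], simp, subst prod.reindex[OF inj]) (simp add: inner_axis)
 qed
 finally show ?thesis by (simp add: Cn_def)
qed

lemma nn_lift:
 fixes k :: "'n::finite"
 assumes [measurable]: "g : bm"
 shows "(NI z. ind (Qp k) z * g (ht k z)) <= ennreal (Cn TYPE('n)) * (NI s. ind {0<..<3} s * g s)"
proof -
 have "(NI z. ind (Qp k) z * g (ht k z))
   = (NI z. ind (slab (ek k)) z * (NI r. ind (Qp k) (upd (ek k) z r) * g (ht k (upd (ek k) z r))))"
  by (rule nn_integral_line(1)[OF ek_Basis]) measurable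
 also have "... = (NI z. ind (slab (ek k) \<inter> Yp k) z * (NI r. ind {0<..<3} r * g r))"
 proof (intro nn_integral_cong)
  fix z :: "'n tx"
  show "ind (slab (ek k)) z * (NI r. ind (Qp k) (upd (ek k) z r) * g (ht k (upd (ek k) z r)))
    = ind (slab (ek k) \<inter> Yp k) z * (NI r. ind {0<..<3} r * g r)"
  proof (cases "z : Yp k")
   case True
   then have "ind (Qp k) (upd (ek k) z r) = (ind {0<..<3} r :: ennreal)" for r
    by (simp add: indicator_def Qp_Yp Yp_upd)
   then show ?thesis using True by (simp add: indicator_def)
  next
   case False
   then have "ind (Qp k) (upd (ek k) z r) = (0 :: ennreal)" for r
    by (simp add: indicator_def Qp_Yp Yp_upd)
   then show ?thesis using False by (simp add: indicator_def)
  qed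
 qed
 also have "... = emeasure lborel (slab (ek k) \<inter> Yp k) * (NI r. ind {0<..<3} r * g r)"
  by (subst nn_integral_multc) auto
 also have "... <= ennreal (Cn TYPE('n)) * (NI s. ind {0<..<3} s * g s)"
  by (intro mult_right_mono slab_Yp) simp
 finally show ?thesis .
qed

lemma integrable_lift:
 fixes k :: "'n::finite"
 assumes g: "Lint (%s. ind {0<..<3} s * g s)" and [measurable]: "g : bm" and nn: "!!s. 0 <= g s"
 shows "Lint (%z. ind (Qp k) z * g (ht k z))"
  and "(LI z. ind (Qp k) z * g (ht k z)) <= Cn TYPE('n) * (LI s. ind {0<..<3} s * g s)"
proof -
 have "(NI z. ennreal (ind (Qp k) z * g (ht k z))) = (NI z. ind (Qp k) z * ennreal (g (ht k z)))"
  by (intro nn_integral_cong) (simp add: indicator_def)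
 also have "... <= ennreal (Cn TYPE('n)) * (NI s. ind {0<..<3} s * ennreal (g s))"
  by (rule nn_lift) measurable
 also have "(NI s. ind {0<..<3} s * ennreal (g s)) = (NI s. ennreal (ind {0<..<3} s * g s))"
  by (intro nn_integral_cong) (simp add: indicator_def)
 also have "... = ennreal (LI s. ind {0<..<3} s * g s)"
  by (rule nn_integral_eq_integral[OF g]) (auto simp: nn)
 finally have *: "(NI z. ennreal (ind (Qp k) z * g (ht k z))) <= ennreal (Cn TYPE('n) * (LI s. ind {0<..<3} s * g s))"
  using nn by (simp add: ennreal_mult Cn_def integral_nonneg_AE)
 show i: "Lint (%z. ind (Qp k) z * g (ht k z))"
 proof (rule integrableI_nonneg)
  show "(NI z. ennreal (ind (Qp k) z * g (ht k z))) < \<infinity>"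
   using * by (rule order_le_less_trans) simp
 qed (auto simp: nn)
 have nz: "0 <= Cn TYPE('n) * (LI s. ind {0<..<3} s * g s)"
  using nn by (auto intro!: mult_nonneg_nonneg integral_nonneg_AE simp: Cn_def)
 have "ennreal (LI z. ind (Qp k) z * g (ht k z)) <= ennreal (Cn TYPE('n) * (LI s. ind {0<..<3} s * g s))"
  using * by (subst nn_integral_eq_integral[OF i, symmetric]) (auto simp: nn)
 then show "(LI z. ind (Qp k) z * g (ht k z)) <= Cn TYPE('n) * (LI s. ind {0<..<3} s * g s)"
  using nz by (simp add: ennreal_le_iff)
qed

lemma abs_le_weighted: "0 < m ==> \<bar>x\<bar> <= 1 / m + m * x^2" "0 < m ==> m * \<bar>x\<bar> <= m + m * x^2" for x m :: real
proof -
 assume m: "0 < m"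
 have "0 <= (1 - m * \<bar>x\<bar>)^2 / m" using m by simp
 also have "... = 1 / m + m * x^2 - 2 * \<bar>x\<bar>" using m by (simp add: power2_diff power_mult_distrib field_simps power2_eq_square)
 finally show "\<bar>x\<bar> <= 1 / m + m * x^2" by simp
 have "0 <= (1 - \<bar>x\<bar>)^2" by simp
 also have "... = 1 - 2 * \<bar>x\<bar> + x^2" by (simp add: power2_diff)
 finally have "\<bar>x\<bar> <= 1 + x^2" by simp
 then show "m * \<bar>x\<bar> <= m + m * x^2" using mult_left_mono[of "\<bar>x\<bar>" "1 + x^2" m] m by (simp add: algebra_simps)
qed

text \<open>Both \<mu> and 1 / \<mu> are integrable over the bounded half cylinder, and together
  with \<mu> * f^2 they dominate \<open>f\<close> and \<mu> * f pointwise by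
  \<open>abs_le_weighted\<close>.\<close>

lemma L2_imp_L1:
 fixes k :: "'n::finite" and f :: "'n tx => real"
 assumes mu: "!!s. 0 < \<mu> s" and [measurable]: "\<mu> : bm" "f : bm"
  and J: "Lint (%s. ind {0<..<3} s / \<mu> s)" and U: "Lint (%s. ind {0<..<3} s * \<mu> s)"
  and f2: "Lint (%z. \<mu> (ht k z) * (f z)^2)" and out: "!!z. z ~: Qp k ==> f z = 0"
 shows "Lint f" "Lint (%z. \<mu> (ht k z) * f z)"
proof -
 have nn: "0 <= 1 / \<mu> s" "0 <= \<mu> s" for s using mu[of s] by auto
 have J': "Lint (%z. ind (Qp k) z * (1 / \<mu> (ht k z)))"
  by (rule integrable_lift(1)[of "%s. 1 / \<mu> s"]) (use J nn in auto)
 have U': "Lint (%z. ind (Qp k) z * \<mu> (ht k z))"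
  by (rule integrable_lift(1)) (use U nn in auto)
 show "Lint f"
 proof (rule Bochner_Integration.integrable_bound[OF Bochner_Integration.integrable_add[OF J' f2]])
  show "AE z in lborel. norm (f z) <= norm (ind (Qp k) z * (1 / \<mu> (ht k z)) + \<mu> (ht k z) * (f z)^2)"
  proof (rule AE_I2)
   fix z show "norm (f z) <= norm (ind (Qp k) z * (1 / \<mu> (ht k z)) + \<mu> (ht k z) * (f z)^2)"
    using abs_le_weighted(1)[OF mu[of "ht k z"], of "f z"] out[of z] by (cases "z : Qp k") auto
  qed
 qed measurable
 show "Lint (%z. \<mu> (ht k z) * f z)"
 proof (rule Bochner_Integration.integrable_bound[OF Bochner_Integration.integrable_add[OF U' f2]])
  show "AE z in lborel. norm (\<mu> (ht k z) * f z) <= norm (ind (Qp k) z * \<mu> (ht k z) + \<mu> (ht k z) * (f z)^2)"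
  proof (rule AE_I2)
   fix z show "norm (\<mu> (ht k z) * f z) <= norm (ind (Qp k) z * \<mu> (ht k z) + \<mu> (ht k z) * (f z)^2)"
    using abs_le_weighted(2)[OF mu[of "ht k z"], of "f z"] out[of z] mu[of "ht k z"] by (cases "z : Qp k") (auto simp: abs_mult)
  qed
 qed measurable
qed

text \<open>Cauchy-Schwarz on each horizontal slice, whose measure is at most \<open>Cn\<close>,
  followed by integration over heights.\<close>

lemma ms_square_integrable:
 fixes k :: "'n::finite" and f :: "'n tx => real"
 assumes mu: "!!s. 0 < \<mu> s" and [measurable]: "\<mu> : bm" and f: "sl k f"
  and f2: "Lint (%z. \<mu> (ht k z) * (f z)^2)" and out: "!!z. z ~: Qp k ==> f z = 0"
 shows "Lint (%s. \<mu> s * (ms k f s)^2)" and "s ~: {0<..<3} ==> ms k f s = 0"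
proof -
 note [measurable] = sl_borel[OF f] ms_borel[OF f]
 have cs: "ennreal ((ms k f s)^2) <= ennreal (Cn TYPE('n)) * (NI w. ind (slab (ek k)) w * ennreal ((f (upd (ek k) w s))^2))" for s
 proof -
  have "ennreal (ms k f s) = (NI w. ennreal (ind (slab (ek k)) w * \<bar>f (upd (ek k) w s)\<bar>))"
   unfolding ms_def using integrable_abs[OF sl_int[OF f, of s]]
   by (intro nn_integral_eq_integral[symmetric]) (auto simp: abs_mult)
  also have "... = (NI w. ind (slab (ek k) \<inter> Yp k) w * (ind (slab (ek k)) w * ennreal \<bar>f (upd (ek k) w s)\<bar>))"
  proof (intro nn_integral_cong)
   fix w :: "'n tx"
   show "ennreal (ind (slab (ek k)) w * \<bar>f (upd (ek k) w s)\<bar>) = ind (slab (ek k) \<inter> Yp k) w * (ind (slab (ek k)) w * ennreal \<bar>f (upd (ek k) w s)\<bar>)"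
    using out[of "upd (ek k) w s"] by (cases "w : Yp k") (auto simp: indicator_def Qp_Yp Yp_upd)
  qed
  finally have eq: "ennreal (ms k f s) = (NI w. ind (slab (ek k) \<inter> Yp k) w * (ind (slab (ek k)) w * ennreal \<bar>f (upd (ek k) w s)\<bar>))" .
  have "ennreal ((ms k f s)^2) = (NI w. ind (slab (ek k) \<inter> Yp k) w * (ind (slab (ek k)) w * ennreal \<bar>f (upd (ek k) w s)\<bar>))^2"
   by (simp only: ennreal_power[OF ms_nonneg, symmetric] eq)
  also have "... <= (NI w. (ind (slab (ek k) \<inter> Yp k) w)^2) * (NI w. (ind (slab (ek k)) w * ennreal \<bar>f (upd (ek k) w s)\<bar>)^2)"
   by (rule Cauchy_Schwarz_nn_integral) measurable
  also have "(NI w. (ind (slab (ek k) \<inter> Yp k) w :: ennreal)^2) = (NI w. ind (slab (ek k) \<inter> Yp k) w)"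
   by (intro nn_integral_cong) (simp add: indicator_def)
  also have "... = emeasure lborel (slab (ek k) \<inter> Yp k)" by (rule nn_integral_indicator) simp
  also have "(NI w. (ind (slab (ek k)) w * ennreal \<bar>f (upd (ek k) w s)\<bar>)^2) = (NI w. ind (slab (ek k)) w * ennreal ((f (upd (ek k) w s))^2))"
   by (intro nn_integral_cong) (simp add: indicator_def ennreal_power)
  also have "emeasure lborel (slab (ek k) \<inter> Yp k) * ... <= ennreal (Cn TYPE('n)) * ..." by (intro mult_right_mono slab_Yp) simp
  finally show ?thesis .
 qed
 show "Lint (%s. \<mu> s * (ms k f s)^2)"
 proof (rule integrableI_nonneg)
  show "AE s in lborel. 0 <= \<mu> s * (ms k f s)^2" using mu by (auto simp: less_imp_le)
  have "(NI s. ennreal (\<mu> s * (ms k f s)^2)) <= (NI s. ennreal (Cn TYPE('n)) * (NI w. ind (slab (ek k)) w * ennreal (\<mu> (ht k (upd (ek k) w s)) * (f (upd (ek k) w s))^2)))"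
  proof (intro nn_integral_mono)
   fix s :: real
   have "ennreal (\<mu> s * (ms k f s)^2) = ennreal (\<mu> s) * ennreal ((ms k f s)^2)" using mu[of s] by (simp add: ennreal_mult)
   also have "... <= ennreal (\<mu> s) * (ennreal (Cn TYPE('n)) * (NI w. ind (slab (ek k)) w * ennreal ((f (upd (ek k) w s))^2)))"
    by (intro mult_left_mono cs) simp
   also have "... = ennreal (Cn TYPE('n)) * (NI w. ennreal (\<mu> s) * (ind (slab (ek k)) w * ennreal ((f (upd (ek k) w s))^2)))"
    by (subst nn_integral_cmult) (measurable, simp add: mult_ac)
   also have "(NI w. ennreal (\<mu> s) * (ind (slab (ek k)) w * ennreal ((f (upd (ek k) w s))^2)))
     = (NI w. ind (slab (ek k)) w * ennreal (\<mu> (ht k (upd (ek k) w s)) * (f (upd (ek k) w s))^2))"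
    using mu[of s] by (intro nn_integral_cong) (simp add: ennreal_mult indicator_def)
   finally show "ennreal (\<mu> s * (ms k f s)^2) <= ennreal (Cn TYPE('n)) * (NI w. ind (slab (ek k)) w * ennreal (\<mu> (ht k (upd (ek k) w s)) * (f (upd (ek k) w s))^2))" .
  qed
  also have "... = ennreal (Cn TYPE('n)) * (NI s. (NI w. ind (slab (ek k)) w * ennreal (\<mu> (ht k (upd (ek k) w s)) * (f (upd (ek k) w s))^2)))"
   by (rule nn_integral_cmult) measurable
  also have "(NI s. (NI w. ind (slab (ek k)) w * ennreal (\<mu> (ht k (upd (ek k) w s)) * (f (upd (ek k) w s))^2)))
    = (NI z. ennreal (\<mu> (ht k z) * (f z)^2))"
   by (rule nn_integral_line(2)[OF ek_Basis, symmetric]) measurable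
  also have "ennreal (Cn TYPE('n)) * ... < \<infinity>"
   using f2 unfolding real_integrable_def by (auto simp: ennreal_mult_less_top less_top)
  finally show "(NI s. ennreal (\<mu> s * (ms k f s)^2)) < \<infinity>" .
 qed measurable
 assume s: "s ~: {0<..<3}"
 have "f (upd (ek k) w s) = 0" for w using s out[of "upd (ek k) w s"] by (auto simp: Qp_Yp)
 then show "ms k f s = 0" by (simp add: ms_def)
qed

text \<open>The problem for Borel representatives: the coefficient bounds hold at every height, and
  \<open>u\<close> and \<open>Du\<close> vanish outside the half cylinder and are integrable on all
  horizontal slices. In \<open>grad\<close> test functions live at positive heights, in
  \<open>weak\<close> they may cross height 0; this difference is the conormal condition.
  \<open>h0\<close> limits the size of kernels.\<close>

locale conormal_solution =
 fixes k :: "'n::finite" and \<Lambda> lam h0 :: real and \<mu> a0 :: "real => real" and A :: "real => real ^ 'n ^ 'n"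
  and u :: "'n tx => real" and Du :: "'n tx => real ^ 'n"
 assumes h0: "0 < h0" "real CARD('n) * h0 <= 1 / 4"
  and Lambda: "1 <= \<Lambda>" and lam: "0 <= lam"
  and mu_pos: "!!s. 0 < \<mu> s" and mu_borel [measurable]: "\<mu> : bm"
  and a0_borel [measurable]: "a0 : bm" and a0_bounds: "!!s. 1 / \<Lambda> <= a0 s" "!!s. a0 s <= \<Lambda>"
  and A_borel [measurable]: "!!i j. (%s. A s $ i $ j) : bm"
  and A_ell: "!!s \<xi>. (norm \<xi>)^2 / \<Lambda> <= (A s *v \<xi>) \<bullet> \<xi>"
  and A_bound: "!!s \<xi>. norm (A s *v \<xi>) <= \<Lambda> * norm \<xi>"
  and J_int: "Lint (%s. ind {0<..<3} s / \<mu> s)"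
  and U_int: "Lint (%s. ind {0<..<3} s * \<mu> s)"
  and u_sl: "sl k u" and Du_sl: "!!l. sl k (%z. Du z $ l)"
  and u_out: "!!z. z ~: Qp k ==> u z = 0" and Du_out: "!!z. z ~: Qp k ==> Du z = 0"
  and u2: "Lint (%z. \<mu> (ht k z) * (u z)^2)" and Du2: "!!l. Lint (%z. \<mu> (ht k z) * (Du z $ l)^2)"
  and weak: "!!\<phi>. smooth \<phi> ==> supp_in \<phi> ({- 9<..<0} \<times> {x. norm (x - axis k (x $ k)) < 3 & - 3 < x $ k & x $ k < 3}) ==>
    - (LI z. \<mu> (ht k z) * a0 (ht k z) * u z * dd \<phi> tau z)
    + (LI z. \<mu> (ht k z) * (\<Sum>l\<in>UNIV. (A (ht k z) *v Du z) $ l * dd \<phi> (ek l) z))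
    + lam * (LI z. \<mu> (ht k z) * u z * \<phi> z) = 0"
  and grad: "!!\<phi> l. smooth \<phi> ==> supp_in \<phi> ({- 9<..<0} \<times> {x. norm (x - axis k (x $ k)) < 3 & 0 < x $ k & x $ k < 3}) ==>
    (LI z. u z * dd \<phi> (ek l) z) = - (LI z. Du z $ l * \<phi> z)"
begin

abbreviation "vv \<equiv> conv k u"
definition pp :: "('n tx => real) => 'n tx => real ^ 'n" where
 "pp th z = (\<chi> l. conv k (%z. Du z $ l) th z)"
text \<open>One majorant in the height for the mollifications of \<open>u\<close> and
  \<open>Du\<close> with all kernels, up to constants that depend on the kernel; it plays the role
  of \<open>m1\<close> in the energy method.\<close>

definition mm :: "real => real" where "mm s = ms k u s + (\<Sum>l\<in>UNIV. ms k (%z. Du z $ l) s)"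

lemma Dul_out: "z ~: Qp k ==> Du z $ l = 0" using Du_out[of z] by simp

lemmas u_L1 = L2_imp_L1[OF mu_pos mu_borel sl_borel[OF u_sl] J_int U_int u2 u_out]
lemmas Du_L1 = L2_imp_L1[OF mu_pos mu_borel sl_borel[OF Du_sl] J_int U_int Du2 Dul_out]

lemma mm_borel [measurable]: "mm : bm"
proof -
 note [measurable] = ms_borel[OF u_sl] ms_borel[OF Du_sl]
 show ?thesis unfolding mm_def[abs_def] by measurable
qed

lemma mm_nonneg: "0 <= mm s"
 unfolding mm_def by (intro add_nonneg_nonneg sum_nonneg ms_nonneg)

lemma mm_out: "s ~: {0<..<3} ==> mm s = 0"
 unfolding mm_def
 using ms_square_integrable(2)[OF mu_pos mu_borel u_sl u2 u_out, of s] ms_square_integrable(2)[OF mu_pos mu_borel Du_sl Du2 Dul_out, of s]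
 by simp

lemma mm_int2: "Lint (%s. \<mu> s * (mm s)^2)"
proof -
 have i: "Lint (%s. 2 * (\<mu> s * (ms k u s)^2) + 2 * real CARD('n) * (\<Sum>l\<in>UNIV. \<mu> s * (ms k (%z. Du z $ l) s)^2))"
  by (intro Bochner_Integration.integrable_add integrable_mult_right Bochner_Integration.integrable_sum
    ms_square_integrable(1) mu_pos mu_borel u_sl u2 u_out Du_sl Du2 Dul_out)
 show ?thesis
 proof (rule Bochner_Integration.integrable_bound[OF i])
  show "AE s in lborel. norm (\<mu> s * (mm s)^2) <= norm (2 * (\<mu> s * (ms k u s)^2) + 2 * real CARD('n) * (\<Sum>l\<in>UNIV. \<mu> s * (ms k (%z. Du z $ l) s)^2))"
  proof (rule AE_I2)
   fix s
   let ?a = "ms k u s" and ?b = "\<Sum>l\<in>UNIV. ms k (%z. Du z $ l) s"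
   have "(?a + ?b)^2 <= 2 * ?a^2 + 2 * ?b^2"
    using zero_le_power2[of "?a - ?b"] by (simp add: power2_eq_square algebra_simps)
   also have "?b^2 <= real CARD('n) * (\<Sum>l\<in>UNIV. (ms k (%z. Du z $ l) s)^2)" by (rule sum_squared_le) simp
   finally have "(mm s)^2 <= 2 * ?a^2 + 2 * (real CARD('n) * (\<Sum>l\<in>UNIV. (ms k (%z. Du z $ l) s)^2))" by (simp add: mm_def)
   then have "\<mu> s * (mm s)^2 <= \<mu> s * (2 * ?a^2 + 2 * (real CARD('n) * (\<Sum>l\<in>UNIV. (ms k (%z. Du z $ l) s)^2)))"
    using mu_pos[of s] by (intro mult_left_mono) auto
   also have "... = 2 * (\<mu> s * ?a^2) + 2 * real CARD('n) * (\<Sum>l\<in>UNIV. \<mu> s * (ms k (%z. Du z $ l) s)^2)"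
    by (simp add: algebra_simps sum_distrib_left)
   also have "... <= norm (2 * (\<mu> s * ?a^2) + 2 * real CARD('n) * (\<Sum>l\<in>UNIV. \<mu> s * (ms k (%z. Du z $ l) s)^2))"
    unfolding real_norm_def by (rule abs_ge_self)
   finally show "norm (\<mu> s * (mm s)^2) <= norm (2 * (\<mu> s * ?a^2) + 2 * real CARD('n) * (\<Sum>l\<in>UNIV. \<mu> s * (ms k (%z. Du z $ l) s)^2))"
    using mu_pos[of s] by (simp add: abs_mult)
  qed
 qed measurable
qed

lemma mm_int1: "Lint mm" "Lint (%s. \<mu> s * mm s)"
proof -
 show "Lint mm"
 proof (rule Bochner_Integration.integrable_bound[OF Bochner_Integration.integrable_add[OF J_int mm_int2]])
  show "AE s in lborel. norm (mm s) <= norm (ind {0<..<3} s / \<mu> s + \<mu> s * (mm s)^2)"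
  proof (rule AE_I2)
   fix s show "norm (mm s) <= norm (ind {0<..<3} s / \<mu> s + \<mu> s * (mm s)^2)"
    using abs_le_weighted(1)[OF mu_pos[of s], of "mm s"] mm_out[of s] by (cases "s : {0<..<3}") auto
  qed
 qed measurable
 show "Lint (%s. \<mu> s * mm s)"
 proof (rule Bochner_Integration.integrable_bound[OF Bochner_Integration.integrable_add[OF U_int mm_int2]])
  show "AE s in lborel. norm (\<mu> s * mm s) <= norm (ind {0<..<3} s * \<mu> s + \<mu> s * (mm s)^2)"
  proof (rule AE_I2)
   fix s show "norm (\<mu> s * mm s) <= norm (ind {0<..<3} s * \<mu> s + \<mu> s * (mm s)^2)"
    using abs_le_weighted(2)[OF mu_pos[of s], of "mm s"] mm_out[of s] mu_pos[of s] by (cases "s : {0<..<3}") (auto simp: abs_mult)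
  qed
 qed measurable
qed

end

lemma test1_dir_deriv:
 assumes "\<eta> : test1 a b" shows "dd \<eta> 1 : test1 a b"
proof -
 obtain c d where cd: "a < c" "d < b" "!!x. x ~: {c..d} ==> \<eta> x = 0" and sm: "smooth \<eta>"
  using assms by (auto simp: test1_def)
 have "dd \<eta> 1 x = 0" if "x ~: {c..d}" for x
 proof -
  have o: "open (- {c..d})" "x : - {c..d}" using that by (auto intro: open_Compl closed_atLeastAtMost)
  have "(\<eta> has_derivative (%_. 0)) (at x)"
   by (rule has_derivative_transform_within_open[OF has_derivative_const[of 0] o]) (use cd in auto)
  then show ?thesis by (rule dir_deriv_eq)
 qed
 then show ?thesis unfolding test1_def using cd(1,2) smooth_dir_deriv[OF sm, of 1] by auto
qed

lemma test1_at_end: "\<eta> : test1 a b ==> b <= x ==> \<eta> x = 0"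
 unfolding test1_def by force

section \<open>The equations of mollified solutions on vertical lines\<close>

context conormal_solution
begin

abbreviation "rg z \<equiv> - 5 < fst z & fst z < 0 & norm (cross k z) < 5 / 2"

lemma tfun_supp3:
 assumes "kern k h0 th" "\<eta> : test1 (-3) 3" "rg z"
 shows "supp_in (tfun k \<eta> th z) ({- 9<..<0} \<times> {x. norm (x - axis k (x $ k)) < 3 & - 3 < x $ k & x $ k < 3})"
 using assms by (intro tfun_supp[OF assms(1) h0 assms(2)]) auto

lemma tfun_supp0:
 assumes "kern k h0 th" "\<eta> : test1 0 3" "rg z"
 shows "supp_in (tfun k \<eta> th z) ({- 9<..<0} \<times> {x. norm (x - axis k (x $ k)) < 3 & 0 < x $ k & x $ k < 3})"
 using assms by (intro tfun_supp[OF assms(1) h0 assms(2)]) auto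

lemma test1_smooth: "\<eta> : test1 a b ==> smooth \<eta>" by (simp add: test1_def)

lemma weighted_test_int:
 assumes i: "Lint (%w. g (ht k w) * f w)" and e: "\<eta> : test1 a b"
 shows "Lint (%w. (\<eta> (ht k w) * g (ht k w)) * f w)"
proof -
 obtain B where B: "!!x. \<bar>\<eta> x\<bar> <= B" using test1_bounded[OF e] by auto
 have [measurable]: "\<eta> : bm" by (rule test1_borel[OF e])
 have "Lint (%w. \<eta> (ht k w) * (g (ht k w) * f w))"
  by (rule integrable_bounded_mult[OF i, where C=B]) (use B in auto)
 then show ?thesis by (simp add: mult.assoc)
qed

lemma grad_slice:
 assumes t: "kern k h0 th" and e: "\<eta> : test1 0 3" and z: "rg z"
 shows "l ~= k ==> (LI s. \<eta> s * vv (dd th (ek l)) (upd (ek k) z s)) = (LI s. \<eta> s * pp th (upd (ek k) z s) $ l)"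
  and "(LI s. dd \<eta> 1 s * vv th (upd (ek k) z s)) = - (LI s. \<eta> s * pp th (upd (ek k) z s) $ k)"
proof -
 note se = test1_smooth[OF e]
 have Pl: "(LI s. \<eta> s * pp th (upd (ek k) z s) $ l) = (LI w. th (z - w) * (\<eta> (ht k w) * Du w $ l))" for l
  unfolding pp_def vec_lambda_beta
  using weighted_test_int[of "%_. 1" "%w. Du w $ l", OF _ e] Du_L1(1)[of l] by (intro pairing(2)[OF t Du_sl]) simp
 have eq: "(LI w. u w * dd (tfun k \<eta> th z) (ek l) w) = - (LI w. Du w $ l * tfun k \<eta> th z w)" for l
  by (rule grad[OF tfun_smooth[OF se t] tfun_supp0[OF t e z]])
 have R: "(LI w. Du w $ l * tfun k \<eta> th z w) = (LI s. \<eta> s * pp th (upd (ek k) z s) $ l)" for l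
  unfolding Pl by (intro Bochner_Integration.integral_cong) (auto simp: tfun_def)
 {
  assume l: "l ~= k"
  have "(LI s. \<eta> s * vv (dd th (ek l)) (upd (ek k) z s)) = (LI w. dd th (ek l) (z - w) * (\<eta> (ht k w) * u w))"
   using weighted_test_int[of "%_. 1" u, OF _ e] u_L1(1) l by (intro pairing(2)[OF kern_dir[OF t] u_sl]) simp_all
  also have "... = - (LI w. u w * dd (tfun k \<eta> th z) (ek l) w)"
   unfolding tfun_deriv[OF se t] using l
   by (subst integral_minus[symmetric]) (auto intro!: Bochner_Integration.integral_cong simp: axis_def)
  finally show "(LI s. \<eta> s * vv (dd th (ek l)) (upd (ek k) z s)) = (LI s. \<eta> s * pp th (upd (ek k) z s) $ l)"
   unfolding eq R by simp
 }
 have "(LI s. dd \<eta> 1 s * vv th (upd (ek k) z s)) = (LI w. th (z - w) * (dd \<eta> 1 (ht k w) * u w))"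
  using weighted_test_int[of "%_. 1" u, OF _ test1_dir_deriv[OF e]] u_L1(1) by (intro pairing(2)[OF t u_sl]) simp
 also have "... = (LI w. u w * dd (tfun k \<eta> th z) (ek k) w)"
  unfolding tfun_deriv[OF se t] kern_dir_ek[OF t] by (intro Bochner_Integration.integral_cong) auto
 finally show "(LI s. dd \<eta> 1 s * vv th (upd (ek k) z s)) = - (LI s. \<eta> s * pp th (upd (ek k) z s) $ k)"
  unfolding eq R .
qed

lemma vv_bound: "kern k h0 th ==> \<exists>C\<ge>0. \<forall>z. \<bar>vv th z\<bar> <= C * mm (ht k z)"
proof -
 assume t: "kern k h0 th"
 obtain C where C: "0 <= C" "!!z. \<bar>vv th z\<bar> <= C * ms k u (ht k z)" using conv_bound[OF t u_sl] by auto
 have "ms k u s <= mm s" for s unfolding mm_def by (simp add: sum_nonneg ms_nonneg)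
 then have "\<bar>vv th z\<bar> <= C * mm (ht k z)" for z
  using C(2)[of z] mult_left_mono[OF _ C(1), of "ms k u (ht k z)" "mm (ht k z)"] order_trans by blast
 then show ?thesis using C(1) by blast
qed

lemma ppl_bound: "kern k h0 th ==> \<exists>C\<ge>0. \<forall>z. \<bar>pp th z $ l\<bar> <= C * mm (ht k z)"
proof -
 assume t: "kern k h0 th"
 obtain C where C: "0 <= C" "!!z. \<bar>pp th z $ l\<bar> <= C * ms k (%z. Du z $ l) (ht k z)" using conv_bound[OF t Du_sl[of l]] by (auto simp: pp_def)
 have "ms k (%z. Du z $ l) s <= mm s" for s
 proof -
  have "ms k (%z. Du z $ l) s <= (\<Sum>l\<in>UNIV. ms k (%z. Du z $ l) s)"
   by (rule member_le_sum[where f="%l. ms k (%z. Du z $ l) s"]) (auto simp: ms_nonneg)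
  then show ?thesis unfolding mm_def using ms_nonneg[of k u s] by linarith
 qed
 then have "\<bar>pp th z $ l\<bar> <= C * mm (ht k z)" for z
  using C(2)[of z] mult_left_mono[OF _ C(1), of "ms k (%z. Du z $ l) (ht k z)" "mm (ht k z)"] order_trans by blast
 then show ?thesis using C(1) by blast
qed

lemma mm_slice_int:
 assumes f: "f : bm" and C: "!!z. \<bar>f z\<bar> <= C * mm (ht k z)"
 shows "Lint (%s. f (upd (ek k) z s))" "Lint (%s. \<mu> s * f (upd (ek k) z s))"
proof -
 have m [measurable]: "(%s. f (upd (ek k) z s)) : bm"
  by (rule measurable_compose[OF _ f]) measurable
 have C': "\<bar>f (upd (ek k) z s)\<bar> <= C * mm s" for s using C[of "upd (ek k) z s"] by simp
 show "Lint (%s. f (upd (ek k) z s))"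
  by (rule Bochner_Integration.integrable_bound[OF integrable_mult_right[OF mm_int1(1), of C]])
   (use m C' in \<open>auto intro!: AE_I2 order_trans[OF _ abs_ge_self]\<close>)
 have "\<bar>\<mu> s * f (upd (ek k) z s)\<bar> <= C * (\<mu> s * mm s)" for s
  using mult_left_mono[OF C'[of s], of "\<mu> s"] mu_pos[of s] by (simp add: abs_mult algebra_simps)
 then show "Lint (%s. \<mu> s * f (upd (ek k) z s))"
  by (intro Bochner_Integration.integrable_bound[OF integrable_mult_right[OF mm_int1(2), of C]])
   (auto intro!: AE_I2 order_trans[OF _ abs_ge_self])
qed

lemma vv_borel: "kern k h0 th ==> vv th : bm" by (rule conv_borel[OF _ u_sl])
lemma ppl_borel: "kern k h0 th ==> (%z. pp th z $ l) : bm"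
 using conv_borel[OF _ Du_sl[of l]] by (simp add: pp_def)

lemma vv_slice: "kern k h0 th ==> Lint (%s. vv th (upd (ek k) z s))" "kern k h0 th ==> Lint (%s. \<mu> s * vv th (upd (ek k) z s))"
 using vv_bound[of th] mm_slice_int[OF vv_borel] by blast+
lemma ppl_slice: "kern k h0 th ==> Lint (%s. pp th (upd (ek k) z s) $ l)" "kern k h0 th ==> Lint (%s. \<mu> s * pp th (upd (ek k) z s) $ l)"
 using ppl_bound[of th l] mm_slice_int[OF ppl_borel] by blast+

lemma pairing_mu:
 assumes t: "kern k h0 th" and f: "sl k f" and i: "Lint (%w. \<mu> (ht k w) * f w)"
  and c: "c : bm" "!!s. \<bar>c s\<bar> <= C" and e: "\<eta> : test1 a b"
 shows "(LI s. (\<eta> s * (c s * \<mu> s)) * conv k f th (upd (ek k) z s)) = (LI w. th (z - w) * ((\<eta> (ht k w) * (c (ht k w) * \<mu> (ht k w))) * f w))"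
  and "Lint (%s. (\<eta> s * (c s * \<mu> s)) * conv k f th (upd (ek k) z s))"
  and "Lint (%w. th (z - w) * ((\<eta> (ht k w) * (c (ht k w) * \<mu> (ht k w))) * f w))"
proof -
 have m: "(%w. c (ht k w)) : bm" using measurable_compose[OF measurable_ht c(1)] .
 have "Lint (%w. c (ht k w) * (\<mu> (ht k w) * f w))"
  by (rule integrable_bounded_mult[OF i, where C=C]) (use m c in auto)
 then have "Lint (%w. (c (ht k w) * \<mu> (ht k w)) * f w)" by (simp add: mult.assoc)
 from weighted_test_int[where g="%s. c s * \<mu> s", OF this e]
 have i': "Lint (%w. (\<eta> (ht k w) * (c (ht k w) * \<mu> (ht k w))) * f w)" .
 show "(LI s. (\<eta> s * (c s * \<mu> s)) * conv k f th (upd (ek k) z s)) = (LI w. th (z - w) * ((\<eta> (ht k w) * (c (ht k w) * \<mu> (ht k w))) * f w))"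
  and "Lint (%s. (\<eta> s * (c s * \<mu> s)) * conv k f th (upd (ek k) z s))"
  using pairing[where g="%s. \<eta> s * (c s * \<mu> s)", OF t f i', of z] by blast+
 obtain B where B: "!!w. \<bar>th w\<bar> <= B" using kern_bounded[OF t] by blast
 show "Lint (%w. th (z - w) * ((\<eta> (ht k w) * (c (ht k w) * \<mu> (ht k w))) * f w))"
  by (rule integrable_bounded_mult[OF i', where C=B]) (use kern_diff_borel[OF t] B in simp_all)
qed

lemma A_entry: "\<bar>A s $ i $ j\<bar> <= \<Lambda>"
proof -
 have "A s $ i $ j = (A s *v axis j 1) $ i" by (simp add: matrix_vector_mult_basis column_def)
 also have "\<bar>...\<bar> <= norm (A s *v axis j 1)" by (rule component_le_norm_cart)
 also have "... <= \<Lambda> * norm (axis j 1 :: real ^ 'n)" by (rule A_bound)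
 finally show ?thesis by simp
qed

lemma a0_abs: "\<bar>a0 s\<bar> <= \<Lambda>"
proof -
 have "0 < 1 / \<Lambda>" using Lambda by simp
 then show ?thesis using a0_bounds(1)[of s] a0_bounds(2)[of s] by linarith
qed

lemma Aflux: "(A s *v x) $ l = (\<Sum>j\<in>UNIV. A s $ l $ j * x $ j)"
 by (simp add: matrix_vector_mult_def)

text \<open>The weak equation with \<open>tfun\<close> as test function. Time and horizontal
  derivatives fall on the reflected kernel and return, with opposite sign, as derivatives of the
  mollified solution; the vertical derivative falls on \<eta>, apart from the kernel, which is
  constant in the height.\<close>

lemma flux_slice:
 assumes t: "kern k h0 th" and e: "\<eta> : test1 (-3) 3" and z: "rg z"
 shows "(LI s. \<eta> s * (\<mu> s * (a0 s * vv (dd th tau) (upd (ek k) z s) + lam * vv th (upd (ek k) z s)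
      - (\<Sum>l\<in>UNIV - {k}. (A s *v pp (dd th (ek l)) (upd (ek k) z s)) $ l)))
     + dd \<eta> 1 s * (\<mu> s * (A s *v pp th (upd (ek k) z s)) $ k)) = 0"
proof -
 note se = test1_smooth[OF e] and e' = test1_dir_deriv[OF e]
 let ?u = "%s. upd (ek k) z s" and ?\<phi> = "tfun k \<eta> th z"
 let ?d = "%l. dd th (ek l)"
 have tt: "kern k h0 (dd th tau)" by (rule kern_dir[OF t tau_tang])
 have tl: "kern k h0 (?d l)" if "l ~= k" for l using that by (intro kern_dir[OF t]) simp
 note P1 = pairing_mu[where c=a0 and z=z, OF tt u_sl u_L1(2) a0_borel a0_abs e]
 have one: "(%_. 1) : bm" "!!s::real. \<bar>1::real\<bar> <= 1" by auto
 note P2 = pairing_mu[where c="%_. 1" and z=z, OF t u_sl u_L1(2) one e]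
 note P3 = pairing_mu[where c="%s. A s $ l $ j" and z=z for l j, OF tl Du_sl Du_L1(2) A_borel A_entry e]
 note P4 = pairing_mu[where c="%s. A s $ k $ j" and z=z for j, OF t Du_sl Du_L1(2) A_borel A_entry e']
 define s1 where "s1 = (LI s. (\<eta> s * (a0 s * \<mu> s)) * vv (dd th tau) (?u s))"
 define s2 where "s2 = (LI s. (\<eta> s * (1 * \<mu> s)) * vv th (?u s))"
 define s3 where "s3 = (%l j. (LI s. (\<eta> s * (A s $ l $ j * \<mu> s)) * conv k (%z. Du z $ j) (?d l) (?u s)))"
 define s4 where "s4 = (%j. (LI s. (dd \<eta> 1 s * (A s $ k $ j * \<mu> s)) * conv k (%z. Du z $ j) th (?u s)))"
 have s2': "s2 = (LI w. th (z - w) * ((\<eta> (ht k w) * (1 * \<mu> (ht k w))) * u w))"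
  unfolding s2_def by (rule P2(1))
 have s1': "s1 = (LI w. dd th tau (z - w) * ((\<eta> (ht k w) * (a0 (ht k w) * \<mu> (ht k w))) * u w))"
  unfolding s1_def by (rule P1(1))
 have "(LI w. \<mu> (ht k w) * a0 (ht k w) * u w * dd ?\<phi> tau w) = - s1"
  unfolding s1' tfun_deriv[OF se t]
  by (subst integral_minus[symmetric]) (intro Bochner_Integration.integral_cong, auto simp: algebra_simps)
 moreover have "(LI w. \<mu> (ht k w) * u w * ?\<phi> w) = s2"
  unfolding s2' tfun_def by (intro Bochner_Integration.integral_cong) (auto simp: algebra_simps)
 moreover have "(LI w. \<mu> (ht k w) * (\<Sum>l\<in>UNIV. (A (ht k w) *v Du w) $ l * dd ?\<phi> (ek l) w))
   = (\<Sum>j\<in>UNIV. s4 j) - (\<Sum>l\<in>UNIV - {k}. \<Sum>j\<in>UNIV. s3 l j)"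
 proof -
  have pw: "\<mu> (ht k w) * (\<Sum>l\<in>UNIV. (A (ht k w) *v Du w) $ l * dd ?\<phi> (ek l) w)
    = (\<Sum>j\<in>UNIV. th (z - w) * ((dd \<eta> 1 (ht k w) * (A (ht k w) $ k $ j * \<mu> (ht k w))) * Du w $ j))
    - (\<Sum>l\<in>UNIV - {k}. \<Sum>j\<in>UNIV. ?d l (z - w) * ((\<eta> (ht k w) * (A (ht k w) $ l $ j * \<mu> (ht k w))) * Du w $ j))" for w
  proof -
   have dk: "dd ?\<phi> (ek k) w = dd \<eta> 1 (ht k w) * th (z - w)" by (simp add: tfun_deriv[OF se t] kern_dir_ek[OF t])
   have dl: "dd ?\<phi> (ek l) w = - (\<eta> (ht k w) * ?d l (z - w))" if "l ~= k" for l using that by (simp add: tfun_deriv[OF se t] axis_def)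
   have e: "(\<Sum>l\<in>UNIV. (A (ht k w) *v Du w) $ l * dd ?\<phi> (ek l) w)
     = (A (ht k w) *v Du w) $ k * (dd \<eta> 1 (ht k w) * th (z - w)) + (\<Sum>l\<in>UNIV - {k}. (A (ht k w) *v Du w) $ l * (- (\<eta> (ht k w) * ?d l (z - w))))"
    by (subst sum.remove[of UNIV k]) (auto simp: dk dl intro!: sum.cong)
   show ?thesis unfolding e
    by (simp add: Aflux sum_distrib_left sum_distrib_right sum_negf algebra_simps)
  qed
  have i3: "Lint (%w. \<Sum>j\<in>UNIV. ?d l (z - w) * ((\<eta> (ht k w) * (A (ht k w) $ l $ j * \<mu> (ht k w))) * Du w $ j))" if "l : UNIV - {k}" for l
   using that by (intro Bochner_Integration.integrable_sum P3(3)) auto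
  have i4: "Lint (%w. \<Sum>j\<in>UNIV. th (z - w) * ((dd \<eta> 1 (ht k w) * (A (ht k w) $ k $ j * \<mu> (ht k w))) * Du w $ j))"
   by (intro Bochner_Integration.integrable_sum P4(3))
  have "(LI w. \<mu> (ht k w) * (\<Sum>l\<in>UNIV. (A (ht k w) *v Du w) $ l * dd ?\<phi> (ek l) w))
    = (LI w. (\<Sum>j\<in>UNIV. th (z - w) * ((dd \<eta> 1 (ht k w) * (A (ht k w) $ k $ j * \<mu> (ht k w))) * Du w $ j)))
    - (LI w. (\<Sum>l\<in>UNIV - {k}. \<Sum>j\<in>UNIV. ?d l (z - w) * ((\<eta> (ht k w) * (A (ht k w) $ l $ j * \<mu> (ht k w))) * Du w $ j)))"
   unfolding pw by (intro Bochner_Integration.integral_diff i4 Bochner_Integration.integrable_sum i3)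
  also have "(LI w. (\<Sum>j\<in>UNIV. th (z - w) * ((dd \<eta> 1 (ht k w) * (A (ht k w) $ k $ j * \<mu> (ht k w))) * Du w $ j))) = (\<Sum>j\<in>UNIV. s4 j)"
  proof (subst Bochner_Integration.integral_sum)
   show "(\<Sum>j\<in>UNIV. (LI w. th (z - w) * ((dd \<eta> 1 (ht k w) * (A (ht k w) $ k $ j * \<mu> (ht k w))) * Du w $ j))) = (\<Sum>j\<in>UNIV. s4 j)"
    unfolding s4_def by (rule sum.cong[OF refl], rule P4(1)[symmetric])
  qed (rule P4(3))
  also have "(LI w. (\<Sum>l\<in>UNIV - {k}. \<Sum>j\<in>UNIV. ?d l (z - w) * ((\<eta> (ht k w) * (A (ht k w) $ l $ j * \<mu> (ht k w))) * Du w $ j)))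
    = (\<Sum>l\<in>UNIV - {k}. \<Sum>j\<in>UNIV. s3 l j)"
  proof (subst Bochner_Integration.integral_sum[OF i3], assumption, rule sum.cong[OF refl])
   fix l assume l: "l : UNIV - {k}"
   then have lk: "l ~= k" by simp
   show "(LI w. (\<Sum>j\<in>UNIV. ?d l (z - w) * ((\<eta> (ht k w) * (A (ht k w) $ l $ j * \<mu> (ht k w))) * Du w $ j))) = (\<Sum>j\<in>UNIV. s3 l j)"
   proof (subst Bochner_Integration.integral_sum)
    show "(\<Sum>j\<in>UNIV. (LI w. ?d l (z - w) * ((\<eta> (ht k w) * (A (ht k w) $ l $ j * \<mu> (ht k w))) * Du w $ j))) = (\<Sum>j\<in>UNIV. s3 l j)"
     unfolding s3_def by (rule sum.cong[OF refl], rule P3(1)[OF lk, symmetric])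
   qed (rule P3(3)[OF lk])
  qed
  finally show ?thesis .
 qed
 ultimately have sum0: "s1 + ((\<Sum>j\<in>UNIV. s4 j) - (\<Sum>l\<in>UNIV - {k}. \<Sum>j\<in>UNIV. s3 l j)) + lam * s2 = 0"
  using weak[OF tfun_smooth[OF se t] tfun_supp3[OF t e z]] by simp
 have pw: "\<eta> s * (\<mu> s * (a0 s * vv (dd th tau) (?u s) + lam * vv th (?u s)
      - (\<Sum>l\<in>UNIV - {k}. (A s *v pp (?d l) (?u s)) $ l))) + dd \<eta> 1 s * (\<mu> s * (A s *v pp th (?u s)) $ k)
   = (((\<eta> s * (a0 s * \<mu> s)) * vv (dd th tau) (?u s) + lam * ((\<eta> s * (1 * \<mu> s)) * vv th (?u s)))
    + (\<Sum>j\<in>UNIV. (dd \<eta> 1 s * (A s $ k $ j * \<mu> s)) * conv k (%z. Du z $ j) th (?u s)))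
    - (\<Sum>l\<in>UNIV - {k}. \<Sum>j\<in>UNIV. (\<eta> s * (A s $ l $ j * \<mu> s)) * conv k (%z. Du z $ j) (?d l) (?u s))" for s
  by (simp add: Aflux pp_def sum_distrib_left algebra_simps)
 have j4: "Lint (%s. \<Sum>j\<in>UNIV. (dd \<eta> 1 s * (A s $ k $ j * \<mu> s)) * conv k (%z. Du z $ j) th (?u s))"
  by (intro Bochner_Integration.integrable_sum P4(2))
 have j3: "Lint (%s. \<Sum>j\<in>UNIV. (\<eta> s * (A s $ l $ j * \<mu> s)) * conv k (%z. Du z $ j) (?d l) (?u s))" if "l : UNIV - {k}" for l
  using that by (intro Bochner_Integration.integrable_sum P3(2)) auto
 have j3': "Lint (%s. \<Sum>l\<in>UNIV - {k}. \<Sum>j\<in>UNIV. (\<eta> s * (A s $ l $ j * \<mu> s)) * conv k (%z. Du z $ j) (?d l) (?u s))"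
  by (intro Bochner_Integration.integrable_sum j3)
 have j12: "Lint (%s. (\<eta> s * (a0 s * \<mu> s)) * vv (dd th tau) (?u s) + lam * ((\<eta> s * (1 * \<mu> s)) * vv th (?u s)))"
  by (intro Bochner_Integration.integrable_add integrable_mult_right P1(2) P2(2))
 have "(LI s. (\<Sum>j\<in>UNIV. (dd \<eta> 1 s * (A s $ k $ j * \<mu> s)) * conv k (%z. Du z $ j) th (?u s))) = (\<Sum>j\<in>UNIV. s4 j)"
  unfolding s4_def by (rule Bochner_Integration.integral_sum) (rule P4(2))
 moreover have "(LI s. (\<Sum>l\<in>UNIV - {k}. \<Sum>j\<in>UNIV. (\<eta> s * (A s $ l $ j * \<mu> s)) * conv k (%z. Du z $ j) (?d l) (?u s))) = (\<Sum>l\<in>UNIV - {k}. \<Sum>j\<in>UNIV. s3 l j)"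
 proof (subst Bochner_Integration.integral_sum[OF j3], assumption, rule sum.cong[OF refl])
  fix l assume l: "l : UNIV - {k}"
  then have lk: "l ~= k" by simp
  show "(LI s. (\<Sum>j\<in>UNIV. (\<eta> s * (A s $ l $ j * \<mu> s)) * conv k (%z. Du z $ j) (?d l) (?u s))) = (\<Sum>j\<in>UNIV. s3 l j)"
   unfolding s3_def by (rule Bochner_Integration.integral_sum) (rule P3(2)[OF lk])
 qed
 moreover have "(LI s. (\<eta> s * (a0 s * \<mu> s)) * vv (dd th tau) (?u s) + lam * ((\<eta> s * (1 * \<mu> s)) * vv th (?u s))) = s1 + lam * s2"
  unfolding s1_def s2_def by (subst Bochner_Integration.integral_add) (auto intro: P1(2) P2(2)[simplified])
 ultimately show ?thesis
  unfolding pw using sum0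
  by (simp only: Bochner_Integration.integral_diff[OF Bochner_Integration.integrable_add[OF j12 j4] j3'] Bochner_Integration.integral_add[OF j12 j4])
qed

end

context conormal_solution
begin

lemma integrable_component_sum:
 assumes "!!l. Lint (%s. \<mu> s * f s $ l)" "!!l. (%s. f s $ l) : bm"
 shows "Lint (%s. \<mu> s * (A s *v f s) $ l)"
proof -
 have "Lint (%s. A s $ l $ j * (\<mu> s * f s $ j))" for j
  by (rule integrable_bounded_mult[OF assms(1), where C=\<Lambda>]) (use A_entry A_borel in auto)
 then have "Lint (%s. \<Sum>j\<in>UNIV. A s $ l $ j * (\<mu> s * f s $ j))" by simp
 then show ?thesis by (simp add: Aflux sum_distrib_left mult_ac)
qed

lemma mm_zero: "\<bar>x\<bar> <= C * mm s ==> s ~: {0<..<3} ==> x = 0"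
 by (simp add: mm_out)

lemma vv_out: "kern k h0 th ==> s ~: {0<..<3} ==> vv th (upd (ek k) z s) = 0"
 using vv_bound[of th] mm_zero[of _ _ s] ht_upd[of k z s] by metis
lemma ppl_out: "kern k h0 th ==> s ~: {0<..<3} ==> pp th (upd (ek k) z s) $ l = 0"
 using ppl_bound[of th l] mm_zero[of _ _ s] ht_upd[of k z s] by metis

lemma slice_tang_grad:
 assumes t: "kern k h0 th" and l: "l ~= k" and z: "rg z"
 shows "AE s in lborel. s : {0<..<3} --> pp th (upd (ek k) z s) $ l = vv (dd th (ek l)) (upd (ek k) z s)"
proof -
 have tl: "kern k h0 (dd th (ek l))" using l by (intro kern_dir[OF t]) simp
 have "AE s in lborel. s : {0<..<3} --> pp th (upd (ek k) z s) $ l - vv (dd th (ek l)) (upd (ek k) z s) = 0"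
 proof (rule fundamental_lemma)
  note i = ppl_slice(1)[OF t, of z l] vv_slice(1)[OF tl, of z]
  show "Lint (%s. pp th (upd (ek k) z s) $ l - vv (dd th (ek l)) (upd (ek k) z s))"
   by (intro Bochner_Integration.integrable_diff i)
  fix \<eta> assume e: "\<eta> : test1 0 3"
  have "(LI s. \<eta> s * pp th (upd (ek k) z s) $ l - \<eta> s * vv (dd th (ek l)) (upd (ek k) z s)) = 0"
   using integrable_times_test1[OF i(1) e] integrable_times_test1[OF i(2) e] grad_slice(1)[OF t e z l]
   by (simp add: mult.commute)
  then show "(LI s. (pp th (upd (ek k) z s) $ l - vv (dd th (ek l)) (upd (ek k) z s)) * \<eta> s) = 0"
   by (simp add: algebra_simps)
 qed
 then show ?thesis by simp
qed

text \<open>The mollified solution minus the primitive of its vertical gradient has zero weak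
  derivative on the line, so it is constant by the lemma of du Bois-Reymond.\<close>

lemma slice_vert_grad:
 assumes t: "kern k h0 th" and z: "rg z"
 shows "\<exists>c. AE s in lborel. s : {0<..<3} --> vv th (upd (ek k) z s) = c + prim (%r. pp th (upd (ek k) z r) $ k) s"
proof -
 let ?v = "%s. vv th (upd (ek k) z s)" and ?p = "%s. pp th (upd (ek k) z s) $ k"
 note iv = vv_slice(1)[OF t, of z] and ip = ppl_slice(1)[OF t, of z k]
 have one: "Lint (ind {0<..<3} :: real => real)" by simp
 have iq: "Lint (%s. ind {0<..<3} s * prim ?p s)" by (rule integrable_times_prim[OF one ip])
 have "\<exists>c. AE s in lborel. s : {0<..<3} --> ?v s - ind {0<..<3} s * prim ?p s = c"
 proof (rule du_Bois_Reymond)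
  show "Lint (%s. ?v s - ind {0<..<3} s * prim ?p s)" by (intro Bochner_Integration.integrable_diff iv iq)
  fix \<eta> \<eta>' :: "real => real" assume e: "\<eta> : test1 0 3" and d: "!!x. (\<eta> has_real_derivative \<eta>' x) (at x)" and e': "\<eta>' : test1 0 3"
  have d1: "dd \<eta> 1 = \<eta>'" using dir_deriv_real[OF d] by auto
  \<comment> \<open>The case V = \<eta> of \<open>vertical_parts\<close>: it says that the primitive
    has weak derivative ?p on (0,3).\<close>
  have "(LI r. ind {0<..<3} r * (?p r * ((1 + prim (%_. 0) r) * \<eta> r) + prim ?p r * (0 * \<eta> r + (1 + prim (%_. 0) r) * \<eta>' r))) = 0"
   by (rule vertical_parts[OF _ ip d test1_continuous[OF e'] test1_at_end[OF e]]) auto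
  then have "(LI r. \<eta> r * ?p r + (ind {0<..<3} r * prim ?p r) * \<eta>' r) = 0"
  proof (rule trans[rotated])
   show "(LI r. \<eta> r * ?p r + (ind {0<..<3} r * prim ?p r) * \<eta>' r)
    = (LI r. ind {0<..<3} r * (?p r * ((1 + prim (%_. 0) r) * \<eta> r) + prim ?p r * (0 * \<eta> r + (1 + prim (%_. 0) r) * \<eta>' r)))"
    using ppl_out[OF t, of _ z k]
    by (intro Bochner_Integration.integral_cong) (auto simp: prim_def indicator_def)
  qed
  moreover have "(LI r. \<eta> r * ?p r + (ind {0<..<3} r * prim ?p r) * \<eta>' r)
   = (LI r. \<eta> r * ?p r) + (LI r. (ind {0<..<3} r * prim ?p r) * \<eta>' r)"
   using integrable_times_test1[OF ip e] integrable_times_test1[OF iq e']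
   by (intro Bochner_Integration.integral_add) (simp_all add: mult.commute)
  moreover have "(LI r. \<eta>' r * ?v r) = - (LI r. \<eta> r * ?p r)" using grad_slice(2)[OF t e z] unfolding d1 .
  moreover have "(LI r. (?v r - ind {0<..<3} r * prim ?p r) * \<eta>' r) = (LI r. \<eta>' r * ?v r) - (LI r. (ind {0<..<3} r * prim ?p r) * \<eta>' r)"
   using integrable_times_test1[OF iv e'] integrable_times_test1[OF iq e']
   by (subst Bochner_Integration.integral_diff[symmetric]) (simp_all add: algebra_simps)
  ultimately show "(LI r. (?v r - ind {0<..<3} r * prim ?p r) * \<eta>' r) = 0" by linarith
 qed simp
 then obtain c where "AE s in lborel. s : {0<..<3} --> ?v s - ind {0<..<3} s * prim ?p s = c" by blast
 then have "AE s in lborel. s : {0<..<3} --> ?v s = c + prim ?p s" by eventually_elim auto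
 then show ?thesis by blast
qed

text \<open>Test functions may be nonzero at height 0, so the lemma of du Bois-Reymond is applied on
  (-3,3), with the flux and the right-hand side equal to zero at negative heights.\<close>

lemma slice_flux:
 assumes t: "kern k h0 th" and z: "rg z"
 shows "AE s in lborel. s : {0<..<3} --> \<mu> s * (A s *v pp th (upd (ek k) z s)) $ k
     = prim (%r. \<mu> r * (a0 r * vv (dd th tau) (upd (ek k) z r) + lam * vv th (upd (ek k) z r)
       - (\<Sum>l\<in>UNIV - {k}. (A r *v pp (dd th (ek l)) (upd (ek k) z r)) $ l))) s"
proof -
 let ?u = "%s. upd (ek k) z s"
 define g where "g = (%s. \<mu> s * (a0 s * vv (dd th tau) (?u s) + lam * vv th (?u s)
       - (\<Sum>l\<in>UNIV - {k}. (A s *v pp (dd th (ek l)) (?u s)) $ l)))"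
 define F where "F = (%s. \<mu> s * (A s *v pp th (?u s)) $ k)"
 have tt: "kern k h0 (dd th tau)" by (rule kern_dir[OF t tau_tang])
 have tl: "kern k h0 (dd th (ek l))" if "l ~= k" for l using that by (intro kern_dir[OF t]) simp
 have iA: "Lint (%s. \<mu> s * (A s *v pp th' (?u s)) $ l)" if "kern k h0 th'" for th' l
  using ppl_slice[OF that] by (intro integrable_component_sum) auto
 have iF: "Lint F" unfolding F_def by (rule iA[OF t])
 have "Lint (%s. a0 s * (\<mu> s * vv (dd th tau) (?u s)))"
  by (rule integrable_bounded_mult[OF vv_slice(2)[OF tt], where C=\<Lambda>]) (use a0_abs in auto)
 then have "Lint (%s. a0 s * (\<mu> s * vv (dd th tau) (?u s)) + lam * (\<mu> s * vv th (?u s))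
   - (\<Sum>l\<in>UNIV - {k}. \<mu> s * (A s *v pp (dd th (ek l)) (?u s)) $ l))"
  by (intro Bochner_Integration.integrable_diff Bochner_Integration.integrable_add Bochner_Integration.integrable_sum
    integrable_mult_right vv_slice(2)[OF t] iA tl) auto
 then have ig: "Lint g" unfolding g_def by (simp add: algebra_simps sum_distrib_left)
 have F0: "F s = 0" if "s ~: {0<..<3}" for s
  using ppl_out[OF t that, of z] by (simp add: F_def Aflux)
 have g0: "g s = 0" if s: "s ~: {0<..<3}" for s
 proof -
  have "(A s *v pp (dd th (ek l)) (?u s)) $ l = 0" if "l : UNIV - {k}" for l
   using ppl_out[OF tl s, of l z] that by (simp add: Aflux)
  then show ?thesis using vv_out[OF t s, of z] vv_out[OF tt s, of z] by (simp add: g_def)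
 qed
 have one: "Lint (ind {0<..<3} :: real => real)" by simp
 have iq: "Lint (%s. ind {0<..<3} s * prim g s)" by (rule integrable_times_prim[OF one ig])
 have "\<exists>c. AE s in lborel. s : {-3<..<3} --> F s - ind {0<..<3} s * prim g s = c"
 proof (rule du_Bois_Reymond)
  show "Lint (%s. F s - ind {0<..<3} s * prim g s)" by (intro Bochner_Integration.integrable_diff iF iq)
  fix \<eta> \<eta>' :: "real => real" assume e: "\<eta> : test1 (-3) 3" and d: "!!x. (\<eta> has_real_derivative \<eta>' x) (at x)" and e': "\<eta>' : test1 (-3) 3"
  have d1: "dd \<eta> 1 = \<eta>'" using dir_deriv_real[OF d] by auto
  have "(LI r. ind {0<..<3} r * (g r * ((1 + prim (%_. 0) r) * \<eta> r) + prim g r * (0 * \<eta> r + (1 + prim (%_. 0) r) * \<eta>' r))) = 0"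
   by (rule vertical_parts[OF _ ig d test1_continuous[OF e'] test1_at_end[OF e]]) auto
  then have "(LI r. \<eta> r * g r + (ind {0<..<3} r * prim g r) * \<eta>' r) = 0"
  proof (rule trans[rotated])
   show "(LI r. \<eta> r * g r + (ind {0<..<3} r * prim g r) * \<eta>' r)
    = (LI r. ind {0<..<3} r * (g r * ((1 + prim (%_. 0) r) * \<eta> r) + prim g r * (0 * \<eta> r + (1 + prim (%_. 0) r) * \<eta>' r)))"
    using g0 by (intro Bochner_Integration.integral_cong) (auto simp: prim_def indicator_def)
  qed
  moreover have "(LI r. \<eta> r * g r + (ind {0<..<3} r * prim g r) * \<eta>' r)
   = (LI r. \<eta> r * g r) + (LI r. (ind {0<..<3} r * prim g r) * \<eta>' r)"
   using integrable_times_test1[OF ig e] integrable_times_test1[OF iq e']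
   by (intro Bochner_Integration.integral_add) (simp_all add: mult.commute)
  moreover have "(LI r. \<eta> r * g r + \<eta>' r * F r) = 0" using flux_slice[OF t e z] unfolding d1 g_def F_def .
  moreover have "(LI r. \<eta> r * g r + \<eta>' r * F r) = (LI r. \<eta> r * g r) + (LI r. \<eta>' r * F r)"
   using integrable_times_test1[OF ig e] integrable_times_test1[OF iF e']
   by (intro Bochner_Integration.integral_add) (simp_all add: mult.commute)
  moreover have "(LI r. (F r - ind {0<..<3} r * prim g r) * \<eta>' r) = (LI r. \<eta>' r * F r) - (LI r. (ind {0<..<3} r * prim g r) * \<eta>' r)"
   using integrable_times_test1[OF iF e'] integrable_times_test1[OF iq e']
   by (subst Bochner_Integration.integral_diff[symmetric]) (simp_all add: algebra_simps)
  ultimately show "(LI r. (F r - ind {0<..<3} r * prim g r) * \<eta>' r) = 0" by linarith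
 qed simp
 then obtain c where c: "AE s in lborel. s : {-3<..<3} --> F s - ind {0<..<3} s * prim g s = c" by blast
 \<comment> \<open>At negative heights the flux and the truncated primitive are both zero, so their
   constant difference is 0. This is the point where the conormal condition makes the flux start at
   zero.\<close>
 have "c = 0"
 proof (rule ccontr)
  assume "c ~= 0"
  from c have "AE s in lborel. s ~: {-3<..<0::real}"
   by eventually_elim (use F0 \<open>c ~= 0\<close> in \<open>auto simp: indicator_def\<close>)
  then have "emeasure lborel {-3<..<0::real} = 0" by (subst (asm) AE_iff_measurable[where N="{-3<..<0}"]) auto
  then show False by simp
 qed
 with c have "AE s in lborel. s : {0<..<3} --> F s = prim g s" by (auto elim!: eventually_mono)
 then show ?thesis unfolding F_def g_def .
qed

lemma pp_norm_bound:
 assumes t: "kern k h0 th"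
 shows "\<exists>C\<ge>0. \<forall>z. \<bar>vv th z\<bar> <= C * mm (ht k z) & norm (pp th z) <= C * mm (ht k z)"
proof -
 obtain C where C: "0 <= C" "!!z. \<bar>vv th z\<bar> <= C * mm (ht k z)" using vv_bound[OF t] by blast
 have "\<forall>l. \<exists>E\<ge>0. \<forall>z. \<bar>pp th z $ l\<bar> <= E * mm (ht k z)" using ppl_bound[OF t] by blast
 then obtain E where E: "!!l. 0 <= E l" "!!l z. \<bar>pp th z $ l\<bar> <= E l * mm (ht k z)" by metis
 have "norm (pp th z) <= (\<Sum>l\<in>UNIV. E l) * mm (ht k z)" for z
 proof -
  have "norm (pp th z) <= (\<Sum>l\<in>UNIV. \<bar>pp th z $ l\<bar>)" by (rule norm_le_l1_cart)
  also have "... <= (\<Sum>l\<in>UNIV. E l * mm (ht k z))" by (intro sum_mono E)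
  finally show ?thesis by (simp add: sum_distrib_right)
 qed
 moreover have "(\<Sum>l\<in>UNIV. E l) * mm s <= (C + (\<Sum>l\<in>UNIV. E l)) * mm s" "C * mm s <= (C + (\<Sum>l\<in>UNIV. E l)) * mm s" for s
  using C(1) E(1) mm_nonneg[of s] by (intro mult_right_mono; simp add: sum_nonneg)+
 ultimately show ?thesis using C E(1) by (intro exI[of _ "C + (\<Sum>l\<in>UNIV. E l)"]) (meson add_nonneg_nonneg order_trans sum_nonneg)
qed

text \<open>The kernels themselves serve as indices, and differentiation of the family is
  differentiation of the kernel, which keeps its support. Only \<open>t0\<close> varies between
  instances.\<close>

lemma tf:
 assumes t0: "t0 < 0"
 shows "tangential_family k \<Lambda> lam t0 \<mu> a0 A {th. kern k h0 th} vv pp (%b th. dd th b) mm"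
proof
 show "1 <= \<Lambda>" "0 <= lam" "t0 < 0" by (fact Lambda lam t0)+
 show "0 < \<mu> s" for s by (rule mu_pos)
 show "\<mu> : bm" "a0 : bm" "(%s. A s $ i $ j) : bm" for i j by (fact mu_borel a0_borel A_borel)+
 show "1 / \<Lambda> <= a0 s" "a0 s <= \<Lambda>" for s by (fact a0_bounds)+
 show "(norm \<xi>)^2 / \<Lambda> <= (A s *v \<xi>) \<bullet> \<xi>" "norm (A s *v \<xi>) <= \<Lambda> * norm \<xi>" for s \<xi> by (fact A_ell A_bound)+
 show "mm : bm" "0 <= mm s" "s ~: {0<..<3} ==> mm s = 0" for s by (fact mm_borel mm_nonneg mm_out)+
 show "Lint mm" "Lint (%s. \<mu> s * mm s)" "Lint (%s. \<mu> s * (mm s)^2)" by (fact mm_int1 mm_int2)+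
 fix th assume "th : {th. kern k h0 th}"
 then have t: "kern k h0 th" by simp
 show "b : tang k ==> dd th b : {th. kern k h0 th}" for b using kern_dir[OF t] by simp
 show "vv th : bm" "(%z. pp th z $ l) : bm" for l by (fact vv_borel[OF t] ppl_borel[OF t])+
 show "((%r. vv th (z + r *\<^sub>R b)) has_real_derivative vv (dd th b) z) (at 0)" if "b : tang k" for b z by (rule conv_deriv[OF t u_sl that])
 show "((%r. pp th (z + r *\<^sub>R b) $ l) has_real_derivative pp (dd th b) z $ l) (at 0)" if "b : tang k" for b z l
  using conv_deriv[OF t Du_sl that] by (simp add: pp_def)
 show "\<exists>C\<ge>0. \<forall>z. \<bar>vv th z\<bar> <= C * mm (ht k z) & norm (pp th z) <= C * mm (ht k z)" by (rule pp_norm_bound[OF t])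
 fix z :: "'n tx" assume "- 5 < fst z" "fst z < 0" "norm (cross k z) < 5 / 2"
 then have z: "rg z" by simp
 show "AE s in lborel. s : {0<..<3} --> pp th (upd (ek k) z s) $ l = vv (dd th (ek l)) (upd (ek k) z s)" if "l ~= k" for l
  by (rule slice_tang_grad[OF t that z])
 show "\<exists>c. AE s in lborel. s : {0<..<3} --> vv th (upd (ek k) z s) = c + prim (%r. pp th (upd (ek k) z r) $ k) s"
  by (rule slice_vert_grad[OF t z])
 show "AE s in lborel. s : {0<..<3} --> \<mu> s * (A s *v pp th (upd (ek k) z s)) $ k
     = prim (%r. \<mu> r * (a0 r * vv (dd th tau) (upd (ek k) z r) + lam * vv th (upd (ek k) z r)
       - (\<Sum>l\<in>UNIV - {k}. (A r *v pp (dd th (ek l)) (upd (ek k) z r)) $ l))) s"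
  by (rule slice_flux[OF t z])
qed

end

section \<open>Young's inequality and mollifiers\<close>

lemma lborel_reflect: "distr lborel borel (%w::'a::euclidean_space. z - w) = lborel"
proof -
 have "lborel = density (distr lborel borel (%w. z + (\<Sum>b\<in>Basis. (- 1 * (w \<bullet> b)) *\<^sub>R b))) (%_. ennreal (\<Prod>b\<in>(Basis :: 'a set). \<bar>- 1\<bar>))"
  by (rule lborel_affine_euclidean[where c="%_. - 1" and t=z]) auto
 also have "(%w. z + (\<Sum>b\<in>Basis. (- 1 * (w \<bullet> b)) *\<^sub>R b)) = (%w::'a. z - w)"
  by (auto simp: sum_negf euclidean_representation)
 finally show ?thesis by (simp add: density_1)
qed

lemma integral_reflect: "f : bm ==> (LI w. f (z - w)) = (LI w. f w)"
 for f :: "'a::euclidean_space => real"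
 by (subst (2) lborel_reflect[of z, symmetric], subst integral_distr) auto

lemma nn_integral_translate: "f : bm ==> (NI w. f (w - y)) = (NI w. f w)"
 for f :: "'a::euclidean_space => ennreal"
 by (subst (2) lborel_distr_plus[of "- y", symmetric], subst nn_integral_distr) auto

lemma integral_translate: "f : bm ==> (LI w. f (w - y)) = (LI w. f w)"
 for f :: "'a::euclidean_space => real"
 by (subst (2) lborel_distr_plus[of "- y", symmetric], subst integral_distr) auto

text \<open>\<open>H\<close> is constant along \<open>b\<close> and both slabs have width one, so
  each side is the integral over the remaining variables. The reflection in \<open>conv_alt\<close>
  displaces the dummy interval, and this lemma puts it back.\<close>

lemma slab_integral_shift:
 fixes H :: "'a::euclidean_space => real"
 assumes b: "b : Basis" and [measurable]: "H : bm" and c: "!!w r. H (upd b w r) = H w"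
  and i: "Lint (%w. ind (slab b) w * H w)"
 shows "(LI w. ind {w. a < w \<bullet> b & w \<bullet> b < a + 1} w * H w) = (LI w. ind (slab b) w * H w)"
proof -
 let ?S = "{w. a < w \<bullet> b & w \<bullet> b < a + 1}"
 have [measurable]: "?S : sets borel" by measurable
 have u: "ind ?S (upd b w r) = (ind {a<..<a + 1} r :: real)" for w r
  using b by (simp add: indicator_def upd_inner)
 have "(NI w. ennreal (norm (ind ?S w * H w)))
   = (NI w. ind (slab b) w * (NI r. ennreal (norm (ind ?S (upd b w r) * H (upd b w r)))))"
  by (rule nn_integral_line(1)[OF b]) measurable
 also have "... = (NI w. ennreal (norm (ind (slab b) w * H w)))"
 proof (intro nn_integral_cong)
  fix w
  have "(NI r. ennreal (norm (ind ?S (upd b w r) * H (upd b w r)))) = (NI r. ennreal \<bar>H w\<bar> * ind {a<..<a + 1} r)"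
   unfolding u c by (intro nn_integral_cong) (auto simp: indicator_def)
  also have "... = ennreal \<bar>H w\<bar>" by (subst nn_integral_cmult_indicator) auto
  finally have e: "(NI r. ennreal (norm (ind ?S (upd b w r) * H (upd b w r)))) = ennreal \<bar>H w\<bar>" .
  show "ind (slab b) w * (NI r. ennreal (norm (ind ?S (upd b w r) * H (upd b w r)))) = ennreal (norm (ind (slab b) w * H w))"
   unfolding e by (simp add: indicator_def)
 qed
 also have "... < \<infinity>" using i by (simp add: integrable_iff_bounded)
 finally have "Lint (%w. ind ?S w * H w)" by (intro integrableI_bounded) measurable
 from integral_line(2)[OF b this]
 have "(LI w. ind ?S w * H w) = (LI w. ind (slab b) w *\<^sub>R (LI r. ind {a<..<a + 1} r * H w))"
  unfolding u c .
 then show ?thesis by simp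
qed

text \<open>The substitution of z - w for w moves the translation from the kernel to
  \<open>f\<close>, the form in which a convolution is an average of translates; Young's inequality
  and the convergence of mollifications rest on it.\<close>

lemma conv_alt:
 assumes k: "kern k h th" and f: "sl k f"
 shows "conv k f th z = (LI w. ind (slab (ek k)) w * (th w * f (z - upd (ek k) w 0)))"
proof -
 note [measurable] = kern_borel[OF k] sl_borel[OF f]
 define H where "H = (%w. th (z - w) * f (upd (ek k) w (ht k z)))"
 have Hm [measurable]: "H : bm" unfolding H_def by measurable
 have Hc: "H (upd (ek k) w r) = H w" for w r
 proof -
  have "z - upd (ek k) w r = (z - w) + (w \<bullet> ek k - r) *\<^sub>R ek k" by (simp add: upd_def algebra_simps zero_prod_def)
  then have "th (z - upd (ek k) w r) = th (z - w)" by (simp only: kern_shift[OF k])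
  then show ?thesis unfolding H_def by (simp only: upd_upd[OF ek_Basis])
 qed
 have i: "Lint (%w. ind (slab (ek k)) w * H w)"
  using conv_int[OF k f, of z "ht k z"] unfolding H_def by (simp add: mult_ac)
 have up: "z - upd (ek k) (z - w) 0 = upd (ek k) w (ht k z)" for w
  by (simp add: upd_def algebra_simps zero_prod_def)
 have sw: "ind (slab (ek k)) (z - w) = (ind {w. ht k z - 1 < w \<bullet> ek k & w \<bullet> ek k < ht k z - 1 + 1} w :: real)" for w
  by (auto simp: indicator_def slab_def)
 have "(LI w. ind (slab (ek k)) w * (th w * f (z - upd (ek k) w 0)))
   = (LI w. ind (slab (ek k)) (z - w) * (th (z - w) * f (z - upd (ek k) (z - w) 0)))"
  by (rule integral_reflect[symmetric]) measurable
 also have "... = (LI w. ind {w. ht k z - 1 < w \<bullet> ek k & w \<bullet> ek k < ht k z - 1 + 1} w * H w)"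
  unfolding up sw H_def ..
 also have "... = (LI w. ind (slab (ek k)) w * H w)"
  by (rule slab_integral_shift[OF ek_Basis Hm Hc i])
 also have "... = conv k f th z" unfolding conv_def H_def by (simp add: mult_ac)
 finally show ?thesis ..
qed

lemma kern_zero_outside:
 assumes k: "kern k h th" "h <= 1" and w: "w : slab (ek k)" "w ~: cbox 0 One"
 shows "th w = 0"
proof (rule ccontr)
 assume nz: "th w ~= 0"
 have "0 <= w \<bullet> b & w \<bullet> b <= 1" if "b : Basis" for b
 proof (cases "b = ek k")
  case True then show ?thesis using w(1) by (simp add: slab_def)
 next
  case False then show ?thesis using kern_supp[OF k(1) nz, of b] that k(2) by (simp add: tang_def)
 qed
 then show False using w(2) by (simp add: mem_box)
qed

lemma kern_integrable:
 assumes k: "kern k h th" "h <= 1"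
 shows "Lint (%w. ind (slab (ek k)) w * th w)"
proof -
 note [measurable] = kern_borel[OF k(1)]
 obtain C where C: "!!w. \<bar>th w\<bar> <= C" using kern_bounded[OF k(1)] by blast
 show ?thesis
 proof (rule Bochner_Integration.integrable_bound)
  show "Lint (%w. C * ind (cbox 0 One) w :: real)" by simp
  show "AE w in lborel. norm (ind (slab (ek k)) w * th w) <= norm (C * ind (cbox 0 One) w)"
   using C kern_zero_outside[OF k] by (intro AE_I2) (force simp: indicator_def intro: order_trans[OF _ abs_ge_self])
 qed measurable
qed

text \<open>The weight is unaffected since the shifts \<open>upd (ek k) w 0\<close> have height zero.\<close>

lemma conv_Young:
 fixes k :: "'n::finite"
 assumes k: "kern k h th" "h <= 1" and f: "sl k f"
  and mu: "!!s. 0 < \<mu> s" and [measurable]: "\<mu> : bm"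
  and f2: "Lint (%z. \<mu> (ht k z) * (f z)^2)"
 shows "Lint (%z. \<mu> (ht k z) * (conv k f th z)^2)"
  and "(LI z. \<mu> (ht k z) * (conv k f th z)^2) <= (LI w. ind (slab (ek k)) w * \<bar>th w\<bar>)^2 * (LI z. \<mu> (ht k z) * (f z)^2)"
proof -
 note [measurable] = kern_borel[OF k(1)] sl_borel[OF f] conv_borel[OF k(1) f]
 define M where "M = (LI w. ind (slab (ek k)) w * \<bar>th w\<bar>)"
 define F where "F = (LI z. \<mu> (ht k z) * (f z)^2)"
 let ?\<nu> = "%w. ennreal (ind (slab (ek k)) w * \<bar>th w\<bar>)" and ?y = "%w. upd (ek k) w 0"
 have M0: "0 <= M" unfolding M_def by (intro integral_nonneg_AE AE_I2) auto
 have F0: "0 <= F" unfolding F_def using mu by (intro integral_nonneg_AE AE_I2) (auto simp: less_imp_le)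
 have nuM: "(NI w. ?\<nu> w) = ennreal M" unfolding M_def
  using integrable_abs[OF kern_integrable[OF k]] by (intro nn_integral_eq_integral) (auto simp: abs_mult)
 have nuF: "(NI z. ennreal (\<mu> (ht k z) * (f z)^2)) = ennreal F" unfolding F_def
  using mu by (intro nn_integral_eq_integral f2 AE_I2) (auto simp: less_imp_le)
 \<comment> \<open>Cauchy-Schwarz after writing the modulus of the kernel as the square of its root:
   one factor yields the mass M, the other keeps the squared translates of \<open>f\<close>.\<close>
 have pw: "ennreal ((conv k f th z)^2) <= ennreal M * (NI w. ?\<nu> w * ennreal ((f (z - ?y w))^2))" for z
 proof -
  have "ennreal \<bar>conv k f th z\<bar> <= (NI w. ennreal \<bar>ind (slab (ek k)) w * (th w * f (z - ?y w))\<bar>)"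
   unfolding conv_alt[OF k(1) f] real_norm_def[symmetric]
   by (cases "Lint (%w. ind (slab (ek k)) w * (th w * f (z - ?y w)))")
    (rule integral_norm_bound_ennreal, auto simp: not_integrable_integral_eq)
  also have "... = (NI w. ennreal (sqrt (ind (slab (ek k)) w * \<bar>th w\<bar>)) * ennreal (sqrt (ind (slab (ek k)) w * \<bar>th w\<bar>) * \<bar>f (z - ?y w)\<bar>))"
   by (intro nn_integral_cong) (simp add: ennreal_mult[symmetric] indicator_def abs_mult)
  finally have "ennreal ((conv k f th z)^2) <= (NI w. ennreal (sqrt (ind (slab (ek k)) w * \<bar>th w\<bar>)) * ennreal (sqrt (ind (slab (ek k)) w * \<bar>th w\<bar>) * \<bar>f (z - ?y w)\<bar>))^2"
   using power_mono[of "ennreal \<bar>conv k f th z\<bar>" _ 2] by (simp add: ennreal_power)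
  also have "... <= (NI w. (ennreal (sqrt (ind (slab (ek k)) w * \<bar>th w\<bar>)))^2) * (NI w. (ennreal (sqrt (ind (slab (ek k)) w * \<bar>th w\<bar>) * \<bar>f (z - ?y w)\<bar>))^2)"
   by (rule Cauchy_Schwarz_nn_integral) measurable
  also have "... = ennreal M * (NI w. ?\<nu> w * ennreal ((f (z - ?y w))^2))"
   unfolding nuM[symmetric]
   by (intro arg_cong2[where f="(*)"] nn_integral_cong) (auto simp: ennreal_power power_mult_distrib ennreal_mult[symmetric] indicator_def)
  finally show ?thesis .
 qed
 have "(NI z. ennreal (\<mu> (ht k z) * (conv k f th z)^2))
   <= (NI z. ennreal M * (NI w. ?\<nu> w * ennreal (\<mu> (ht k (z - ?y w)) * (f (z - ?y w))^2)))"
 proof (intro nn_integral_mono)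
  fix z :: "'n tx"
  have "ennreal (\<mu> (ht k z) * (conv k f th z)^2) <= ennreal (\<mu> (ht k z)) * (ennreal M * (NI w. ?\<nu> w * ennreal ((f (z - ?y w))^2)))"
   using mu[of "ht k z"] pw[of z] by (simp add: ennreal_mult mult_left_mono)
  also have "... = ennreal M * (NI w. ennreal (\<mu> (ht k z)) * (?\<nu> w * ennreal ((f (z - ?y w))^2)))"
   by (subst nn_integral_cmult) (measurable, simp add: mult_ac)
  also have "(NI w. ennreal (\<mu> (ht k z)) * (?\<nu> w * ennreal ((f (z - ?y w))^2))) = (NI w. ?\<nu> w * ennreal (\<mu> (ht k (z - ?y w)) * (f (z - ?y w))^2))"
  proof (intro nn_integral_cong)
   fix w
   have "ht k (z - ?y w) = ht k z" using ht_upd[of k w 0] by simp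
   then show "ennreal (\<mu> (ht k z)) * (?\<nu> w * ennreal ((f (z - ?y w))^2)) = ?\<nu> w * ennreal (\<mu> (ht k (z - ?y w)) * (f (z - ?y w))^2)"
    using mu[of "ht k z"] by (simp only: ennreal_mult less_imp_le zero_le_power2 mult_ac)
  qed
  finally show "ennreal (\<mu> (ht k z) * (conv k f th z)^2) <= ennreal M * (NI w. ?\<nu> w * ennreal (\<mu> (ht k (z - ?y w)) * (f (z - ?y w))^2))" .
 qed
 also have "... = ennreal M * (NI z. (NI w. ?\<nu> w * ennreal (\<mu> (ht k (z - ?y w)) * (f (z - ?y w))^2)))"
  by (rule nn_integral_cmult) measurable
 also have "(NI z. (NI w. ?\<nu> w * ennreal (\<mu> (ht k (z - ?y w)) * (f (z - ?y w))^2)))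
  = (NI w. (NI z. ?\<nu> w * ennreal (\<mu> (ht k (z - ?y w)) * (f (z - ?y w))^2)))"
  by (rule lborel_pair.Fubini') measurable
 also have "... = (NI w. ?\<nu> w * ennreal F)"
 proof (intro nn_integral_cong)
  fix w :: "'n tx"
  have m: "(%z. ennreal (\<mu> (ht k (z - ?y w)) * (f (z - ?y w))^2)) : borel_measurable lborel" by measurable
  have e: "(NI z. ennreal (\<mu> (ht k (z - ?y w)) * (f (z - ?y w))^2)) = ennreal F"
   unfolding nuF[symmetric] by (rule nn_integral_translate) measurable
  show "(NI z. ?\<nu> w * ennreal (\<mu> (ht k (z - ?y w)) * (f (z - ?y w))^2)) = ?\<nu> w * ennreal F"
   by (simp only: nn_integral_cmult[OF m] e)
 qed
 also have "... = (NI w. ?\<nu> w) * ennreal F" by (rule nn_integral_multc) measurable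
 also have "... = ennreal M * ennreal F" by (simp only: nuM)
 also have "ennreal M * (ennreal M * ennreal F) = ennreal (M^2 * F)" using M0 F0 by (simp add: ennreal_mult power2_eq_square mult_ac)
 finally have fin: "(NI z. ennreal (\<mu> (ht k z) * (conv k f th z)^2)) <= ennreal (M^2 * F)" .
 have nn: "AE z in lborel. 0 <= \<mu> (ht k z) * (conv k f th z)^2" using mu by (auto simp: less_imp_le)
 show i: "Lint (%z. \<mu> (ht k z) * (conv k f th z)^2)"
  by (rule integrableI_nonneg[OF _ nn]) (measurable, use fin in \<open>simp add: le_less_trans\<close>)
 show "(LI z. \<mu> (ht k z) * (conv k f th z)^2) <= (LI w. ind (slab (ek k)) w * \<bar>th w\<bar>)^2 * (LI z. \<mu> (ht k z) * (f z)^2)"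
  using fin nn_integral_eq_integral[OF i nn] M0 F0 unfolding M_def[symmetric] F_def[symmetric] by simp
qed

definition mollifiers :: "'n::finite => real => ('n tx => real) set" where
 "mollifiers k h = {th. kern k h th & (\<forall>w. 0 <= th w) & (LI w. ind (slab (ek k)) w * th w) = 1}"

text \<open>A product of bumps in the tangential coordinates, divided by its mass; the mass is
  positive because the product is positive on a small cube inside the slab.\<close>

lemma mollifiers_nonempty:
 fixes k :: "'n::finite"
 assumes h: "0 < h" "h <= 1"
 shows "mollifiers k h ~= {}"
proof -
 define th where "th = (%w. \<Prod>b\<in>tang k. bump 1 0 h (w \<bullet> b))"
 have fin: "finite (tang k)" by (simp add: tang_def)
 have k: "kern k h th"
  unfolding kern_def
 proof (intro conjI allI impI ballI)
  show "smooth th" unfolding th_def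
  proof (intro smooth_prod fin)
   fix b :: "'n tx"
   show "smooth (%w. bump 1 0 h (w \<bullet> b))"
    using smooth_affine[OF bounded_linear_inner_left[of b] smooth_bump[of 1 0 h], of 0] by simp
  qed
  fix w r
  have "(w + r *\<^sub>R ek k) \<bullet> b = w \<bullet> b" if "b : tang k" for b
   using inner_Basis[OF ek_Basis[of k] tang_Basis[OF that]] tang_neq[OF that]
   unfolding inner_add_left inner_scaleR_left by (simp del: inner_Pair)
  then show "th (w + r *\<^sub>R ek k) = th w" unfolding th_def by (intro prod.cong) (simp_all del: inner_Pair)
 next
  fix w b assume "th w ~= 0" and b: "b : tang k"
  then have "bump 1 0 h (w \<bullet> b) ~= 0" using fin by (auto simp: th_def)
  then show "0 <= w \<bullet> b" "w \<bullet> b <= h" using bump_outside[of "w \<bullet> b" 0 h 1] by linarith+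
 qed
 note [measurable] = kern_borel[OF k]
 have nn: "0 <= th w" for w unfolding th_def by (intro prod_nonneg) (simp add: bump_nonneg)
 define c where "c = (LI w. ind (slab (ek k)) w * th w)"
 have "0 <= c" unfolding c_def using nn by (intro integral_nonneg_AE AE_I2) auto
 moreover have "c ~= 0"
 proof
  assume "c = 0"
  then have "AE w in lborel. ind (slab (ek k)) w * th w = 0"
   unfolding c_def using nn by (subst (asm) integral_nonneg_eq_0_iff_AE[OF kern_integrable[OF k h(2)]]) auto
  then have ae: "AE w in lborel. (w :: 'n tx) ~: box 0 (h *\<^sub>R One)"
  proof eventually_elim
   fix w :: "'n tx" assume z: "ind (slab (ek k)) w * th w = 0"
   show "w ~: box 0 (h *\<^sub>R One)"
   proof
    assume "w : box 0 (h *\<^sub>R One)"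
    then have w: "0 < w \<bullet> b" "w \<bullet> b < h" if "b : Basis" for b using that by (auto simp: mem_box)
    have "0 < th w" unfolding th_def using w[OF tang_Basis] by (intro prod_pos) (auto intro!: bump_pos)
    moreover have "w : slab (ek k)" using w[OF ek_Basis[of k]] h(2) unfolding slab_def by simp
    ultimately show False using z by simp
   qed
  qed
  have "emeasure lborel (box 0 (h *\<^sub>R One) :: ('n tx) set) = 0"
   using ae by (subst (asm) AE_iff_measurable[where N="box 0 (h *\<^sub>R One)"]) auto
  moreover have "emeasure lborel (box 0 (h *\<^sub>R One) :: ('n tx) set) = ennreal (h ^ DIM('n tx))"
   using h(1) by (subst emeasure_lborel_box) auto
  ultimately show False using h(1) by simp
 qed
 ultimately have c: "0 < c" by simp
 have "(%w. (1 / c) * th w) : mollifiers k h"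
  unfolding mollifiers_def
 proof (intro CollectI conjI allI)
  show "kern k h (%w. (1 / c) * th w)" by (rule kern_cmult[OF k])
  show "0 <= (1 / c) * th w" for w using c nn by simp
  have "(LI w. ind (slab (ek k)) w * ((1 / c) * th w)) = (LI w. (1 / c) * (ind (slab (ek k)) w * th w))"
   by (intro Bochner_Integration.integral_cong) auto
  also have "... = 1" using c by (subst integral_mult_right_zero) (simp add: c_def)
  finally show "(LI w. ind (slab (ek k)) w * ((1 / c) * th w)) = 1" .
 qed
 then show ?thesis by blast
qed

lemma mollifiers_mono: "h <= h' ==> mollifiers k h \<subseteq> mollifiers k h'"
 unfolding mollifiers_def using kern_mono by blast

text \<open>Convexity at the midpoint, which lets the parallelogram identity compare two kernels
  with the infimum over the class.\<close>

lemma mollifiers_mid: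
 assumes h: "h <= 1" and a: "th : mollifiers k h" and b: "th' : mollifiers k h"
 shows "(%w. (1 / 2) * (th w + th' w)) : mollifiers k h"
 unfolding mollifiers_def
proof (intro CollectI conjI allI)
 have k: "kern k h th" "kern k h th'" using a b by (auto simp: mollifiers_def)
 show "kern k h (%w. (1 / 2) * (th w + th' w))" by (intro kern_cmult kern_add k)
 have nn: "0 <= th w" "0 <= th' w" for w using a b unfolding mollifiers_def by blast+
 show "0 <= (1 / 2) * (th w + th' w)" for w using nn[of w] by simp
 have "(LI w. ind (slab (ek k)) w * ((1 / 2) * (th w + th' w)))
  = (LI w. (1 / 2) * (ind (slab (ek k)) w * th w) + (1 / 2) * (ind (slab (ek k)) w * th' w))"
  by (intro Bochner_Integration.integral_cong) (auto simp: algebra_simps)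
 also have "... = (1 / 2) * 1 + (1 / 2) * 1"
  using a b kern_integrable[OF k(1) h] kern_integrable[OF k(2) h]
  by (subst Bochner_Integration.integral_add) (auto simp: mollifiers_def)
 finally show "(LI w. ind (slab (ek k)) w * ((1 / 2) * (th w + th' w))) = 1" by simp
qed

lemma conv_add: "kern k h th ==> kern k h th' ==> sl k f ==> conv k f (%w. th w + th' w) z = conv k f th z + conv k f th' z"
 unfolding conv_def distrib_right by (intro Bochner_Integration.integral_add conv_int)

lemma conv_cmult: "conv k f (%w. c * th w) z = c * conv k f th z"
 unfolding conv_def mult.assoc by (rule integral_mult_right_zero)

section \<open>Convergence of mollifications\<close>

text \<open>The infima over the decreasing sets increase and are bounded by \<open>E\<close>, so
  they converge to some l. For i, j >= N the midpoint lies in K N, and the parallelogram inequality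
  bounds the value at the difference by 4 * (l - m N) + 4 / (N + 1). The Cauchy property is obtained
  without knowing a limit.\<close>

lemma minimizing_sequence:
 fixes X :: "('a => real) => real" and K :: "nat => ('a => real) set"
 assumes ne: "!!j. K j ~= {}" and dec: "!!i j. i <= j ==> K j \<subseteq> K i"
  and nn: "!!th. th : K 0 ==> 0 <= X th" and E: "!!th. th : K 0 ==> X th <= E"
  and mid: "!!i th th'. th : K i ==> th' : K i ==> (%w. (1 / 2) * (th w + th' w)) : K i"
  and par: "!!th th'. th : K 0 ==> th' : K 0 ==> X (%w. th w - th' w) <= 2 * X th + 2 * X th' - 4 * X (%w. (1 / 2) * (th w + th' w))"
 shows "\<exists>th. (\<forall>j. th j : K j) & (\<forall>e>0. \<exists>N. \<forall>i\<ge>N. \<forall>j\<ge>N. X (%w. th i w - th j w) < e)"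
proof -
 have K0: "th : K j ==> th : K 0" for th j using dec[of 0 j] by auto
 define m where "m j = Inf (X ` K j)" for j
 have bdd: "bdd_below (X ` K j)" for j using nn K0 by (intro bdd_belowI[of _ 0]) auto
 have mle: "th : K j ==> m j <= X th" for th j unfolding m_def by (intro cInf_lower bdd) auto
 have "\<exists>th\<in>K j. X th < m j + 1 / real (Suc j)" for j
  using cInf_lessD[of "X ` K j" "m j + 1 / real (Suc j)"] ne[of j] unfolding m_def by auto
 then obtain th where t: "!!j. th j : K j" "!!j. X (th j) < m j + 1 / real (Suc j)" by metis
 have inc: "incseq m"
  unfolding m_def using ne dec bdd by (intro incseq_SucI cInf_superset_mono image_mono) auto
 have mE: "m j <= E" for j using mle[OF t(1)[of j]] E[OF K0[OF t(1)[of j]]] by linarith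
 obtain l where l: "m \<longlonglongrightarrow> l" "!!j. m j <= l" using incseq_convergent[OF inc] mE by blast
 have "\<exists>N. \<forall>i\<ge>N. \<forall>j\<ge>N. X (%w. th i w - th j w) < e" if e: "0 < e" for e
 proof -
  have "(%N. 4 * (l - m N) + 4 * (1 / real (Suc N))) \<longlonglongrightarrow> 4 * (l - l) + 4 * 0"
   by (intro tendsto_intros l LIMSEQ_Suc[OF lim_1_over_n])
  then have "eventually (%N. 4 * (l - m N) + 4 * (1 / real (Suc N)) < e) sequentially"
   using e order_tendstoD(2)[of _ 0] by simp
  then obtain N where N: "4 * (l - m N) + 4 * (1 / real (Suc N)) < e"
   unfolding eventually_sequentially by (metis order_refl)
  have "X (%w. th i w - th j w) < e" if ij: "N <= i" "N <= j" for i j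
  proof -
   have tN: "th i : K N" "th j : K N" using dec[OF ij(1)] dec[OF ij(2)] t(1) by blast+
   have "X (%w. th i w - th j w) <= 2 * X (th i) + 2 * X (th j) - 4 * X (%w. (1 / 2) * (th i w + th j w))"
    by (intro par K0[OF t(1)])
   moreover have "X (th i) <= l + 1 / real (Suc N)" "X (th j) <= l + 1 / real (Suc N)"
    using t(2)[of i] t(2)[of j] l(2)[of i] l(2)[of j] frac_le[of 1 1 "real (Suc N)" "real (Suc i)"] frac_le[of 1 1 "real (Suc N)" "real (Suc j)"] ij by auto
   moreover have "m N <= X (%w. (1 / 2) * (th i w + th j w))" by (intro mle mid tN)
   ultimately show ?thesis using N by argo
  qed
  then show ?thesis by blast
 qed
 then show ?thesis using t(1) by blast
qed

lemma mollifiersD: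
 assumes "th : mollifiers k h"
 shows "kern k h th" "0 <= th w" "(LI w. ind (slab (ek k)) w * th w) = 1"
 using assms unfolding mollifiers_def by blast+

lemma conv_pairing_tendsto:
 fixes k :: "'n::finite" and f g :: "'n tx => real"
 assumes f: "sl k f" "Lint f" and g [measurable]: "g : bm" and B: "!!z. \<bar>g z\<bar> <= B"
  and c: "AE z in lborel. isCont g z" and t: "!!j. th j : mollifiers k (h j)" and h: "!!j. h j <= 1" "h \<longlonglongrightarrow> 0"
 shows "(%j. (LI z. g z * conv k f (th j) z)) \<longlonglongrightarrow> (LI z. g z * f z)"
proof -
 note [measurable] = sl_borel[OF f(1)]
 define G where "G y = (LI z. g (z + y) * f z)" for y
 let ?y = "%w. upd (ek k) w 0"
 have B0: "0 <= B" using order_trans[OF abs_ge_zero B] .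
 have bm: "\<bar>g z * x\<bar> <= B * \<bar>x\<bar>" for z x unfolding abs_mult by (intro mult_right_mono B abs_ge_zero)
 have cont: "(G \<longlongrightarrow> G 0) (at 0)"
  unfolding tendsto_at_iff_sequentially comp_def
 proof (intro allI impI)
  fix Y :: "nat => 'n tx" assume Y: "Y \<longlonglongrightarrow> 0"
  show "(%n. G (Y n)) \<longlonglongrightarrow> G 0"
   unfolding G_def
  proof (rule integral_dominated_convergence[where w="%z. B * \<bar>f z\<bar>"])
   show "Lint (%z. B * \<bar>f z\<bar>)" using f(2) by simp
   show "AE z in lborel. (%n. g (z + Y n) * f z) \<longlonglongrightarrow> g (z + 0) * f z"
    using c
   proof eventually_elim
    fix z assume z: "isCont g z"
    have "(%n. z + Y n) \<longlonglongrightarrow> z + 0" by (intro tendsto_intros Y)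
    then have "(%n. g (z + Y n)) \<longlonglongrightarrow> g z" using isCont_tendsto_compose[OF z, of "%n. z + Y n"] by simp
    then show "(%n. g (z + Y n) * f z) \<longlonglongrightarrow> g (z + 0) * f z" by (simp add: tendsto_mult_right)
   qed
   show "AE z in lborel. norm (g (z + Y n) * f z) <= B * \<bar>f z\<bar>" for n
    unfolding real_norm_def by (intro AE_I2 bm)
  qed measurable
 qed
 have eq: "(LI z. g z * conv k f (th j) z) = (LI w. (ind (slab (ek k)) w * th j w) * G (?y w))" for j
 proof -
  note k = mollifiersD(1)[OF t[of j]]
  note [measurable] = kern_borel[OF k]
  let ?\<nu> = "%w. ind (slab (ek k)) w * th j w"
  have i1: "Lint (%z. \<bar>f (z - y)\<bar>)" "(LI z. \<bar>f (z - y)\<bar>) = (LI z. \<bar>f z\<bar>)" for y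
  proof -
   have "(NI z. ennreal \<bar>f (z - y)\<bar>) = (NI z. ennreal \<bar>f z\<bar>)"
    by (rule nn_integral_translate) measurable
   then show "Lint (%z. \<bar>f (z - y)\<bar>)" using f(2) by (simp add: integrable_iff_bounded)
   show "(LI z. \<bar>f (z - y)\<bar>) = (LI z. \<bar>f z\<bar>)" by (rule integral_translate) measurable
  qed
  have i2: "Lint (%z. g z * f (z - y))" for y
  proof -
   have "Lint (%z. f (z - y))" using i1(1)[of y] by (subst (asm) integrable_abs_iff) measurable
   then show ?thesis by (rule integrable_bounded_mult[OF _ _ B]) measurable
  qed
  have int: "integrable (lborel \<Otimes>\<^sub>M lborel) (%(w, z). ?\<nu> w * (g z * f (z - ?y w)))"
  proof (rule lborel_pair.Fubini_integrable)
   show "(%(w, z). ?\<nu> w * (g z * f (z - ?y w))) : borel_measurable (lborel \<Otimes>\<^sub>M lborel)" by measurable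
   have "(LI z. norm (case (w, z) of (w, z) => ?\<nu> w * (g z * f (z - ?y w)))) = \<bar>?\<nu> w\<bar> * (LI z. \<bar>g z * f (z - ?y w)\<bar>)" for w
    by (simp add: abs_mult)
   moreover have "Lint (%w. (LI z. \<bar>g z * f (z - ?y w)\<bar>) * \<bar>?\<nu> w\<bar>)"
   proof (rule integrable_bounded_mult[where C="B * (LI z. \<bar>f z\<bar>)"])
    show "Lint (%w. \<bar>?\<nu> w\<bar>)" using kern_integrable[OF k h(1)] by simp
    show "(%w. (LI z. \<bar>g z * f (z - ?y w)\<bar>)) : borel_measurable lborel" by measurable
    fix w
    have "(LI z. \<bar>g z * f (z - ?y w)\<bar>) <= (LI z. B * \<bar>f (z - ?y w)\<bar>)"
     by (intro integral_mono integrable_abs i2 integrable_mult_right i1(1) bm)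
    then show "\<bar>\<integral>z. \<bar>g z * f (z - ?y w)\<bar> \<partial>lborel\<bar> <= B * (LI z. \<bar>f z\<bar>)"
     using i1(2) by (simp add: integral_nonneg_AE)
   qed
   ultimately show "Lint (%w. (LI z. norm (case (w, z) of (w, z) => ?\<nu> w * (g z * f (z - ?y w)))))"
    by (simp add: mult.commute)
   show "AE w in lborel. Lint (%z. case (w, z) of (w, z) => ?\<nu> w * (g z * f (z - ?y w)))"
    using i2 by (intro AE_I2) simp
  qed
  have "(LI z. g z * conv k f (th j) z) = (LI z. (LI w. ?\<nu> w * (g z * f (z - ?y w))))"
  proof (intro Bochner_Integration.integral_cong refl)
   fix z
   have "g z * conv k f (th j) z = (LI w. g z * (ind (slab (ek k)) w * (th j w * f (z - ?y w))))"
    unfolding conv_alt[OF k f(1)] by (rule integral_mult_right_zero[symmetric])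
   also have "... = (LI w. ?\<nu> w * (g z * f (z - ?y w)))"
    by (intro Bochner_Integration.integral_cong refl) (simp only: mult_ac)
   finally show "g z * conv k f (th j) z = (LI w. ?\<nu> w * (g z * f (z - ?y w)))" .
  qed
  also have "... = (LI w. (LI z. ?\<nu> w * (g z * f (z - ?y w))))"
   by (rule lborel_pair.Fubini_integral[OF int])
  also have "... = (LI w. ?\<nu> w * G (?y w))"
  proof (intro Bochner_Integration.integral_cong refl)
   fix w
   have "(LI z. g z * f (z - ?y w)) = (LI z. (%z. g (z + ?y w) * f z) (z - ?y w))" by simp
   also have "... = G (?y w)" unfolding G_def by (rule integral_translate) measurable
   finally show "(LI z. ?\<nu> w * (g z * f (z - ?y w))) = ?\<nu> w * G (?y w)" by simp
  qed
  finally show ?thesis .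
 qed
 have Gm [measurable]: "G : bm" unfolding G_def by measurable
 have Gb: "\<bar>G y\<bar> <= B * (LI z. \<bar>f z\<bar>)" for y
 proof -
  have "\<bar>G y\<bar> <= (LI z. \<bar>g (z + y) * f z\<bar>)" unfolding G_def real_norm_def[symmetric] by (rule integral_norm_bound)
  also have "... <= (LI z. B * \<bar>f z\<bar>)"
  proof (intro integral_mono bm)
   have "Lint (%z. g (z + y) * f z)"
    by (rule integrable_bounded_mult[OF f(2) _ B]) measurable
   then show "Lint (%z. \<bar>g (z + y) * f z\<bar>)" by (rule integrable_abs)
   show "Lint (%z. B * \<bar>f z\<bar>)" using f(2) by simp
  qed
  finally show ?thesis by simp
 qed
 have G0: "(LI z. g z * f z) = G 0" by (simp add: G_def)
 show ?thesis unfolding eq G0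
 proof (rule LIMSEQ_I)
  fix e :: real assume e: "0 < e"
  from LIM_D[OF cont, of "e / 2"] e obtain d where d: "0 < d" "!!y. y ~= 0 ==> norm y < d ==> \<bar>G y - G 0\<bar> < e / 2" by auto
  have d': "norm y < d ==> \<bar>G y - G 0\<bar> <= e / 2" for y using d(2)[of y] e by (cases "y = 0") auto
  let ?n = "real DIM('n tx)"
  have "(%j. ?n * h j) \<longlonglongrightarrow> 0" using tendsto_mult_left[OF h(2), of ?n] by (simp only: mult_zero_right)
  then have "eventually (%j. ?n * h j < d) sequentially" by (rule order_tendstoD(2)[OF _ d(1)])
  then obtain N where N: "!!j. N <= j ==> ?n * h j < d" unfolding eventually_sequentially by blast
  have "norm ((LI w. (ind (slab (ek k)) w * th j w) * G (?y w)) - G 0) < e" if j: "N <= j" for j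
  proof -
   note k = mollifiersD(1)[OF t[of j]]
   note [measurable] = kern_borel[OF k]
   let ?\<nu> = "%w. ind (slab (ek k)) w * th j w"
   have nu: "Lint ?\<nu>" "(LI w. ?\<nu> w) = 1" "!!w. 0 <= ?\<nu> w"
    using kern_integrable[OF k h(1)] mollifiersD(2,3)[OF t[of j]] by auto
   have "Lint (%w. G (?y w) * ?\<nu> w)"
    by (rule integrable_bounded_mult[OF nu(1) _ Gb]) measurable
   then have i: "Lint (%w. ?\<nu> w * G (?y w))" by (simp add: mult.commute)
   have df: "(LI w. ?\<nu> w * G (?y w)) - G 0 = (LI w. ?\<nu> w * G (?y w) - ?\<nu> w * G 0)"
    using nu i by (subst Bochner_Integration.integral_diff) auto
   have "norm ((LI w. ?\<nu> w * G (?y w)) - G 0) <= (LI w. \<bar>?\<nu> w * G (?y w) - ?\<nu> w * G 0\<bar>)"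
    unfolding df real_norm_def[symmetric] by (rule integral_norm_bound)
   also have "... <= (LI w. e / 2 * ?\<nu> w)"
   proof (rule integral_mono)
    show "Lint (%w. \<bar>?\<nu> w * G (?y w) - ?\<nu> w * G 0\<bar>)"
     by (intro integrable_abs Bochner_Integration.integrable_diff i integrable_mult_left nu(1))
    show "Lint (%w. e / 2 * ?\<nu> w)" using nu(1) by (rule integrable_mult_right)
    fix w
    show "\<bar>?\<nu> w * G (?y w) - ?\<nu> w * G 0\<bar> <= e / 2 * ?\<nu> w"
    proof (cases "?\<nu> w = 0")
     case False
     then have nz: "th j w ~= 0" by simp
     \<comment> \<open>The shift has vertical coordinate 0 and tangential coordinates between 0 and
       h j on the support of the kernel, so its length tends to 0 with h j.\<close>
     have "\<bar>?y w \<bullet> b\<bar> <= h j" if b: "b : Basis" for b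
     proof (cases "b = ek k")
      case True
      have "0 <= h j" using kern_supp[OF k nz tau_tang] by linarith
      then show ?thesis using upd_inner[OF ek_Basis[of k] b, of w 0] True by simp
     next
      case F: False
      then have "b : tang k" using b by (simp add: tang_def)
      then show ?thesis using kern_supp[OF k nz, of b] upd_inner[OF ek_Basis[of k] b, of w 0] F by simp
     qed
     then have "norm (?y w) <= (\<Sum>b\<in>(Basis :: ('n tx) set). h j)"
      by (intro order_trans[OF norm_le_l1] sum_mono)
     also have "... < d" using N[OF j] by (simp only: sum_constant)
     finally have "\<bar>G (?y w) - G 0\<bar> <= e / 2" by (rule d')
     then have "?\<nu> w * \<bar>G (?y w) - G 0\<bar> <= ?\<nu> w * (e / 2)" using nu(3) by (rule mult_left_mono)
     moreover have "\<bar>?\<nu> w * G (?y w) - ?\<nu> w * G 0\<bar> = ?\<nu> w * \<bar>G (?y w) - G 0\<bar>"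
      unfolding right_diff_distrib[symmetric] abs_mult[of "?\<nu> w"] by (simp only: abs_of_nonneg[OF nu(3)])
     ultimately show ?thesis by (simp only: mult.commute)
    next
     case True
     show ?thesis by (simp only: True mult_zero_left mult_zero_right diff_self abs_zero order_refl)
    qed
   qed
   also have "... = e / 2" using nu(2) by simp
   finally show ?thesis using e by simp
  qed
  then show "\<exists>N. \<forall>j\<ge>N. norm ((LI w. (ind (slab (ek k)) w * th j w) * G (?y w)) - G 0) < e" by blast
 qed
qed

lemma AE_isCont_box: "AE z in lborel. isCont (ind (box l r) :: 'a::euclidean_space => real) z"
proof -
 have "negligible (frontier (box l r))" by (rule negligible_convex_frontier) (rule convex_box)
 then have "frontier (box l r) : null_sets lborel"
  by (simp add: negligible_iff_null_sets null_sets_completion_iff frontier_def)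
 then show ?thesis by (auto simp: isCont_indicator dest: AE_not_in)
qed

text \<open>Outside countably many null sets the sequence is Cauchy at the points of
  \<open>R\<close>. The limit is taken after multiplication by the indicator of \<open>R\<close>,
  which makes it measurable and zero elsewhere.\<close>

lemma AE_limit:
 fixes F :: "nat => 'a => real"
 assumes [measurable]: "!!j. F j : borel_measurable M" "R : sets M" and C: "0 <= C"
  and Y: "!!e. 0 < e ==> \<exists>N. \<forall>i\<ge>N. \<forall>j\<ge>N. Y i j < (e::real)"
  and F: "!!i j. AE z in M. z : R --> (F i z - F j z)^2 <= C * Y i j"
  and B: "!!j. AE z in M. z : R --> (F j z)^2 <= B"
 obtains g where "g : borel_measurable M" "AE z in M. z : R --> (%j. F j z) \<longlonglongrightarrow> g z & (g z)^2 <= B" "!!z. z ~: R ==> g z = 0"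
proof
 define g where "g z = lim (%j. ind R z * F j z)" for z
 show "g : borel_measurable M" unfolding g_def by measurable
 show "z ~: R ==> g z = 0" for z by (simp add: g_def lim_const)
 have "AE z in M. \<forall>i j. z : R --> (F i z - F j z)^2 <= C * Y i j" unfolding AE_all_countable using F by blast
 moreover have "AE z in M. \<forall>j. z : R --> (F j z)^2 <= B" unfolding AE_all_countable using B by blast
 ultimately show "AE z in M. z : R --> (%j. F j z) \<longlonglongrightarrow> g z & (g z)^2 <= B"
 proof eventually_elim
  fix z assume z: "\<forall>i j. z : R --> (F i z - F j z)^2 <= C * Y i j" and b: "\<forall>j. z : R --> (F j z)^2 <= B"
  show "z : R --> (%j. F j z) \<longlonglongrightarrow> g z & (g z)^2 <= B"
  proof
   assume R: "z : R"
   have "Cauchy (%j. F j z)"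
   proof (rule CauchyI)
    fix e :: real assume e: "0 < e"
    \<comment> \<open>The constant \<open>C\<close> may be 0, hence the quotient by C + 1.\<close>
    then obtain N where N: "\<forall>i\<ge>N. \<forall>j\<ge>N. Y i j < e^2 / (C + 1)" using Y[of "e^2 / (C + 1)"] C by auto
    have "norm (F i z - F j z) < e" if "N <= i" "N <= j" for i j
    proof -
     have "(F i z - F j z)^2 <= C * (e^2 / (C + 1))"
      using z R N that C by (intro order_trans[OF _ mult_left_mono[of "Y i j" "e^2 / (C + 1)" C]]) (auto intro: less_imp_le)
     also have "... < e^2" using e C by (simp add: field_simps)
     finally show ?thesis using power2_less_imp_less[of "\<bar>F i z - F j z\<bar>" e] e by simp
    qed
    then show "\<exists>N. \<forall>i\<ge>N. \<forall>j\<ge>N. norm (F i z - F j z) < e" by blast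
   qed
   then have "convergent (%j. F j z)" by (rule real_Cauchy_convergent)
   then have c: "(%j. F j z) \<longlonglongrightarrow> g z" using R by (simp add: g_def convergent_LIMSEQ_iff)
   then have "(%j. (F j z)^2) \<longlonglongrightarrow> (g z)^2" by (intro tendsto_intros)
   then have "(g z)^2 <= B" using b R by (intro LIMSEQ_le_const2) auto
   with c show "(%j. F j z) \<longlonglongrightarrow> g z & (g z)^2 <= B" by blast
  qed
 qed
qed

text \<open>The bound turns pointwise convergence into convergence of integrals over boxes inside
  \<open>R\<close>, whose limits are also those of \<open>f\<close>; integrals over boxes determine
  a function.\<close>

lemma AE_eq_limit:
 fixes F :: "nat => 'a::euclidean_space => real"
 assumes R: "open R" "emeasure lborel R < \<infinity>" and Fm: "!!j. F j : bm" and g: "g : bm"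
  and lim: "AE z in lborel. z : R --> (%j. F j z) \<longlonglongrightarrow> g z & (g z)^2 <= B"
  and b: "!!j. AE z in lborel. z : R --> (F j z)^2 <= B"
  and f: "Lint f"
  and box: "!!l r. box l r \<subseteq> R ==> (%j. (LI z. ind (box l r) z * F j z)) \<longlonglongrightarrow> (LI z. ind (box l r) z * f z)"
 shows "AE z in lborel. z : R --> f z = g z"
proof -
 note [measurable] = Fm g borel_open[OF R(1)]
 have sq: "x^2 <= B ==> \<bar>x\<bar> <= sqrt B" for x by (metis real_sqrt_abs real_sqrt_le_mono)
 have iR: "Lint (%z. sqrt B * ind R z)" using R(2) by simp
 have ig: "Lint (%z. ind R z * g z)"
 proof (rule Bochner_Integration.integrable_bound[OF iR])
  show "AE z in lborel. norm (ind R z * g z) <= norm (sqrt B * ind R z)"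
   using lim by eventually_elim (auto simp: indicator_def intro: order_trans[OF sq abs_ge_self])
 qed measurable
 have "AE z in lborel. z : R --> f z - g z = 0"
 proof (rule AE_zero_of_box_integrals_on[OF R(1)])
  show "Lint (%z. ind R z * (f z - g z))"
   using Bochner_Integration.integrable_diff[OF integrable_indicator_times[OF _ f, of R] ig] by (simp add: right_diff_distrib)
  fix l r :: 'a assume lr: "box l r \<subseteq> R"
  have i: "Lint (%z. ind (box l r) z * f z)" "Lint (%z. ind (box l r) z * (ind R z * g z))"
   by (intro integrable_indicator_times f ig; simp)+
  have e: "ind (box l r) z * (ind R z * g z) = ind (box l r) z * g z" for z using lr by (auto simp: indicator_def)
  have "(%j. (LI z. ind (box l r) z * F j z)) \<longlonglongrightarrow> (LI z. ind (box l r) z * g z)"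
  proof (rule integral_dominated_convergence[OF _ _ iR])
   show "AE z in lborel. (%j. ind (box l r) z * F j z) \<longlonglongrightarrow> ind (box l r) z * g z"
    using lim by eventually_elim (use lr in \<open>auto simp: indicator_def\<close>)
   show "AE z in lborel. norm (ind (box l r) z * F j z) <= sqrt B * ind R z" for j
    using b[of j]
   proof eventually_elim
    fix z assume z: "z : R --> (F j z)^2 <= B"
    show "norm (ind (box l r) z * F j z) <= sqrt B * ind R z"
    proof (cases "z : R")
     case True
     then have "\<bar>F j z\<bar> <= sqrt B" using z sq by blast
     then show ?thesis using True order_trans[OF abs_ge_zero, of "F j z" "sqrt B"] by (simp add: indicator_def)
    qed (use lr in \<open>auto simp: indicator_def\<close>)
   qed
  qed measurable
  then have "(LI z. ind (box l r) z * g z) = (LI z. ind (box l r) z * f z)"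
   using box[OF lr] LIMSEQ_unique by blast
  then show "(LI z. ind (box l r) z * (f z - g z)) = 0"
   using Bochner_Integration.integral_diff[OF i] unfolding e by (simp add: right_diff_distrib)
 qed
 then show ?thesis by simp
qed

lemma supp_in_dir_deriv:
 assumes "supp_in \<phi> U" shows "supp_in (dd \<phi> b) U"
proof -
 obtain C where C: "compact C" "C \<subseteq> U" "!!w. w ~: C ==> \<phi> w = 0" using assms by (auto simp: supp_in_def)
 have "dd \<phi> b w = 0" if w: "w ~: C" for w
 proof -
  have o: "open (- C)" "w : - C" using C(1) w by (auto intro: compact_imp_closed)
  have "(\<phi> has_derivative (%_. 0)) (at w)"
   by (rule has_derivative_transform_within_open[OF has_derivative_const[of 0] o]) (use C in auto)
  then show ?thesis by (rule dir_deriv_eq)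
 qed
 then show ?thesis unfolding supp_in_def using C by blast
qed

lemma supp_in_bounded:
 assumes "supp_in \<phi> U" "continuous_on UNIV \<phi>" shows "\<exists>B. \<forall>z. \<bar>\<phi> z\<bar> <= B"
proof -
 obtain C where C: "compact C" "!!w. w ~: C ==> \<phi> w = 0" using assms by (auto simp: supp_in_def)
 have "bounded (\<phi> ` C)" by (intro compact_imp_bounded compact_continuous_image C continuous_on_subset[OF assms(2)]) auto
 then obtain B where "!!z. z : C ==> \<bar>\<phi> z\<bar> <= B" by (auto simp: bounded_iff)
 then have "\<bar>\<phi> z\<bar> <= max B 0" for z using C(2)[of z] by (cases "z : C") force+
 then show ?thesis by blast
qed

text \<open>The constants of the energy method outside their locale. Their only arguments are the
  dimension, as a type, and \<Lambda>, which exhibits their independence of coefficients, weight and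
  solution. The absolute value makes them nonnegative for every \<Lambda>.\<close>

definition csup :: "'n::finite itself => real => real" where
 "csup t \<Lambda> = \<bar>tangential_family.Kv t \<Lambda>\<bar>"
definition ctime :: "'n::finite itself => real => real" where
 "ctime t \<Lambda> = \<bar>tangential_family.Kv t \<Lambda> * tangential_family.ke t \<Lambda> (tangential_family.NN t)\<bar>"
definition cgrad :: "'n::finite itself => real => real" where
 "cgrad t \<Lambda> = \<bar>tangential_family.Kp t \<Lambda>\<bar>"

lemma const_nonneg: "0 <= csup t \<Lambda>" "0 <= ctime t \<Lambda>" "0 <= cgrad t \<Lambda>"
 by (simp_all add: csup_def ctime_def cgrad_def)

lemma dir_deriv_diff:
 "f differentiable (at x) ==> g differentiable (at x) ==> dd (%x. f x - g x) b x = dd f b x - dd g b x"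
 by (rule dir_deriv_eq[OF has_derivative_diff[OF has_derivative_dir_deriv has_derivative_dir_deriv]])

lemma kern_diff: "kern k h th ==> kern k h th' ==> kern k h (%w. th w - th' w)"
 using kern_add[OF _ kern_cmult[of k h th' "- 1"], of th] by simp

lemma conv_diff: "kern k h th ==> kern k h th' ==> sl k f ==> conv k f (%w. th w - th' w) z = conv k f th z - conv k f th' z"
 using conv_add[OF _ kern_cmult[of k h th' "- 1"], of th f z] conv_cmult[of k f "- 1" th' z] by simp

lemma norm_squared_sum: "(norm (x :: real ^ 'n::finite))^2 = (\<Sum>l\<in>UNIV. (x $ l)^2)"
 unfolding power2_norm_eq_inner inner_vec_def by (simp add: power2_eq_square)

text \<open>The interior of the half cylinder of radius 1, from which it differs only by the null
  face t = 0.\<close>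

definition Rp :: "'n::finite => ('n tx) set" where
 "Rp k = {z. - 1 < fst z & fst z < 0 & norm (cross k z) < 1 & 0 < ht k z & ht k z < 1}"

lemma Rp_open: "open (Rp k)"
proof -
 have c: "cross k z = snd z - ht k z *\<^sub>R axis k 1" for z :: "'a tx"
  by (simp add: cross_def vec_eq_iff axis_def)
 show ?thesis unfolding Rp_def c
  by (intro open_Collect_conj open_Collect_less continuous_intros)
qed

lemma Rp_Qp: "z : Rp k ==> z : Qp k" by (auto simp: Rp_def Qp_def)

lemma Rp_finite: "emeasure lborel (Rp k) < \<infinity>"
proof -
 have "Rp k \<subseteq> cbox (-1, \<chi> l. -1) (0, \<chi> l. 1)"
 proof
  fix z assume z: "z : Rp k"
  have "-1 <= snd z $ l & snd z $ l <= 1" for l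
  proof (cases "l = k")
   case True then show ?thesis using z by (auto simp: Rp_def)
  next
   case False then show ?thesis using z component_le_norm_cart[of "cross k z" l] by (auto simp: Rp_def cross_nth)
  qed
  then show "z : cbox (-1, \<chi> l. -1) (0, \<chi> l. 1)"
   using z by (cases z) (auto simp: Rp_def mem_box_cart cbox_Pair_eq)
 qed
 then have "emeasure lborel (Rp k) <= emeasure lborel (cbox (-1, \<chi> l. -1) (0 :: real, (\<chi> l. 1) :: real ^ 'a))"
  by (intro emeasure_mono) auto
 also have "... < \<infinity>" by (rule emeasure_lborel_cbox_finite)
 finally show ?thesis .
qed

section \<open>Bounds for mollified solutions and a Cauchy sequence of kernels\<close>

context conormal_solution
begin

abbreviation "Nf f th \<equiv> (LI z. \<mu> (ht k z) * (conv k f th z)^2)"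
definition En :: "('n tx => real) => real" where
 "En th = (\<Sum>l\<in>UNIV. Nf (%z. Du z $ l) th) + lam * Nf u th"
abbreviation "U2 \<equiv> (LI z. \<mu> (ht k z) * (u z)^2)"
definition Ei :: real where
 "Ei = (\<Sum>l\<in>UNIV. (LI z. \<mu> (ht k z) * (Du z $ l)^2)) + lam * U2"

lemma h0_le_1: "h0 <= 1"
proof -
 have "1 * h0 <= real CARD('n) * h0" using h0(1) by (intro mult_right_mono) (auto simp: Suc_leI)
 then show ?thesis using h0(2) by simp
qed

lemmas Nf_int = conv_Young(1)[OF _ h0_le_1 u_sl mu_pos mu_borel u2]
lemmas Nfl_int = conv_Young(1)[OF _ h0_le_1 Du_sl mu_pos mu_borel Du2]

lemma Nf_nonneg: "0 <= Nf f th"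
 using mu_pos by (intro integral_nonneg_AE AE_I2) (auto simp: less_imp_le)
lemma En_nonneg: "0 <= En th"
 unfolding En_def by (intro add_nonneg_nonneg sum_nonneg mult_nonneg_nonneg lam Nf_nonneg)

text \<open>The energy method is instantiated with the time of the point \<open>z\<close> itself as
  terminal time. Its constants do not depend on \<open>t0\<close>, so the bounds are uniform up to t
  = 0.\<close>

lemma sup_slices:
 assumes J: "(LI s. ind {0<..<3} s / \<mu> s) <= J"
  and K: "AE s in lborel. s : {0<..<1} --> (LI r. ind {0<..<s} r * \<mu> r) <= K^2 * J * (\<mu> s)^2"
  and t: "kern k h0 th" and z: "- 1 <= fst z" "fst z < 0" "norm (cross k z) <= 1"
 shows "AE s in lborel. s : {0<..<1} --> (vv th (upd (ek k) z s))^2 <= csup TYPE('n) \<Lambda> * J * Nf u th"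
  and "AE s in lborel. s : {0<..<1} --> (vv (dd th tau) (upd (ek k) z s))^2 <= ctime TYPE('n) \<Lambda> * J * En th"
  and "AE s in lborel. s : {0<..<1} --> (norm (pp th (upd (ek k) z s)))^2 <= cgrad TYPE('n) \<Lambda> * (1 + K^2) * J * En th"
proof -
 interpret F: tangential_family k \<Lambda> lam "fst z" \<mu> a0 A "{th. kern k h0 th}" vv pp "%b th. dd th b" mm
  by (rule tf[OF z(2)])
 have tS: "th : {th. kern k h0 th}" using t by simp
 have T: "F.T z ~= 0" by (simp add: F.T_def)
 have J0: "0 <= J"
 proof -
  have "0 <= (LI s. ind {0<..<3} s / \<mu> s)"
   using mu_pos by (intro integral_nonneg_AE AE_I2) (auto simp: less_imp_le)
  then show ?thesis using J by simp
 qed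
 \<comment> \<open>For t <= 0 the cutoff is at most one, so dropping it together with
   \<open>T\<close> bounds local energies by global ones.\<close>
 have Wle: "F.Wn f 0 <= (LI z. \<mu> (ht k z) * f z)" if i: "Lint (%z. \<mu> (ht k z) * f z)" and f: "!!z. 0 <= f z" for f
  unfolding F.Wn_def
 proof (rule integral_mono'[OF i])
  fix y
  have mf: "0 <= \<mu> (ht k y) * f y" using mu_pos[of "ht k y"] f[of y] by simp
  then show "0 <= \<mu> (ht k y) * f y" .
  show "F.T y * (\<mu> (ht k y) * (zeta k y ^ Suc 0 * f y)) <= \<mu> (ht k y) * f y"
  proof (cases "F.T y = 0")
   case False
   then have T1: "F.T y = 1" "fst y <= 0" using F.T_cases[of y] z(2) by auto
   have "zeta k y * (\<mu> (ht k y) * f y) <= 1 * (\<mu> (ht k y) * f y)" by (rule mult_right_mono[OF zeta_le_1[OF T1(2)] mf])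
   then show ?thesis using T1(1) by (simp add: mult_ac)
  qed (use mf in simp)
 qed
 have Wv: "F.Wn (%z. (vv th z)^2) 0 <= Nf u th" by (rule Wle[OF Nf_int[OF t]]) simp
 have "F.Wn (F.pn th) 0 <= (\<Sum>l\<in>UNIV. Nf (%z. Du z $ l) th)"
 proof -
  have e: "\<mu> (ht k y) * F.pn th y = (\<Sum>l\<in>UNIV. \<mu> (ht k y) * (conv k (%z. Du z $ l) th y)^2)" for y
   unfolding F.pn_def norm_squared_sum sum_distrib_left pp_def vec_lambda_beta ..
  have "Lint (%y. \<mu> (ht k y) * F.pn th y)"
   unfolding e by (intro Bochner_Integration.integrable_sum Nfl_int[OF t])
  then have "F.Wn (F.pn th) 0 <= (LI y. \<mu> (ht k y) * F.pn th y)" by (rule Wle) (simp add: F.pn_def)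
  also have "... = (\<Sum>l\<in>UNIV. Nf (%z. Du z $ l) th)"
   unfolding e by (rule Bochner_Integration.integral_sum) (rule Nfl_int[OF t])
  finally show ?thesis .
 qed
 then have I: "F.I0 th <= En th"
  unfolding F.I0_def En_def using mult_left_mono[OF Wv lam] by linarith
 have I0: "0 <= F.I0 th"
  unfolding F.I0_def by (intro add_nonneg_nonneg mult_nonneg_nonneg lam F.Wn_nonneg) (auto simp: F.pn_def)
 have W0: "0 <= F.Wn (%z. (vv th z)^2) 0" by (rule F.Wn_nonneg) simp
 have mono: "c * j * a <= \<bar>c\<bar> * j * b" if "a <= b" "0 <= a" "0 <= j" for a b c j :: real
 proof -
  have "c * (j * a) <= \<bar>c\<bar> * (j * b)" using that by (intro mult_mono mult_left_mono) auto
  then show ?thesis by (simp add: mult.assoc)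
 qed
 show "AE s in lborel. s : {0<..<1} --> (vv th (upd (ek k) z s))^2 <= csup TYPE('n) \<Lambda> * J * Nf u th"
  using F.sup_v[OF J_int J tS T z(1,3), of 0] mono[OF Wv W0 J0, of F.Kv] unfolding csup_def
  by (auto elim!: eventually_mono)
 show "AE s in lborel. s : {0<..<1} --> (vv (dd th tau) (upd (ek k) z s))^2 <= ctime TYPE('n) \<Lambda> * J * En th"
  using F.sup_tang[OF J_int J tS T z(1,3) tau_tang] mono[OF I I0 J0, of "F.Kv * F.ke F.NN"] unfolding ctime_def
  by (auto elim!: eventually_mono)
 have "0 <= (1 + K^2) * J" using J0 by simp
 from mono[OF I I0 this, of F.Kp] 
 show "AE s in lborel. s : {0<..<1} --> (norm (pp th (upd (ek k) z s)))^2 <= cgrad TYPE('n) \<Lambda> * (1 + K^2) * J * En th"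
  using F.sup_grad[OF J_int J U_int K tS T z(1,3)] unfolding cgrad_def F.pn_def
  by (auto elim!: eventually_mono simp: mult.assoc)
qed

text \<open>On every vertical line that meets \<open>Rp\<close> the bound holds for almost all
  heights; \<open>AE_line\<close> assembles the lines.\<close>

lemma sup_AE:
 assumes J: "(LI s. ind {0<..<3} s / \<mu> s) <= J"
  and K: "AE s in lborel. s : {0<..<1} --> (LI r. ind {0<..<s} r * \<mu> r) <= K^2 * J * (\<mu> s)^2"
  and t: "kern k h0 th"
 shows "AE z in lborel. z : Rp k --> (vv th z)^2 <= csup TYPE('n) \<Lambda> * J * Nf u th"
  and "AE z in lborel. z : Rp k --> (vv (dd th tau) z)^2 <= ctime TYPE('n) \<Lambda> * J * En th"
  and "AE z in lborel. z : Rp k --> (norm (pp th z))^2 <= cgrad TYPE('n) \<Lambda> * (1 + K^2) * J * En th"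
proof -
 note [measurable] = vv_borel[OF t] vv_borel[OF kern_dir[OF t tau_tang]] borel_open[OF Rp_open[of k]]
 have [measurable]: "(%z. (norm (pp th z))^2) : bm"
  unfolding norm_squared_sum using ppl_borel[OF t] by measurable
 have *: "AE z in lborel. z : Rp k --> f z <= B" if f [measurable]: "f : bm"
  and s: "!!z. - 1 <= fst z ==> fst z < 0 ==> norm (cross k z) <= 1 ==> AE s in lborel. s : {0<..<1} --> f (upd (ek k) z s) <= B" for f :: "_ => real" and B
 proof (rule AE_line[OF ek_Basis[of k]])
  fix z
  show "AE s in lborel. upd (ek k) z s : Rp k --> f (upd (ek k) z s) <= B"
  proof (cases "- 1 <= fst z & fst z < 0 & norm (cross k z) <= 1")
   case True
   then have "AE s in lborel. s : {0<..<1} --> f (upd (ek k) z s) <= B" using s by blast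
   then show ?thesis by eventually_elim (auto simp: Rp_def)
  qed (auto simp: Rp_def)
 qed measurable
 show "AE z in lborel. z : Rp k --> (vv th z)^2 <= csup TYPE('n) \<Lambda> * J * Nf u th"
  by (rule *[OF _ sup_slices(1)[OF J K t]]) measurable
 show "AE z in lborel. z : Rp k --> (vv (dd th tau) z)^2 <= ctime TYPE('n) \<Lambda> * J * En th"
  by (rule *[OF _ sup_slices(2)[OF J K t]]) measurable
 show "AE z in lborel. z : Rp k --> (norm (pp th z))^2 <= cgrad TYPE('n) \<Lambda> * (1 + K^2) * J * En th"
  by (rule *[OF _ sup_slices(3)[OF J K t]]) measurable
qed

text \<open>Young's inequality for a nonnegative kernel, whose mass is one.\<close>

lemma mollifier_energy:
 assumes t: "th : mollifiers k h0"
 shows "Nf u th <= U2" "En th <= Ei"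
proof -
 have M: "(LI w. ind (slab (ek k)) w * \<bar>th w\<bar>) = 1"
  using mollifiersD(3)[OF t] mollifiersD(2)[OF t] by (simp only: abs_of_nonneg)
 show u: "Nf u th <= U2"
  using conv_Young(2)[OF mollifiersD(1)[OF t] h0_le_1 u_sl mu_pos mu_borel u2] unfolding M by simp
 have "Nf (%z. Du z $ l) th <= (LI z. \<mu> (ht k z) * (Du z $ l)^2)" for l
  using conv_Young(2)[OF mollifiersD(1)[OF t] h0_le_1 Du_sl mu_pos mu_borel Du2] unfolding M by simp
 then show "En th <= Ei" unfolding En_def Ei_def by (intro add_mono sum_mono mult_left_mono u lam)
qed

lemma Nf_parallelogram:
 assumes t: "kern k h0 th" "kern k h0 th'" and f: "sl k f" and f2: "Lint (%z. \<mu> (ht k z) * (f z)^2)"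
 shows "Nf f (%w. th w - th' w) = 2 * Nf f th + 2 * Nf f th' - 4 * Nf f (%w. (1 / 2) * (th w + th' w))"
proof -
 have tm: "kern k h0 (%w. (1 / 2) * (th w + th' w))" by (intro kern_cmult kern_add t)
 note i = conv_Young(1)[OF _ h0_le_1 f mu_pos mu_borel f2]
 have e: "\<mu> (ht k z) * (conv k f (%w. th w - th' w) z)^2 = 2 * (\<mu> (ht k z) * (conv k f th z)^2) + 2 * (\<mu> (ht k z) * (conv k f th' z)^2)
   - 4 * (\<mu> (ht k z) * (conv k f (%w. (1 / 2) * (th w + th' w)) z)^2)" for z
  unfolding conv_diff[OF t f] conv_cmult conv_add[OF t f] by (simp add: power2_eq_square algebra_simps)
 show ?thesis unfolding e
  by (subst Bochner_Integration.integral_diff Bochner_Integration.integral_add,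
    intro Bochner_Integration.integrable_add integrable_mult_right i t tm,
    intro integrable_mult_right i t tm)+ simp
qed

text \<open>The energy, which controls u_t and Du, and the plain norm of u are minimised together.
  Both are quadratic in the kernel, so the parallelogram identity holds for their sum and one
  sequence serves all three limits.\<close>

lemma Cauchy_mollifiers:
 "\<exists>th. (\<forall>j. th j : mollifiers k (h0 / real (Suc j))) \<and>
  (\<forall>e>0. \<exists>N. \<forall>i\<ge>N. \<forall>j\<ge>N. En (%w. th i w - th j w) + Nf u (%w. th i w - th j w) < e)"
proof (rule minimizing_sequence[where X="%th. En th + Nf u th" and E="Ei + U2"])
 have hp: "0 < h0 / real (Suc j)" "h0 / real (Suc j) <= 1" for j
 proof -
  show "0 < h0 / real (Suc j)" using h0(1) by simp
  have "h0 / real (Suc j) <= h0" using h0(1) by (simp add: divide_le_eq mult_le_cancel_left1)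
  then show "h0 / real (Suc j) <= 1" using h0_le_1 by linarith
 qed
 show "mollifiers k (h0 / real (Suc j)) ~= {}" for j by (rule mollifiers_nonempty[OF hp])
 show "mollifiers k (h0 / real (Suc j)) \<subseteq> mollifiers k (h0 / real (Suc i))" if "i <= j" for i j
  using that h0(1) by (intro mollifiers_mono divide_left_mono) auto
 fix th assume "th : mollifiers k (h0 / real (Suc 0))"
 then have t: "th : mollifiers k h0" by simp
 show "0 <= En th + Nf u th" by (intro add_nonneg_nonneg En_nonneg Nf_nonneg)
 show "En th + Nf u th <= Ei + U2" by (intro add_mono mollifier_energy t)
 fix th' assume "th' : mollifiers k (h0 / real (Suc 0))"
 then have t': "th' : mollifiers k h0" by simp
 note p = Nf_parallelogram[OF mollifiersD(1)[OF t] mollifiersD(1)[OF t']]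
 show "En (%w. th w - th' w) + Nf u (%w. th w - th' w)
   <= 2 * (En th + Nf u th) + 2 * (En th' + Nf u th') - 4 * (En (%w. (1 / 2) * (th w + th' w)) + Nf u (%w. (1 / 2) * (th w + th' w)))"
  unfolding En_def p[OF u_sl u2] p[OF Du_sl Du2]
  by (simp add: sum.distrib sum_subtractf sum_distrib_left[symmetric] algebra_simps)
next
 fix i th th' assume t: "th : mollifiers k (h0 / real (Suc i))" "th' : mollifiers k (h0 / real (Suc i))"
 have "h0 / real (Suc i) <= h0" using h0(1) by (simp add: divide_le_eq mult_le_cancel_left1)
 then show "(%w. (1 / 2) * (th w + th' w)) : mollifiers k (h0 / real (Suc i))"
  using h0_le_1 by (intro mollifiers_mid t) linarith
qed

end

section \<open>Passage to the limit\<close>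

context conormal_solution
begin

text \<open>The bounds of \<open>sup_AE\<close> are used twice: for each mollifier, which gives a
  uniform bound, and for the difference of two of them, which makes the sequence Cauchy almost
  everywhere. Pairings with boxes identify the limits.\<close>

theorem interior_estimates:
 assumes J: "(LI s. ind {0<..<3} s / \<mu> s) <= J"
  and K: "AE s in lborel. s : {0<..<1} --> (LI r. ind {0<..<s} r * \<mu> r) <= K^2 * J * (\<mu> s)^2"
 shows "AE z in lborel. z : Rp k --> (u z)^2 <= csup TYPE('n) \<Lambda> * J * U2"
  and "AE z in lborel. z : Rp k --> (norm (Du z))^2 <= cgrad TYPE('n) \<Lambda> * (1 + K^2) * J * Ei"
  and "\<exists>ut. ut : bm & (AE z in lborel. z : Rp k --> (ut z)^2 <= ctime TYPE('n) \<Lambda> * J * Ei)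
   & (\<forall>z. z ~: Rp k --> ut z = 0)
   & (\<forall>\<phi>. smooth \<phi> --> supp_in \<phi> (Rp k) --> (LI z. u z * dd \<phi> tau z) = - (LI z. ut z * \<phi> z))"
proof -
 have J0: "0 <= J"
 proof -
  have "0 <= (LI s. ind {0<..<3} s / \<mu> s)"
   using mu_pos by (intro integral_nonneg_AE AE_I2) (auto simp: less_imp_le)
  then show ?thesis using J by simp
 qed
 obtain th where t: "!!j. th j : mollifiers k (h0 / real (Suc j))"
  and ca: "!!e. 0 < e ==> \<exists>N. \<forall>i\<ge>N. \<forall>j\<ge>N. En (%w. th i w - th j w) + Nf u (%w. th i w - th j w) < e"
  using Cauchy_mollifiers by blast
 define Y where "Y i j = En (%w. th i w - th j w) + Nf u (%w. th i w - th j w)" for i j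
 note ca = ca[folded Y_def]
 have hj: "h0 / real (Suc j) <= h0" for j using h0(1) by (simp add: divide_le_eq mult_le_cancel_left1)
 have t0: "th j : mollifiers k h0" for j using t mollifiers_mono[OF hj] by blast
 note kt = mollifiersD(1)[OF t0]
 have kd: "kern k h0 (%w. th i w - th j w)" for i j by (intro kern_diff kt)
 have hl: "(%j. h0 / real (Suc j)) \<longlonglongrightarrow> 0"
  using tendsto_mult_left[OF LIMSEQ_Suc[OF lim_1_over_n], of h0] by simp
 have h1: "h0 / real (Suc j) <= 1" for j using hj[of j] h0_le_1 by linarith
 note [measurable] = borel_open[OF Rp_open[of k]]
 have YE: "En (%w. th i w - th j w) <= Y i j" "Nf u (%w. th i w - th j w) <= Y i j" for i j
  unfolding Y_def using En_nonneg Nf_nonneg by simp_all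
 define Cu Cg Ct where "Cu = csup TYPE('n) \<Lambda> * J" and "Cg = cgrad TYPE('n) \<Lambda> * (1 + K^2) * J" and "Ct = ctime TYPE('n) \<Lambda> * J"
 have C0: "0 <= Cu" "0 <= Cg" "0 <= Ct" unfolding Cu_def Cg_def Ct_def using J0 const_nonneg by (auto intro!: mult_nonneg_nonneg)
 note S = sup_AE[OF J K, folded Cu_def Cg_def Ct_def]
 have ev: "AE z in lborel. z : Rp k --> f z <= c * b" if "AE z in lborel. z : Rp k --> f z <= c * a" "a <= b" "0 <= c" for f :: "'n tx => real" and a b c
  using that(1) by eventually_elim (use mult_left_mono[OF that(2,3)] in \<open>auto intro: order_trans\<close>)
 have box_lim: "(%j. (LI z. ind (box l r) z * conv k f (th j) z)) \<longlonglongrightarrow> (LI z. ind (box l r) z * f z)"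
  if "sl k f" "Lint f" for f l r
  by (rule conv_pairing_tendsto[OF that _ _ AE_isCont_box t h1 hl, where B=1]) (auto simp: indicator_def)

 have bu: "AE z in lborel. z : Rp k --> (vv (th j) z)^2 <= Cu * U2" for j
  by (rule ev[OF S(1)[OF kt] mollifier_energy(1)[OF t0] C0(1)])
 have dv: "AE z in lborel. z : Rp k --> (vv (th i) z - vv (th j) z)^2 <= Cu * Y i j" for i j
  using ev[OF S(1)[OF kd] YE(2) C0(1), of i j] by (simp only: conv_diff[OF kt kt u_sl])
 have Rs: "Rp k : sets lborel" by simp
 have m1: "vv (th j) : borel_measurable lborel" for j using vv_borel[OF kt] by simp
 obtain g where g: "g : borel_measurable lborel" "AE z in lborel. z : Rp k --> (%j. vv (th j) z) \<longlonglongrightarrow> g z & (g z)^2 <= Cu * U2"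
  by (rule AE_limit[OF m1 Rs C0(1) ca dv bu]) (assumption, rule that, assumption+)
 have "AE z in lborel. z : Rp k --> u z = g z"
  using g(1) by (intro AE_eq_limit[OF Rp_open Rp_finite vv_borel[OF kt] _ g(2) bu u_L1(1) box_lim[OF u_sl u_L1(1)]]) simp
 with g(2) show "AE z in lborel. z : Rp k --> (u z)^2 <= csup TYPE('n) \<Lambda> * J * U2"
  unfolding Cu_def[symmetric] by eventually_elim auto

 have cn: "(pp th' z $ l)^2 <= (norm (pp th' z))^2" for th' z l
  using power_mono[OF component_le_norm_cart[of "pp th' z" l], of 2] by simp
 have bp: "AE z in lborel. z : Rp k --> (norm (pp (th j) z))^2 <= Cg * Ei" for j
  by (rule ev[OF S(3)[OF kt] mollifier_energy(2)[OF t0] C0(2)])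
 have bpl: "AE z in lborel. z : Rp k --> (pp (th j) z $ l)^2 <= Cg * Ei" for j l
  using bp[of j] by eventually_elim (use cn order_trans in blast)
 have dpl: "AE z in lborel. z : Rp k --> (pp (th i) z $ l - pp (th j) z $ l)^2 <= Cg * Y i j" for i j l
 proof -
  have e: "pp (%w. th i w - th j w) z $ l = pp (th i) z $ l - pp (th j) z $ l" for z
   unfolding pp_def vec_lambda_beta by (rule conv_diff[OF kt kt Du_sl])
  show ?thesis using ev[OF S(3)[OF kd] YE(1) C0(2), of i j]
   by eventually_elim (use cn[of "%w. th i w - th j w" _ l] order_trans in \<open>unfold e, blast\<close>)
 qed
 \<comment> \<open>Convergence is proved for each component, but the bound passes to the limit for
   the full norm, so no factor n is lost.\<close>
 have "AE z in lborel. z : Rp k --> (%j. pp (th j) z $ l) \<longlonglongrightarrow> Du z $ l" for l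
 proof -
  have m2: "(%z. pp (th j) z $ l) : borel_measurable lborel" for j using ppl_borel[OF kt] by simp
  obtain g where g: "g : borel_measurable lborel" "AE z in lborel. z : Rp k --> (%j. pp (th j) z $ l) \<longlonglongrightarrow> g z & (g z)^2 <= Cg * Ei"
   by (rule AE_limit[OF m2 Rs C0(2) ca dpl bpl]) (assumption, rule that, assumption+)
  have "AE z in lborel. z : Rp k --> Du z $ l = g z"
  proof (rule AE_eq_limit[OF Rp_open Rp_finite ppl_borel[OF kt] _ g(2) bpl Du_L1(1)])
   show "g : bm" using g(1) by simp
   show "(%j. (LI z. ind (box a b) z * pp (th j) z $ l)) \<longlonglongrightarrow> (LI z. ind (box a b) z * Du z $ l)" for a b
    unfolding pp_def vec_lambda_beta by (rule box_lim[OF Du_sl Du_L1(1)])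
  qed
  with g(2) show ?thesis by eventually_elim auto
 qed
 then have "AE z in lborel. \<forall>l\<in>UNIV. z : Rp k --> (%j. pp (th j) z $ l) \<longlonglongrightarrow> Du z $ l"
  by (subst AE_finite_all) auto
 then have "AE z in lborel. \<forall>l. z : Rp k --> (%j. pp (th j) z $ l) \<longlonglongrightarrow> Du z $ l" by simp
 moreover have "AE z in lborel. \<forall>j. z : Rp k --> (norm (pp (th j) z))^2 <= Cg * Ei" unfolding AE_all_countable using bp by blast
 ultimately show "AE z in lborel. z : Rp k --> (norm (Du z))^2 <= cgrad TYPE('n) \<Lambda> * (1 + K^2) * J * Ei"
  unfolding Cg_def[symmetric]
 proof eventually_elim
  fix z assume z: "\<forall>l. z : Rp k --> (%j. pp (th j) z $ l) \<longlonglongrightarrow> Du z $ l" and b: "\<forall>j. z : Rp k --> (norm (pp (th j) z))^2 <= Cg * Ei"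
  show "z : Rp k --> (norm (Du z))^2 <= Cg * Ei"
  proof
   assume R: "z : Rp k"
   have "(%j. \<Sum>l\<in>UNIV. (pp (th j) z $ l)^2) \<longlonglongrightarrow> (\<Sum>l\<in>UNIV. (Du z $ l)^2)"
    using z R by (intro tendsto_sum tendsto_power) blast
   then show "(norm (Du z))^2 <= Cg * Ei"
    using b R unfolding norm_squared_sum by (intro LIMSEQ_le_const2) auto
  qed
 qed

 \<comment> \<open>For the time derivative there is no given function to compare with: the limit of
   the mollified derivatives defines \<open>ut\<close>, and integration by parts is carried to the
   limit.\<close>
 let ?w = "%j. vv (dd (th j) tau)"
 note kt' = kern_dir[OF kt tau_tang]
 have bw: "AE z in lborel. z : Rp k --> (?w j z)^2 <= Ct * Ei" for j
  by (rule ev[OF S(2)[OF kt] mollifier_energy(2)[OF t0] C0(3)])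
 have dw: "AE z in lborel. z : Rp k --> (?w i z - ?w j z)^2 <= Ct * Y i j" for i j
 proof -
  have "dd (%w. th i w - th j w) tau = (%w. dd (th i) tau w - dd (th j) tau w)"
   by (intro ext dir_deriv_diff smooth_differentiable kern_smooth[OF kt])
  then show ?thesis using ev[OF S(2)[OF kd] YE(1) C0(3), of i j] by (simp only: conv_diff[OF kt' kt' u_sl])
 qed
 have m3: "?w j : borel_measurable lborel" for j using vv_borel[OF kt'] by simp
 obtain ut where ut: "ut : borel_measurable lborel" "AE z in lborel. z : Rp k --> (%j. ?w j z) \<longlonglongrightarrow> ut z & (ut z)^2 <= Ct * Ei" "!!z. z ~: Rp k ==> ut z = 0"
  by (rule AE_limit[OF m3 Rs C0(3) ca dw bw]) (assumption, rule that, assumption+)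
 show "\<exists>ut. ut : bm & (AE z in lborel. z : Rp k --> (ut z)^2 <= ctime TYPE('n) \<Lambda> * J * Ei)
   & (\<forall>z. z ~: Rp k --> ut z = 0)
   & (\<forall>\<phi>. smooth \<phi> --> supp_in \<phi> (Rp k) --> (LI z. u z * dd \<phi> tau z) = - (LI z. ut z * \<phi> z))"
 proof (intro exI[of _ ut] conjI allI impI)
  show "ut : bm" using ut(1) by simp
  show "AE z in lborel. z : Rp k --> (ut z)^2 <= ctime TYPE('n) \<Lambda> * J * Ei"
   unfolding Ct_def[symmetric] using ut(2) by eventually_elim auto
  show "z ~: Rp k ==> ut z = 0" for z by (rule ut(3))
  fix \<phi> :: "'n tx => real" assume sm: "smooth \<phi>" and sp: "supp_in \<phi> (Rp k)"
  let ?\<psi> = "dd \<phi> tau"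
  have sm': "smooth ?\<psi>" by (rule smooth_dir_deriv[OF sm tau_Basis])
  have sp': "supp_in ?\<psi> (Rp k)" by (rule supp_in_dir_deriv[OF sp])
  obtain B where B: "!!z. \<bar>\<phi> z\<bar> <= B" using supp_in_bounded[OF sp smooth_continuous[OF sm]] by blast
  obtain B' where B': "!!z. \<bar>?\<psi> z\<bar> <= B'" using supp_in_bounded[OF sp' smooth_continuous[OF sm']] by blast
  have out: "\<phi> z = 0" "?\<psi> z = 0" if "z ~: Rp k" for z using sp sp' that unfolding supp_in_def by blast+
  have m [measurable]: "\<phi> : bm" "?\<psi> : bm"
   by (intro borel_measurable_continuous_onI smooth_continuous sm sm')+
  \<comment> \<open>Nothing in the bounds of \<open>dom\<close> type controls a mollified solution
    on all of space. Restricted to the half cylinder it is square integrable with weight, hence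
    integrable, and the factor \<open>f\<close> lives there.\<close>
  have vi: "Lint (%z. f z * vv th' z)" if k': "kern k h0 th'" and f: "f : bm" "!!z. \<bar>f z\<bar> <= E" "!!z. z ~: Rp k ==> f z = 0" for th' f E
  proof -
   note [measurable] = vv_borel[OF k']
   have e: "\<mu> (ht k z) * (ind (Qp k) z * vv th' z)^2 = ind (Qp k) z * (\<mu> (ht k z) * (vv th' z)^2)" for z
    by (simp add: indicator_def)
   have iq: "Lint (%z. \<mu> (ht k z) * (ind (Qp k) z * vv th' z)^2)"
    unfolding e by (intro integrable_indicator_times Nf_int[OF k']) simp
   have mq: "(%z. ind (Qp k) z * vv th' z) : bm" by measurable
   have "Lint (%z. ind (Qp k) z * vv th' z)"
    by (rule L2_imp_L1(1)[OF mu_pos mu_borel mq J_int U_int iq]) simp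
   then have "Lint (%z. f z * (ind (Qp k) z * vv th' z))"
    by (rule integrable_bounded_mult[OF _ _ f(2)]) (use f(1) in simp)
   moreover have "f z * (ind (Qp k) z * vv th' z) = f z * vv th' z" for z
    using f(3)[of z] Rp_Qp[of z k] by (cases "z : Rp k") auto
   ultimately show ?thesis by simp
  qed
  have ip: "(LI z. ?\<psi> z * vv (th j) z) = - (LI z. \<phi> z * ?w j z)" for j
  proof -
   note i1 = vi[OF kt m(2) B' out(2), of j] and i2 = vi[OF kt' m(1) B out(1), of j]
   have "(LI z. \<phi> z * ?w j z + ?\<psi> z * vv (th j) z) = 0"
   proof (rule integral_deriv_zero[OF tau_Basis])
    show "((%r. \<phi> (z + r *\<^sub>R tau) * vv (th j) (z + r *\<^sub>R tau)) has_real_derivative \<phi> z * ?w j z + ?\<psi> z * vv (th j) z) (at 0)" for z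
    proof -
     have "((%r. \<phi> (z + r *\<^sub>R tau)) has_real_derivative ?\<psi> (z + 0 *\<^sub>R tau)) (at 0)"
      by (rule dir_deriv_line[OF smooth_differentiable[OF sm]])
     from DERIV_mult[OF this conv_deriv[OF kt[of j] u_sl tau_tang, of z]]
     show ?thesis by (simp only: scaleR_zero_left add_0_left add_0_right mult.commute add.commute)
    qed
    show "Lint (%z. \<phi> z * ?w j z + ?\<psi> z * vv (th j) z)" by (intro Bochner_Integration.integrable_add i1 i2)
    show "\<bar>z \<bullet> tau\<bar> \<ge> 1 ==> \<phi> z * vv (th j) z = 0" for z
    proof -
     assume "\<bar>z \<bullet> tau\<bar> \<ge> 1"
     then have "z ~: Rp k" unfolding inner_tau Rp_def by auto
     then show ?thesis using out(1) by simp
    qed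
   qed
   then show ?thesis using i1 i2 by simp
  qed
  have "(%j. (LI z. ?\<psi> z * vv (th j) z)) \<longlonglongrightarrow> (LI z. ?\<psi> z * u z)"
  proof (rule conv_pairing_tendsto[OF u_sl u_L1(1) m(2) B' _ t h1 hl])
   show "AE z in lborel. isCont ?\<psi> z"
    using smooth_continuous[OF sm'] unfolding continuous_on_eq_continuous_at[OF open_UNIV] by (intro AE_I2) blast
  qed
  moreover have "(%j. (LI z. \<phi> z * ?w j z)) \<longlonglongrightarrow> (LI z. \<phi> z * ut z)"
  proof (rule integral_dominated_convergence[where w="%z. (B * sqrt (Ct * Ei)) * ind (Rp k) z"])
   have B0: "0 <= B" using order_trans[OF abs_ge_zero B] .
   have sq: "x^2 <= b ==> \<bar>x\<bar> <= sqrt b" for x b :: real by (metis real_sqrt_abs real_sqrt_le_mono)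
   show "Lint (%z. (B * sqrt (Ct * Ei)) * ind (Rp k) z)" using Rp_finite[of k] by simp
   show "AE z in lborel. (%j. \<phi> z * ?w j z) \<longlonglongrightarrow> \<phi> z * ut z"
    using ut(2)
   proof eventually_elim
    fix z assume "z : Rp k --> (%j. ?w j z) \<longlonglongrightarrow> ut z & (ut z)^2 <= Ct * Ei"
    then show "(%j. \<phi> z * ?w j z) \<longlonglongrightarrow> \<phi> z * ut z"
     using out(1)[of z] by (cases "z : Rp k") (auto intro: tendsto_mult_left)
   qed
   show "AE z in lborel. norm (\<phi> z * ?w j z) <= (B * sqrt (Ct * Ei)) * ind (Rp k) z" for j
    using bw[of j]
   proof eventually_elim
    fix z assume z: "z : Rp k --> (?w j z)^2 <= Ct * Ei"
    show "norm (\<phi> z * ?w j z) <= (B * sqrt (Ct * Ei)) * ind (Rp k) z"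
    proof (cases "z : Rp k")
     case True
     then have wb: "\<bar>?w j z\<bar> <= sqrt (Ct * Ei)" using z sq by blast
     show ?thesis using mult_mono[OF B[of z] wb B0 abs_ge_zero] True by (simp add: abs_mult)
    qed (use out(1)[of z] in simp)
   qed
  qed (use ut(1) vv_borel[OF kt'] in simp_all)
  ultimately have "(LI z. ?\<psi> z * u z) = - (LI z. \<phi> z * ut z)"
   unfolding ip using tendsto_minus LIMSEQ_unique by blast
  then show "(LI z. u z * ?\<psi> z) = - (LI z. ut z * \<phi> z)" by (simp only: mult.commute)
 qed
qed

end

section \<open>Borel representatives\<close>

lemma lebesgue_measurable_AE_eq:
 fixes f g :: "'a::euclidean_space => real"
 assumes g: "g : bm" and e: "AE x in lborel. f x = g x"
 shows "f : borel_measurable lebesgue"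
 unfolding borel_measurable_iff_le
proof
 fix a
 obtain N where N: "N : null_sets lborel" "{x : space lborel. ~ f x = g x} \<subseteq> N" using e unfolding eventually_ae_filter by blast
 have "f x = g x" if "x ~: N" for x using N(2) that by auto
 then have "{x. f x <= a} = ({x. g x <= a} - N) \<union> {x : N. f x <= a}" by force
 moreover have "{x : N. f x <= a} : null_sets lebesgue"
  by (rule null_sets_completion_subset[OF _ null_sets_completionI[OF N(1)]]) auto
 moreover have "{x. g x <= a} - N : sets lborel" using g N(1) by (intro sets.Diff) auto
 ultimately show "{w : space lebesgue. f w <= a} : sets lebesgue" by (auto intro!: sets.Un)
qed

lemma lebesgue_integral_rep:
 fixes f g :: "'a::euclidean_space => real"
 assumes g: "g : bm" and e: "AE x in lborel. f x = g x"
 shows "(\<integral>x. f x \<partial>lebesgue) = (LI x. g x)"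
proof -
 have "(\<integral>x. f x \<partial>lebesgue) = (\<integral>x. g x \<partial>lebesgue)"
  by (rule integral_cong_AE[OF lebesgue_measurable_AE_eq[OF g e] _ AE_completion[OF e]])
   (rule measurable_completion, use g in simp)
 also have "... = (LI x. g x)" by (rule integral_completion) (use g in simp)
 finally show ?thesis .
qed

lemma AE_lebesgue_on:
 "S : sets borel ==> (AE x in lebesgue_on S. P x) \<longleftrightarrow> (AE x in lborel. x : S --> P x)"
 by (subst AE_restrict_space_iff) (auto simp: AE_completion_iff)

lemma borel_representative:
 fixes f :: "'a::euclidean_space => real"
 assumes f: "f : borel_measurable (lebesgue_on S)" and S: "S : sets borel"
 shows "\<exists>g\<in>borel_measurable borel. AE x in lborel. x : S --> f x = g x"
proof -
 have "(%x. ind S x *\<^sub>R f x) : borel_measurable lebesgue"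
  using f S by (subst (asm) borel_measurable_restrict_space_iff) auto
 then obtain g where g: "g : borel_measurable lborel" "AE x in lborel. ind S x *\<^sub>R f x = g x"
  using completion_ex_borel_measurable_real by blast
 from g(2) have "AE x in lborel. x : S --> f x = g x" by eventually_elim auto
 then show ?thesis using g(1) by auto
qed

lemma AE_coordinate:
 fixes b :: "'a::euclidean_space"
 assumes b: "b : Basis" and P: "AE s in lborel. P s"
 shows "AE z in lborel. P (z \<bullet> b)"
proof -
 obtain N where N: "N : null_sets lborel" "{s : space lborel. ~ P s} \<subseteq> N" using P unfolding eventually_ae_filter by blast
 have [measurable]: "N : sets borel" using N(1) by auto
 have "AE z in lborel. z \<bullet> b ~: N"
 proof (rule AE_line[OF b])
  show "AE r in lborel. upd b z r \<bullet> b ~: N" for z using AE_not_in[OF N(1)] b by (simp add: upd_inner)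
 qed measurable
 then show ?thesis by eventually_elim (use N(2) in auto)
qed

lemma wmeasure_rep:
 fixes w w' :: "'a::euclidean_space => real"
 assumes E: "E : sets borel" and w': "w' : bm" "!!x. 0 <= w' x" and e: "AE x in lborel. x : E --> w x = w' x"
 shows "wmeasure w E = density (lebesgue_on E) (%x. ennreal (w' x))"
 unfolding wmeasure_def
proof (rule density_cong)
 have w'l: "w' : borel_measurable lebesgue" by (rule measurable_completion) (use w'(1) in simp)
 then show "(%x. ennreal (w' x)) : borel_measurable (lebesgue_on E)"
  by (intro measurable_compose[OF _ measurable_ennreal] measurable_restrict_space1)
 have "(%x. ind E x *\<^sub>R w x) : borel_measurable lebesgue"
 proof (rule lebesgue_measurable_AE_eq)
  show "(%x. ind E x *\<^sub>R w' x) : bm" using E w' by measurable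
  show "AE x in lborel. ind E x *\<^sub>R w x = ind E x *\<^sub>R w' x" using e by eventually_elim (auto simp: indicator_def)
 qed
 then have "w : borel_measurable (lebesgue_on E)" using E by (subst borel_measurable_restrict_space_iff) auto
 then show "(%x. ennreal (w x)) : borel_measurable (lebesgue_on E)" by (rule measurable_compose[OF _ measurable_ennreal])
 show "AE x in lebesgue_on E. ennreal (w x) = ennreal (w' x)"
  unfolding AE_lebesgue_on[OF E] using e by eventually_elim auto
qed

text \<open>\<open>wmeasure\<close> is built on Lebesgue measurable sets and functions given almost
  everywhere; these formulas pass to Borel functions on the whole space, cut off by an
  indicator.\<close>

lemma wmeasure_integrals:
 fixes w w' F G :: "'a::euclidean_space => real"
 assumes E: "E : sets borel" and w': "w' : bm" "!!x. 0 <= w' x" and e: "AE x in lborel. x : E --> w x = w' x"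
  and G: "G : bm" and Ge: "AE x in lborel. x : E --> F x = G x"
 shows "(\<integral>\<^sup>+x. ennreal (F x) \<partial>wmeasure w E) = (NI x. ind E x * (ennreal (w' x) * ennreal (G x)))"
  and "(\<integral>x. F x \<partial>wmeasure w E) = (LI x. ind E x * (w' x * G x))"
  and "Lint (%x. ind E x * w' x) ==> measure (wmeasure w E) E = (LI x. ind E x * w' x)"
proof -
 note R = wmeasure_rep[OF E w' e]
 note [measurable] = E G w'(1)
 have El: "E : sets lebesgue" using E by auto
 have Gl: "G : borel_measurable lebesgue" "w' : borel_measurable lebesgue" by (rule measurable_completion, use G w' in simp)+
 have m: "G : borel_measurable (lebesgue_on E)" "w' : borel_measurable (lebesgue_on E)"
  by (rule measurable_restrict_space1[OF Gl(1)], rule measurable_restrict_space1[OF Gl(2)])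
 have mw: "(%x. ennreal (w' x)) : borel_measurable (lebesgue_on E)" by (rule measurable_compose[OF m(2) measurable_ennreal])
 have AEd: "AE x in density (lebesgue_on E) (%x. ennreal (w' x)). F x = G x"
  unfolding AE_density[OF mw] AE_lebesgue_on[OF E] using Ge by eventually_elim auto
 have "(\<integral>\<^sup>+x. ennreal (F x) \<partial>wmeasure w E) = (\<integral>\<^sup>+x. ennreal (G x) \<partial>density (lebesgue_on E) (%x. ennreal (w' x)))"
  unfolding R by (rule nn_integral_cong_AE) (use AEd in \<open>eventually_elim, simp\<close>)
 also have "... = (\<integral>\<^sup>+x. ennreal (w' x) * ennreal (G x) \<partial>lebesgue_on E)"
  by (rule nn_integral_density[OF mw measurable_compose[OF m(1) measurable_ennreal]])
 also have "... = (NI x. ind E x * (ennreal (w' x) * ennreal (G x)))"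
  using El by (subst nn_integral_restrict_space) (auto simp: nn_integral_completion mult.commute)
 finally show "(\<integral>\<^sup>+x. ennreal (F x) \<partial>wmeasure w E) = (NI x. ind E x * (ennreal (w' x) * ennreal (G x)))" .
 have Fm: "F : borel_measurable (lebesgue_on E)"
 proof -
  have "(%x. ind E x *\<^sub>R F x) : borel_measurable lebesgue"
  proof (rule lebesgue_measurable_AE_eq)
   show "(%x. ind E x *\<^sub>R G x) : bm" using E G by measurable
   show "AE x in lborel. ind E x *\<^sub>R F x = ind E x *\<^sub>R G x" using Ge by eventually_elim (auto simp: indicator_def)
  qed
  then show ?thesis using El by (subst borel_measurable_restrict_space_iff) auto
 qed
 have "(\<integral>x. F x \<partial>wmeasure w E) = (\<integral>x. G x \<partial>density (lebesgue_on E) (%x. ennreal (w' x)))"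
  unfolding R using Fm m(1) by (intro integral_cong_AE AEd) auto
 also have "... = (\<integral>x. w' x *\<^sub>R G x \<partial>lebesgue_on E)" using w' m by (intro integral_density) auto
 also have "... = (\<integral>x. ind E x *\<^sub>R (w' x *\<^sub>R G x) \<partial>lebesgue)" using El by (intro integral_restrict_space) auto
 also have "... = (LI x. ind E x * (w' x * G x))"
  unfolding real_scaleR_def by (intro integral_completion) measurable
 finally show "(\<integral>x. F x \<partial>wmeasure w E) = (LI x. ind E x * (w' x * G x))" .
 assume i: "Lint (%x. ind E x * w' x)"
 have "emeasure (wmeasure w E) E = (\<integral>\<^sup>+x. ennreal (w' x) * ind E x \<partial>lebesgue_on E)"
  unfolding R using El by (intro emeasure_density mw) (auto simp: sets_restrict_space)
 also have "... = (NI x. ennreal (ind E x * w' x))"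
  using El by (subst nn_integral_restrict_space) (auto simp: nn_integral_completion indicator_def intro!: nn_integral_cong)
 also have "... = ennreal (LI x. ind E x * w' x)"
  using w'(2) by (intro nn_integral_eq_integral i) auto
 finally show "measure (wmeasure w E) E = (LI x. ind E x * w' x)"
  using w'(2) by (simp add: measure_def integral_nonneg_AE)
qed

section \<open>Representatives of the weight and of the coefficients\<close>

lemma A2_representative:
 assumes "A2_weight \<mu>"
 shows "\<exists>\<mu>'. \<mu>' : bm & (\<forall>s. 0 < \<mu>' s) & (AE s in lborel. \<mu> s = \<mu>' s)"
proof -
 from assms have m: "\<mu> : borel_measurable lebesgue" and p: "AE s in lborel. 0 < \<mu> s"
  by (auto simp: A2_weight_def AE_completion_iff)
 then obtain g where [measurable]: "g : bm" and e: "AE s in lborel. \<mu> s = g s"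
  using completion_ex_borel_measurable_real[of \<mu> lborel] by auto
 have "AE s in lborel. \<mu> s = (if 0 < g s then g s else 1)" using p e by eventually_elim auto
 then show ?thesis by (intro exI[of _ "%s. if 0 < g s then g s else 1"]) auto
qed

text \<open>The A2 product on the interval is finite and neither integral vanishes, so both are
  finite; the squared length b - a undoes the two averages.\<close>

lemma A2_interval:
 assumes M: "A2_const \<mu> <= ennreal M0" "0 <= M0" and m [measurable]: "\<mu>' : bm" and p: "!!s. 0 < \<mu>' s"
  and e: "AE s in lborel. \<mu> s = \<mu>' s" and ab: "a < b"
 shows "Lint (%s. ind {a<..<b} s * \<mu>' s)" "Lint (%s. ind {a<..<b} s / \<mu>' s)"
  "(LI s. ind {a<..<b} s * \<mu>' s) * (LI s. ind {a<..<b} s / \<mu>' s) <= (b - a)^2 * M0"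
proof -
 define r y where "r = (b - a) / 2" and "y = (a + b) / 2"
 have r: "0 < r" "y - r = a" "y + r = b" using ab by (auto simp: r_def y_def field_simps)
 define P where "P = (NI s. ennreal (ind {a<..<b} s * \<mu>' s))"
 define R where "R = (NI s. ennreal (ind {a<..<b} s / \<mu>' s))"
 have ends: "AE s in lborel. s ~= a & s ~= b" using AE_lborel_singleton[of a] AE_lborel_singleton[of b] by eventually_elim auto
 have P: "(\<integral>\<^sup>+s\<in>{y-r..y+r}. ennreal (\<mu> s) \<partial>lebesgue) = P"
  unfolding P_def nn_integral_completion r(2,3)
  by (rule nn_integral_cong_AE) (use e ends in \<open>eventually_elim, auto simp: indicator_def\<close>)
 have R: "(\<integral>\<^sup>+s\<in>{y-r..y+r}. inverse (ennreal (\<mu> s)) \<partial>lebesgue) = R"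
  unfolding R_def nn_integral_completion r(2,3)
 proof (rule nn_integral_cong_AE)
  show "AE s in lborel. inverse (ennreal (\<mu> s)) * ind {a..b} s = ennreal (ind {a<..<b} s / \<mu>' s)"
   using e ends
  proof eventually_elim
   fix s assume "\<mu> s = \<mu>' s" "s ~= a & s ~= b"
   then show "inverse (ennreal (\<mu> s)) * ind {a..b} s = ennreal (ind {a<..<b} s / \<mu>' s)"
    using p[of s] by (auto simp: indicator_def inverse_ennreal inverse_eq_divide)
  qed
 qed
 have "(ennreal (1 / (2 * r)) * P) * (ennreal (1 / (2 * r)) * R) <= A2_const \<mu>"
  unfolding A2_const_def P[symmetric] R[symmetric] using r(1) by (intro SUP_upper2[of "(y, r)"]) auto
 then have PR: "(ennreal (1 / (2 * r)) * P) * (ennreal (1 / (2 * r)) * R) <= ennreal M0" using M(1) by (rule order_trans)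
 \<comment> \<open>In \<open>ennreal\<close>, zero times infinity is zero, so a finite product
   bounds its factors only once both are known to be nonzero.\<close>
 have nz: "P ~= 0" "R ~= 0"
 proof -
  have ne: "~ (AE s in lborel. s ~: {a<..<b})"
  proof
   assume "AE s in lborel. s ~: {a<..<b}"
   then have "emeasure lborel {a<..<b} = 0" by (subst (asm) AE_iff_measurable[where N="{a<..<b}"]) auto
   then show False using ab by simp
  qed
  have "P ~= 0" unfolding P_def
  proof (subst nn_integral_0_iff_AE)
   show "~ (AE s in lborel. ennreal (ind {a<..<b} s * \<mu>' s) = 0)"
   proof
    assume "AE s in lborel. ennreal (ind {a<..<b} s * \<mu>' s) = 0"
    then have "AE s in lborel. s ~: {a<..<b}"
    proof eventually_elim
     fix s assume "ennreal (ind {a<..<b} s * \<mu>' s) = 0"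
     then have "ind {a<..<b} s * \<mu>' s <= 0" by (simp add: ennreal_eq_0_iff)
     then show "s ~: {a<..<b}" using p[of s] by (auto simp: indicator_def)
    qed
    with ne show False by blast
   qed
  qed measurable
  moreover have "R ~= 0" unfolding R_def
  proof (subst nn_integral_0_iff_AE)
   show "~ (AE s in lborel. ennreal (ind {a<..<b} s / \<mu>' s) = 0)"
   proof
    assume "AE s in lborel. ennreal (ind {a<..<b} s / \<mu>' s) = 0"
    then have "AE s in lborel. s ~: {a<..<b}"
    proof eventually_elim
     fix s assume "ennreal (ind {a<..<b} s / \<mu>' s) = 0"
     then have "ind {a<..<b} s / \<mu>' s <= 0" by (simp add: ennreal_eq_0_iff)
     then show "s ~: {a<..<b}" using p[of s] by (auto simp: divide_le_0_iff)
    qed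
    with ne show False by blast
   qed
  qed measurable
  ultimately show "P ~= 0" "R ~= 0" by blast+
 qed
 have c0: "ennreal (1 / (2 * r)) ~= 0" using r(1) by (simp add: ennreal_eq_0_iff)
 have fin: "P < \<infinity>" "R < \<infinity>"
  using PR nz c0 by (auto simp: less_top[symmetric] ennreal_mult_eq_top_iff ennreal_top_mult ennreal_mult_top top_unique)
 have nn: "0 <= ind {a<..<b} s * \<mu>' s" "0 <= ind {a<..<b} s / \<mu>' s" for s using p[of s] by auto
 show i1: "Lint (%s. ind {a<..<b} s * \<mu>' s)"
  by (rule integrableI_nonneg) (use fin(1) nn(1) in \<open>auto simp: P_def\<close>)
 show i2: "Lint (%s. ind {a<..<b} s / \<mu>' s)"
  by (rule integrableI_nonneg) (use fin(2) nn(2) in \<open>auto simp: R_def\<close>)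
 let ?p = "(LI s. ind {a<..<b} s * \<mu>' s)" and ?r = "(LI s. ind {a<..<b} s / \<mu>' s)"
 have pr: "P = ennreal ?p" "R = ennreal ?r" "0 <= ?p" "0 <= ?r" unfolding P_def R_def
  using nn by (auto intro!: nn_integral_eq_integral i1 i2 integral_nonneg_AE)
 have "ennreal ((1 / (2 * r) * ?p) * (1 / (2 * r) * ?r)) <= ennreal M0"
  using PR r(1) pr(3,4) unfolding pr(1,2) by (simp add: ennreal_mult[symmetric])
 then have "(1 / (2 * r) * ?p) * (1 / (2 * r) * ?r) <= M0" using M(2) by simp
 then have "?p * ?r <= (2 * r)^2 * M0" using r(1) by (simp add: field_simps power2_eq_square)
 moreover have "2 * r = b - a" by (simp add: r_def)
 ultimately show "?p * ?r <= (b - a)^2 * M0" by simp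
qed

lemma AE_interval_exists:
 assumes "AE s in lborel. s : {a<..<b} --> P s" "a < (b::real)"
 shows "\<exists>s\<in>{a<..<b}. P s"
proof (rule ccontr)
 assume "~ ?thesis"
 then have "AE s in lborel. s ~: {a<..<b}" using assms(1) by (auto elim!: eventually_mono)
 then have "emeasure lborel {a<..<b} = 0" by (subst (asm) AE_iff_measurable[where N="{a<..<b}"]) auto
 then show False using assms(2) by simp
qed

lemma scalar_coefficient_representative:
 assumes m: "a0 : borel_measurable (lebesgue_on {0<..<3::real})" and L: "1 / \<Lambda> <= \<Lambda>"
  and b: "AE s in lborel. s : {0<..<3} --> 1 / \<Lambda> <= a0 s & a0 s <= \<Lambda>"
 shows "\<exists>a'. a' : bm & (\<forall>s. 1 / \<Lambda> <= a' s & a' s <= \<Lambda>) & (AE s in lborel. s : {0<..<3} --> a0 s = (a' s :: real))"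
proof -
 obtain g where [measurable]: "g : bm" and e: "AE s in lborel. s : {0<..<3} --> a0 s = g s"
  using borel_representative[OF m] by auto
 have "AE s in lborel. s : {0<..<3} --> a0 s = (if 1 / \<Lambda> <= g s & g s <= \<Lambda> then g s else \<Lambda>)"
  using b e by eventually_elim auto
 then show ?thesis using L by (intro exI[of _ "%s. if 1 / \<Lambda> <= g s & g s <= \<Lambda> then g s else \<Lambda>"]) auto
qed

text \<open>On the bad null set, and outside (0,3), the identity matrix is put in; it satisfies both
  bounds because \<Lambda> >= 1. Borel representatives are chosen entry by entry.\<close>

lemma matrix_coefficient_representative:
 fixes A :: "real => real ^ 'n::finite ^ 'n"
 assumes m: "A : borel_measurable (lebesgue_on {0<..<3})" and L: "1 <= \<Lambda>"
  and el: "AE s in lborel. s : {0<..<3} --> (\<forall>\<xi>. 1 / \<Lambda> * (norm \<xi>)^2 <= (A s *v \<xi>) \<bullet> \<xi>)"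
  and bd: "AE s in lborel. s : {0<..<3} --> onorm ((*v) (A s)) <= \<Lambda>"
 shows "\<exists>A'. (\<forall>i j. (%s. A' s $ i $ j) : bm) & (\<forall>s \<xi>. (norm \<xi>)^2 / \<Lambda> <= (A' s *v \<xi>) \<bullet> \<xi>)
  & (\<forall>s \<xi>. norm (A' s *v \<xi>) <= \<Lambda> * norm \<xi>) & (AE s in lborel. s : {0<..<3} --> A s = A' s)"
proof -
 have "(%s. A s $ i $ j) : borel_measurable (lebesgue_on {0<..<3})" for i j
  by (rule measurable_compose[OF m borel_measurable_continuous_onI]) (intro continuous_intros)
 then have "\<exists>g\<in>borel_measurable borel. AE s in lborel. s : {0<..<3} --> A s $ i $ j = g s" for i j
  by (intro borel_representative) auto
 then have ex: "\<exists>g. g : bm & (AE s in lborel. s : {0<..<3} --> A s $ i $ j = g s)" for i j by blast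
 define B where "B i j = (SOME g. g : bm & (AE s in lborel. s : {0<..<3} --> A s $ i $ j = g s))" for i j
 have B: "B i j : bm" "AE s in lborel. s : {0<..<3} --> A s $ i $ j = B i j s" for i j
  using someI_ex[OF ex[of i j]] unfolding B_def by blast+
 have "AE s in lborel. \<forall>i\<in>UNIV. \<forall>j\<in>UNIV. s : {0<..<3} --> A s $ i $ j = B i j s"
  unfolding AE_finite_all[OF finite] using B(2) by blast
 then have "AE s in lborel. s : {0<..<3} --> (\<forall>i j. A s $ i $ j = B i j s) & (\<forall>\<xi>. 1 / \<Lambda> * (norm \<xi>)^2 <= (A s *v \<xi>) \<bullet> \<xi>) & onorm ((*v) (A s)) <= \<Lambda>"
  using el bd by eventually_elim auto
 then obtain N where N: "N : null_sets lborel"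
  "{s : space lborel. ~ (s : {0<..<3} --> (\<forall>i j. A s $ i $ j = B i j s) & (\<forall>\<xi>. 1 / \<Lambda> * (norm \<xi>)^2 <= (A s *v \<xi>) \<bullet> \<xi>) & onorm ((*v) (A s)) <= \<Lambda>)} \<subseteq> N"
  unfolding eventually_ae_filter by blast
 define G where "G = {0<..<3} - N"
 have Gs: "G : sets borel" using N(1) by (auto simp: G_def)
 have G: "!!i j. A s $ i $ j = B i j s" "!!\<xi>. 1 / \<Lambda> * (norm \<xi>)^2 <= (A s *v \<xi>) \<bullet> \<xi>" "onorm ((*v) (A s)) <= \<Lambda>" if "s : G" for s
  using N(2) that unfolding G_def by auto
 define A' where "A' s = (if s : G then A s else mat 1)" for s
 show ?thesis
 proof (intro exI[of _ A'] conjI allI)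
  fix i j
  have e: "A' s $ i $ j = (if s : G then B i j s else mat 1 $ i $ j)" for s using G(1)[of s] by (simp add: A'_def)
  show "(%s. A' s $ i $ j) : bm" unfolding e using B(1) Gs by measurable
 next
  fix s \<xi>
  show "(norm \<xi>)^2 / \<Lambda> <= (A' s *v \<xi>) \<bullet> \<xi>"
  proof (cases "s : G")
   case False
   have "(norm \<xi>)^2 / \<Lambda> <= (norm \<xi>)^2" using L divide_left_mono[of 1 \<Lambda> "(norm \<xi>)^2"] by simp
   then show ?thesis using False by (simp add: A'_def power2_norm_eq_inner)
  qed (use G(2)[of s \<xi>] in \<open>simp add: A'_def\<close>)
  show "norm (A' s *v \<xi>) <= \<Lambda> * norm \<xi>"
  proof (cases "s : G")
   case True
   have "norm (A s *v \<xi>) <= onorm ((*v) (A s)) * norm \<xi>" by (rule onorm[OF matrix_vector_mul_bounded_linear])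
   also have "... <= \<Lambda> * norm \<xi>" by (intro mult_right_mono G(3) True) simp
   finally show ?thesis using True by (simp add: A'_def)
  next
   case False
   have "1 * norm \<xi> <= \<Lambda> * norm \<xi>" using L by (intro mult_right_mono) auto
   then show ?thesis using False by (simp add: A'_def)
  qed
 next
  show "AE s in lborel. s : {0<..<3} --> A s = A' s"
   using AE_not_in[OF N(1)] by eventually_elim (auto simp: A'_def G_def)
 qed
qed

section \<open>Representatives of the solution\<close>

lemma Qplus_eq: "Qplus k 3 = Qp k"
 by (auto simp: Qplus_def Qp_def Dplus_def D_def cross_def)

lemma D_open: "open (D k r)"
proof -
 have e: "axis k (x $ k) = (x $ k) *\<^sub>R axis k 1" for x :: "real ^ 'a" by (simp add: vec_eq_iff axis_def)
 show ?thesis unfolding D_def e by (intro open_Collect_conj open_Collect_less continuous_intros)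
qed

lemma Dplus_open: "open (Dplus k r)"
 unfolding Dplus_def by (intro open_Int D_open open_Collect_less continuous_intros)

lemma AE_slices:
 assumes "AE z in lborel. P (z :: real \<times> (real ^ 'n::finite))"
 shows "AE t in lborel. AE x in lborel. P (t, x)"
 using lborel_pair.AE_pair[of P] assms unfolding lborel_prod by blast

text \<open>A norm that is L^2 in time with values in weighted L^2 is an iterated integral; after
  passing to Borel representatives on almost every time slice, Tonelli makes it one integral over
  the half cylinder.\<close>

lemma slice_norm_integral:
 fixes k :: "'n::finite"
 assumes mu [measurable]: "\<mu>' : bm" and p: "!!s. 0 < \<mu>' s" and me: "AE s in lborel. \<mu> s = \<mu>' s"
  and G [measurable]: "G : bm" and e: "AE z in lborel. z : Qp k --> F z = G z"
 shows "(\<integral>\<^sup>+t. (\<integral>\<^sup>+x. ennreal (F (t, x)) \<partial>wmeasure (%x. \<mu> (x $ k)) (Dplus k 3)) \<partial>lebesgue_on {- 9<..0})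
  = (NI z. ind (Qp k) z * (ennreal (\<mu>' (ht k z)) * ennreal (G z)))"
proof -
 note [measurable] = borel_open[OF Dplus_open[of k 3]]
 have Q: "(t, x) : Qp k \<longleftrightarrow> t : {- 9<..0} & x : Dplus k 3" for t x
  by (simp add: Qplus_eq[symmetric] Qplus_def)
 have mx: "AE x in lborel. x : Dplus k 3 --> \<mu> (x $ k) = \<mu>' (x $ k)"
 proof -
  have "axis k (1 :: real) : Basis" by (simp add: axis_in_Basis_iff)
  from AE_coordinate[OF this me] show ?thesis by eventually_elim (simp add: inner_axis)
 qed
 have "(\<integral>\<^sup>+t. (\<integral>\<^sup>+x. ennreal (F (t, x)) \<partial>wmeasure (%x. \<mu> (x $ k)) (Dplus k 3)) \<partial>lebesgue_on {- 9<..0})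
  = (NI t. (\<integral>\<^sup>+x. ennreal (F (t, x)) \<partial>wmeasure (%x. \<mu> (x $ k)) (Dplus k 3)) * ind {- 9<..0} t)"
  by (subst nn_integral_restrict_space) (auto simp: nn_integral_completion)
 also have "... = (NI t. (NI x. ind (Qp k) (t, x) * (ennreal (\<mu>' (ht k (t, x))) * ennreal (G (t, x)))))"
 proof (rule nn_integral_cong_AE)
  show "AE t in lborel. (\<integral>\<^sup>+x. ennreal (F (t, x)) \<partial>wmeasure (%x. \<mu> (x $ k)) (Dplus k 3)) * ind {- 9<..0} t
    = (NI x. ind (Qp k) (t, x) * (ennreal (\<mu>' (ht k (t, x))) * ennreal (G (t, x))))"
   using AE_slices[OF e]
  proof eventually_elim
   fix t assume t: "AE x in lborel. (t, x) : Qp k --> F (t, x) = G (t, x)"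
   show "(\<integral>\<^sup>+x. ennreal (F (t, x)) \<partial>wmeasure (%x. \<mu> (x $ k)) (Dplus k 3)) * ind {- 9<..0} t
    = (NI x. ind (Qp k) (t, x) * (ennreal (\<mu>' (ht k (t, x))) * ennreal (G (t, x))))"
   proof (cases "t : {- 9<..0}")
    case True
    then have t': "AE x in lborel. x : Dplus k 3 --> F (t, x) = G (t, x)" using t by (simp only: Q simp_thms)
    have m1: "(%x. \<mu>' (x $ k)) : bm" by measurable
    have m2: "(%x. G (t, x)) : bm" by measurable
    have "(\<integral>\<^sup>+x. ennreal (F (t, x)) \<partial>wmeasure (%x. \<mu> (x $ k)) (Dplus k 3))
      = (NI x. ind (Dplus k 3) x * (ennreal (\<mu>' (x $ k)) * ennreal (G (t, x))))"
     by (rule wmeasure_integrals(1)[OF _ m1 less_imp_le[OF p] mx m2 t']) measurable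
    moreover have "ind (Qp k) (t, x) = (ind (Dplus k 3) x :: ennreal)" for x using True Q by (auto simp: indicator_def)
    ultimately show ?thesis using True by simp
   next
    case False
    then have "ind (Qp k) (t, x) = (0 :: ennreal)" for x using Q by (auto simp: indicator_def)
    then show ?thesis using False by simp
   qed
  qed
 qed
 also have "... = (\<integral>\<^sup>+z. ind (Qp k) z * (ennreal (\<mu>' (ht k z)) * ennreal (G z)) \<partial>(lborel \<Otimes>\<^sub>M lborel))"
 proof (rule lborel.nn_integral_fst)
  have "(%z. ind (Qp k) z * (ennreal (\<mu>' (ht k z)) * ennreal (G z))) : borel_measurable lborel" by measurable
  then show "(%z. ind (Qp k) z * (ennreal (\<mu>' (ht k z)) * ennreal (G z))) : borel_measurable (lborel \<Otimes>\<^sub>M lborel)"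
   unfolding lborel_prod .
 qed
 finally show ?thesis unfolding lborel_prod .
qed

text \<open>The function is integrable, hence so are almost all of its horizontal slices. On the
  remaining heights, which form a null set, it is replaced by 0; then all slices are
  integrable.\<close>

lemma slice_representative:
 fixes k :: "'n::finite" and f :: "'n tx => real"
 assumes f: "f : borel_measurable (lebesgue_on (Qp k))"
  and mu [measurable]: "\<mu>' : bm" and p: "!!s. 0 < \<mu>' s"
  and J: "Lint (%s. ind {0<..<3} s / \<mu>' s)" and U: "Lint (%s. ind {0<..<3} s * \<mu>' s)"
  and fin: "!!g. g : bm ==> AE z in lborel. z : Qp k --> f z = g z ==>
   (NI z. ind (Qp k) z * (ennreal (\<mu>' (ht k z)) * ennreal ((g z)^2))) < \<infinity>"
 shows "\<exists>g. sl k g & (\<forall>z. z ~: Qp k --> g z = 0) & (AE z in lborel. z : Qp k --> f z = g z)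
  & Lint (%z. \<mu>' (ht k z) * (g z)^2)"
proof -
 obtain f1 where [measurable]: "f1 : bm" and e1: "AE z in lborel. z : Qp k --> f z = f1 z"
  using borel_representative[OF f] by auto
 define f2 where "f2 z = ind (Qp k) z * f1 z" for z
 have m2 [measurable]: "f2 : bm" unfolding f2_def by measurable
 have e2: "AE z in lborel. z : Qp k --> f z = f2 z" using e1 by eventually_elim (simp add: f2_def)
 have int: "Lint (%z. \<mu>' (ht k z) * (g z)^2)" if g [measurable]: "g : bm" and ge: "AE z in lborel. z : Qp k --> f z = g z" and g0: "!!z. z ~: Qp k ==> g z = 0" for g
 proof (rule integrableI_nonneg)
  show "AE z in lborel. 0 <= \<mu>' (ht k z) * (g z)^2" using p by (intro AE_I2) (simp add: less_imp_le)
  have "(NI z. ennreal (\<mu>' (ht k z) * (g z)^2)) = (NI z. ind (Qp k) z * (ennreal (\<mu>' (ht k z)) * ennreal ((g z)^2)))"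
  proof (rule nn_integral_cong)
   fix z show "ennreal (\<mu>' (ht k z) * (g z)^2) = ind (Qp k) z * (ennreal (\<mu>' (ht k z)) * ennreal ((g z)^2))"
    using g0[of z] p[of "ht k z"] by (cases "z : Qp k") (simp_all add: ennreal_mult)
  qed
  then show "(NI z. ennreal (\<mu>' (ht k z) * (g z)^2)) < \<infinity>" using fin[OF g ge] by simp
 qed measurable
 have f2o: "f2 z = 0" if "z ~: Qp k" for z using that by (simp add: f2_def)
 have f2i: "Lint f2" by (rule L2_imp_L1(1)[OF p mu m2 J U int[OF m2 e2 f2o] f2o])
 define N where "N s = (NI w. ennreal (norm (ind (slab (ek k)) w * f2 (upd (ek k) w s))))" for s
 have Nm [measurable]: "N : bm" unfolding N_def[abs_def] by measurable
 have "(NI s. N s) = (NI s. (NI w. ind (slab (ek k)) w * ennreal (norm (f2 (upd (ek k) w s)))))"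
  unfolding N_def by (intro nn_integral_cong) (auto simp: indicator_def)
 also have "... = (NI z. ennreal (norm (f2 z)))"
  by (rule nn_integral_line(2)[OF ek_Basis, symmetric]) measurable
 also have "... < \<infinity>" using f2i by (simp add: integrable_iff_bounded)
 finally have "AE s in lborel. N s ~= \<infinity>" by (intro nn_integral_noteq_infinite) auto
 from AE_coordinate[OF ek_Basis[of k] this] have good: "AE z in lborel. N (ht k z) ~= \<infinity>" by (simp only: inner_ek)
 define g where "g z = (if N (ht k z) < \<infinity> then f2 z else 0)" for z
 have gm [measurable]: "g : bm" unfolding g_def by measurable
 have go: "g z = 0" if "z ~: Qp k" for z using f2o[OF that] by (simp add: g_def)
 have ge: "AE z in lborel. z : Qp k --> f z = g z"
  using good e2 by eventually_elim (auto simp: g_def less_top)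
 have "Lint (%w. ind (slab (ek k)) w * g (upd (ek k) w s))" for s
 proof (cases "N s < \<infinity>")
  case True
  then have "Lint (%w. ind (slab (ek k)) w * f2 (upd (ek k) w s))"
   unfolding N_def by (intro integrableI_bounded) measurable
  then show ?thesis using True by (simp add: g_def)
 next
  case False
  then show ?thesis by (simp add: g_def)
 qed
 then have "sl k g" unfolding sl_def using gm by blast
 then show ?thesis using go ge int[OF gm ge go] by blast
qed

lemma test_functions_iff: "\<phi> : test_functions U \<longleftrightarrow> smooth \<phi> & supp_in \<phi> U"
proof
 assume "\<phi> : test_functions U"
 then have t: "\<forall>m. Ck m \<phi>" "compact (closure {x. \<phi> x ~= 0})" "closure {x. \<phi> x ~= 0} \<subseteq> U" by (auto simp: test_functions_def)
 have "\<phi> w = 0" if "w ~: closure {x. \<phi> x ~= 0}" for w using that closure_subset[of "{x. \<phi> x ~= 0}"] by auto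
 then show "smooth \<phi> & supp_in \<phi> U" unfolding smooth_def supp_in_def using t by blast
next
 assume a: "smooth \<phi> & supp_in \<phi> U"
 then obtain C where C: "compact C" "C \<subseteq> U" "!!w. w ~: C ==> \<phi> w = 0" unfolding supp_in_def by blast
 have cl: "closure {x. \<phi> x ~= 0} \<subseteq> C" using C by (intro closure_minimal compact_imp_closed) auto
 then have "compact (closure {x. \<phi> x ~= 0})"
  using compact_imp_bounded[OF C(1)] bounded_subset by (auto simp: compact_eq_bounded_closed)
 then show "\<phi> : test_functions U" using a cl C(2) unfolding test_functions_def smooth_def by blast
qed

lemma supp_in_mono: "supp_in \<phi> U ==> U \<subseteq> V ==> supp_in \<phi> V"
 unfolding supp_in_def by blast

lemma smooth_borel: "smooth \<phi> ==> \<phi> : bm"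
 by (rule borel_measurable_continuous_onI[OF smooth_continuous])

lemma set_integral_rep:
 fixes f g :: "'a::euclidean_space => real"
 assumes g: "g : bm" and e: "AE x in lborel. x : S --> f x = g x" and o: "!!x. x ~: S ==> g x = 0"
 shows "(LINT x:S|lebesgue. f x) = (LI x. g x)"
 unfolding set_lebesgue_integral_def
proof (rule lebesgue_integral_rep[OF g])
 show "AE x in lborel. ind S x *\<^sub>R f x = g x"
  using e by eventually_elim (use o in \<open>auto simp: indicator_def\<close>)
qed

lemma smooth_slice:
 fixes \<phi> :: "real \<times> (real ^ 'n::finite) => real"
 assumes s: "smooth \<phi>"
 shows "smooth (%x. \<phi> (t, x))" "dd (%x. \<phi> (t, x)) b x = dd \<phi> (0, b) (t, x)"
proof -
 have bl: "bounded_linear (%x. (0 :: real, x :: real ^ 'n))"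
  by (rule bounded_linear_intro[where K=1]) (auto simp: norm_Pair)
 show "smooth (%x. \<phi> (t, x))" using smooth_affine[OF bl s, of "(t, 0)"] by simp
 show "dd (%x. \<phi> (t, x)) b x = dd \<phi> (0, b) (t, x)"
  using dir_deriv_affine(1)[OF bl smooth_differentiable[OF s], of "(t, 0)" b x] by simp
qed

lemma supp_in_slice:
 fixes \<phi> :: "real \<times> (real ^ 'n::finite) => real"
 assumes "supp_in \<phi> (I \<times> U)" shows "supp_in (%x. \<phi> (t, x)) U"
proof -
 obtain C where C: "compact C" "C \<subseteq> I \<times> U" "!!w. w ~: C ==> \<phi> w = 0" using assms unfolding supp_in_def by blast
 have "compact (snd ` (C \<inter> ({t} \<times> UNIV)))"
  by (intro compact_continuous_image compact_Int_closed C closed_Times continuous_on_snd) auto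
 moreover have "snd ` (C \<inter> ({t} \<times> UNIV)) \<subseteq> U" using C(2) by auto
 moreover have "\<phi> (t, x) = 0" if "x ~: snd ` (C \<inter> ({t} \<times> UNIV))" for x
  using that C(3)[of "(t, x)"] by force
 ultimately show ?thesis unfolding supp_in_def by blast
qed

text \<open>The kernel size 1 / (4 * n) is the largest that \<open>tfun_supp\<close> admits.\<close>

lemma conormal_solution_of_weak_solution:
 fixes k :: "'n::finite" and A A' :: "real => real ^ 'n ^ 'n" and u :: "'n tx => real"
 assumes sol: "weak_solution k \<mu> a0 A lam u Du" and lam: "0 <= lam" and L: "1 <= \<Lambda>"
  and mu [measurable]: "\<mu>' : bm" and p: "!!s. 0 < \<mu>' s" and me: "AE s in lborel. \<mu> s = \<mu>' s"
  and J: "Lint (%s. ind {0<..<3} s / \<mu>' s)" and U: "Lint (%s. ind {0<..<3} s * \<mu>' s)"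
  and a [measurable]: "a0' : bm" and ab: "!!s. 1 / \<Lambda> <= a0' s" "!!s. a0' s <= \<Lambda>"
  and ae: "AE s in lborel. s : {0<..<3} --> a0 s = a0' s"
  and Am [measurable]: "!!i j. (%s. A' s $ i $ j) : bm" and Ael: "!!s \<xi>. (norm \<xi>)^2 / \<Lambda> <= (A' s *v \<xi>) \<bullet> \<xi>"
  and Abd: "!!s \<xi>. norm (A' s *v \<xi>) <= \<Lambda> * norm \<xi>" and Ae: "AE s in lborel. s : {0<..<3} --> A s = A' s"
 obtains u' Du' where "conormal_solution k \<Lambda> lam (1 / (4 * real CARD('n))) \<mu>' a0' A' u' Du'"
  "AE z in lborel. z : Qp k --> u z = u' z & Du z = Du' z"
proof -
 have S: "{- 9<..0} \<times> Dplus k 3 = Qp k" using Qplus_eq[of k] by (simp add: Qplus_def)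
 have Q: "(t, x) : Qp k \<longleftrightarrow> t : {- 9<..0} & x : Dplus k 3" for t x
  unfolding S[symmetric] by (rule mem_Sigma_iff)
 let ?wm = "wmeasure (%x. \<mu> (x $ k)) (Dplus k 3)"
 have V: "u : borel_measurable (lebesgue_on (Qp k))" "Du : borel_measurable (lebesgue_on (Qp k))"
  "AE t in lebesgue_on {- 9<..0}. W12 (Dplus k 3) (%x. \<mu> (x $ k)) (%x. u (t, x)) (%x. Du (t, x))"
  "(\<integral>\<^sup>+t. L2sq ?wm (%x. u (t, x)) + L2sq ?wm (%x. Du (t, x)) \<partial>(lebesgue_on {- 9<..0})) < \<infinity>"
  using sol unfolding weak_solution_def V12_def S by blast+
 have fin: "(NI z. ind (Qp k) z * (ennreal (\<mu>' (ht k z)) * ennreal ((g z)^2))) < \<infinity>"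
  if g [measurable]: "g : bm" and e: "AE z in lborel. z : Qp k --> f z = g z"
   and le: "!!t. (\<integral>\<^sup>+x. ennreal ((f (t, x))^2) \<partial>?wm) <= L2sq ?wm (%x. u (t, x)) + L2sq ?wm (%x. Du (t, x))" for f g :: "'n tx => real"
 proof -
  have m2: "(%z. (g z)^2) : bm" by measurable
  have e2: "AE z in lborel. z : Qp k --> (f z)^2 = (g z)^2" using e by eventually_elim simp
  show ?thesis
   unfolding slice_norm_integral[OF mu p me m2 e2, symmetric]
   by (rule le_less_trans[OF nn_integral_mono V(4)]) (rule le)
 qed
 have leu: "(\<integral>\<^sup>+x. ennreal ((u (t, x))^2) \<partial>?wm) <= L2sq ?wm (%x. u (t, x)) + L2sq ?wm (%x. Du (t, x))" for t
  unfolding L2sq_def by (rule order_trans[OF _ add_increasing2[OF _ order_refl]]) auto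
 have led: "(\<integral>\<^sup>+x. ennreal ((Du (t, x) $ l)^2) \<partial>?wm) <= L2sq ?wm (%x. u (t, x)) + L2sq ?wm (%x. Du (t, x))" for t l
 proof -
  have "(\<integral>\<^sup>+x. ennreal ((Du (t, x) $ l)^2) \<partial>?wm) <= L2sq ?wm (%x. Du (t, x))" unfolding L2sq_def
  proof (intro nn_integral_mono ennreal_leI)
   fix x show "(Du (t, x) $ l)^2 <= (norm (Du (t, x)))^2"
    using power_mono[OF component_le_norm_cart[of "Du (t, x)" l], of 2] by simp
  qed
  then show ?thesis by (rule add_increasing[OF zero_le])
 qed
 obtain u' where u': "sl k u'" "!!z. z ~: Qp k ==> u' z = 0" "AE z in lborel. z : Qp k --> u z = u' z" "Lint (%z. \<mu>' (ht k z) * (u' z)^2)"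
  using slice_representative[OF V(1) mu p J U fin[OF _ _ leu]] by blast
 have Dm: "(%z. Du z $ l) : borel_measurable (lebesgue_on (Qp k))" for l
  by (rule measurable_compose[OF V(2) borel_measurable_continuous_onI]) (intro continuous_intros)
 define E where "E l = (SOME g. sl k g & (\<forall>z. z ~: Qp k --> g z = 0) & (AE z in lborel. z : Qp k --> Du z $ l = g z) & Lint (%z. \<mu>' (ht k z) * (g z)^2))" for l
 have ex: "\<exists>g. sl k g & (\<forall>z. z ~: Qp k --> g z = 0) & (AE z in lborel. z : Qp k --> Du z $ l = g z) & Lint (%z. \<mu>' (ht k z) * (g z)^2)" for l
  by (rule slice_representative[OF Dm mu p J U fin[OF _ _ led]])
 have Eall: "sl k (E l) & (\<forall>z. z ~: Qp k --> E l z = 0) & (AE z in lborel. z : Qp k --> Du z $ l = E l z) & Lint (%z. \<mu>' (ht k z) * (E l z)^2)" for l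
  using someI_ex[OF ex[of l]] unfolding E_def .
 have E: "sl k (E l)" "!!z. z ~: Qp k ==> E l z = 0" "AE z in lborel. z : Qp k --> Du z $ l = E l z" "Lint (%z. \<mu>' (ht k z) * (E l z)^2)" for l
  using Eall[of l] by blast+
 define Du' where "Du' z = (\<chi> l. E l z)" for z
 have Dl: "Du' z $ l = E l z" for z l by (simp add: Du'_def)
 have Du0: "Du' z = 0" if "z ~: Qp k" for z using E(2)[OF that] by (simp add: Du'_def vec_eq_iff)
 note [measurable] = sl_borel[OF u'(1)] sl_borel[OF E(1)]
 have "AE z in lborel. \<forall>l\<in>UNIV. z : Qp k --> Du z $ l = E l z" unfolding AE_finite_all[OF finite] using E(3) by blast
 then have eqs: "AE z in lborel. z : Qp k --> u z = u' z & Du z = Du' z"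
  using u'(3) by eventually_elim (auto simp: Du'_def vec_eq_iff)
 have hts: "AE z in lborel. z : Qp k --> \<mu> (ht k z) = \<mu>' (ht k z) & a0 (ht k z) = a0' (ht k z) & A (ht k z) = A' (ht k z)"
 proof -
  have "AE s in lborel. s : {0<..<3} --> \<mu> s = \<mu>' s & a0 s = a0' s & A s = A' s" using me ae Ae by eventually_elim auto
  from AE_coordinate[OF ek_Basis[of k] this] show ?thesis unfolding inner_ek by eventually_elim (auto simp: Qp_def)
 qed
 have uL: "Lint u'" by (rule L2_imp_L1(1)[OF p mu sl_borel[OF u'(1)] J U u'(4) u'(2)])
 have EL: "Lint (E l)" for l by (rule L2_imp_L1(1)[OF p mu sl_borel[OF E(1)] J U E(4) E(2)])
 let ?O = "{- 9<..<0 :: real} \<times> {x :: real ^ 'n. norm (x - axis k (x $ k)) < 3 & - 3 < x $ k & x $ k < 3}"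
 let ?P = "{- 9<..<0 :: real} \<times> {x :: real ^ 'n. norm (x - axis k (x $ k)) < 3 & 0 < x $ k & x $ k < 3}"
 have "conormal_solution k \<Lambda> lam (1 / (4 * real CARD('n))) \<mu>' a0' A' u' Du'"
 proof (rule conormal_solution.intro)
  show "0 < 1 / (4 * real CARD('n))" "real CARD('n) * (1 / (4 * real CARD('n))) <= 1 / 4" by simp_all
  show "1 <= \<Lambda>" "0 <= lam" by (fact L lam)+
  show "0 < \<mu>' s" "1 / \<Lambda> <= a0' s" "a0' s <= \<Lambda>" for s by (fact p ab)+
  show "\<mu>' : bm" "a0' : bm" by (fact mu a)+
  show "(%s. A' s $ i $ j) : bm" for i j by (fact Am)
  show "(norm \<xi>)^2 / \<Lambda> <= (A' s *v \<xi>) \<bullet> \<xi>" "norm (A' s *v \<xi>) <= \<Lambda> * norm \<xi>" for s \<xi> by (fact Ael Abd)+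
  show "Lint (%s. ind {0<..<3} s / \<mu>' s)" "Lint (%s. ind {0<..<3} s * \<mu>' s)" by (fact J U)+
  show "sl k u'" by (fact u'(1))
  show "sl k (%z. Du' z $ l)" for l using E(1)[of l] by (simp add: Dl)
  show "u' z = 0" "Du' z = 0" if "z ~: Qp k" for z using u'(2) Du0 that by blast+
  show "Lint (%z. \<mu>' (ht k z) * (u' z)^2)" by (fact u'(4))
  show "Lint (%z. \<mu>' (ht k z) * (Du' z $ l)^2)" for l using E(4)[of l] by (simp add: Dl)
 next
  fix \<phi> :: "'n tx => real" assume s: "smooth \<phi>" and sp: "supp_in \<phi> ?O"
  \<comment> \<open>An open subset of the cylinder lies in its interior, so these test functions are
    admissible although they may be nonzero at height 0.\<close>
  have "?O \<subseteq> interior (Q k 3)"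
  proof (rule interior_maximal)
   show "?O \<subseteq> Q k 3" by (auto simp: Q_def D_def)
   show "open ?O" using D_open[of k 3] unfolding D_def by (intro open_Times) auto
  qed
  then have "\<phi> : test_functions (interior (Q k 3))" using s supp_in_mono[OF sp] by (simp add: test_functions_iff)
  then have eq: "- (LINT z:Qp k|lebesgue. \<mu> (ht k z) * a0 (ht k z) * u z * time_deriv \<phi> z)
    + (LINT z:Qp k|lebesgue. \<mu> (ht k z) * ((A (ht k z) *v Du z) \<bullet> space_grad \<phi> z))
    + lam * (LINT z:Qp k|lebesgue. \<mu> (ht k z) * u z * \<phi> z) = 0"
   using sol unfolding weak_solution_def Qplus_eq by blast
  note [measurable] = smooth_borel[OF s] smooth_borel[OF smooth_dir_deriv[OF s tau_Basis]] smooth_borel[OF smooth_dir_deriv[OF s ek_Basis]]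
  have e1: "(LINT z:Qp k|lebesgue. \<mu> (ht k z) * a0 (ht k z) * u z * time_deriv \<phi> z) = (LI z. \<mu>' (ht k z) * a0' (ht k z) * u' z * dd \<phi> tau z)"
  proof (rule set_integral_rep)
   show "(%z. \<mu>' (ht k z) * a0' (ht k z) * u' z * dd \<phi> tau z) : bm" by measurable
   show "AE z in lborel. z : Qp k --> \<mu> (ht k z) * a0 (ht k z) * u z * time_deriv \<phi> z = \<mu>' (ht k z) * a0' (ht k z) * u' z * dd \<phi> tau z"
    using hts eqs by eventually_elim (simp add: time_deriv_def)
  qed (simp add: u'(2))
  have sg: "x \<bullet> space_grad \<phi> z = (\<Sum>l\<in>UNIV. x $ l * dd \<phi> (ek l) z)" for x z by (simp add: inner_vec_def space_grad_def)
  have e2: "(LINT z:Qp k|lebesgue. \<mu> (ht k z) * ((A (ht k z) *v Du z) \<bullet> space_grad \<phi> z)) = (LI z. \<mu>' (ht k z) * (\<Sum>l\<in>UNIV. (A' (ht k z) *v Du' z) $ l * dd \<phi> (ek l) z))"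
  proof (rule set_integral_rep)
   have Aht: "(%z. A' (ht k z) $ i $ j) : bm" for i j by (rule measurable_compose[OF measurable_ht Am])
   have Adu: "(%z. (A' (ht k z) *v Du' z) $ l) : bm" for l
    unfolding matrix_vector_mult_def vec_lambda_beta Dl using Aht by measurable
   show "(%z. \<mu>' (ht k z) * (\<Sum>l\<in>UNIV. (A' (ht k z) *v Du' z) $ l * dd \<phi> (ek l) z)) : bm" using Adu by measurable
   show "AE z in lborel. z : Qp k --> \<mu> (ht k z) * ((A (ht k z) *v Du z) \<bullet> space_grad \<phi> z) = \<mu>' (ht k z) * (\<Sum>l\<in>UNIV. (A' (ht k z) *v Du' z) $ l * dd \<phi> (ek l) z)"
    using hts eqs by eventually_elim (simp add: sg)
  qed (simp add: Du0)
  have e3: "(LINT z:Qp k|lebesgue. \<mu> (ht k z) * u z * \<phi> z) = (LI z. \<mu>' (ht k z) * u' z * \<phi> z)"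
  proof (rule set_integral_rep)
   show "(%z. \<mu>' (ht k z) * u' z * \<phi> z) : bm" by measurable
   show "AE z in lborel. z : Qp k --> \<mu> (ht k z) * u z * \<phi> z = \<mu>' (ht k z) * u' z * \<phi> z"
    using hts eqs by eventually_elim simp
  qed (simp add: u'(2))
  show "- (LI z. \<mu>' (ht k z) * a0' (ht k z) * u' z * dd \<phi> tau z)
    + (LI z. \<mu>' (ht k z) * (\<Sum>l\<in>UNIV. (A' (ht k z) *v Du' z) $ l * dd \<phi> (ek l) z))
    + lam * (LI z. \<mu>' (ht k z) * u' z * \<phi> z) = 0"
   using eq unfolding e1 e2 e3 .
 next
  fix \<phi> :: "'n tx => real" and l assume s: "smooth \<phi>" and sp: "supp_in \<phi> ?P"
  have sd: "smooth (dd \<phi> (ek l))" by (rule smooth_dir_deriv[OF s ek_Basis])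
  note [measurable] = smooth_borel[OF s] smooth_borel[OF sd]
  \<comment> \<open>The weak gradient is given on almost every time slice. Slices of a space-time
    test function are test functions, so the slice identities can be integrated in t.\<close>
  have "supp_in (%x. \<phi> (t, x)) (Dplus k 3)" for t
   by (rule supp_in_mono[OF supp_in_slice[OF sp]]) (auto simp: Dplus_def D_def)
  then have tf: "(%x. \<phi> (t, x)) : test_functions (Dplus k 3)" for t using smooth_slice(1)[OF s] by (simp add: test_functions_iff)
  have W: "AE t in lborel. t : {- 9<..0} --> W12 (Dplus k 3) (%x. \<mu> (x $ k)) (%x. u (t, x)) (%x. Du (t, x))"
   using V(3) by (subst (asm) AE_lebesgue_on) auto
  have sl: "AE t in lborel. (LI x. u' (t, x) * dd \<phi> (ek l) (t, x)) = - (LI x. E l (t, x) * \<phi> (t, x))"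
   using W AE_slices[OF eqs]
  proof eventually_elim
   fix t assume w: "t : {- 9<..0} --> W12 (Dplus k 3) (%x. \<mu> (x $ k)) (%x. u (t, x)) (%x. Du (t, x))"
    and e: "AE x in lborel. (t, x) : Qp k --> u (t, x) = u' (t, x) & Du (t, x) = Du' (t, x)"
   show "(LI x. u' (t, x) * dd \<phi> (ek l) (t, x)) = - (LI x. E l (t, x) * \<phi> (t, x))"
   proof (cases "t : {- 9<..0}")
    case True
    then have "weak_deriv (Dplus k 3) (axis l 1) (%x. u (t, x)) (%x. Du (t, x) $ l)" using w unfolding W12_def by blast
    then have "(LINT x:Dplus k 3|lebesgue. u (t, x) * dd (%x. \<phi> (t, x)) (axis l 1) x) = - (LINT x:Dplus k 3|lebesgue. Du (t, x) $ l * \<phi> (t, x))"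
     using tf[of t] unfolding weak_deriv_def by blast
    moreover have "(LINT x:Dplus k 3|lebesgue. u (t, x) * dd (%x. \<phi> (t, x)) (axis l 1) x) = (LI x. u' (t, x) * dd \<phi> (ek l) (t, x))"
    proof (rule set_integral_rep)
     show "(%x. u' (t, x) * dd \<phi> (ek l) (t, x)) : bm" by measurable
     show "AE x in lborel. x : Dplus k 3 --> u (t, x) * dd (%x. \<phi> (t, x)) (axis l 1) x = u' (t, x) * dd \<phi> (ek l) (t, x)"
      using e by eventually_elim (use True in \<open>simp add: smooth_slice(2)[OF s] Q\<close>)
     show "u' (t, x) * dd \<phi> (ek l) (t, x) = 0" if "x ~: Dplus k 3" for x using u'(2)[of "(t, x)"] that by (simp add: Q)
    qed
    moreover have "(LINT x:Dplus k 3|lebesgue. Du (t, x) $ l * \<phi> (t, x)) = (LI x. E l (t, x) * \<phi> (t, x))"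
    proof (rule set_integral_rep)
     show "(%x. E l (t, x) * \<phi> (t, x)) : bm" by measurable
     show "AE x in lborel. x : Dplus k 3 --> Du (t, x) $ l * \<phi> (t, x) = E l (t, x) * \<phi> (t, x)"
      using e by eventually_elim (use True in \<open>simp add: Q Dl\<close>)
     show "E l (t, x) * \<phi> (t, x) = 0" if "x ~: Dplus k 3" for x using E(2)[of "(t, x)" l] that by (simp add: Q)
    qed
    ultimately show ?thesis by simp
   next
    case False
    then have "u' (t, x) = 0" "E l (t, x) = 0" for x using u'(2)[of "(t, x)"] E(2)[of "(t, x)" l] by (auto simp: Q)
    then show ?thesis by simp
   qed
  qed
  obtain B where B: "!!z. \<bar>\<phi> z\<bar> <= B" using supp_in_bounded[OF sp smooth_continuous[OF s]] by blast
  obtain B' where B': "!!z. \<bar>dd \<phi> (ek l) z\<bar> <= B'" using supp_in_bounded[OF supp_in_dir_deriv[OF sp] smooth_continuous[OF sd]] by blast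
  have "Lint (%z. dd \<phi> (ek l) z * u' z)" by (rule integrable_bounded_mult[OF uL _ B']) measurable
  then have i1: "Lint (%z. u' z * dd \<phi> (ek l) z)" by (simp only: mult.commute)
  have "Lint (%z. \<phi> z * E l z)" by (rule integrable_bounded_mult[OF EL _ B]) measurable
  then have i2: "Lint (%z. E l z * \<phi> z)" by (simp only: mult.commute)
  have f1: "(LI t. (LI x. u' (t, x) * dd \<phi> (ek l) (t, x))) = (LI z. u' z * dd \<phi> (ek l) z)"
   using lborel_pair.integral_fst'[of "%z. u' z * dd \<phi> (ek l) z"] i1 unfolding lborel_prod by blast
  have f2: "(LI t. (LI x. E l (t, x) * \<phi> (t, x))) = (LI z. E l z * \<phi> z)"
   using lborel_pair.integral_fst'[of "%z. E l z * \<phi> z"] i2 unfolding lborel_prod by blast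
  have "(LI t. (LI x. u' (t, x) * dd \<phi> (ek l) (t, x))) = (LI t. - (LI x. E l (t, x) * \<phi> (t, x)))"
   by (intro integral_cong_AE sl) measurable
  then show "(LI z. u' z * dd \<phi> (ek l) z) = - (LI z. Du' z $ l * \<phi> z)"
   unfolding Dl using f1 f2 by simp
 qed
 then show thesis using eqs by (rule that)
qed

section \<open>Growth of the weight\<close>

lemma interval_Cauchy_Schwarz:
 assumes m [measurable]: "\<mu> : bm" and p: "!!s. 0 < \<mu> s" and ab: "a <= (b::real)"
  and P: "Lint (%s. ind {a<..<b} s * \<mu> s)" and R: "Lint (%s. ind {a<..<b} s / \<mu> s)"
 shows "(b - a)^2 <= (LI s. ind {a<..<b} s * \<mu> s) * (LI s. ind {a<..<b} s / \<mu> s)"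
proof -
 let ?p = "(LI s. ind {a<..<b} s * \<mu> s)" and ?r = "(LI s. ind {a<..<b} s / \<mu> s)"
 have e: "ind {a<..<b} s / \<mu> s * (\<mu> s)^2 = ind {a<..<b} s * \<mu> s" for s
  using p[of s] by (simp add: power2_eq_square)
 have "(NI s. ennreal (ind {a<..<b} s / \<mu> s * \<bar>\<mu> s\<bar>)) <= ennreal (sqrt (?r * ?p))"
 proof (rule weighted_Cauchy_Schwarz)
  show "0 <= ind {a<..<b} s / \<mu> s" for s using p[of s] by simp
  show "Lint (%s. ind {a<..<b} s / \<mu> s)" by (rule R)
  show "Lint (%s. ind {a<..<b} s / \<mu> s * (\<mu> s)^2)" unfolding e by (rule P)
  show "(LI s. ind {a<..<b} s / \<mu> s * (\<mu> s)^2) <= ?p" unfolding e by simp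
 qed auto
 moreover have "(NI s. ennreal (ind {a<..<b} s / \<mu> s * \<bar>\<mu> s\<bar>)) = (NI s. ind {a<..<b} s)"
 proof (intro nn_integral_cong)
  fix s show "ennreal (ind {a<..<b} s / \<mu> s * \<bar>\<mu> s\<bar>) = ind {a<..<b} s" using p[of s] by (simp add: indicator_def)
 qed
 moreover have "(NI s. ind {a<..<b} s) = ennreal (b - a)" using ab by simp
 ultimately have le: "ennreal (b - a) <= ennreal (sqrt (?r * ?p))" by simp
 have nn: "0 <= ?r" "0 <= ?p" using p by (auto intro!: integral_nonneg_AE AE_I2 simp: less_imp_le)
 then have "b - a <= sqrt (?r * ?p)" using le by simp
 then have "(b - a)^2 <= (sqrt (?r * ?p))^2" using ab by (intro power_mono) auto
 then show ?thesis using nn by (simp add: mult.commute)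
qed

lemma weighted_interval_mono:
 assumes p: "!!s. 0 <= f s" and i: "Lint (%s. ind B s * f s)" and AB: "A \<subseteq> B"
 shows "(LI s. ind A s * f s) <= (LI s. ind B s * (f s :: real))"
 by (rule integral_mono'[OF i]) (use p AB in \<open>auto simp: indicator_def\<close>)

text \<open>Write P and R for integrals of \<mu> and 1 / \<mu>. The pointwise hypothesis with radius
  y / 4 bounds P(3y/4, 5y/4) by y / 2 * K0 * \<mu>(y), and the A2 condition extends this to P(0,y)
  <= 8 * M0 * K0 * y * \<mu>(y). Squaring, and replacing y^2 by its upper bound P(0,y) * R(0,3), one
  factor P(0,y) cancels.\<close>

lemma weight_growth:
 assumes M: "A2_const \<mu> <= ennreal M0" "0 <= M0" and m [measurable]: "\<mu>' : bm" and p: "!!s. 0 < \<mu>' s"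
  and e: "AE s in lborel. \<mu> s = \<mu>' s"
  and K: "AE y in lborel. y : {0<..<2} --> (\<forall>\<rho>. 0 < \<rho> & \<rho> < y / 2 --> 1 / (2 * \<rho>) * (LINT s:{y-\<rho>..y+\<rho>}|lebesgue. \<mu> s) <= K0 * \<mu> y)"
 shows "AE s in lborel. s : {0<..<1} --> (LI r. ind {0<..<s} r * \<mu>' r)
   <= (8 * M0 * K0)^2 * (LI s. ind {0<..<3} s / \<mu>' s) * (\<mu>' s)^2"
 using K e
proof eventually_elim
 fix y assume Ky: "y : {0<..<2} --> (\<forall>\<rho>. 0 < \<rho> & \<rho> < y / 2 --> 1 / (2 * \<rho>) * (LINT s:{y-\<rho>..y+\<rho>}|lebesgue. \<mu> s) <= K0 * \<mu> y)"
  and ey: "\<mu> y = \<mu>' y"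
 show "y : {0<..<1} --> (LI r. ind {0<..<y} r * \<mu>' r)
   <= (8 * M0 * K0)^2 * (LI s. ind {0<..<3} s / \<mu>' s) * (\<mu>' y)^2"
 proof
  assume y: "y : {0<..<1}"
  define P where "P a b = (LI s. ind {a<..<b} s * \<mu>' s)" for a b
  define R where "R a b = (LI s. ind {a<..<b} s / \<mu>' s)" for a b
  note i = A2_interval[OF M m p e]
  have pn: "0 <= \<mu>' s" "0 <= 1 / \<mu>' s" for s using p[of s] by (auto simp: less_imp_le)
  have Pm: "P a b <= P a' b'" if "a' <= a" "b <= b'" "a' < b'" for a b a' b'
   unfolding P_def using that by (intro weighted_interval_mono pn i) auto
  have Rm: "R a b <= R a' b'" if "a' <= a" "b <= b'" "a' < b'" for a b a' b'
  proof -
   have "{a<..<b} \<subseteq> {a'<..<b'}" using that by auto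
   from weighted_interval_mono[of "%s. 1 / \<mu>' s" "{a'<..<b'}" "{a<..<b}", OF pn(2) _ this] i(2)[OF that(3)]
   show ?thesis unfolding R_def by simp
  qed
  have CS: "(b - a)^2 <= P a b * R a b" if "a < b" for a b
   unfolding P_def R_def using that by (intro interval_Cauchy_Schwarz m p i) auto
  have A: "P a b * R a b <= (b - a)^2 * M0" if "a < b" for a b unfolding P_def R_def by (rule i(3)[OF that])
  have P0: "0 <= P a b" "0 <= R a b" for a b unfolding P_def R_def using p by (auto intro!: integral_nonneg_AE AE_I2 simp: less_imp_le)
  let ?a = "y - y / 4" and ?b = "y + y / 4"
  have I: "P ?a ?b <= y / 2 * K0 * \<mu>' y"
  proof -
   have ends: "AE s in lborel. s ~= ?a & s ~= ?b" using AE_lborel_singleton[of ?a] AE_lborel_singleton[of ?b] by eventually_elim auto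
   have "(LINT s:{?a..?b}|lebesgue. \<mu> s) = P ?a ?b" unfolding P_def set_lebesgue_integral_def
    by (rule lebesgue_integral_rep) (measurable, use e ends in \<open>eventually_elim, auto simp: indicator_def\<close>)
   moreover have "1 / (2 * (y / 4)) * (LINT s:{?a..?b}|lebesgue. \<mu> s) <= K0 * \<mu> y"
   proof -
    have "y : {0<..<2}" "0 < y / 4 & y / 4 < y / 2" using y by auto
    then show ?thesis using Ky by blast
   qed
   ultimately show ?thesis using y ey by (simp add: field_simps)
  qed
  \<comment> \<open>Doubling in A2 form: Cauchy-Schwarz on the interval of length y / 2 bounds (y /
    2)^2 by its \<mu>-mass times R(0,2y), and P(0,2y) * R(0,2y) is at most 4 * y^2 * M0.\<close>
  have "P 0 y * (y / 2)^2 <= P 0 (2 * y) * (P ?a ?b * R 0 (2 * y))"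
  proof (rule mult_mono)
   show "P 0 y <= P 0 (2 * y)" using y by (intro Pm) auto
   have "(y / 2)^2 = (?b - ?a)^2" by (simp add: field_simps)
   also have "... <= P ?a ?b * R ?a ?b" using y by (intro CS) auto
   also have "... <= P ?a ?b * R 0 (2 * y)" using y by (intro mult_left_mono Rm P0) auto
   finally show "(y / 2)^2 <= P ?a ?b * R 0 (2 * y)" .
  qed (auto intro: P0)
  also have "... = P ?a ?b * (P 0 (2 * y) * R 0 (2 * y))" by simp
  also have "... <= P ?a ?b * ((2 * y - 0)^2 * M0)" using y by (intro mult_left_mono A P0) auto
  also have "... <= (y / 2 * K0 * \<mu>' y) * ((2 * y - 0)^2 * M0)" using M(2) by (intro mult_right_mono I) auto
  finally have "y^2 * P 0 y <= y^2 * (8 * M0 * K0 * (y * \<mu>' y))" by (simp add: power2_eq_square algebra_simps)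
  then have up: "P 0 y <= 8 * M0 * K0 * (y * \<mu>' y)" using y by (simp add: mult_le_cancel_left)
  have low: "y^2 <= P 0 y * R 0 3"
  proof -
   have "y^2 <= P 0 y * R 0 y" using CS[of 0 y] y by simp
   also have "... <= P 0 y * R 0 3" using y by (intro mult_left_mono Rm P0) auto
   finally show ?thesis .
  qed
  have pos: "0 < P 0 y"
  proof (rule ccontr)
   assume "~ 0 < P 0 y"
   then have "P 0 y = 0" using P0(1)[of 0 y] by simp
   then show False using low y by simp
  qed
  have "(P 0 y)^2 <= (8 * M0 * K0 * (y * \<mu>' y))^2" by (rule power_mono[OF up P0(1)])
  also have "... = (8 * M0 * K0)^2 * (\<mu>' y)^2 * y^2" by (simp add: power_mult_distrib)
  also have "... <= (8 * M0 * K0)^2 * (\<mu>' y)^2 * (P 0 y * R 0 3)" by (intro mult_left_mono low) auto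
  finally have "P 0 y * P 0 y <= P 0 y * ((8 * M0 * K0)^2 * R 0 3 * (\<mu>' y)^2)" by (simp add: power2_eq_square[of "P 0 y"] mult_ac)
  then have "P 0 y <= (8 * M0 * K0)^2 * R 0 3 * (\<mu>' y)^2" using pos by (simp add: mult_le_cancel_left)
  then show "(LI r. ind {0<..<y} r * \<mu>' r) <= (8 * M0 * K0)^2 * (LI s. ind {0<..<3} s / \<mu>' s) * (\<mu>' y)^2"
   unfolding P_def R_def .
 qed
qed

section \<open>Supremum bounds and averages\<close>

lemma Qplus1_sub: "z : Qplus k 1 ==> z : Qp k"
 by (auto simp: Qplus_def Qp_def Dplus_def D_def cross_def)

lemma interior_Qplus1: "interior (Qplus k 1) = Rp k"
proof -
 have "interior (Qplus k 1) = {- 1<..<0} \<times> Dplus k 1"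
  unfolding Qplus_def interior_Times using interior_open[OF Dplus_open[of k 1]] by simp
 also have "... = Rp k" by (auto simp: Rp_def Dplus_def D_def cross_def)
 finally show ?thesis .
qed

lemma Qplus1_borel: "Qplus k 1 : sets borel"
 unfolding Qplus_def using Dplus_open[of k 1] by (intro borel_Times) auto

text \<open>The estimates are proved on the open set \<open>Rp\<close>; the face t = 0 that is
  missing is a null set.\<close>

lemma Linf_norm_le:
 fixes f :: "real \<times> (real ^ 'n::finite) => 'b::euclidean_space"
 assumes m: "f : borel_measurable (lebesgue_on (Qplus k 1))" and b: "AE z in lborel. z : Rp k --> (norm (f z))^2 <= B"
 shows "Linf_norm (Qplus k 1) f <= ennreal (sqrt B)"
 unfolding Linf_norm_def
proof (rule esssup_I)
 show "(%x. ennreal (norm (f x))) : borel_measurable (lebesgue_on (Qplus k 1))" using m by measurable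
 have "AE z in lborel. z \<bullet> tau ~= (0::real)" by (rule AE_coordinate[OF tau_Basis AE_lborel_singleton])
 then have t: "AE z in lborel. fst (z :: 'n tx) ~= 0" by (simp only: inner_tau)
 show "AE x in lebesgue_on (Qplus k 1). ennreal (norm (f x)) <= ennreal (sqrt B)"
  unfolding AE_lebesgue_on[OF Qplus1_borel] using b t
 proof eventually_elim
  fix z assume z: "z : Rp k --> (norm (f z))^2 <= B" "fst z ~= 0"
  show "z : Qplus k 1 --> ennreal (norm (f z)) <= ennreal (sqrt B)"
  proof
   assume "z : Qplus k 1"
   then have "z : Rp k" using z(2) by (auto simp: Qplus_def Rp_def Dplus_def D_def cross_def)
   then have "norm (f z) <= sqrt B" using z(1) by (intro real_le_rsqrt) blast
   then show "ennreal (norm (f z)) <= ennreal (sqrt B)" by (rule ennreal_leI)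
  qed
 qed
qed

lemma weak_deriv_of_representative:
 fixes u u' ut :: "real \<times> (real ^ 'n::finite) => real"
 assumes u': "Lint u'" and e: "AE z in lborel. z : Rp k --> u z = u' z"
  and m [measurable]: "ut : bm" and b: "AE z in lborel. z : Rp k --> (ut z)^2 <= B" and o: "!!z. z ~: Rp k ==> ut z = 0"
  and w: "!!\<phi>. smooth \<phi> ==> supp_in \<phi> (Rp k) ==> (LI z. u' z * dd \<phi> tau z) = - (LI z. ut z * \<phi> z)"
 shows "weak_deriv (Rp k) (1, 0) u ut"
proof -
 have [measurable]: "u' : bm" "Rp k : sets borel" using u' Rp_open[of k] by auto
 have sq: "x^2 <= c ==> \<bar>x\<bar> <= sqrt c" for x c :: real by (metis real_sqrt_abs real_sqrt_le_mono)
 have iut: "Lint ut"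
 proof (rule Bochner_Integration.integrable_bound)
  show "Lint (%z. sqrt B * ind (Rp k) z)" using Rp_finite[of k] by simp
  show "AE z in lborel. norm (ut z) <= norm (sqrt B * ind (Rp k) z)"
   using b
  proof eventually_elim
   fix z assume z: "z : Rp k --> (ut z)^2 <= B"
   show "norm (ut z) <= norm (sqrt B * ind (Rp k) z)"
   proof (cases "z : Rp k")
    case True
    then have "\<bar>ut z\<bar> <= sqrt B" using z sq by blast
    then show ?thesis using True by simp
   qed (simp add: o)
  qed
 qed measurable
 have loc: "locally_integrable (Rp k) f" if g: "Lint g" and fg: "AE z in lborel. z : Rp k --> f z = g z" for f g :: "'n tx => real"
  unfolding locally_integrable_def set_integrable_def
 proof (intro allI impI)
  fix K assume K: "compact K & K \<subseteq> Rp k"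
  then have Kb: "K : sets borel" using borel_compact by blast
  have i: "Lint (%z. ind K z *\<^sub>R g z)" using integrable_indicator_times[OF _ g, of K] Kb by simp
  have ae: "AE z in lborel. ind K z *\<^sub>R f z = ind K z *\<^sub>R g z" using fg by eventually_elim (use K in \<open>auto simp: indicator_def\<close>)
  have gm: "(%z. ind K z *\<^sub>R g z) : bm" using borel_measurable_integrable[OF i] by simp
  show "integrable lebesgue (%z. ind K z *\<^sub>R f z)"
  proof (rule integrable_cong_AE_imp)
   show "integrable lebesgue (%z. ind K z *\<^sub>R g z)" using i gm by (subst integrable_completion) auto
   show "(%z. ind K z *\<^sub>R f z) : borel_measurable lebesgue" by (rule lebesgue_measurable_AE_eq[OF gm ae])
   show "AE z in lebesgue. ind K z *\<^sub>R g z = ind K z *\<^sub>R f z" using AE_completion[OF ae] by eventually_elim (rule sym)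
  qed
 qed
 show ?thesis unfolding weak_deriv_def
 proof (intro conjI ballI)
  show "locally_integrable (Rp k) u" by (rule loc[OF u' e])
  show "locally_integrable (Rp k) ut" by (rule loc[OF iut]) simp
  fix \<phi> assume "\<phi> : test_functions (Rp k)"
  then have s: "smooth \<phi>" and sp: "supp_in \<phi> (Rp k)" by (simp_all add: test_functions_iff)
  note [measurable] = smooth_borel[OF s] smooth_borel[OF smooth_dir_deriv[OF s tau_Basis]]
  have "dd \<phi> tau z = 0" if "z ~: Rp k" for z using supp_in_dir_deriv[OF sp, of tau] that unfolding supp_in_def by blast
  then have "(LINT z:Rp k|lebesgue. u z * dd \<phi> tau z) = (LI z. u' z * dd \<phi> tau z)"
   by (intro set_integral_rep) (measurable, use e in \<open>eventually_elim, simp\<close>, simp)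
  moreover have "(LINT z:Rp k|lebesgue. ut z * \<phi> z) = (LI z. ut z * \<phi> z)"
   by (intro set_integral_rep) (measurable, simp, simp add: o)
  ultimately show "(LINT z:Rp k|lebesgue. u z * dd \<phi> (1, 0) z) = - (LINT z:Rp k|lebesgue. ut z * \<phi> z)"
   using w[OF s sp] by simp
 qed
qed

text \<open>The integral is the average times the \<mu>-measure of the half cylinder, and that
  measure is at most \<open>Cn\<close> times the integral of \<mu> over (0,3).\<close>

lemma average_representative:
 fixes k :: "'n::finite" and F G :: "'n tx => real"
 assumes m [measurable]: "\<mu>' : bm" and p: "!!s. 0 < \<mu>' s" and me: "AE s in lborel. \<mu> s = \<mu>' s"
  and U: "Lint (%s. ind {0<..<3} s * \<mu>' s)"
  and G [measurable]: "G : bm" and e: "AE z in lborel. z : Qp k --> F z = G z" and o: "!!z. z ~: Qp k ==> G z = 0" and nn: "!!z. 0 <= G z"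
 shows "0 <= average (%z. \<mu> (ht k z)) (Qplus k 3) F"
  and "(LI z. \<mu>' (ht k z) * G z) <= Cn TYPE('n) * (LI s. ind {0<..<3} s * \<mu>' s) * average (%z. \<mu> (ht k z)) (Qplus k 3) F"
proof -
 define M where "M = (LI z. ind (Qp k) z * \<mu>' (ht k z))"
 define I where "I = (LI z. \<mu>' (ht k z) * G z)"
 have muh: "AE z in lborel. z : Qp k --> \<mu> (ht k z) = \<mu>' (ht k z)"
  using AE_coordinate[OF ek_Basis[of k] me] unfolding inner_ek by eventually_elim simp
 have mh: "(%z. \<mu>' (ht k z)) : bm" by measurable
 have li: "Lint (%z. ind (Qp k) z * \<mu>' (ht k z))" by (rule integrable_lift(1)[OF U m]) (rule less_imp_le[OF p])
 have lM: "M <= Cn TYPE('n) * (LI s. ind {0<..<3} s * \<mu>' s)" unfolding M_def by (rule integrable_lift(2)[OF U m]) (rule less_imp_le[OF p])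
 note wi = wmeasure_integrals[OF Qp_sets[of k] mh less_imp_le[OF p] muh G e]
 have iI: "(LI z. ind (Qp k) z * (\<mu>' (ht k z) * G z)) = I" unfolding I_def
 proof (intro Bochner_Integration.integral_cong refl)
  fix z show "ind (Qp k) z * (\<mu>' (ht k z) * G z) = \<mu>' (ht k z) * G z" using o[of z] by (cases "z : Qp k") auto
 qed
 have av: "average (%z. \<mu> (ht k z)) (Qplus k 3) F = I / M"
  unfolding average_def Qplus_eq wi(2) wi(3)[OF li] iI M_def ..
 have M0: "0 <= M" "0 <= I" unfolding M_def I_def using p nn by (auto intro!: integral_nonneg_AE AE_I2 mult_nonneg_nonneg simp: less_imp_le)
 show a0: "0 <= average (%z. \<mu> (ht k z)) (Qplus k 3) F" unfolding av using M0 by simp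
 \<comment> \<open>Division by zero gives 0, so the case M = 0 is treated separately: the integrand
   of \<open>I\<close> then vanishes almost everywhere.\<close>
 have "I = M * (I / M)"
 proof (cases "M = 0")
  case True
  have "AE z in lborel. ind (Qp k) z * \<mu>' (ht k z) = 0"
   using True p unfolding M_def by (subst (asm) integral_nonneg_eq_0_iff_AE[OF li]) (auto simp: less_imp_le)
  then have "AE z in lborel. \<mu>' (ht k z) * G z = 0"
  proof eventually_elim
   fix z assume "ind (Qp k) z * \<mu>' (ht k z) = 0"
   then have "z ~: Qp k" using p[of "ht k z"] by (auto simp: indicator_def)
   then show "\<mu>' (ht k z) * G z = 0" using o by simp
  qed
  then have "I = 0" unfolding I_def by (rule integral_eq_zero_AE)
  then show ?thesis by simp
 qed simp
 also have "... <= Cn TYPE('n) * (LI s. ind {0<..<3} s * \<mu>' s) * (I / M)"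
  using lM a0 unfolding av by (rule mult_right_mono)
 finally show "(LI z. \<mu>' (ht k z) * G z) <= Cn TYPE('n) * (LI s. ind {0<..<3} s * \<mu>' s) * average (%z. \<mu> (ht k z)) (Qplus k 3) F"
  unfolding I_def[symmetric] av .
qed

lemma sup_bounds:
 fixes k :: "'n::finite" and A :: "real => real ^ 'n ^ 'n" and u :: "'n tx => real"
 assumes Lpos: "0 < \<Lambda>" and M0: "1 <= M0"
  and mA: "A : borel_measurable (lebesgue_on {0<..<3})" and ma: "a0 : borel_measurable (lebesgue_on {0<..<3})"
  and ab: "AE s in lebesgue_on {0<..<3}. 1 / \<Lambda> <= a0 s & a0 s <= \<Lambda>"
  and el: "AE s in lebesgue_on {0<..<3}. \<forall>\<xi>. 1 / \<Lambda> * (norm \<xi>)^2 <= (A s *v \<xi>) \<bullet> \<xi>"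
  and bd: "AE s in lebesgue_on {0<..<3}. onorm ((*v) (A s)) <= \<Lambda>"
  and w: "A2_weight \<mu>" "A2_const \<mu> <= ennreal M0"
  and K: "AE y in lebesgue_on {0<..<2}. \<forall>\<rho>. 0 < \<rho> & \<rho> < y / 2 -->
    1 / (2 * \<rho>) * (LINT s:{y-\<rho>..y+\<rho>}|lebesgue. \<mu> s) <= K0 * \<mu> y"
  and lam: "0 <= lam" and sol: "weak_solution k \<mu> a0 A lam u Du"
 defines "c \<equiv> 9 * M0 * Cn TYPE('n)"
  and "avu \<equiv> average (%z. \<mu> (snd z $ k)) (Qplus k 3) (%z. (u z)^2)"
  and "avg \<equiv> average (%z. \<mu> (snd z $ k)) (Qplus k 3) (%z. (norm (Du z))^2 + lam * (u z)^2)"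
 shows "0 <= avu" "0 <= avg"
  "Linf_norm (Qplus k 1) u <= ennreal (sqrt (csup TYPE('n) \<Lambda> * c * avu))"
  "Linf_norm (Qplus k 1) Du <= ennreal (sqrt (cgrad TYPE('n) \<Lambda> * (1 + (8 * M0 * K0)^2) * c * avg))"
  "\<exists>ut. weak_deriv (interior (Qplus k 1)) (1, 0) u ut & Linf_norm (Qplus k 1) ut <= ennreal (sqrt (ctime TYPE('n) \<Lambda> * c * avg))"
proof -
 have I: "{0<..<3::real} : sets borel" "{0<..<2::real} : sets borel" by auto
 note ab = ab[unfolded AE_lebesgue_on[OF I(1)]] and el = el[unfolded AE_lebesgue_on[OF I(1)]]
  and bd = bd[unfolded AE_lebesgue_on[OF I(1)]] and K = K[unfolded AE_lebesgue_on[OF I(2)]]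
 \<comment> \<open>The two bounds on a0 hold together at some height, which forces 1 / \<Lambda> <=
   \<Lambda> and hence \<Lambda> >= 1, as the energy method demands.\<close>
 obtain s where "1 / \<Lambda> <= a0 s" "a0 s <= \<Lambda>" using AE_interval_exists[OF ab] by auto
 then have L': "1 / \<Lambda> <= \<Lambda>" by linarith
 have L: "1 <= \<Lambda>"
 proof (rule ccontr)
  assume "~ 1 <= \<Lambda>"
  then have "\<Lambda> < 1" "1 < 1 / \<Lambda>" using Lpos by (auto simp: less_divide_eq)
  then show False using L' by linarith
 qed
 obtain \<mu>' where mu [measurable]: "\<mu>' : bm" and p: "!!s. 0 < \<mu>' s" and me: "AE s in lborel. \<mu> s = \<mu>' s"
  using A2_representative[OF w(1)] by blast
 obtain a' where a': "a' : bm" "!!s. 1 / \<Lambda> <= a' s" "!!s. a' s <= \<Lambda>" "AE s in lborel. s : {0<..<3} --> a0 s = a' s"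
  using scalar_coefficient_representative[OF ma L' ab] by blast
 obtain A' where A': "!!i j. (%s. A' s $ i $ j) : bm" "!!s \<xi>. (norm \<xi>)^2 / \<Lambda> <= (A' s *v \<xi>) \<bullet> \<xi>"
  "!!s \<xi>. norm (A' s *v \<xi>) <= \<Lambda> * norm \<xi>" "AE s in lborel. s : {0<..<3} --> A s = A' s"
  using matrix_coefficient_representative[OF mA L el bd] by blast
 have M0': "0 <= M0" using M0 by simp
 have z3: "(0::real) < 3" by simp
 note A2 = A2_interval[OF w(2) M0' mu p me z3]
 obtain u' Du' where cs: "conormal_solution k \<Lambda> lam (1 / (4 * real CARD('n))) \<mu>' a' A' u' Du'"
  and eqs: "AE z in lborel. z : Qp k --> u z = u' z & Du z = Du' z"
  by (rule conormal_solution_of_weak_solution[OF sol lam L mu p me A2(2,1) a' A'])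
 interpret C: conormal_solution k \<Lambda> lam "1 / (4 * real CARD('n))" \<mu>' a' A' u' Du' by (rule cs)
 define J where "J = (LI s. ind {0<..<3} s / \<mu>' s)"
 define W where "W = (LI s. ind {0<..<3} s * \<mu>' s)"
 have J0: "0 <= J" "0 <= W" unfolding J_def W_def using p by (auto intro!: integral_nonneg_AE AE_I2 simp: less_imp_le)
 \<comment> \<open>The A2 condition on (0,3), with 9 the squared length. J from the pointwise bounds
   and W from the averages depend on the weight, but their product is bounded in terms of
   M0.\<close>
 have WJ: "W * J <= 9 * M0" using A2(3) unfolding W_def J_def by simp
 note est = C.interior_estimates[OF order_refl weight_growth[OF w(2) M0' mu p me K], folded J_def]
 have C0: "0 <= Cn TYPE('n)" by (simp add: Cn_def)
 have fin: "q * J * X <= q * c * a" if "0 <= q" "0 <= a" "X <= Cn TYPE('n) * W * a" for q a X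
 proof -
  have "J * X <= J * (Cn TYPE('n) * W * a)" by (intro mult_left_mono that J0)
  also have "... = (W * J) * (Cn TYPE('n) * a)" by (simp add: mult_ac)
  also have "... <= (9 * M0) * (Cn TYPE('n) * a)" using C0 that(2) by (intro mult_right_mono WJ) simp
  finally have "q * (J * X) <= q * ((9 * M0) * (Cn TYPE('n) * a))" using that(1) by (rule mult_left_mono)
  then show ?thesis by (simp add: c_def mult_ac)
 qed
 note [measurable] = sl_borel[OF C.u_sl] sl_borel[OF C.Du_sl]
 have mG1: "(%z. (u' z)^2) : bm" by measurable
 have mG2: "(%z. (norm (Du' z))^2 + lam * (u' z)^2) : bm" unfolding norm_squared_sum by measurable
 have e1: "AE z in lborel. z : Qp k --> (u z)^2 = (u' z)^2" using eqs by eventually_elim simp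
 have e2: "AE z in lborel. z : Qp k --> (norm (Du z))^2 + lam * (u z)^2 = (norm (Du' z))^2 + lam * (u' z)^2" using eqs by eventually_elim simp
 have nn2: "0 <= (norm (Du' z))^2 + lam * (u' z)^2" for z using lam by simp
 have o1: "(u' z)^2 = 0" "(norm (Du' z))^2 + lam * (u' z)^2 = 0" if "z ~: Qp k" for z using C.u_out[OF that] C.Du_out[OF that] by simp_all
 note ar1 = average_representative[where F="%z. (u z)^2" and G="%z. (u' z)^2", OF mu p me A2(1) mG1 e1]
 note ar2 = average_representative[where F="%z. (norm (Du z))^2 + lam * (u z)^2" and G="%z. (norm (Du' z))^2 + lam * (u' z)^2", OF mu p me A2(1) mG2 e2]
 show a1: "0 <= avu" unfolding avu_def by (rule ar1(1)) (erule o1(1), rule zero_le_power2)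
 show a2: "0 <= avg" unfolding avg_def by (rule ar2(1)) (erule o1(2), rule nn2)
 have av1: "(LI z. \<mu>' (ht k z) * (u' z)^2) <= Cn TYPE('n) * W * avu"
  unfolding avu_def W_def by (rule ar1(2)) (erule o1(1), rule zero_le_power2)
 have av2: "(LI z. \<mu>' (ht k z) * ((norm (Du' z))^2 + lam * (u' z)^2)) <= Cn TYPE('n) * W * avg"
  unfolding avg_def W_def by (rule ar2(2)) (erule o1(2), rule nn2)
 have Ei: "C.Ei = (LI z. \<mu>' (ht k z) * ((norm (Du' z))^2 + lam * (u' z)^2))"
 proof -
  have pw: "\<mu>' (ht k z) * ((norm (Du' z))^2 + lam * (u' z)^2) = (\<Sum>l\<in>UNIV. \<mu>' (ht k z) * (Du' z $ l)^2) + lam * (\<mu>' (ht k z) * (u' z)^2)" for z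
   unfolding norm_squared_sum by (simp add: algebra_simps sum_distrib_left)
  have s: "(LI z. (\<Sum>l\<in>UNIV. \<mu>' (ht k z) * (Du' z $ l)^2)) = (\<Sum>l\<in>UNIV. (LI z. \<mu>' (ht k z) * (Du' z $ l)^2))"
   by (rule Bochner_Integration.integral_sum) (rule C.Du2)
  show ?thesis unfolding pw C.Ei_def s[symmetric]
   by (subst Bochner_Integration.integral_add) (auto intro!: Bochner_Integration.integrable_sum C.Du2 C.u2)
 qed
 have RQ: "AE z in lborel. z : Rp k --> u z = u' z & Du z = Du' z" using eqs by eventually_elim (use Rp_Qp in blast)
 have um: "u : borel_measurable (lebesgue_on (Qplus k 1))" "Du : borel_measurable (lebesgue_on (Qplus k 1))"
 proof -
  have S: "{- 9<..0} \<times> Dplus k 3 = Qp k" using Qplus_eq[of k] by (simp add: Qplus_def)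
  have V: "u : borel_measurable (lebesgue_on (Qp k))" "Du : borel_measurable (lebesgue_on (Qp k))"
   using sol unfolding weak_solution_def V12_def S by blast+
  have "Qplus k 1 \<subseteq> Qp k" using Qplus1_sub by blast
  then show "u : borel_measurable (lebesgue_on (Qplus k 1))" "Du : borel_measurable (lebesgue_on (Qplus k 1))"
   by (rule measurable_restrict_mono[OF V(1)], rule measurable_restrict_mono[OF V(2)])
 qed
 have gc: "0 <= cgrad TYPE('n) \<Lambda> * (1 + (8 * M0 * K0)^2)" by (intro mult_nonneg_nonneg const_nonneg) simp
 show "Linf_norm (Qplus k 1) u <= ennreal (sqrt (csup TYPE('n) \<Lambda> * c * avu))"
 proof (rule Linf_norm_le[OF um(1)])
  show "AE z in lborel. z : Rp k --> (norm (u z))^2 <= csup TYPE('n) \<Lambda> * c * avu"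
   using est(1) RQ
  proof eventually_elim
   fix z assume "z : Rp k --> (u' z)^2 <= csup TYPE('n) \<Lambda> * J * C.U2" "z : Rp k --> u z = u' z & Du z = Du' z"
   then show "z : Rp k --> (norm (u z))^2 <= csup TYPE('n) \<Lambda> * c * avu"
    using fin[OF const_nonneg(1) a1 av1] by (auto intro: order_trans)
  qed
 qed
 show "Linf_norm (Qplus k 1) Du <= ennreal (sqrt (cgrad TYPE('n) \<Lambda> * (1 + (8 * M0 * K0)^2) * c * avg))"
 proof (rule Linf_norm_le[OF um(2)])
  show "AE z in lborel. z : Rp k --> (norm (Du z))^2 <= cgrad TYPE('n) \<Lambda> * (1 + (8 * M0 * K0)^2) * c * avg"
   using est(2) RQ
  proof eventually_elim
   fix z assume "z : Rp k --> (norm (Du' z))^2 <= cgrad TYPE('n) \<Lambda> * (1 + (8 * M0 * K0)^2) * J * C.Ei" "z : Rp k --> u z = u' z & Du z = Du' z"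
   then show "z : Rp k --> (norm (Du z))^2 <= cgrad TYPE('n) \<Lambda> * (1 + (8 * M0 * K0)^2) * c * avg"
    using fin[OF gc a2 av2] unfolding Ei by (auto intro: order_trans)
  qed
 qed
 obtain ut where ut: "ut : bm" "AE z in lborel. z : Rp k --> (ut z)^2 <= ctime TYPE('n) \<Lambda> * J * C.Ei"
  "!!z. z ~: Rp k ==> ut z = 0" "!!\<phi>. smooth \<phi> ==> supp_in \<phi> (Rp k) ==> (LI z. u' z * dd \<phi> tau z) = - (LI z. ut z * \<phi> z)"
  using est(3) by blast
 have RQu: "AE z in lborel. z : Rp k --> u z = u' z" using RQ by eventually_elim blast
 have "weak_deriv (interior (Qplus k 1)) (1, 0) u ut"
  unfolding interior_Qplus1 by (rule weak_deriv_of_representative[OF C.u_L1(1) RQu ut])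
 moreover have "Linf_norm (Qplus k 1) ut <= ennreal (sqrt (ctime TYPE('n) \<Lambda> * c * avg))"
 proof (rule Linf_norm_le)
  show "ut : borel_measurable (lebesgue_on (Qplus k 1))"
   by (rule measurable_restrict_space1, rule measurable_completion) (use ut(1) in simp)
  show "AE z in lborel. z : Rp k --> (norm (ut z))^2 <= ctime TYPE('n) \<Lambda> * c * avg"
   using ut(2) by eventually_elim (use fin[OF const_nonneg(2) a2 av2] in \<open>auto simp: Ei intro: order_trans\<close>)
 qed
 ultimately show "\<exists>ut. weak_deriv (interior (Qplus k 1)) (1, 0) u ut & Linf_norm (Qplus k 1) ut <= ennreal (sqrt (ctime TYPE('n) \<Lambda> * c * avg))" by blast
qed

theorem proposition4p23:
  fixes \<Lambda> M0 :: real
  assumes "\<Lambda> > 0" and "M0 \<ge> 1"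
  shows "\<exists>C1>0. \<forall>K0\<ge>1. \<exists>C2>0.
    \<forall>(k::'n::finite) (A :: real \<Rightarrow> real ^ 'n ^ 'n) (a0 :: real \<Rightarrow> real) (\<mu> :: real \<Rightarrow> real)
      (lam :: real) (u :: real \<times> (real ^ 'n) \<Rightarrow> real) (Du :: real \<times> (real ^ 'n) \<Rightarrow> real ^ 'n).
      A \<in> borel_measurable (lebesgue_on {0<..<3}) \<longrightarrow>
      a0 \<in> borel_measurable (lebesgue_on {0<..<3}) \<longrightarrow>
      (AE s in lebesgue_on {0<..<3}. 1 / \<Lambda> \<le> a0 s \<and> a0 s \<le> \<Lambda>) \<longrightarrow>
      (AE s in lebesgue_on {0<..<3}. \<forall>\<xi>. 1 / \<Lambda> * (norm \<xi>)\<^sup>2 \<le> (A s *v \<xi>) \<bullet> \<xi>) \<longrightarrow>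
      (AE s in lebesgue_on {0<..<3}. onorm ((*v) (A s)) \<le> \<Lambda>) \<longrightarrow>
      A2_weight \<mu> \<longrightarrow>
      A2_const \<mu> \<le> ennreal M0 \<longrightarrow>
      (AE y in lebesgue_on {0<..<2}. \<forall>\<rho>. 0 < \<rho> \<and> \<rho> < y / 2 \<longrightarrow>
         1 / (2 * \<rho>) * (LINT s:{y-\<rho>..y+\<rho>}|lebesgue. \<mu> s) \<le> K0 * \<mu> y) \<longrightarrow>
      lam \<ge> 0 \<longrightarrow>
      weak_solution k \<mu> a0 A lam u Du \<longrightarrow>
        Linf_norm (Qplus k 1) u
          \<le> ennreal (C1 * sqrt (average (\<lambda>z. \<mu> (snd z $ k)) (Qplus k 3) (\<lambda>z. (u z)\<^sup>2))) \<and>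
        (\<exists>ut. weak_deriv (interior (Qplus k 1)) (1, 0) u ut \<and>
          Linf_norm (Qplus k 1) ut + Linf_norm (Qplus k 1) Du
            \<le> ennreal (C2 * sqrt (average (\<lambda>z. \<mu> (snd z $ k)) (Qplus k 3)
                 (\<lambda>z. (norm (Du z))\<^sup>2 + lam * (u z)\<^sup>2))))"
proof -
 define c where "c = 9 * M0 * Cn TYPE('n)"
 have c0: "0 <= c" using assms(2) by (simp add: c_def Cn_def)
 have split: "ennreal (sqrt (q * c * a)) <= ennreal (C * sqrt a)" if "sqrt (q * c) <= C" "0 <= a" for q a C :: real
  using that by (intro ennreal_leI) (simp add: real_sqrt_mult mult_right_mono)
 \<comment> \<open>The square roots may vanish; adding 1 makes the constant positive.\<close>
 define C2 where "C2 K0 = sqrt (ctime TYPE('n) \<Lambda> * c) + sqrt (cgrad TYPE('n) \<Lambda> * (1 + (8 * M0 * K0)^2) * c) + 1" for K0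
 have nn: "0 <= sqrt (csup TYPE('n) \<Lambda> * c)" "0 <= sqrt (ctime TYPE('n) \<Lambda> * c)" "0 <= sqrt (cgrad TYPE('n) \<Lambda> * (1 + (8 * M0 * K0)^2) * c)" for K0
  using c0 by (simp_all add: const_nonneg)
 have C2: "0 < C2 K0" for K0 unfolding C2_def using nn(2) nn(3)[of K0] by linarith
 show ?thesis
 proof (rule exI[of _ "sqrt (csup TYPE('n) \<Lambda> * c) + 1"], intro conjI allI impI)
  show "0 < sqrt (csup TYPE('n) \<Lambda> * c) + 1" using nn(1) by linarith
  fix K0 :: real assume "1 <= K0"
  show "\<exists>C2>0. \<forall>(k::'n::finite) A a0 \<mu> lam u Du.
   A : borel_measurable (lebesgue_on {0<..<3}) -->
   a0 : borel_measurable (lebesgue_on {0<..<3}) -->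
   (AE s in lebesgue_on {0<..<3}. 1 / \<Lambda> <= a0 s & a0 s <= \<Lambda>) -->
   (AE s in lebesgue_on {0<..<3}. \<forall>\<xi>. 1 / \<Lambda> * (norm \<xi>)^2 <= (A s *v \<xi>) \<bullet> \<xi>) -->
   (AE s in lebesgue_on {0<..<3}. onorm ((*v) (A s)) <= \<Lambda>) -->
   A2_weight \<mu> -->
   A2_const \<mu> <= ennreal M0 -->
   (AE y in lebesgue_on {0<..<2}. \<forall>\<rho>. 0 < \<rho> & \<rho> < y / 2 -->
    1 / (2 * \<rho>) * (LINT s:{y-\<rho>..y+\<rho>}|lebesgue. \<mu> s) <= K0 * \<mu> y) -->
   lam \<ge> 0 -->
   weak_solution k \<mu> a0 A lam u Du -->
    Linf_norm (Qplus k 1) u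
     <= ennreal ((sqrt (csup TYPE('n) \<Lambda> * c) + 1) * sqrt (average (%z. \<mu> (snd z $ k)) (Qplus k 3) (%z. (u z)^2))) \<and>
    (\<exists>ut. weak_deriv (interior (Qplus k 1)) (1, 0) u ut \<and>
     Linf_norm (Qplus k 1) ut + Linf_norm (Qplus k 1) Du
      <= ennreal (C2 * sqrt (average (%z. \<mu> (snd z $ k)) (Qplus k 3)
        (%z. (norm (Du z))^2 + lam * (u z)^2))))"
  proof (rule exI[of _ "C2 K0"], rule conjI[OF C2], intro allI impI)
   fix k :: 'n and A :: "real => real ^ 'n ^ 'n" and a0 \<mu> :: "real => real" and lam :: real
    and u :: "'n tx => real" and Du :: "'n tx => real ^ 'n"
   assume h: "A : borel_measurable (lebesgue_on {0<..<3})" "a0 : borel_measurable (lebesgue_on {0<..<3})"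
    "AE s in lebesgue_on {0<..<3}. 1 / \<Lambda> <= a0 s & a0 s <= \<Lambda>"
    "AE s in lebesgue_on {0<..<3}. \<forall>\<xi>. 1 / \<Lambda> * (norm \<xi>)^2 <= (A s *v \<xi>) \<bullet> \<xi>"
    "AE s in lebesgue_on {0<..<3}. onorm ((*v) (A s)) <= \<Lambda>" "A2_weight \<mu>" "A2_const \<mu> <= ennreal M0"
    "AE y in lebesgue_on {0<..<2}. \<forall>\<rho>. 0 < \<rho> & \<rho> < y / 2 -->
    1 / (2 * \<rho>) * (LINT s:{y-\<rho>..y+\<rho>}|lebesgue. \<mu> s) <= K0 * \<mu> y" "lam \<ge> 0" "weak_solution k \<mu> a0 A lam u Du"
   let ?avu = "average (%z. \<mu> (snd z $ k)) (Qplus k 3) (%z. (u z)^2)"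
   let ?avg = "average (%z. \<mu> (snd z $ k)) (Qplus k 3) (%z. (norm (Du z))^2 + lam * (u z)^2)"
   note S = sup_bounds[OF assms h, folded c_def]
   obtain ut where ut: "weak_deriv (interior (Qplus k 1)) (1, 0) u ut" "Linf_norm (Qplus k 1) ut <= ennreal (sqrt (ctime TYPE('n) \<Lambda> * c * ?avg))"
    using S(5) by blast
   have u1: "Linf_norm (Qplus k 1) u <= ennreal ((sqrt (csup TYPE('n) \<Lambda> * c) + 1) * sqrt ?avu)"
    by (rule order_trans[OF S(3) split[OF _ S(1)]]) simp
   let ?t = "sqrt (ctime TYPE('n) \<Lambda> * c)" and ?g = "sqrt (cgrad TYPE('n) \<Lambda> * (1 + (8 * M0 * K0)^2) * c)"
   have t1: "Linf_norm (Qplus k 1) ut <= ennreal (?t * sqrt ?avg)" by (rule order_trans[OF ut(2) split[OF order_refl S(2)]])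
   have g1: "Linf_norm (Qplus k 1) Du <= ennreal (?g * sqrt ?avg)" by (rule order_trans[OF S(4) split[OF order_refl S(2)]])
   have "Linf_norm (Qplus k 1) ut + Linf_norm (Qplus k 1) Du <= ennreal (?t * sqrt ?avg) + ennreal (?g * sqrt ?avg)"
    by (rule add_mono[OF t1 g1])
   also have "... = ennreal (?t * sqrt ?avg + ?g * sqrt ?avg)"
    using nn S(2) by (intro ennreal_plus[symmetric] mult_nonneg_nonneg) simp_all
   also have "... <= ennreal (C2 K0 * sqrt ?avg)"
    using S(2) by (intro ennreal_leI) (simp add: C2_def distrib_right)
   finally show "Linf_norm (Qplus k 1) u <= ennreal ((sqrt (csup TYPE('n) \<Lambda> * c) + 1) * sqrt ?avu) \<and>
    (\<exists>ut. weak_deriv (interior (Qplus k 1)) (1, 0) u ut & Linf_norm (Qplus k 1) ut + Linf_norm (Qplus k 1) Du <= ennreal (C2 K0 * sqrt ?avg))"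
    using u1 ut(1) by blast
  qed
 qed
qed

end
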